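(* For a category $\mathcal X$, the following conditions are equivalent: (a) $\mathcal X$ is regular, additive, and has stable coequalizers of equivalence relations; (b) $\mathcal X$ is a semi-localization of an abelian category $\mathcal C$; (c) $\mathcal X$ is a semi-localization of an abelian category $\mathcal C$, and the units of the reflection are regular epimorphisms (i.e. every component $\eta_C$ is a regular epimorphism in $\mathcal C$); (d) $\mathcal X$ is regular, is a semi-localization of its exact completion $\mathcal X_{\mathrm{ex/reg}}$ as a regular category, and $\mathcal X_{\mathrm{ex/reg}}$ is additive; (e) $\mathcal X$ is regular, additive, and has stable cokernels; (f) $\mathcal X$ is additive, every morphism $f\colon A\to D$ has a factorization $A\xrightarrow{q}B\xrightarrow{g}C\xrightarrow{k}D$ where $q$ is a regular epimorphism, $g$ is an epimorphism and a monomorphism, and $k$ is a regular monomorphism; and regular (= normal) epimorphisms are pullback stable; (g) $\mathcal X$ is a torsion-free subcategory of an abelian category.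
   Context: Regular category: has finite limits, coequalizers of kernel pairs, and pullback-stable regular epimorphisms. Exact (Barr-exact) category: a regular category in which every equivalence relation is a kernel pair. Additive category: has a zero object and finite biproducts, and the resulting commutative monoid structures on hom-sets are abelian groups. Stable coequalizers of equivalence relations: every equivalence relation $R\rightrightarrows X$ has a coequalizer $q\colon X\to Q$, and for every $f\colon Y\to Q$, if $q'\colon X'\to Y$ is the pullback of $q$ along $f$ and $S\rightrightarrows X'$ is the equivalence relation obtained by pulling back $R\to Q$ along $f$, then $q'$ is the coequalizer of $S\rightrightarrows X'$. Stable cokernels: the cokernel $q\colon B\to C$ of $x\colon A\to B$ is stable if for every $f\colon D\to C$, with pullback $P=B\times_C D$, projections $u\colon P\to B$, $v\colon P\to D$, and $x'\colon A\to P$ the unique morphism with $ux'=x$ and $vx'=0$, the morphism $v$ is the cokernel of $x'$. "Has stable cokernels" means that every morphism has a cokernel and this cokernel is stable. Semi-localization: a full reflective subcategory $U\colon\mathcal X\to\mathcal C$, with reflector $L\colon\mathcal C\to\mathcal X$ and unit $\eta$, is a semi-localization of $\mathcal C$ if $L$ is semi-left-exact: for every object $Q$ of $\mathcal C$ and every $f\colon X\to LQ$ in $\mathcal X$, $L$ preserves the pullback of $Uf\colon UX\to ULQ$ along $\eta_Q\colon Q\to ULQ$. A category is said to be a semi-localization (resp. torsion-free subcategory) of $\mathcal C$ if it is equivalent to such a subcategory. Torsion theory: in a category $\mathcal C$ with a zero object, kernels and cokernels, a torsion theory $(\mathcal T,\mathcal X)$ consists of full replete subcategories such that every morphism from an object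 of $\mathcal T$ to an object of $\mathcal X$ is zero, and for every $C\in\mathcal C$ there is a short exact sequence $0\to TC\to C\to LC\to 0$ with $TC\in\mathcal T$ and $LC\in\mathcal X$. A torsion-free subcategory of $\mathcal C$ is the part $\mathcal X$ of some torsion theory $(\mathcal T,\mathcal X)$ in $\mathcal C$. Exact completion: for a regular category $\mathcal X$, $\mathcal X_{\mathrm{ex/reg}}$ is its exact completion as a regular category, i.e. the value at $\mathcal X$ of the left biadjoint to the inclusion of the 2-category of exact categories into that of regular categories, regular functors (preserving finite limits and regular epimorphisms) and natural transformations. Explicitly, objects are pairs $(X,R)$ with $R$ an equivalence relation on $X\in\mathcal X$; a morphism $(X,R)\to(Y,S)$ is a relation $\varphi$ from $X$ to $Y$ with $S\varphi R=\varphi$, $R\le\varphi^\circ\varphi$ and $\varphi\varphi^\circ\le S$, where $\varphi^\circ$ is the opposite relation; composition is that of relations, and the identity of $(X,R)$ is $R$. The category $\mathcal X$ is regarded as a full subcategory of $\mathcal X_{\mathrm{ex/reg}}$ via the fully faithful unit $X\mapsto (X,1_X)$; in (d), "is a semi-localization" refers to this embedding. *)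

theory Defs
  imports "HOL-Algebra.Group"
begin

section \<open>Categories, functors, equivalences\<close>

record ('o, 'a) cat =
  Obj :: "'o set"
  Arr :: "'a set"
  Dom :: "'a \<Rightarrow> 'o"
  Cod :: "'a \<Rightarrow> 'o"
  Id :: "'o \<Rightarrow> 'a"
  Comp :: "'a \<Rightarrow> 'a \<Rightarrow> 'a" (infixr "\<cdot>\<index>" 70)

definition Hom :: "('o, 'a) cat \<Rightarrow> 'o \<Rightarrow> 'o \<Rightarrow> 'a set" where
  "Hom C A B = {f \<in> Arr C. Dom C f = A \<and> Cod C f = B}"

text \<open>Composition is written in the usual order: \<open>g \<cdot> f\<close> is \<open>f\<close> followed by \<open>g\<close>, and
  only composites with \<open>Cod f = Dom g\<close> are constrained.\<close>

locale category =
  fixes C :: "('o, 'a) cat" (structure)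
  assumes Dom_in: "f \<in> Arr C \<Longrightarrow> Dom C f \<in> Obj C"
    and Cod_in: "f \<in> Arr C \<Longrightarrow> Cod C f \<in> Obj C"
    and Id_in: "A \<in> Obj C \<Longrightarrow> Id C A \<in> Hom C A A"
    and Comp_in: "f \<in> Hom C A B \<Longrightarrow> g \<in> Hom C B D \<Longrightarrow> g \<cdot> f \<in> Hom C A D"
    and Id_left: "f \<in> Hom C A B \<Longrightarrow> Id C B \<cdot> f = f"
    and Id_right: "f \<in> Hom C A B \<Longrightarrow> f \<cdot> Id C A = f"
    and Comp_assoc: "f \<in> Hom C A B \<Longrightarrow> g \<in> Hom C B D \<Longrightarrow> h \<in> Hom C D E \<Longrightarrow>
      (h \<cdot> g) \<cdot> f = h \<cdot> (g \<cdot> f)"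

definition full_sub :: "('o, 'a) cat \<Rightarrow> 'o set \<Rightarrow> ('o, 'a) cat" where
  "full_sub C S = C\<lparr>Obj := S, Arr := {f \<in> Arr C. Dom C f \<in> S \<and> Cod C f \<in> S}\<rparr>"

record ('o, 'a, 'p, 'b) Fun =
  FObj :: "'o \<Rightarrow> 'p"
  FArr :: "'a \<Rightarrow> 'b"

definition is_functor :: "('o, 'a) cat \<Rightarrow> ('p, 'b) cat \<Rightarrow> ('o, 'a, 'p, 'b) Fun \<Rightarrow> bool" where
  "is_functor C D F \<longleftrightarrow>
     (\<forall>A \<in> Obj C. FObj F A \<in> Obj D) \<and>
     (\<forall>A \<in> Obj C. \<forall>B \<in> Obj C. \<forall>f \<in> Hom C A B. FArr F f \<in> Hom D (FObj F A) (FObj F B)) \<and>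
     (\<forall>A \<in> Obj C. FArr F (Id C A) = Id D (FObj F A)) \<and>
     (\<forall>f \<in> Arr C. \<forall>g \<in> Arr C. Cod C f = Dom C g \<longrightarrow>
        FArr F (g \<cdot>\<^bsub>C\<^esub> f) = FArr F g \<cdot>\<^bsub>D\<^esub> FArr F f)"

definition fully_faithful :: "('o, 'a) cat \<Rightarrow> ('p, 'b) cat \<Rightarrow> ('o, 'a, 'p, 'b) Fun \<Rightarrow> bool" where
  "fully_faithful C D F \<longleftrightarrow>
     (\<forall>A \<in> Obj C. \<forall>B \<in> Obj C. bij_betw (FArr F) (Hom C A B) (Hom D (FObj F A) (FObj F B)))"

definition id_fun :: "('o, 'a, 'o, 'a) Fun" where
  "id_fun = \<lparr>FObj = (\<lambda>A. A), FArr = (\<lambda>f. f)\<rparr>"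

definition comp_fun ::
    "('p, 'b, 'q, 'c) Fun \<Rightarrow> ('o, 'a, 'p, 'b) Fun \<Rightarrow> ('o, 'a, 'q, 'c) Fun" where
  "comp_fun G F = \<lparr>FObj = FObj G \<circ> FObj F, FArr = FArr G \<circ> FArr F\<rparr>"

definition iso_in :: "('o, 'a) cat \<Rightarrow> 'a \<Rightarrow> bool" where
  "iso_in C f \<longleftrightarrow> f \<in> Arr C \<and>
     (\<exists>g \<in> Hom C (Cod C f) (Dom C f).
        g \<cdot>\<^bsub>C\<^esub> f = Id C (Dom C f) \<and> f \<cdot>\<^bsub>C\<^esub> g = Id C (Cod C f))"

definition natural_trans :: "('o, 'a) cat \<Rightarrow> ('p, 'b) cat \<Rightarrow> ('o, 'a, 'p, 'b) Fun \<Rightarrow>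
    ('o, 'a, 'p, 'b) Fun \<Rightarrow> ('o \<Rightarrow> 'b) \<Rightarrow> bool" where
  "natural_trans C D F G \<alpha> \<longleftrightarrow>
     (\<forall>A \<in> Obj C. \<alpha> A \<in> Hom D (FObj F A) (FObj G A)) \<and>
     (\<forall>A \<in> Obj C. \<forall>B \<in> Obj C. \<forall>f \<in> Hom C A B.
        FArr G f \<cdot>\<^bsub>D\<^esub> \<alpha> A = \<alpha> B \<cdot>\<^bsub>D\<^esub> FArr F f)"

definition natural_iso :: "('o, 'a) cat \<Rightarrow> ('p, 'b) cat \<Rightarrow> ('o, 'a, 'p, 'b) Fun \<Rightarrow>
    ('o, 'a, 'p, 'b) Fun \<Rightarrow> ('o \<Rightarrow> 'b) \<Rightarrow> bool" where
  "natural_iso C D F G \<alpha> \<longleftrightarrow> natural_trans C D F G \<alpha> \<and> (\<forall>A \<in> Obj C. iso_in D (\<alpha> A))"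

definition equivalent_cats :: "('o, 'a) cat \<Rightarrow> ('p, 'b) cat \<Rightarrow> bool" where
  "equivalent_cats C D \<longleftrightarrow>
     (\<exists>F G \<alpha> \<beta>. is_functor C D F \<and> is_functor D C G \<and>
        natural_iso C C (comp_fun G F) id_fun \<alpha> \<and>
        natural_iso D D (comp_fun F G) id_fun \<beta>)"


section \<open>Limits and colimits\<close>

definition mono_in :: "('o, 'a) cat \<Rightarrow> 'a \<Rightarrow> bool" where
  "mono_in C m \<longleftrightarrow> m \<in> Arr C \<and>
     (\<forall>T \<in> Obj C. \<forall>f \<in> Hom C T (Dom C m). \<forall>g \<in> Hom C T (Dom C m).
        m \<cdot>\<^bsub>C\<^esub> f = m \<cdot>\<^bsub>C\<^esub> g \<longrightarrow> f = g)"

definition epi_in :: "('o, 'a) cat \<Rightarrow> 'a \<Rightarrow> bool" where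
  "epi_in C e \<longleftrightarrow> e \<in> Arr C \<and>
     (\<forall>T \<in> Obj C. \<forall>f \<in> Hom C (Cod C e) T. \<forall>g \<in> Hom C (Cod C e) T.
        f \<cdot>\<^bsub>C\<^esub> e = g \<cdot>\<^bsub>C\<^esub> e \<longrightarrow> f = g)"

definition parallel :: "('o, 'a) cat \<Rightarrow> 'a \<Rightarrow> 'a \<Rightarrow> bool" where
  "parallel C f g \<longleftrightarrow> f \<in> Arr C \<and> g \<in> Arr C \<and> Dom C f = Dom C g \<and> Cod C f = Cod C g"

definition is_equalizer :: "('o, 'a) cat \<Rightarrow> 'a \<Rightarrow> 'a \<Rightarrow> 'a \<Rightarrow> bool" where
  "is_equalizer C f g m \<longleftrightarrow> parallel C f g \<and> m \<in> Arr C \<and> Cod C m = Dom C f \<and>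
     f \<cdot>\<^bsub>C\<^esub> m = g \<cdot>\<^bsub>C\<^esub> m \<and>
     (\<forall>T \<in> Obj C. \<forall>h \<in> Hom C T (Dom C f). f \<cdot>\<^bsub>C\<^esub> h = g \<cdot>\<^bsub>C\<^esub> h \<longrightarrow>
        (\<exists>!u. u \<in> Hom C T (Dom C m) \<and> m \<cdot>\<^bsub>C\<^esub> u = h))"

definition is_coequalizer :: "('o, 'a) cat \<Rightarrow> 'a \<Rightarrow> 'a \<Rightarrow> 'a \<Rightarrow> bool" where
  "is_coequalizer C f g q \<longleftrightarrow> parallel C f g \<and> q \<in> Arr C \<and> Dom C q = Cod C f \<and>
     q \<cdot>\<^bsub>C\<^esub> f = q \<cdot>\<^bsub>C\<^esub> g \<and>
     (\<forall>T \<in> Obj C. \<forall>h \<in> Hom C (Cod C f) T. h \<cdot>\<^bsub>C\<^esub> f = h \<cdot>\<^bsub>C\<^esub> g \<longrightarrow>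
        (\<exists>!u. u \<in> Hom C (Cod C q) T \<and> u \<cdot>\<^bsub>C\<^esub> q = h))"

definition regular_mono :: "('o, 'a) cat \<Rightarrow> 'a \<Rightarrow> bool" where
  "regular_mono C m \<longleftrightarrow> (\<exists>f g. is_equalizer C f g m)"

definition regular_epi :: "('o, 'a) cat \<Rightarrow> 'a \<Rightarrow> bool" where
  "regular_epi C q \<longleftrightarrow> (\<exists>f g. is_coequalizer C f g q)"

text \<open>In \<open>is_pullback C f g p q\<close> the square is \<open>f \<cdot> p = g \<cdot> q\<close>; thus \<open>q\<close> is the pullback of \<open>f\<close>
  along \<open>g\<close>.\<close>

definition is_pullback :: "('o, 'a) cat \<Rightarrow> 'a \<Rightarrow> 'a \<Rightarrow> 'a \<Rightarrow> 'a \<Rightarrow> bool" where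
  "is_pullback C f g p q \<longleftrightarrow> f \<in> Arr C \<and> g \<in> Arr C \<and> Cod C f = Cod C g \<and>
     p \<in> Arr C \<and> q \<in> Arr C \<and> Dom C p = Dom C q \<and> Cod C p = Dom C f \<and> Cod C q = Dom C g \<and>
     f \<cdot>\<^bsub>C\<^esub> p = g \<cdot>\<^bsub>C\<^esub> q \<and>
     (\<forall>T \<in> Obj C. \<forall>h \<in> Hom C T (Dom C f). \<forall>k \<in> Hom C T (Dom C g).
        f \<cdot>\<^bsub>C\<^esub> h = g \<cdot>\<^bsub>C\<^esub> k \<longrightarrow>
        (\<exists>!u. u \<in> Hom C T (Dom C p) \<and> p \<cdot>\<^bsub>C\<^esub> u = h \<and> q \<cdot>\<^bsub>C\<^esub> u = k))"

definition is_cone :: "('i, 'j) cat \<Rightarrow> ('o, 'a) cat \<Rightarrow> ('i, 'j, 'o, 'a) Fun \<Rightarrow> 'o \<Rightarrow> ('i \<Rightarrow> 'a) \<Rightarrow> bool"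
  where
  "is_cone J C D A a \<longleftrightarrow> A \<in> Obj C \<and> (\<forall>j \<in> Obj J. a j \<in> Hom C A (FObj D j)) \<and>
     (\<forall>u \<in> Arr J. FArr D u \<cdot>\<^bsub>C\<^esub> a (Dom J u) = a (Cod J u))"

definition is_limit :: "('i, 'j) cat \<Rightarrow> ('o, 'a) cat \<Rightarrow> ('i, 'j, 'o, 'a) Fun \<Rightarrow> 'o \<Rightarrow> ('i \<Rightarrow> 'a) \<Rightarrow> bool"
  where
  "is_limit J C D A a \<longleftrightarrow> is_cone J C D A a \<and>
     (\<forall>B b. is_cone J C D B b \<longrightarrow>
        (\<exists>!h. h \<in> Hom C B A \<and> (\<forall>j \<in> Obj J. a j \<cdot>\<^bsub>C\<^esub> h = b j)))"

text \<open>Every finite category is isomorphic to one whose objects and arrows are natural numbers, so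
  it suffices to let the shape range over those.\<close>

definition has_finite_limits :: "('o, 'a) cat \<Rightarrow> bool" where
  "has_finite_limits C \<longleftrightarrow>
     (\<forall>(J :: (nat, nat) cat) D. category J \<and> finite (Obj J) \<and> finite (Arr J) \<and> is_functor J C D \<longrightarrow>
        (\<exists>A a. is_limit J C D A a))"


section \<open>Regular categories and equivalence relations\<close>

definition regular_epis_pullback_stable :: "('o, 'a) cat \<Rightarrow> bool" where
  "regular_epis_pullback_stable C \<longleftrightarrow>
     (\<forall>f g p q. is_pullback C f g p q \<and> regular_epi C f \<longrightarrow> regular_epi C q)"

definition regular_category :: "('o, 'a) cat \<Rightarrow> bool" where
  "regular_category C \<longleftrightarrow> category C \<and> has_finite_limits C \<and>
     (\<forall>f p q. is_pullback C f f p q \<longrightarrow> (\<exists>e. is_coequalizer C p q e)) \<and>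
     regular_epis_pullback_stable C"

definition jointly_monic :: "('o, 'a) cat \<Rightarrow> 'a \<Rightarrow> 'a \<Rightarrow> bool" where
  "jointly_monic C r0 r1 \<longleftrightarrow> r0 \<in> Arr C \<and> r1 \<in> Arr C \<and> Dom C r0 = Dom C r1 \<and>
     (\<forall>T \<in> Obj C. \<forall>f \<in> Hom C T (Dom C r0). \<forall>g \<in> Hom C T (Dom C r0).
        r0 \<cdot>\<^bsub>C\<^esub> f = r0 \<cdot>\<^bsub>C\<^esub> g \<and> r1 \<cdot>\<^bsub>C\<^esub> f = r1 \<cdot>\<^bsub>C\<^esub> g \<longrightarrow> f = g)"

definition equivalence_relation :: "('o, 'a) cat \<Rightarrow> 'o \<Rightarrow> 'a \<Rightarrow> 'a \<Rightarrow> bool" where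
  "equivalence_relation C X r0 r1 \<longleftrightarrow>
     jointly_monic C r0 r1 \<and> Cod C r0 = X \<and> Cod C r1 = X \<and>
     (\<forall>T \<in> Obj C. equiv (Hom C T X) {(r0 \<cdot>\<^bsub>C\<^esub> h, r1 \<cdot>\<^bsub>C\<^esub> h) | h. h \<in> Hom C T (Dom C r0)})"

text \<open>In the second conjunct \<open>q'\<close>, with \<open>x\<close> the other projection, is the pullback of \<open>q\<close> along
  \<open>f\<close>; \<open>a\<close> and \<open>b\<close> are the projections to \<open>R\<close> and \<open>Y\<close> of the pullback \<open>S\<close> of
  \<open>q \<cdot> r0 = q \<cdot> r1\<close> along \<open>f\<close>; and \<open>s0\<close>, \<open>s1\<close> are the induced arrows \<open>S \<rightarrow> X'\<close>.\<close>

definition stable_coequalizer :: "('o, 'a) cat \<Rightarrow> 'a \<Rightarrow> 'a \<Rightarrow> 'a \<Rightarrow> bool" where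
  "stable_coequalizer C r0 r1 q \<longleftrightarrow> is_coequalizer C r0 r1 q \<and>
     (\<forall>f x q' a b s0 s1.
        f \<in> Arr C \<and> Cod C f = Cod C q \<and>
        is_pullback C q f x q' \<and>
        is_pullback C (q \<cdot>\<^bsub>C\<^esub> r0) f a b \<and>
        s0 \<in> Hom C (Dom C a) (Dom C x) \<and> x \<cdot>\<^bsub>C\<^esub> s0 = r0 \<cdot>\<^bsub>C\<^esub> a \<and> q' \<cdot>\<^bsub>C\<^esub> s0 = b \<and>
        s1 \<in> Hom C (Dom C a) (Dom C x) \<and> x \<cdot>\<^bsub>C\<^esub> s1 = r1 \<cdot>\<^bsub>C\<^esub> a \<and> q' \<cdot>\<^bsub>C\<^esub> s1 = b
        \<longrightarrow> is_coequalizer C s0 s1 q')"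

definition has_stable_coequalizers_of_equivalence_relations :: "('o, 'a) cat \<Rightarrow> bool" where
  "has_stable_coequalizers_of_equivalence_relations C \<longleftrightarrow>
     (\<forall>X \<in> Obj C. \<forall>r0 r1. equivalence_relation C X r0 r1 \<longrightarrow> (\<exists>q. stable_coequalizer C r0 r1 q))"


section \<open>Additive and abelian categories\<close>

definition zero_object :: "('o, 'a) cat \<Rightarrow> 'o \<Rightarrow> bool" where
  "zero_object C Z \<longleftrightarrow> Z \<in> Obj C \<and>
     (\<forall>A \<in> Obj C. (\<exists>!f. f \<in> Hom C A Z) \<and> (\<exists>!f. f \<in> Hom C Z A))"

text \<open>Meaningful only if a zero object exists.\<close>

definition zero_arr :: "('o, 'a) cat \<Rightarrow> 'o \<Rightarrow> 'o \<Rightarrow> 'a" where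
  "zero_arr C A B =
     (THE f. \<exists>Z s t. zero_object C Z \<and> s \<in> Hom C A Z \<and> t \<in> Hom C Z B \<and> f = t \<cdot>\<^bsub>C\<^esub> s)"

definition is_kernel :: "('o, 'a) cat \<Rightarrow> 'a \<Rightarrow> 'a \<Rightarrow> bool" where
  "is_kernel C f k \<longleftrightarrow> is_equalizer C f (zero_arr C (Dom C f) (Cod C f)) k"

definition is_cokernel :: "('o, 'a) cat \<Rightarrow> 'a \<Rightarrow> 'a \<Rightarrow> bool" where
  "is_cokernel C f q \<longleftrightarrow> is_coequalizer C f (zero_arr C (Dom C f) (Cod C f)) q"

text \<open>\<open>P\<close>, with injections \<open>i\<close> and projections \<open>p\<close>, is a biproduct of the family \<open>A\<close> indexed by
  \<open>{..<n}\<close>.\<close>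

definition is_biproduct ::
    "('o, 'a) cat \<Rightarrow> nat \<Rightarrow> (nat \<Rightarrow> 'o) \<Rightarrow> 'o \<Rightarrow> (nat \<Rightarrow> 'a) \<Rightarrow> (nat \<Rightarrow> 'a) \<Rightarrow> bool" where
  "is_biproduct C n A P i p \<longleftrightarrow> P \<in> Obj C \<and>
     (\<forall>k<n. i k \<in> Hom C (A k) P \<and> p k \<in> Hom C P (A k)) \<and>
     (\<forall>k<n. \<forall>l<n. p l \<cdot>\<^bsub>C\<^esub> i k = (if k = l then Id C (A k) else zero_arr C (A k) (A l))) \<and>
     (\<forall>T \<in> Obj C. \<forall>f. (\<forall>k<n. f k \<in> Hom C T (A k)) \<longrightarrow>
        (\<exists>!u. u \<in> Hom C T P \<and> (\<forall>k<n. p k \<cdot>\<^bsub>C\<^esub> u = f k))) \<and>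
     (\<forall>T \<in> Obj C. \<forall>f. (\<forall>k<n. f k \<in> Hom C (A k) T) \<longrightarrow>
        (\<exists>!u. u \<in> Hom C P T \<and> (\<forall>k<n. u \<cdot>\<^bsub>C\<^esub> i k = f k)))"

definition has_finite_biproducts :: "('o, 'a) cat \<Rightarrow> bool" where
  "has_finite_biproducts C \<longleftrightarrow>
     (\<forall>n A. (\<forall>k<n. A k \<in> Obj C) \<longrightarrow> (\<exists>P i p. is_biproduct C n A P i p))"

text \<open>The sum of \<open>f, g : A \<rightarrow> B\<close> is \<open>A \<rightarrow> B \<oplus> B \<rightarrow> B\<close>, the pairing \<open>h\<close> of \<open>f\<close> and \<open>g\<close>
  followed by the codiagonal \<open>d\<close>.\<close>

definition hom_plus :: "('o, 'a) cat \<Rightarrow> 'a \<Rightarrow> 'a \<Rightarrow> 'a" where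
  "hom_plus C f g =
     (THE s. \<exists>P i p h d. is_biproduct C 2 (\<lambda>_. Cod C f) P i p \<and>
        h \<in> Hom C (Dom C f) P \<and> p 0 \<cdot>\<^bsub>C\<^esub> h = f \<and> p 1 \<cdot>\<^bsub>C\<^esub> h = g \<and>
        d \<in> Hom C P (Cod C f) \<and> d \<cdot>\<^bsub>C\<^esub> i 0 = Id C (Cod C f) \<and> d \<cdot>\<^bsub>C\<^esub> i 1 = Id C (Cod C f) \<and>
        s = d \<cdot>\<^bsub>C\<^esub> h)"

definition hom_monoid :: "('o, 'a) cat \<Rightarrow> 'o \<Rightarrow> 'o \<Rightarrow> 'a monoid" where
  "hom_monoid C A B = \<lparr>carrier = Hom C A B, mult = hom_plus C, one = zero_arr C A B\<rparr>"

definition additive_category :: "('o, 'a) cat \<Rightarrow> bool" where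
  "additive_category C \<longleftrightarrow> category C \<and> (\<exists>Z. zero_object C Z) \<and> has_finite_biproducts C \<and>
     (\<forall>A \<in> Obj C. \<forall>B \<in> Obj C. comm_group (hom_monoid C A B))"

definition abelian_category :: "('o, 'a) cat \<Rightarrow> bool" where
  "abelian_category C \<longleftrightarrow> additive_category C \<and>
     (\<forall>f \<in> Arr C. \<exists>k. is_kernel C f k) \<and>
     (\<forall>f \<in> Arr C. \<exists>q. is_cokernel C f q) \<and>
     (\<forall>m. mono_in C m \<longrightarrow> (\<exists>f. is_kernel C f m)) \<and>
     (\<forall>e. epi_in C e \<longrightarrow> (\<exists>f. is_cokernel C f e))"

text \<open>\<open>u\<close> and \<open>v\<close> are the projections of the pullback of \<open>q\<close> along \<open>f\<close>.\<close>

definition stable_cokernel :: "('o, 'a) cat \<Rightarrow> 'a \<Rightarrow> 'a \<Rightarrow> bool" where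
  "stable_cokernel C x q \<longleftrightarrow> is_cokernel C x q \<and>
     (\<forall>f u v x'.
        f \<in> Arr C \<and> Cod C f = Cod C q \<and> is_pullback C q f u v \<and>
        x' \<in> Hom C (Dom C x) (Dom C u) \<and>
        u \<cdot>\<^bsub>C\<^esub> x' = x \<and> v \<cdot>\<^bsub>C\<^esub> x' = zero_arr C (Dom C x) (Dom C f)
        \<longrightarrow> is_cokernel C x' v)"

definition has_stable_cokernels :: "('o, 'a) cat \<Rightarrow> bool" where
  "has_stable_cokernels C \<longleftrightarrow> (\<forall>x \<in> Arr C. \<exists>q. stable_cokernel C x q)"

definition has_factorizations :: "('o, 'a) cat \<Rightarrow> bool" where
  "has_factorizations C \<longleftrightarrow>
     (\<forall>f \<in> Arr C. \<exists>q g k. regular_epi C q \<and> epi_in C g \<and> mono_in C g \<and> regular_mono C k \<and>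
        Dom C q = Dom C f \<and> Dom C g = Cod C q \<and> Dom C k = Cod C g \<and> Cod C k = Cod C f \<and>
        f = k \<cdot>\<^bsub>C\<^esub> (g \<cdot>\<^bsub>C\<^esub> q))"


section \<open>Semi-localizations and torsion theories\<close>

definition is_reflection :: "('o, 'a) cat \<Rightarrow> ('p, 'b) cat \<Rightarrow> ('o, 'a, 'p, 'b) Fun \<Rightarrow>
    ('p, 'b, 'o, 'a) Fun \<Rightarrow> ('p \<Rightarrow> 'b) \<Rightarrow> bool" where
  "is_reflection X C U L \<eta> \<longleftrightarrow>
     is_functor X C U \<and> fully_faithful X C U \<and> is_functor C X L \<and>
     natural_trans C C id_fun (comp_fun U L) \<eta> \<and>
     (\<forall>Q \<in> Obj C. \<forall>Y \<in> Obj X. \<forall>f \<in> Hom C Q (FObj U Y).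
        \<exists>!g. g \<in> Hom X (FObj L Q) Y \<and> FArr U g \<cdot>\<^bsub>C\<^esub> \<eta> Q = f)"

definition semi_left_exact :: "('o, 'a) cat \<Rightarrow> ('p, 'b) cat \<Rightarrow> ('o, 'a, 'p, 'b) Fun \<Rightarrow>
    ('p, 'b, 'o, 'a) Fun \<Rightarrow> ('p \<Rightarrow> 'b) \<Rightarrow> bool" where
  "semi_left_exact X C U L \<eta> \<longleftrightarrow>
     (\<forall>Q \<in> Obj C. \<forall>A \<in> Obj X. \<forall>f \<in> Hom X A (FObj L Q). \<forall>p q.
        is_pullback C (FArr U f) (\<eta> Q) p q \<longrightarrow>
        is_pullback X (FArr L (FArr U f)) (FArr L (\<eta> Q)) (FArr L p) (FArr L q))"

definition semi_localization :: "('o, 'a) cat \<Rightarrow> ('p, 'b) cat \<Rightarrow> ('o, 'a, 'p, 'b) Fun \<Rightarrow>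
    ('p, 'b, 'o, 'a) Fun \<Rightarrow> ('p \<Rightarrow> 'b) \<Rightarrow> bool" where
  "semi_localization X C U L \<eta> \<longleftrightarrow> is_reflection X C U L \<eta> \<and> semi_left_exact X C U L \<eta>"

text \<open>\<open>X\<close> is equivalent to the full subcategory of \<open>C\<close> on \<open>S\<close>, which is a semi-localization of
  \<open>C\<close>; the functor \<open>id_fun\<close> is the inclusion.\<close>

definition semi_localization_via ::
    "('o, 'a) cat \<Rightarrow> ('p, 'b) cat \<Rightarrow> 'p set \<Rightarrow> ('p, 'b, 'p, 'b) Fun \<Rightarrow> ('p \<Rightarrow> 'b) \<Rightarrow> bool" where
  "semi_localization_via X C S L \<eta> \<longleftrightarrow> S \<subseteq> Obj C \<and>
     semi_localization (full_sub C S) C id_fun L \<eta> \<and> equivalent_cats X (full_sub C S)"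

definition replete :: "('o, 'a) cat \<Rightarrow> 'o set \<Rightarrow> bool" where
  "replete C S \<longleftrightarrow> S \<subseteq> Obj C \<and> (\<forall>f. iso_in C f \<and> Dom C f \<in> S \<longrightarrow> Cod C f \<in> S)"

text \<open>A full subcategory is given by its set of objects.\<close>

definition torsion_theory :: "('o, 'a) cat \<Rightarrow> 'o set \<Rightarrow> 'o set \<Rightarrow> bool" where
  "torsion_theory C \<T> \<F> \<longleftrightarrow> replete C \<T> \<and> replete C \<F> \<and>
     (\<forall>A \<in> \<T>. \<forall>B \<in> \<F>. \<forall>f \<in> Hom C A B. f = zero_arr C A B) \<and>
     (\<forall>B \<in> Obj C. \<exists>k q. Cod C k = B \<and> Dom C q = B \<and> Dom C k \<in> \<T> \<and> Cod C q \<in> \<F> \<and>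
        is_kernel C q k \<and> is_cokernel C k q)"

text \<open>HOL cannot quantify over types inside a proposition, so the types of objects and arrows of the
  ambient abelian category are given by the first argument of the following predicates. The types of
  the exact completion, \<open>('o, 'a) ex_cat\<close> below, turn out to be large enough.\<close>

definition semi_localization_of_abelian :: "('p, 'b) cat itself \<Rightarrow> ('o, 'a) cat \<Rightarrow> bool" where
  "semi_localization_of_abelian ty X \<longleftrightarrow>
     (\<exists>(C :: ('p, 'b) cat) S L \<eta>. abelian_category C \<and> semi_localization_via X C S L \<eta>)"

definition regular_epi_semi_localization_of_abelian ::
    "('p, 'b) cat itself \<Rightarrow> ('o, 'a) cat \<Rightarrow> bool" where
  "regular_epi_semi_localization_of_abelian ty X \<longleftrightarrow>
     (\<exists>(C :: ('p, 'b) cat) S L \<eta>. abelian_category C \<and> semi_localization_via X C S L \<eta> \<and>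
        (\<forall>Q \<in> Obj C. regular_epi C (\<eta> Q)))"

definition torsion_free_subcategory_of_abelian ::
    "('p, 'b) cat itself \<Rightarrow> ('o, 'a) cat \<Rightarrow> bool" where
  "torsion_free_subcategory_of_abelian ty X \<longleftrightarrow>
     (\<exists>(C :: ('p, 'b) cat) \<T> \<F>. abelian_category C \<and> torsion_theory C \<T> \<F> \<and>
        equivalent_cats X (full_sub C \<F>))"


section \<open>The exact completion of a regular category\<close>

text \<open>A relation from \<open>X\<close> to \<open>Y\<close> is an isomorphism class of jointly monic spans
  \<open>X \<leftarrow> R \<rightarrow> Y\<close>, represented by the set of these spans; hence the opposite relation is the set-theoretic
  converse.\<close>

type_synonym 'a rel_class = "('a \<times> 'a) set"

definition rel_class :: "('o, 'a) cat \<Rightarrow> 'a \<Rightarrow> 'a \<Rightarrow> 'a rel_class" where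
  "rel_class C r0 r1 = {(r0 \<cdot>\<^bsub>C\<^esub> i, r1 \<cdot>\<^bsub>C\<^esub> i) | i. iso_in C i \<and> Cod C i = Dom C r0}"

definition relations :: "('o, 'a) cat \<Rightarrow> 'o \<Rightarrow> 'o \<Rightarrow> 'a rel_class set" where
  "relations C X Y =
     {rel_class C r0 r1 | r0 r1. jointly_monic C r0 r1 \<and> Cod C r0 = X \<and> Cod C r1 = Y}"

definition rel_le :: "('o, 'a) cat \<Rightarrow> 'a rel_class \<Rightarrow> 'a rel_class \<Rightarrow> bool" where
  "rel_le C \<phi> \<psi> \<longleftrightarrow>
     (\<exists>(r0, r1) \<in> \<phi>. \<exists>(s0, s1) \<in> \<psi>. \<exists>h \<in> Hom C (Dom C r0) (Dom C s0).
        s0 \<cdot>\<^bsub>C\<^esub> h = r0 \<and> s1 \<cdot>\<^bsub>C\<^esub> h = r1)"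

text \<open>The composite \<open>\<psi>\<phi>\<close> (\<open>\<phi>\<close> first) is the regular image \<open>(t0, t1)\<close> of the span given by the
  pullback of a representative of \<open>\<phi>\<close> and one of \<open>\<psi>\<close>.\<close>

definition rel_comp :: "('o, 'a) cat \<Rightarrow> 'a rel_class \<Rightarrow> 'a rel_class \<Rightarrow> 'a rel_class" where
  "rel_comp C \<psi> \<phi> =
     {(t0, t1). jointly_monic C t0 t1 \<and>
        (\<exists>(r0, r1) \<in> \<phi>. \<exists>(s0, s1) \<in> \<psi>. \<exists>p q e. is_pullback C r1 s0 p q \<and>
           regular_epi C e \<and> Dom C e = Dom C p \<and> Cod C e = Dom C t0 \<and>
           t0 \<cdot>\<^bsub>C\<^esub> e = r0 \<cdot>\<^bsub>C\<^esub> p \<and> t1 \<cdot>\<^bsub>C\<^esub> e = s1 \<cdot>\<^bsub>C\<^esub> q)}"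

type_synonym ('o, 'a) ex_obj = "'o \<times> 'a rel_class"
type_synonym ('o, 'a) ex_arr = "('o, 'a) ex_obj \<times> 'a rel_class \<times> ('o, 'a) ex_obj"
type_synonym ('o, 'a) ex_cat = "(('o, 'a) ex_obj, ('o, 'a) ex_arr) cat"

definition ex_Obj :: "('o, 'a) cat \<Rightarrow> ('o, 'a) ex_obj set" where
  "ex_Obj C = {(X, rel_class C r0 r1) | X r0 r1. X \<in> Obj C \<and> equivalence_relation C X r0 r1}"

definition ex_Arr :: "('o, 'a) cat \<Rightarrow> ('o, 'a) ex_arr set" where
  "ex_Arr C = {((X, R), \<phi>, (Y, S)) | X R \<phi> Y S.
     (X, R) \<in> ex_Obj C \<and> (Y, S) \<in> ex_Obj C \<and> \<phi> \<in> relations C X Y \<and>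
     rel_comp C S (rel_comp C \<phi> R) = \<phi> \<and>
     rel_le C R (rel_comp C (converse \<phi>) \<phi>) \<and>
     rel_le C (rel_comp C \<phi> (converse \<phi>)) S}"

definition ex_reg :: "('o, 'a) cat \<Rightarrow> ('o, 'a) ex_cat" where
  "ex_reg C = \<lparr>
     Obj = ex_Obj C,
     Arr = ex_Arr C,
     Dom = (\<lambda>(A, \<phi>, B). A),
     Cod = (\<lambda>(A, \<phi>, B). B),
     Id = (\<lambda>(X, R). ((X, R), R, (X, R))),
     Comp = (\<lambda>(B, \<psi>, D) (A, \<phi>, B'). (A, rel_comp C \<psi> \<phi>, D))\<rparr>"

definition ex_obj_embedding :: "('o, 'a) cat \<Rightarrow> 'o \<Rightarrow> ('o, 'a) ex_obj" where
  "ex_obj_embedding C X = (X, rel_class C (Id C X) (Id C X))"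

definition ex_embedding :: "('o, 'a) cat \<Rightarrow> ('o, 'a, ('o, 'a) ex_obj, ('o, 'a) ex_arr) Fun" where
  "ex_embedding C = \<lparr>
     FObj = ex_obj_embedding C,
     FArr = (\<lambda>f. (ex_obj_embedding C (Dom C f), rel_class C (Id C (Dom C f)) f,
                  ex_obj_embedding C (Cod C f)))\<rparr>"

definition semi_localization_of_exact_completion :: "('o, 'a) cat \<Rightarrow> bool" where
  "semi_localization_of_exact_completion X \<longleftrightarrow>
     (\<exists>L \<eta>. semi_localization X (ex_reg X) (ex_embedding X) L \<eta>)"

end

theory Submission
  imports Defs
begin

text \<open>Every condition is compared with the following one: the category is additive, has kernels and
  cokernels, and its cokernels are stable. A semi-left-exact reflection transports this property from
  an abelian category. Conversely, the exact completion is computed with generalized elements: an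
  equivalence relation on an object of an additive category is a congruence on the arrows into it, so
  that kernels and cokernels in the exact completion are obtained by hand and the completion is
  abelian. The reflection of the pair of an object and an equivalence relation is the cokernel of the
  zero class of the relation. The kernel of this unit is torsion, because the comparison from an arrow
  to the kernel of its cokernel is an epimorphism when cokernels are stable.\<close>

notation Comp (infixr "##\<index>" 70)

section \<open>Categories\<close>

lemma in_Hom [simp]: "f : Hom C A B \<longleftrightarrow> f : Arr C & Dom C f = A & Cod C f = B"
 by (auto simp: Hom_def)

context category
begin

lemma dom_obj [simp]: "f : Arr C ==> Dom C f : Obj C"
 and cod_obj [simp]: "f : Arr C ==> Cod C f : Obj C"
 by (auto intro: Dom_in Cod_in)

lemma id_simps [simp]:
 assumes "A : Obj C"
 shows "Id C A : Arr C" "Dom C (Id C A) = A" "Cod C (Id C A) = A"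
 using Id_in[OF assms] by auto

lemma id_comp [simp]: "f : Arr C ==> Cod C f = B ==> Id C B ## f = f"
 and comp_id [simp]: "f : Arr C ==> Dom C f = A ==> f ## Id C A = f"
 using Id_left[of f] Id_right[of f] by auto

lemma comp_simps [simp]:
 assumes "f : Arr C" "g : Arr C" "Cod C f = Dom C g"
 shows "g ## f : Arr C" "Dom C (g ## f) = Dom C f" "Cod C (g ## f) = Cod C g"
 using Comp_in[of f "Dom C f" "Dom C g" g "Cod C g"] assms by auto

lemma assoc [simp]:
 assumes "f : Arr C" "g : Arr C" "h : Arr C" "Cod C f = Dom C g" "Cod C g = Dom C h"
 shows "(h ## g) ## f = h ## (g ## f)"
 using Comp_assoc[of f "Dom C f" "Dom C g" g "Dom C h" h "Cod C h"] assms by auto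

lemma assoc_rewrite:
 assumes "g ## f = k" "f : Arr C" "g : Arr C" "Cod C f = Dom C g" "h : Arr C" "Cod C h = Dom C f"
 shows "g ## (f ## h) = k ## h"
 using assoc[of h f g] assms by simp

lemma monoD:
 assumes "mono_in C m" "m ## f = m ## g" "f : Arr C" "g : Arr C" "Dom C f = Dom C g"
  "Cod C f = Dom C m" "Cod C g = Dom C m"
 shows "f = g"
 using assms unfolding mono_in_def by (auto dest!: bspec[where x = "Dom C f"])

lemma monoI:
 assumes "m : Arr C"
  "!!f g. f : Arr C ==> g : Arr C ==> Dom C f = Dom C g ==> Cod C f = Dom C m ==> Cod C g = Dom C m
   ==> m ## f = m ## g ==> f = g"
 shows "mono_in C m"
 using assms unfolding mono_in_def by auto

lemma mono_arr: "mono_in C m ==> m : Arr C"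
 by (simp add: mono_in_def)

lemma epiD:
 assumes "epi_in C e" "f ## e = g ## e" "f : Arr C" "g : Arr C" "Cod C f = Cod C g"
  "Dom C f = Cod C e" "Dom C g = Cod C e"
 shows "f = g"
 using assms unfolding epi_in_def by (auto dest!: bspec[where x = "Cod C f"])

lemma epiI:
 assumes "e : Arr C"
  "!!f g. f : Arr C ==> g : Arr C ==> Cod C f = Cod C g ==> Dom C f = Cod C e ==> Dom C g = Cod C e
   ==> f ## e = g ## e ==> f = g"
 shows "epi_in C e"
 using assms unfolding epi_in_def by auto

lemma epi_arr: "epi_in C e ==> e : Arr C"
 by (simp add: epi_in_def)

lemma mono_comp:
 assumes "mono_in C m" "mono_in C n" "Cod C n = Dom C m"
 shows "mono_in C (m ## n)"
proof (rule monoI)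
 note a[simp] = mono_arr[OF assms(1)] mono_arr[OF assms(2)] assms(3)
 show "m ## n : Arr C" by simp
 fix f g assume h[simp]: "f : Arr C" "g : Arr C" "Dom C f = Dom C g" "Cod C f = Dom C (m ## n)"
  "Cod C g = Dom C (m ## n)" and "(m ## n) ## f = (m ## n) ## g"
 then have "m ## (n ## f) = m ## (n ## g)" by simp
 then have "n ## f = n ## g" by (rule monoD[OF assms(1)]) auto
 then show "f = g" by (rule monoD[OF assms(2)]) auto
qed

lemma epi_comp:
 assumes "epi_in C d" "epi_in C e" "Cod C e = Dom C d"
 shows "epi_in C (d ## e)"
proof (rule epiI)
 note a[simp] = epi_arr[OF assms(1)] epi_arr[OF assms(2)] assms(3)
 show "d ## e : Arr C" by simp
 fix f g assume h[simp]: "f : Arr C" "g : Arr C" "Cod C f = Cod C g" "Dom C f = Cod C (d ## e)"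
  "Dom C g = Cod C (d ## e)" and "f ## (d ## e) = g ## (d ## e)"
 then have "(f ## d) ## e = (g ## d) ## e" by simp
 then have "f ## d = g ## d" by (rule epiD[OF assms(2)]) auto
 then show "f = g" by (rule epiD[OF assms(1)]) auto
qed

lemma isoE:
 assumes "iso_in C f"
 obtains g where "f : Arr C" "g : Arr C" "Dom C g = Cod C f" "Cod C g = Dom C f"
  "g ## f = Id C (Dom C f)" "f ## g = Id C (Cod C f)"
 using assms unfolding iso_in_def by auto

lemma isoI:
 assumes "f : Arr C" "g : Arr C" "Dom C g = Cod C f" "Cod C g = Dom C f"
  "g ## f = Id C (Dom C f)" "f ## g = Id C (Cod C f)"
 shows "iso_in C f"
 using assms unfolding iso_in_def by auto

lemma iso_id [simp]: "A : Obj C ==> iso_in C (Id C A)"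
 by (rule isoI[of _ "Id C A"]) auto

lemma iso_mono:
 assumes "iso_in C f" shows "mono_in C f"
proof -
 obtain i where i[simp]: "f : Arr C" "i : Arr C" "Dom C i = Cod C f" "Cod C i = Dom C f"
  "i ## f = Id C (Dom C f)" "f ## i = Id C (Cod C f)" using assms by (rule isoE)
 show ?thesis
 proof (rule monoI)
  fix g h assume g[simp]: "g : Arr C" "h : Arr C" "Dom C g = Dom C h" "Cod C g = Dom C f"
   "Cod C h = Dom C f" "f ## g = f ## h"
  have "g = (i ## f) ## g" by (simp del: assoc)
  also have "\<dots> = i ## (f ## h)" using g(6) by (subst assoc) auto
  also have "\<dots> = (i ## f) ## h" by (subst assoc) auto
  finally show "g = h" by (simp del: assoc)
 qed simp
qed

lemma iso_epi:
 assumes "iso_in C f" shows "epi_in C f"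
proof -
 obtain i where i[simp]: "f : Arr C" "i : Arr C" "Dom C i = Cod C f" "Cod C i = Dom C f"
  "i ## f = Id C (Dom C f)" "f ## i = Id C (Cod C f)" using assms by (rule isoE)
 show ?thesis
 proof (rule epiI)
  fix g h assume g[simp]: "g : Arr C" "h : Arr C" "Cod C g = Cod C h" "Dom C g = Cod C f"
   "Dom C h = Cod C f" "g ## f = h ## f"
  have "(g ## f) ## i = (h ## f) ## i" by simp
  then show "g = h" by (subst (asm) (1 2) assoc) auto
 qed simp
qed

lemma iso_comp:
 assumes "iso_in C f" "iso_in C g" "Cod C f = Dom C g"
 shows "iso_in C (g ## f)"
proof -
 obtain i where i[simp]: "f : Arr C" "i : Arr C" "Dom C i = Cod C f" "Cod C i = Dom C f"
  "i ## f = Id C (Dom C f)" "f ## i = Id C (Cod C f)" using assms(1) by (rule isoE)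
 obtain j where j[simp]: "g : Arr C" "j : Arr C" "Dom C j = Cod C g" "Cod C j = Dom C g"
  "j ## g = Id C (Dom C g)" "g ## j = Id C (Cod C g)" using assms(2) by (rule isoE)
 have [simp]: "j ## (g ## f) = f" "f ## (i ## j) = j"
  using assoc_rewrite[of j g _ f] assoc_rewrite[of f i _ j] assms(3) by auto
 show ?thesis by (rule isoI[of _ "i ## j"]) (use assms(3) in auto)
qed

lemma iso_inverse:
 assumes "iso_in C f"
 obtains g where "iso_in C g" "f : Arr C" "g : Arr C" "Dom C g = Cod C f" "Cod C g = Dom C f"
  "g ## f = Id C (Dom C f)" "f ## g = Id C (Cod C f)"
proof -
 obtain i where i: "f : Arr C" "i : Arr C" "Dom C i = Cod C f" "Cod C i = Dom C f"
  "i ## f = Id C (Dom C f)" "f ## i = Id C (Cod C f)" using assms by (rule isoE)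
 then show thesis by (intro that[of i]) (auto intro: isoI[of i f])
qed

lemma iso_arr: "iso_in C f ==> f : Arr C"
 by (simp add: iso_in_def)

lemma pullbackD:
 assumes "is_pullback C f g p q"
 shows "f : Arr C" "g : Arr C" "p : Arr C" "q : Arr C" "Cod C f = Cod C g" "Dom C p = Dom C q"
  "Cod C p = Dom C f" "Cod C q = Dom C g" "f ## p = g ## q"
 using assms unfolding is_pullback_def by blast+

lemma pullback_univ:
 assumes "is_pullback C f g p q" "h : Arr C" "k : Arr C" "Dom C h = Dom C k" "Cod C h = Dom C f"
  "Cod C k = Dom C g" "f ## h = g ## k"
 shows "EX! u. u : Hom C (Dom C k) (Dom C p) & p ## u = h & q ## u = k"
proof -
 have "ALL T : Obj C. ALL h : Hom C T (Dom C f). ALL k : Hom C T (Dom C g). f ## h = g ## k \<longrightarrow>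
    (EX! u. u : Hom C T (Dom C p) & p ## u = h & q ## u = k)"
  using assms(1) unfolding is_pullback_def by blast
 moreover have "Dom C k : Obj C" "h : Hom C (Dom C k) (Dom C f)" "k : Hom C (Dom C k) (Dom C g)"
  using assms by auto
 ultimately show ?thesis using assms(7) by blast
qed

lemma pullback_lift:
 assumes "is_pullback C f g p q" "h : Arr C" "k : Arr C" "Dom C h = Dom C k" "Cod C h = Dom C f"
  "Cod C k = Dom C g" "f ## h = g ## k"
 obtains u where "u : Arr C" "Dom C u = Dom C h" "Cod C u = Dom C p" "p ## u = h" "q ## u = k"
proof -
 have "EX! u. u : Hom C (Dom C k) (Dom C p) & p ## u = h & q ## u = k"
  using assms by (rule pullback_univ)
 then show thesis using that assms by auto
qed

lemma pullback_unique:
 assumes "is_pullback C f g p q" "u : Arr C" "v : Arr C" "Dom C u = Dom C v" "Cod C u = Dom C p"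
  "Cod C v = Dom C p" "p ## u = p ## v" "q ## u = q ## v"
 shows "u = v"
proof -
 note d[simp] = pullbackD[OF assms(1)]
 have e: "f ## (p ## v) = g ## (q ## v)"
  using assoc_rewrite[OF d(9), of v] assms by simp
 have "EX! w. w : Hom C (Dom C v) (Dom C p) & p ## w = p ## v & q ## w = q ## v"
  using pullback_univ[OF assms(1) _ _ _ _ _ e] assms(2-) by simp
 then show ?thesis using assms by auto
qed

lemma pullbackI:
 assumes "f : Arr C" "g : Arr C" "p : Arr C" "q : Arr C" "Cod C f = Cod C g" "Dom C p = Dom C q"
  "Cod C p = Dom C f" "Cod C q = Dom C g" "f ## p = g ## q"
  "!!h k. h : Arr C ==> k : Arr C ==> Dom C h = Dom C k ==> Cod C h = Dom C f ==> Cod C k = Dom C g ==>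
   f ## h = g ## k ==> EX u. u : Arr C & Dom C u = Dom C h & Cod C u = Dom C p & p ## u = h & q ## u = k"
  "!!u v. u : Arr C ==> v : Arr C ==> Dom C u = Dom C v ==> Cod C u = Dom C p ==> Cod C v = Dom C p ==>
   p ## u = p ## v ==> q ## u = q ## v ==> u = v"
 shows "is_pullback C f g p q"
 unfolding is_pullback_def
proof (intro conjI ballI impI)
 fix T h k assume "T : Obj C" and hk: "h : Hom C T (Dom C f)" "k : Hom C T (Dom C g)" "f ## h = g ## k"
 obtain u where u: "u : Arr C & Dom C u = Dom C h & Cod C u = Dom C p & p ## u = h & q ## u = k"
  using assms(10)[of h k] hk by auto
 show "EX! u. u : Hom C T (Dom C p) & p ## u = h & q ## u = k"
  using u hk by (intro ex1I[of _ u]) (auto intro!: assms(11))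
qed (use assms in auto)

lemma pullback_of_iso:
 assumes "is_pullback C f g p q" "iso_in C g"
 shows "iso_in C p"
proof -
 note d[simp] = pullbackD[OF assms(1)]
 obtain i where i[simp]: "i : Arr C" "Dom C i = Cod C g" "Cod C i = Dom C g"
  "i ## g = Id C (Dom C g)" "g ## i = Id C (Cod C g)" using assms(2) by (rule isoE)
 have e: "f ## Id C (Dom C f) = g ## (i ## f)" using assoc_rewrite[OF i(5), of f] by simp
 obtain u where u[simp]: "u : Arr C" "Dom C u = Dom C f" "Cod C u = Dom C p" "p ## u = Id C (Dom C f)"
  "q ## u = i ## f"
  by (rule pullback_lift[OF assms(1) _ _ _ _ _ e]) auto
 have "u ## p = Id C (Dom C p)"
 proof (rule pullback_unique[OF assms(1)])
  show "p ## (u ## p) = p ## Id C (Dom C p)" using assoc_rewrite[OF u(4), of p] by simp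
  have "q ## (u ## p) = i ## (g ## q)" using assoc_rewrite[OF u(5), of p] by simp
  also have "\<dots> = q" using assoc_rewrite[OF i(4), of q] by simp
  finally show "q ## (u ## p) = q ## Id C (Dom C p)" by simp
 qed auto
 then show ?thesis by (intro isoI[of p u]) auto
qed

lemma pullback_of_isos:
 assumes "f : Arr C" "q : Arr C" "iso_in C g" "iso_in C p" "Cod C f = Cod C g" "Dom C p = Dom C q"
  "Cod C p = Dom C f" "Cod C q = Dom C g" "f ## p = g ## q"
 shows "is_pullback C f g p q"
proof -
 note a[simp] = assms(1,2,5-8)
 obtain i where i[simp]: "p : Arr C" "i : Arr C" "Dom C i = Cod C p" "Cod C i = Dom C p"
  "i ## p = Id C (Dom C p)" "p ## i = Id C (Cod C p)" using assms(4) by (rule isoE)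
 have [simp]: "g : Arr C" using assms(3) by (rule iso_arr)
 show ?thesis
 proof (rule pullbackI)
  fix h k assume h[simp]: "h : Arr C" "k : Arr C" "Dom C h = Dom C k" "Cod C h = Dom C f" "Cod C k = Dom C g"
  and e: "f ## h = g ## k"
  have 1: "p ## (i ## h) = h" using assoc_rewrite[OF i(6), of h] by simp
  have "g ## (q ## (i ## h)) = g ## k"
   using assoc_rewrite[OF assms(9)[symmetric], of "i ## h"] 1 e by simp
  then have "q ## (i ## h) = k" by (rule monoD[OF iso_mono[OF assms(3)]]) auto
  then show "EX u. u : Arr C & Dom C u = Dom C h & Cod C u = Dom C p & p ## u = h & q ## u = k"
   using 1 by (intro exI[of _ "i ## h"]) auto
 qed (use assms monoD[OF iso_mono[OF assms(4)]] in auto)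
qed

lemma zero_object_hom:
 assumes "zero_object C Z" "A : Obj C"
 shows "EX! f. f : Hom C A Z" "EX! f. f : Hom C Z A" "Z : Obj C"
 using assms unfolding zero_object_def by blast+

lemma zero_arr_eq:
 assumes "zero_object C Z" "s : Arr C" "t : Arr C" "Cod C s = Z" "Dom C t = Z"
 shows "zero_arr C (Dom C s) (Cod C t) = t ## s"
 unfolding zero_arr_def
proof (rule the_equality)
 show "EX Z' s' t'. zero_object C Z' & s' : Hom C (Dom C s) Z' & t' : Hom C Z' (Cod C t) & t ## s = t' ## s'"
  using assms by auto
 fix f assume "EX Z' s' t'. zero_object C Z' & s' : Hom C (Dom C s) Z' & t' : Hom C Z' (Cod C t) & f = t' ## s'"
 then obtain Z' s' t' where z: "zero_object C Z'" and [simp]: "s' : Arr C" "Dom C s' = Dom C s" "Cod C s' = Z'"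
  "t' : Arr C" "Dom C t' = Z'" "Cod C t' = Cod C t" "f = t' ## s'" by auto
 have Z: "Z : Obj C" "Z' : Obj C" using assms(1) z by (auto simp: zero_object_def)
 obtain w where w[simp]: "w : Arr C" "Dom C w = Z" "Cod C w = Z'"
  using zero_object_hom(1)[OF z Z(1)] by auto
 have 1: "w ## s = s'" using zero_object_hom(1)[OF z, of "Dom C s"] assms by auto
 have 2: "t' ## w = t" using zero_object_hom(2)[OF assms(1), of "Cod C t"] assms by auto
 show "f = t ## s" using 1 assoc_rewrite[OF 2, of s] assms by simp
qed

end

section \<open>Preadditive categories\<close>

locale preadd = category C for C :: "('o, 'a) cat" (structure) +
 fixes pl :: "'a \<Rightarrow> 'a \<Rightarrow> 'a" and ze :: "'o \<Rightarrow> 'o \<Rightarrow> 'a" and ng :: "'a \<Rightarrow> 'a"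
 assumes pl_arr: "[|f : Arr C; g : Arr C; Dom C f = Dom C g; Cod C f = Cod C g|] ==>
   pl f g : Arr C & Dom C (pl f g) = Dom C f & Cod C (pl f g) = Cod C f"
  and ze_arr: "[|A : Obj C; B : Obj C|] ==> ze A B : Arr C & Dom C (ze A B) = A & Cod C (ze A B) = B"
  and ng_arr: "f : Arr C ==> ng f : Arr C & Dom C (ng f) = Dom C f & Cod C (ng f) = Cod C f"
  and pl_assoc: "[|f : Arr C; g : Arr C; h : Arr C; Dom C f = Dom C g; Cod C f = Cod C g;
   Dom C g = Dom C h; Cod C g = Cod C h|] ==> pl (pl f g) h = pl f (pl g h)"
  and pl_comm: "[|f : Arr C; g : Arr C; Dom C f = Dom C g; Cod C f = Cod C g|] ==> pl f g = pl g f"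
  and pl_ze': "f : Arr C ==> pl f (ze (Dom C f) (Cod C f)) = f"
  and pl_ng: "f : Arr C ==> pl f (ng f) = ze (Dom C f) (Cod C f)"
  and comp_pl: "[|f : Arr C; g : Arr C; h : Arr C; Dom C f = Dom C g; Cod C f = Dom C h; Cod C g = Dom C h|]
   ==> h ## pl f g = pl (h ## f) (h ## g)"
  and pl_comp: "[|f : Arr C; g : Arr C; h : Arr C; Cod C f = Cod C g; Cod C h = Dom C f; Cod C h = Dom C g|]
   ==> pl f g ## h = pl (f ## h) (g ## h)"
begin

lemma pl_simps [simp]:
 assumes "f : Arr C" "g : Arr C" "Dom C f = Dom C g" "Cod C f = Cod C g"
 shows "pl f g : Arr C" "Dom C (pl f g) = Dom C f" "Cod C (pl f g) = Cod C f"
 using pl_arr[OF assms] by auto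

lemma ze_simps [simp]:
 assumes "A : Obj C" "B : Obj C"
 shows "ze A B : Arr C" "Dom C (ze A B) = A" "Cod C (ze A B) = B"
 using ze_arr[OF assms] by auto

lemma ng_simps [simp]:
 assumes "f : Arr C"
 shows "ng f : Arr C" "Dom C (ng f) = Dom C f" "Cod C (ng f) = Cod C f"
 using ng_arr[OF assms] by auto

lemma pl_ze [simp]: "f : Arr C ==> Dom C f = A ==> Cod C f = B ==> pl f (ze A B) = f"
 using pl_ze' by auto

lemma ze_pl [simp]: "f : Arr C ==> Dom C f = A ==> Cod C f = B ==> pl (ze A B) f = f"
 using pl_comm[of f "ze A B"] by auto

lemma ng_pl: "f : Arr C ==> pl (ng f) f = ze (Dom C f) (Cod C f)"
 using pl_ng[of f] pl_comm[of f "ng f"] by auto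

lemma ng_pl_pl:
 assumes "f : Arr C" "g : Arr C" "Dom C f = Dom C g" "Cod C f = Cod C g"
 shows "pl (ng f) (pl f g) = g"
 using assms by (simp add: pl_assoc[of "ng f" f g, symmetric] ng_pl)

lemma pl_cancel:
 assumes "f : Arr C" "g : Arr C" "h : Arr C" "Dom C f = Dom C h" "Cod C f = Cod C h"
  "Dom C g = Dom C h" "Cod C g = Cod C h" "pl f g = pl f h"
 shows "g = h"
proof -
 have "g = pl (ng f) (pl f g)" by (rule ng_pl_pl[symmetric]) (simp_all add: assms(1-7))
 also have "... = h" unfolding assms(8) by (rule ng_pl_pl) (simp_all add: assms(1-7))
 finally show ?thesis .
qed

lemma comp_ze [simp]:
 assumes "h : Arr C" "Dom C h = B" "A : Obj C"
 shows "h ## ze A B = ze A (Cod C h)"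
proof -
 have B: "B : Obj C" using assms by auto
 have "pl (h ## ze A B) (h ## ze A B) = h ## pl (ze A B) (ze A B)" using assms B by (subst comp_pl) auto
 also have "\<dots> = pl (h ## ze A B) (ze A (Cod C h))" using assms B by simp
 finally show ?thesis by (rule pl_cancel[rotated -1]) (use assms B in simp_all)
qed

lemma ze_comp [simp]:
 assumes "h : Arr C" "Cod C h = A" "B : Obj C"
 shows "ze A B ## h = ze (Dom C h) B"
proof -
 have A: "A : Obj C" using assms by auto
 have "pl (ze A B ## h) (ze A B ## h) = pl (ze A B) (ze A B) ## h" using assms A by (subst pl_comp) auto
 also have "\<dots> = pl (ze A B ## h) (ze (Dom C h) B)" using assms A by simp
 finally show ?thesis by (rule pl_cancel[rotated -1]) (use assms A in simp_all)
qed

lemma ng_unique: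
 assumes "f : Arr C" "g : Arr C" "Dom C f = Dom C g" "Cod C f = Cod C g" "pl f g = ze (Dom C f) (Cod C f)"
 shows "g = ng f"
 by (rule pl_cancel[of f]) (use assms in \<open>simp_all add: pl_ng\<close>)

lemma comp_ng: "f : Arr C ==> h : Arr C ==> Cod C f = Dom C h ==> h ## ng f = ng (h ## f)"
 by (rule ng_unique) (auto simp: comp_pl[symmetric] pl_ng)

lemma ng_comp: "f : Arr C ==> h : Arr C ==> Cod C h = Dom C f ==> ng f ## h = ng (f ## h)"
 by (rule ng_unique) (auto simp: pl_comp[symmetric] pl_ng)

lemma ng_ng [simp]: "f : Arr C ==> ng (ng f) = f"
 by (rule ng_unique[symmetric]) (simp_all add: ng_pl)

lemma diff_eq_ze_iff:
 assumes "f : Arr C" "g : Arr C" "Dom C f = Dom C g" "Cod C f = Cod C g"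
 shows "pl f (ng g) = ze (Dom C g) (Cod C g) \<longleftrightarrow> f = g"
proof
 assume "pl f (ng g) = ze (Dom C g) (Cod C g)"
 then have "ng g = ng f" using assms by (intro ng_unique) auto
 then show "f = g" using assms ng_ng by metis
qed (use assms pl_ng in auto)

lemma zero_objectI:
 assumes "Z : Obj C" "Id C Z = ze Z Z" shows "zero_object C Z"
 unfolding zero_object_def
proof (intro conjI ballI)
 fix A assume A[simp]: "A : Obj C"
 note [simp] = assms(1)
 have 1: "f = ze A Z" if [simp]: "f : Arr C" "Dom C f = A" "Cod C f = Z" for f
 proof -
  have "f = Id C Z ## f" by simp
  then show ?thesis by (simp add: assms(2) del: id_comp)
 qed
 have 2: "f = ze Z A" if [simp]: "f : Arr C" "Dom C f = Z" "Cod C f = A" for f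
 proof -
  have "f = f ## Id C Z" by simp
  then show ?thesis by (simp add: assms(2) del: comp_id)
 qed
 show "EX! f. f : Hom C A Z" by (rule ex1I[of _ "ze A Z"]) (simp, rule 1, simp_all)
 show "EX! f. f : Hom C Z A" by (rule ex1I[of _ "ze Z A"]) (simp, rule 2, simp_all)
qed (fact assms(1))

lemma zero_arr_ze:
 assumes "zero_object C Z" "A : Obj C" "B : Obj C"
 shows "zero_arr C A B = ze A B"
proof -
 have [simp]: "Z : Obj C" using assms by (simp add: zero_object_def)
 show ?thesis using zero_arr_eq[OF assms(1), of "ze A Z" "ze Z B"] assms by simp
qed

end

declare One_nat_def [simp del]

section \<open>Additive categories\<close>

definition biprod ::
 "('o, 'a) cat \<Rightarrow> ('a \<Rightarrow> 'a \<Rightarrow> 'a) \<Rightarrow> ('o \<Rightarrow> 'o \<Rightarrow> 'a) \<Rightarrow> 'o \<Rightarrow> 'o \<Rightarrow> 'o \<Rightarrow> 'a \<Rightarrow> 'a \<Rightarrow> 'a \<Rightarrow> 'a \<Rightarrow> bool" where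
 "biprod C pl ze A B P i j p q \<longleftrightarrow> A : Obj C & B : Obj C & P : Obj C \<and>
  i : Hom C A P & j : Hom C B P & p : Hom C P A & q : Hom C P B \<and>
  Comp C p i = Id C A & Comp C q j = Id C B & Comp C q i = ze A B & Comp C p j = ze B A \<and>
  pl (Comp C i p) (Comp C j q) = Id C P"

context preadd
begin

lemma biprod_simps [simp]:
 assumes "biprod C pl ze A B P i j p q"
 shows "A : Obj C" "B : Obj C" "P : Obj C" "i : Arr C" "Dom C i = A" "Cod C i = P"
  "j : Arr C" "Dom C j = B" "Cod C j = P" "p : Arr C" "Dom C p = P" "Cod C p = A"
  "q : Arr C" "Dom C q = P" "Cod C q = B"
  "p ## i = Id C A" "q ## j = Id C B" "q ## i = ze A B" "p ## j = ze B A"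
 using assms unfolding biprod_def by auto

lemma biprod_decomp:
 assumes b: "biprod C pl ze A B P i j p q" and u: "u : Arr C" "Cod C u = P"
 shows "u = pl (i ## (p ## u)) (j ## (q ## u))"
proof -
 note [simp] = biprod_simps[OF b] u
 have "u = pl (i ## p) (j ## q) ## u" using b unfolding biprod_def by simp
 also have "\<dots> = pl (i ## (p ## u)) (j ## (q ## u))" by (simp add: pl_comp)
 finally show ?thesis .
qed

lemma biprod_codecomp:
 assumes b: "biprod C pl ze A B P i j p q" and u: "u : Arr C" "Dom C u = P"
 shows "u = pl ((u ## i) ## p) ((u ## j) ## q)"
proof -
 note [simp] = biprod_simps[OF b] u
 have "u = u ## pl (i ## p) (j ## q)" using b unfolding biprod_def by simp
 also have "\<dots> = pl ((u ## i) ## p) ((u ## j) ## q)" by (simp add: comp_pl)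
 finally show ?thesis .
qed

lemma biprod_unique:
 assumes b: "biprod C pl ze A B P i j p q" and "u : Arr C" "Cod C u = P" "v : Arr C" "Cod C v = P"
  "p ## u = p ## v" "q ## u = q ## v"
 shows "u = v"
 using biprod_decomp[OF b assms(2,3)] biprod_decomp[OF b assms(4,5)] assms(6,7) by metis

lemma biprod_counique:
 assumes b: "biprod C pl ze A B P i j p q" and "u : Arr C" "Dom C u = P" "v : Arr C" "Dom C v = P"
  "u ## i = v ## i" "u ## j = v ## j"
 shows "u = v"
 using biprod_codecomp[OF b assms(2,3)] biprod_codecomp[OF b assms(4,5)] assms(6,7) by metis

lemma biprod_pair:
 assumes b: "biprod C pl ze A B P i j p q"
  and "f : Arr C" "g : Arr C" "Dom C f = Dom C g" "Cod C f = A" "Cod C g = B"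
 obtains u where "u : Arr C" "Dom C u = Dom C f" "Cod C u = P" "p ## u = f" "q ## u = g"
proof -
 note [simp] = biprod_simps[OF b] assms(2-)
 let ?u = "pl (i ## f) (j ## g)"
 have r: "p ## (i ## f) = f" "p ## (j ## g) = ze (Dom C f) A" "q ## (i ## f) = ze (Dom C g) B" "q ## (j ## g) = g"
  using assoc_rewrite[of p i "Id C A" f] assoc_rewrite[of p j _ g] assoc_rewrite[of q i _ f]
   assoc_rewrite[of q j "Id C B" g] by simp_all
 show thesis by (rule that[of ?u]) (simp_all add: comp_pl r)
qed

lemma biprod_copair:
 assumes b: "biprod C pl ze A B P i j p q"
  and "f : Arr C" "g : Arr C" "Cod C f = Cod C g" "Dom C f = A" "Dom C g = B"
 obtains u where "u : Arr C" "Dom C u = P" "Cod C u = Cod C f" "u ## i = f" "u ## j = g"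
proof -
 note [simp] = biprod_simps[OF b] assms(2-)
 let ?u = "pl (f ## p) (g ## q)"
 show thesis by (rule that[of ?u]) (simp_all add: pl_comp)
qed

end

context category
begin

lemma biproductI:
 assumes "P : Obj C" "!!k. k < n ==> i k : Hom C (A k) P" "!!k. k < n ==> p k : Hom C P (A k)"
  "!!k l. k < n ==> l < n ==> p l ## i k = (if k = l then Id C (A k) else zero_arr C (A k) (A l))"
  "!!T f. T : Obj C ==> (!!k. k < n ==> f k : Hom C T (A k)) ==> EX u. u : Hom C T P & (ALL k<n. p k ## u = f k)"
  "!!u v. u : Arr C ==> v : Arr C ==> Dom C u = Dom C v ==> Cod C u = P ==> Cod C v = P ==>
   (!!k. k < n ==> p k ## u = p k ## v) ==> u = v"
  "!!T f. T : Obj C ==> (!!k. k < n ==> f k : Hom C (A k) T) ==> EX u. u : Hom C P T & (ALL k<n. u ## i k = f k)"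
  "!!u v. u : Arr C ==> v : Arr C ==> Cod C u = Cod C v ==> Dom C u = P ==> Dom C v = P ==>
   (!!k. k < n ==> u ## i k = v ## i k) ==> u = v"
 shows "is_biproduct C n A P i p"
 unfolding is_biproduct_def
proof (intro conjI allI ballI impI)
 fix T f assume T: "T : Obj C" "ALL k<n. f k : Hom C T (A k)"
 obtain u where u: "u : Hom C T P & (ALL k<n. p k ## u = f k)" using assms(5)[of T f] T by blast
 show "EX! u. u : Hom C T P & (ALL k<n. p k ## u = f k)"
  using u by (intro ex1I[of _ u]) (simp, rule assms(6), simp_all)
next
 fix T f assume T: "T : Obj C" "ALL k<n. f k : Hom C (A k) T"
 obtain u where u: "u : Hom C P T & (ALL k<n. u ## i k = f k)" using assms(7)[of T f] T by blast
 show "EX! u. u : Hom C P T & (ALL k<n. u ## i k = f k)"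
  using u by (intro ex1I[of _ u]) (simp, rule assms(8), simp_all)
qed (use assms in auto)

lemma biproductD:
 assumes "is_biproduct C n A P i p"
 shows "P : Obj C"
  "k < n ==> i k : Arr C & Dom C (i k) = A k & Cod C (i k) = P"
  "k < n ==> p k : Arr C & Dom C (p k) = P & Cod C (p k) = A k"
  "k < n ==> l < n ==> p l ## i k = (if k = l then Id C (A k) else zero_arr C (A k) (A l))"
  "T : Obj C ==> (!!k. k < n ==> f k : Arr C & Dom C (f k) = T & Cod C (f k) = A k) ==>
   EX u. u : Arr C & Dom C u = T & Cod C u = P & (ALL k<n. p k ## u = f k)"
  "T : Obj C ==> (!!k. k < n ==> f k : Arr C & Dom C (f k) = A k & Cod C (f k) = T) ==>
   EX u. u : Arr C & Dom C u = P & Cod C u = T & (ALL k<n. u ## i k = f k)"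
proof -
 note d = assms[unfolded is_biproduct_def in_Hom]
 note d1 = d[THEN conjunct1] and d2 = d[THEN conjunct2, THEN conjunct1]
  and d3 = d[THEN conjunct2, THEN conjunct2, THEN conjunct1]
  and d4 = d[THEN conjunct2, THEN conjunct2, THEN conjunct2, THEN conjunct1]
  and d5 = d[THEN conjunct2, THEN conjunct2, THEN conjunct2, THEN conjunct2]
 show "P : Obj C" by (rule d1)
 show "k < n ==> i k : Arr C & Dom C (i k) = A k & Cod C (i k) = P" using d2 by blast
 show "k < n ==> p k : Arr C & Dom C (p k) = P & Cod C (p k) = A k" using d2 by blast
 show "k < n ==> l < n ==> p l ## i k = (if k = l then Id C (A k) else zero_arr C (A k) (A l))"
  using d3 by blast
 show "EX u. u : Arr C & Dom C u = T & Cod C u = P & (ALL k<n. p k ## u = f k)"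
  if "T : Obj C" "!!k. k < n ==> f k : Arr C & Dom C (f k) = T & Cod C (f k) = A k"
 proof -
  have "EX! u. (u : Arr C & Dom C u = T & Cod C u = P) & (ALL k<n. p k ## u = f k)"
   by (rule d4[rule_format, OF that(1)]) (rule that(2))
  then show ?thesis by (elim ex1E conjE) (intro exI conjI, assumption+)
 qed
 show "EX u. u : Arr C & Dom C u = P & Cod C u = T & (ALL k<n. u ## i k = f k)"
  if "T : Obj C" "!!k. k < n ==> f k : Arr C & Dom C (f k) = A k & Cod C (f k) = T"
 proof -
  have "EX! u. (u : Arr C & Dom C u = P & Cod C u = T) & (ALL k<n. u ## i k = f k)"
   by (rule d5[rule_format, OF that(1)]) (rule that(2))
  then show ?thesis by (elim ex1E conjE) (intro exI conjI, assumption+)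
 qed
qed

lemma biproduct_unique:
 assumes b: "is_biproduct C n A P i p" and "u : Arr C" "v : Arr C" "Dom C u = Dom C v" "Cod C u = P"
  "Cod C v = P" "!!k. k < n ==> p k ## u = p k ## v"
 shows "u = v"
proof -
 have d: "ALL T : Obj C. ALL f. (ALL k<n. f k : Hom C T (A k)) \<longrightarrow> (EX! u. u : Hom C T P & (ALL k<n. p k ## u = f k))"
  using b unfolding is_biproduct_def by (elim conjE)
 have "EX! w. w : Hom C (Dom C v) P & (ALL k<n. p k ## w = p k ## v)"
  by (rule d[rule_format]) (use assms(2-6) biproductD(3)[OF b] in simp_all)
 moreover have "u : Hom C (Dom C v) P & (ALL k<n. p k ## u = p k ## v)"
  "v : Hom C (Dom C v) P & (ALL k<n. p k ## v = p k ## v)" using assms(2-) by simp_all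
 ultimately show ?thesis by blast
qed

lemma biproduct_counique:
 assumes b: "is_biproduct C n A P i p" and "u : Arr C" "v : Arr C" "Cod C u = Cod C v" "Dom C u = P"
  "Dom C v = P" "!!k. k < n ==> u ## i k = v ## i k"
 shows "u = v"
proof -
 have d: "ALL T : Obj C. ALL f. (ALL k<n. f k : Hom C (A k) T) \<longrightarrow> (EX! u. u : Hom C P T & (ALL k<n. u ## i k = f k))"
  using b unfolding is_biproduct_def by (elim conjE)
 have "EX! w. w : Hom C P (Cod C v) & (ALL k<n. w ## i k = v ## i k)"
  by (rule d[rule_format]) (use assms(2-6) biproductD(2)[OF b] in simp_all)
 moreover have "u : Hom C P (Cod C v) & (ALL k<n. u ## i k = v ## i k)"
  "v : Hom C P (Cod C v) & (ALL k<n. v ## i k = v ## i k)" using assms(2-) by simp_all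
 ultimately show ?thesis by blast
qed

lemma hom_plus_eq:
 assumes b: "is_biproduct C 2 (\<lambda>_. Cod C f) P i p" and
  h: "h : Arr C" "Dom C h = Dom C f" "Cod C h = P" "p 0 ## h = f" "p 1 ## h = g" and
  d: "d : Arr C" "Dom C d = P" "Cod C d = Cod C f" "d ## i 0 = Id C (Cod C f)" "d ## i 1 = Id C (Cod C f)"
 shows "hom_plus C f g = d ## h"
 unfolding hom_plus_def
proof (rule the_equality)
 show "EX P i p h' d'. is_biproduct C 2 (\<lambda>_. Cod C f) P i p & h' : Hom C (Dom C f) P & p 0 ## h' = f & p 1 ## h' = g \<and>
  d' : Hom C P (Cod C f) & d' ## i 0 = Id C (Cod C f) & d' ## i 1 = Id C (Cod C f) & d ## h = d' ## h'"
  using b h d by (intro exI[of _ P] exI[of _ i] exI[of _ p] exI[of _ h] exI[of _ d]) simp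
next
 fix s assume "EX P i p h d. is_biproduct C 2 (\<lambda>_. Cod C f) P i p & h : Hom C (Dom C f) P & p 0 ## h = f & p 1 ## h = g \<and>
  d : Hom C P (Cod C f) & d ## i 0 = Id C (Cod C f) & d ## i 1 = Id C (Cod C f) & s = d ## h"
 then obtain P' i' p' h' d' where b': "is_biproduct C 2 (\<lambda>_. Cod C f) P' i' p'" and
  h': "h' : Arr C" "Dom C h' = Dom C f" "Cod C h' = P'" "p' 0 ## h' = f" "p' 1 ## h' = g" and
  d': "d' : Arr C" "Dom C d' = P'" "Cod C d' = Cod C f" "d' ## i' 0 = Id C (Cod C f)" "d' ## i' 1 = Id C (Cod C f)"
  and s: "s = d' ## h'" by auto
 note a = biproductD[OF b] and a' = biproductD[OF b']
 have l2: "k < 2 ==> k = 0 \<or> k = (1::nat)" for k by auto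
 have "EX u. u : Arr C & Dom C u = P & Cod C u = P' & (ALL k<2. p' k ## u = p k)"
  by (rule a'(5)) (use a(1,3) in auto)
 then obtain w where w: "w : Arr C" "Dom C w = P" "Cod C w = P'" "!!k. k < 2 ==> p' k ## w = p k" by blast
 have 1: "w ## h = h'"
 proof (rule biproduct_unique[OF b'])
  fix k :: nat assume k: "k < 2"
  have "p' k ## (w ## h) = p k ## h" using assoc_rewrite[OF w(4)[OF k], of h] a'(3)[OF k] w h by simp
  then show "p' k ## (w ## h) = p' k ## h'" using l2[OF k] h h' by auto
 qed (use w h h' in simp_all)
 have 2: "w ## i k = i' k" if k: "k < 2" for k
 proof (rule biproduct_unique[OF b'])
  fix l :: nat assume l: "l < 2"
  show "p' l ## (w ## i k) = p' l ## i' k"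
   using assoc_rewrite[OF w(4)[OF l], of "i k"] a'(3)[OF l] a(2)[OF k] a(4)[OF k l] a'(4)[OF k l] w
   by simp
 qed (use w a(2)[OF k] a'(2)[OF k] in simp_all)
 have "d' ## w = d"
 proof (rule biproduct_counique[OF b])
  fix k :: nat assume k: "k < 2"
  then show "(d' ## w) ## i k = d ## i k" using 2[OF k] l2[OF k] a(2)[OF k] d d' w by auto
 qed (use w d d' in simp_all)
 then show "s = d ## h" using 1 s assoc[of h w d'] w h d' by simp
qed

end

definition hom_neg :: "('o, 'a) cat \<Rightarrow> 'a \<Rightarrow> 'a" where
 "hom_neg C f = m_inv (hom_monoid C (Dom C f) (Cod C f)) f"

locale additive =
 fixes C :: "('o, 'a) cat" (structure)
 assumes additive: "additive_category C"
begin

sublocale category C using additive by (simp add: additive_category_def)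

lemma zero_objectE: obtains Z where "zero_object C Z"
 using additive unfolding additive_category_def by blast

lemma zero_arr_factor:
 assumes "A : Obj C" "B : Obj C"
 obtains Z s t where "zero_object C Z" "s : Arr C" "t : Arr C" "Dom C s = A" "Cod C s = Z" "Dom C t = Z" "Cod C t = B"
  "zero_arr C A B = t ## s"
proof -
 obtain Z where Z: "zero_object C Z" by (rule zero_objectE)
 obtain s t where "s : Hom C A Z" "t : Hom C Z B"
  using zero_object_hom[OF Z assms(1)] zero_object_hom[OF Z assms(2)] by blast
 then show thesis using zero_arr_eq[OF Z, of s t] by (intro that[OF Z, of s t]) auto
qed

lemma comm_group_hom: "A : Obj C ==> B : Obj C ==> comm_group (hom_monoid C A B)"
 using additive unfolding additive_category_def by blast

lemma has_biproducts: "ALL k<n. A k : Obj C ==> EX P i p. is_biproduct C n A P i p"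
 using additive unfolding additive_category_def has_finite_biproducts_def by blast

lemma diagonal:
 assumes "B : Obj C"
 obtains P i p d where "is_biproduct C 2 (\<lambda>_. B) P i p" "d : Arr C" "Dom C d = P" "Cod C d = B"
  "d ## i 0 = Id C B" "d ## i 1 = Id C B"
proof -
 obtain P i p where b: "is_biproduct C 2 (\<lambda>_. B) P i p"
  using has_biproducts[of 2 "\<lambda>_. B"] assms by blast
 obtain d where "d : Arr C" "Dom C d = P" "Cod C d = B" "ALL k<2. d ## i k = Id C B"
  using biproductD(6)[OF b assms, of "\<lambda>_. Id C B"] assms by auto
 then show thesis by (intro that[OF b, of d]) auto
qed

lemma pairing:
 assumes b: "is_biproduct C 2 F P i p" and "f : Arr C" "g : Arr C" "Dom C f = Dom C g" "Cod C f = F 0" "Cod C g = F 1"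
 obtains h where "h : Arr C" "Dom C h = Dom C f" "Cod C h = P" "p 0 ## h = f" "p 1 ## h = g"
proof -
 have l2: "k < 2 ==> 0 < k ==> k = (1::nat)" for k by auto
 have "EX u. u : Arr C & Dom C u = Dom C f & Cod C u = P & (ALL k<2. p k ## u = (if k = 0 then f else g))"
  by (rule biproductD(5)[OF b]) (use assms in \<open>auto dest!: l2\<close>)
 then obtain h where h: "h : Arr C" "Dom C h = Dom C f" "Cod C h = P" "!!k. k < 2 ==> p k ## h = (if k = 0 then f else g)"
  by blast
 show thesis by (rule that[of h]) (use h(1-3) h(4)[of 0] h(4)[of 1] in auto)
qed

lemma hom_plus_comp:
 assumes "f : Arr C" "g : Arr C" "h : Arr C" "Dom C f = Dom C g" "Cod C f = Cod C g" "Cod C h = Dom C f"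
 shows "hom_plus C f g ## h = hom_plus C (f ## h) (g ## h)"
proof -
 obtain P i p d where b: "is_biproduct C 2 (\<lambda>_. Cod C f) P i p" "d : Arr C" "Dom C d = P" "Cod C d = Cod C f"
  "d ## i 0 = Id C (Cod C f)" "d ## i 1 = Id C (Cod C f)"
  by (rule diagonal[of "Cod C f"]) (use assms in auto)
 obtain k where k: "k : Arr C" "Dom C k = Dom C f" "Cod C k = P" "p 0 ## k = f" "p 1 ## k = g"
  by (rule pairing[OF b(1), of f g]) (use assms in auto)
 have p: "p 0 : Arr C" "p 1 : Arr C" "Dom C (p 0) = P" "Dom C (p 1) = P"
  using biproductD(3)[OF b(1), of 0] biproductD(3)[OF b(1), of 1] by auto
 have 1: "hom_plus C f g = d ## k" by (rule hom_plus_eq[OF b(1) k b(2-6)])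
 have 2: "hom_plus C (f ## h) (g ## h) = d ## (k ## h)"
  using assoc_rewrite[OF k(4), of h] assoc_rewrite[OF k(5), of h] assms p k b
  by (intro hom_plus_eq[of _ P i p]) simp_all
 show ?thesis using 1 2 assms b k by simp
qed

lemma comp_hom_plus:
 assumes "f : Arr C" "g : Arr C" "h : Arr C" "Dom C f = Dom C g" "Cod C f = Cod C g" "Dom C h = Cod C f"
 shows "h ## hom_plus C f g = hom_plus C (h ## f) (h ## g)"
proof -
 obtain P i p d where b: "is_biproduct C 2 (\<lambda>_. Cod C f) P i p" "d : Arr C" "Dom C d = P" "Cod C d = Cod C f"
  "d ## i 0 = Id C (Cod C f)" "d ## i 1 = Id C (Cod C f)"
  by (rule diagonal[of "Cod C f"]) (use assms in auto)
 obtain P' i' p' d' where b': "is_biproduct C 2 (\<lambda>_. Cod C h) P' i' p'" "d' : Arr C" "Dom C d' = P'" "Cod C d' = Cod C h"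
  "d' ## i' 0 = Id C (Cod C h)" "d' ## i' 1 = Id C (Cod C h)"
  by (rule diagonal[of "Cod C h"]) (use assms in auto)
 obtain k where k: "k : Arr C" "Dom C k = Dom C f" "Cod C k = P" "p 0 ## k = f" "p 1 ## k = g"
  by (rule pairing[OF b(1), of f g]) (use assms in auto)
 have p: "p l : Arr C" "Dom C (p l) = P" "Cod C (p l) = Cod C f" "p' l : Arr C" "Dom C (p' l) = P'" "Cod C (p' l) = Cod C h"
  "i l : Arr C" "Dom C (i l) = Cod C f" "Cod C (i l) = P" "i' l : Arr C" "Dom C (i' l) = Cod C h" "Cod C (i' l) = P'"
  if "l < 2" for l
  using biproductD(2,3)[OF b(1) that] biproductD(2,3)[OF b'(1) that] by auto
 have z: "0 < (2::nat)" "1 < (2::nat)" by auto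
 have l2: "l < 2 ==> l = 0 \<or> l = (1::nat)" for l by auto
 note p01[simp] = p[OF z(1)] p[OF z(2)]
 obtain w where w: "w : Arr C" "Dom C w = P" "Cod C w = P'" "p' 0 ## w = h ## p 0" "p' 1 ## w = h ## p 1"
  by (rule pairing[OF b'(1), of "h ## p 0" "h ## p 1"]) (use assms in auto)
 have w': "p' l ## w = h ## p l" if "l < 2" for l using l2[OF that] w by auto
 have 1: "hom_plus C f g = d ## k" by (rule hom_plus_eq[OF b(1) k b(2-6)])
 have 2: "hom_plus C (h ## f) (h ## g) = d' ## (w ## k)"
  using assoc_rewrite[OF w(4), of k] assoc_rewrite[OF w(5), of k] assms k b' w
  by (intro hom_plus_eq[of _ P' i' p']) simp_all
 have 3: "w ## i l = i' l ## h" if l: "l < 2" for l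
 proof (rule biproduct_unique[OF b'(1)])
  fix m :: nat assume m: "m < 2"
  have "p' m ## (w ## i l) = h ## (p m ## i l)"
   using assoc_rewrite[OF w'[OF m], of "i l"] p[OF m] p[OF l] w assms by simp
  also have "\<dots> = (p' m ## i' l) ## h"
  proof (cases "l = m")
   case True
   then show ?thesis using biproductD(4)[OF b(1) l m] biproductD(4)[OF b'(1) l m] assms by simp
  next
   case False
   obtain Z s t where Z: "zero_object C Z" "s : Arr C" "t : Arr C" "Dom C s = Cod C f" "Cod C s = Z" "Dom C t = Z" "Cod C t = Cod C f"
     "zero_arr C (Cod C f) (Cod C f) = t ## s" using zero_arr_factor[of "Cod C f" "Cod C f"] assms by auto
   obtain Z' s' t' where Z': "zero_object C Z'" "s' : Arr C" "t' : Arr C" "Dom C s' = Cod C h" "Cod C s' = Z'" "Dom C t' = Z'" "Cod C t' = Cod C h"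
     "zero_arr C (Cod C h) (Cod C h) = t' ## s'" using zero_arr_factor[of "Cod C h" "Cod C h"] assms by auto
   have "zero_arr C (Cod C f) (Cod C h) = h ## (t ## s)"
    using zero_arr_eq[OF Z(1), of s "h ## t"] Z assms by simp
   moreover have "zero_arr C (Cod C f) (Cod C h) = (t' ## s') ## h"
    using zero_arr_eq[OF Z'(1), of "s' ## h" t'] Z' assms by simp
   ultimately show ?thesis using False biproductD(4)[OF b(1) l m] biproductD(4)[OF b'(1) l m] Z(8) Z'(8)
    by simp
  qed
  also have "\<dots> = p' m ## (i' l ## h)" using p[OF m] p[OF l] assms by simp
  finally show "p' m ## (w ## i l) = p' m ## (i' l ## h)" .
 qed (use w p[OF l] assms in simp_all)
 have "d' ## w = h ## d"
 proof (rule biproduct_counique[OF b(1)])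
  fix l :: nat assume l: "l < 2"
  have d1: "d ## i l = Id C (Cod C f)" "d' ## i' l = Id C (Cod C h)" using l2[OF l] b b' by auto
  show "(d' ## w) ## i l = (h ## d) ## i l"
   using 3[OF l] assoc_rewrite[OF d1(2), of h] d1(1) p[OF l] b b' w assms by simp
 qed (use b b' w assms in simp_all)
 then have "d' ## (w ## k) = (h ## d) ## k" using assoc_rewrite[of d' w _ k] b' w k by simp
 then show ?thesis using 1 2 assms b k by simp
qed

sublocale preadd C "hom_plus C" "zero_arr C" "hom_neg C"
proof
 have z: "zero_arr C A B : Hom C A B" if "A : Obj C" "B : Obj C" for A B
  using zero_arr_factor[OF that] by (metis comp_simps in_Hom)
 then show "zero_arr C A B : Arr C & Dom C (zero_arr C A B) = A & Cod C (zero_arr C A B) = B"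
  if "A : Obj C" "B : Obj C" for A B using that by auto
 have c: "comm_group (hom_monoid C (Dom C f) (Cod C f))" if "f : Arr C" for f
  using that by (intro comm_group_hom) auto
 have g: "group (hom_monoid C (Dom C f) (Cod C f))" if "f : Arr C" for f
  using c[OF that] by (simp add: comm_group_def)
 have m: "comm_monoid (hom_monoid C (Dom C f) (Cod C f))" if "f : Arr C" for f
  using c[OF that] by (simp add: comm_group_def)
 have mm: "monoid (hom_monoid C (Dom C f) (Cod C f))" if "f : Arr C" for f
  using m[OF that] by (simp add: comm_monoid_def)
 fix f assume f: "f : Arr C"
 have neg: "hom_neg C f : Hom C (Dom C f) (Cod C f)"
  using group.inv_closed[OF g[OF f], of f] f unfolding hom_neg_def by (simp add: hom_monoid_def)
 then show "hom_neg C f : Arr C & Dom C (hom_neg C f) = Dom C f & Cod C (hom_neg C f) = Cod C f" by simp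
 show "hom_plus C f (zero_arr C (Dom C f) (Cod C f)) = f"
  using monoid.r_one[OF mm[OF f], of f] f by (simp add: hom_monoid_def)
 show "hom_plus C f (hom_neg C f) = zero_arr C (Dom C f) (Cod C f)"
  using group.r_inv[OF g[OF f], of f] f by (simp add: hom_monoid_def hom_neg_def)
 fix g assume g': "g : Arr C"
 show "hom_plus C f g : Arr C & Dom C (hom_plus C f g) = Dom C f & Cod C (hom_plus C f g) = Cod C f"
  if "Dom C f = Dom C g" "Cod C f = Cod C g"
  using monoid.m_closed[OF mm[OF f], of f g] f g' that by (simp add: hom_monoid_def)
 show "hom_plus C f g = hom_plus C g f" if "Dom C f = Dom C g" "Cod C f = Cod C g"
  using comm_monoid.m_comm[OF m[OF f], of f g] f g' that by (simp add: hom_monoid_def)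
 fix h assume h: "h : Arr C"
 show "hom_plus C (hom_plus C f g) h = hom_plus C f (hom_plus C g h)"
  if "Dom C f = Dom C g" "Cod C f = Cod C g" "Dom C g = Dom C h" "Cod C g = Cod C h"
  using monoid.m_assoc[OF mm[OF f], of f g h] f g' h that by (simp add: hom_monoid_def)
 show "h ## hom_plus C f g = hom_plus C (h ## f) (h ## g)"
  if "Dom C f = Dom C g" "Cod C f = Dom C h" "Cod C g = Dom C h"
  by (rule comp_hom_plus) (use f g' h that in auto)
 show "hom_plus C f g ## h = hom_plus C (f ## h) (g ## h)"
  if "Cod C f = Cod C g" "Cod C h = Dom C f" "Cod C h = Dom C g"
  by (rule hom_plus_comp) (use f g' h that in auto)
qed

lemma biprodE:
 assumes "A : Obj C" "B : Obj C"
 obtains P i j p q where "biprod C (hom_plus C) (zero_arr C) A B P i j p q"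
proof -
 let ?F = "\<lambda>k::nat. if k = 0 then A else B"
 have "EX P i p. is_biproduct C 2 ?F P i p" by (rule has_biproducts) (use assms in simp)
 then obtain P i p where b: "is_biproduct C 2 ?F P i p" by blast
 have l2: "k < 2 ==> k = 0 \<or> k = (1::nat)" for k by auto
 note d = biproductD[OF b]
 have z: "0 < (2::nat)" "1 < (2::nat)" by auto
 have [simp]: "P : Obj C" "i 0 : Arr C" "Dom C (i 0) = A" "Cod C (i 0) = P" "i 1 : Arr C" "Dom C (i 1) = B" "Cod C (i 1) = P"
  "p 0 : Arr C" "Cod C (p 0) = A" "Dom C (p 0) = P" "p 1 : Arr C" "Cod C (p 1) = B" "Dom C (p 1) = P"
  using d(1) d(2)[OF z(1)] d(2)[OF z(2)] d(3)[OF z(1)] d(3)[OF z(2)] by simp_all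
 have e[simp]: "p 0 ## i 0 = Id C A" "p 1 ## i 1 = Id C B" "p 1 ## i 0 = zero_arr C A B" "p 0 ## i 1 = zero_arr C B A"
  using d(4)[OF z(1) z(1)] d(4)[OF z(2) z(2)] d(4)[OF z(1) z(2)] d(4)[OF z(2) z(1)] by auto
 have "hom_plus C (i 0 ## p 0) (i 1 ## p 1) = Id C P"
 proof (rule biproduct_unique[OF b])
  fix k :: nat assume "k < 2"
  then have "k = 0 \<or> k = 1" by auto
  moreover have "p 0 ## (i 0 ## p 0) = p 0" "p 0 ## (i 1 ## p 1) = zero_arr C P A"
   "p 1 ## (i 0 ## p 0) = zero_arr C P B" "p 1 ## (i 1 ## p 1) = p 1"
   using assoc_rewrite[OF e(1), of "p 0"] assoc_rewrite[OF e(2), of "p 1"] assoc_rewrite[OF e(3), of "p 0"]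
    assoc_rewrite[OF e(4), of "p 1"] assms by simp_all
  ultimately show "p k ## hom_plus C (i 0 ## p 0) (i 1 ## p 1) = p k ## Id C P"
   by (auto simp: comp_pl)
 qed auto
 then show thesis using assms
  by (intro that[of P "i 0" "i 1" "p 0" "p 1"], unfold biprod_def) simp
qed

end

context preadd
begin

lemma nary_biproduct:
 assumes Z: "zero_object C Z"
  and bip: "!!A B. A : Obj C ==> B : Obj C ==> EX P i j p q. biprod C pl ze A B P i j p q"
 shows "(ALL k<n. A k : Obj C) ==> EX P i p. is_biproduct C n A P i p"
proof (induction n)
 case 0
 have "is_biproduct C 0 A Z i p" for i p
  using Z unfolding is_biproduct_def zero_object_def by auto
 then show ?case by blast
next
 case (Suc n)
 then obtain P i p where b: "is_biproduct C n A P i p" by auto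
 note d = biproductD[OF b]
 have An: "A n : Obj C" "!!k. k < n ==> A k : Obj C" using Suc.prems by auto
 obtain Q a c s t where q: "biprod C pl ze P (A n) Q a c s t" using bip[OF d(1) An(1)] by blast
 note [simp] = biprod_simps[OF q]
 have [simp]: "i k : Arr C" "Dom C (i k) = A k" "Cod C (i k) = P" "p k : Arr C" "Cod C (p k) = A k" "Dom C (p k) = P"
  if "k < n" for k using d(2,3)[OF that] by auto
 define i' where "i' k = (if k < n then a ## i k else c)" for k
 define p' where "p' k = (if k < n then p k ## s else t)" for k
 have z: "zero_arr C (A k) (A l) = ze (A k) (A l)" if "k \<le> n" "l \<le> n" for k l
  by (rule zero_arr_ze[OF Z]) (use that An in \<open>auto simp: le_less\<close>)
 have r: "s ## (a ## x) = x" "t ## (a ## x) = ze (Dom C x) (A n)" if "x : Arr C" "Cod C x = P" for x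
  using assoc_rewrite[of s a "Id C P" x] assoc_rewrite[of t a _ x] that by auto
 have r': "s ## (c ## x) = ze (Dom C x) P" "t ## (c ## x) = x" if "x : Arr C" "Cod C x = A n" for x
  using assoc_rewrite[of s c _ x] assoc_rewrite[of t c "Id C (A n)" x] that by auto
 have "is_biproduct C (Suc n) A Q i' p'"
 proof (rule biproductI)
  show "Q : Obj C" by simp
  fix k assume k: "k < Suc n"
  show "i' k : Hom C (A k) Q" "p' k : Hom C Q (A k)"
   using k by (auto simp: i'_def p'_def less_Suc_eq)
  fix l assume l: "l < Suc n"
  show "p' l ## i' k = (if k = l then Id C (A k) else zero_arr C (A k) (A l))"
  proof (cases "k < n"; cases "l < n")
   assume h: "k < n" "l < n"
   then show ?thesis using d(4)[OF h] An by (simp add: i'_def p'_def r)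
  next
   assume h: "k < n" "\<not> l < n"
   then have [simp]: "l = n" using l by simp
   show ?thesis using h An z[of k n] by (simp add: i'_def p'_def r)
  next
   assume h: "\<not> k < n" "l < n"
   then have [simp]: "k = n" using k by simp
   show ?thesis using h An z[of n l] by (auto simp add: i'_def p'_def)
  next
   assume h: "\<not> k < n" "\<not> l < n"
   then have [simp]: "k = n" "l = n" using k l by simp_all
   show ?thesis using h An by (simp add: i'_def p'_def)
  qed
 next
  fix T f assume T: "T : Obj C" and f: "!!k. k < Suc n ==> f k : Hom C T (A k)"
  obtain u where u: "u : Arr C" "Dom C u = T" "Cod C u = P" "!!k. k < n ==> p k ## u = f k"
   using d(5)[OF T, of f] f by auto
  obtain w where w: "w : Arr C" "Dom C w = Dom C u" "Cod C w = Q" "s ## w = u" "t ## w = f n"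
   by (rule biprod_pair[OF q, of u "f n"]) (use u f in auto)
  show "EX u. u : Hom C T Q & (ALL k<Suc n. p' k ## u = f k)"
   using u w by (intro exI[of _ w]) (auto simp: p'_def less_Suc_eq)
 next
  fix u v assume uv: "u : Arr C" "v : Arr C" "Dom C u = Dom C v" "Cod C u = Q" "Cod C v = Q"
   and e: "!!k. k < Suc n ==> p' k ## u = p' k ## v"
  have "s ## u = s ## v"
  proof (rule biproduct_unique[OF b])
   fix k assume "k < n"
   then show "p k ## (s ## u) = p k ## (s ## v)" using e[of k] uv by (simp add: p'_def)
  qed (use uv in auto)
  moreover have "t ## u = t ## v" using e[of n] by (simp add: p'_def)
  ultimately show "u = v" by (intro biprod_unique[OF q uv(1,4,2,5)])
 next
  fix T f assume T: "T : Obj C" and f: "!!k. k < Suc n ==> f k : Hom C (A k) T"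
  obtain u where u: "u : Arr C" "Dom C u = P" "Cod C u = T" "!!k. k < n ==> u ## i k = f k"
   using d(6)[OF T, of f] f by auto
  obtain w where w: "w : Arr C" "Dom C w = Q" "Cod C w = Cod C u" "w ## a = u" "w ## c = f n"
   by (rule biprod_copair[OF q, of u "f n"]) (use u f in auto)
  have "w ## (a ## i k) = f k" if "k < n" for k
   using assoc_rewrite[OF w(4), of "i k"] u w that by simp
  then show "EX u. u : Hom C Q T & (ALL k<Suc n. u ## i' k = f k)"
   using u w by (intro exI[of _ w]) (auto simp: i'_def less_Suc_eq)
 next
  fix u v assume uv: "u : Arr C" "v : Arr C" "Cod C u = Cod C v" "Dom C u = Q" "Dom C v = Q"
   and e: "!!k. k < Suc n ==> u ## i' k = v ## i' k"
  have "u ## a = v ## a"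
  proof (rule biproduct_counique[OF b])
   fix k assume "k < n"
   then show "(u ## a) ## i k = (v ## a) ## i k" using e[of k] uv by (simp add: i'_def)
  qed (use uv in auto)
  moreover have "u ## c = v ## c" using e[of n] by (simp add: i'_def)
  ultimately show "u = v" by (intro biprod_counique[OF q uv(1,4,2,5)])
 qed
 then show ?case by blast
qed

theorem additiveI:
 assumes Z: "Z : Obj C" "Id C Z = ze Z Z"
  and bip: "!!A B. A : Obj C ==> B : Obj C ==> EX P i j p q. biprod C pl ze A B P i j p q"
 shows "additive_category C"
proof -
 have zo: "zero_object C Z" using zero_objectI[OF Z] .
 note nb = nary_biproduct[OF zo bip]
 have hp: "hom_plus C f g = pl f g" if fg: "f : Arr C" "g : Arr C" "Dom C f = Dom C g" "Cod C f = Cod C g" for f g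
 proof -
  have B: "Cod C g : Obj C" using fg by simp
  obtain P i j p q where b: "biprod C pl ze (Cod C g) (Cod C g) P i j p q" using bip[OF B B] by blast
  note [simp] = biprod_simps[OF b] fg
  obtain h where h: "h : Arr C" "Dom C h = Dom C f" "Cod C h = P" "p ## h = f" "q ## h = g"
   by (rule biprod_pair[OF b, of f g]) auto
  obtain d where d: "d : Arr C" "Dom C d = P" "Cod C d = Cod C g" "d ## i = Id C (Cod C g)" "d ## j = Id C (Cod C g)"
   by (rule biprod_copair[OF b, of "Id C (Cod C g)" "Id C (Cod C g)"]) auto
  let ?i = "\<lambda>k::nat. if k = 0 then i else j" and ?p = "\<lambda>k::nat. if k = 0 then p else q"
  have z: "zero_arr C (Cod C g) (Cod C g) = ze (Cod C g) (Cod C g)" by (rule zero_arr_ze[OF zo]) auto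
  have l2: "k < 2 ==> 0 < k ==> k = (1::nat)" for k by auto
  have bb: "is_biproduct C 2 (\<lambda>_. Cod C g) P ?i ?p"
  proof (rule biproductI)
   fix T and f' :: "nat \<Rightarrow> 'a" assume T: "T : Obj C" and f': "!!k. k < 2 ==> f' k : Hom C T (Cod C g)"
   obtain u where u: "u : Arr C" "Dom C u = Dom C (f' 0)" "Cod C u = P" "p ## u = f' 0" "q ## u = f' 1"
    by (rule biprod_pair[OF b, of "f' 0" "f' 1"]) (use f'[of 0] f'[of 1] in auto)
   then show "EX u. u : Hom C T P & (ALL k<2. ?p k ## u = f' k)"
    using f'[of 0] by (intro exI[of _ u]) (auto dest!: l2)
  next
   fix T and f' :: "nat \<Rightarrow> 'a" assume T: "T : Obj C" and f': "!!k. k < 2 ==> f' k : Hom C (Cod C g) T"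
   obtain u where u: "u : Arr C" "Dom C u = P" "Cod C u = Cod C (f' 0)" "u ## i = f' 0" "u ## j = f' 1"
    by (rule biprod_copair[OF b, of "f' 0" "f' 1"]) (use f'[of 0] f'[of 1] in auto)
   then show "EX u. u : Hom C P T & (ALL k<2. u ## ?i k = f' k)"
    using f'[of 0] by (intro exI[of _ u]) (auto dest!: l2)
  next
   fix u v assume uv: "u : Arr C" "v : Arr C" "Dom C u = Dom C v" "Cod C u = P" "Cod C v = P"
    "!!k. k < 2 ==> ?p k ## u = ?p k ## v"
   show "u = v" by (rule biprod_unique[OF b]) (use uv(6)[of 0] uv(6)[of 1] uv(1-5) in auto)
  next
   fix u v assume uv: "u : Arr C" "v : Arr C" "Cod C u = Cod C v" "Dom C u = P" "Dom C v = P"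
    "!!k. k < 2 ==> u ## ?i k = v ## ?i k"
   show "u = v" by (rule biprod_counique[OF b]) (use uv(6)[of 0] uv(6)[of 1] uv(1-5) in auto)
  next
   fix k l :: nat assume "k < 2" "l < 2"
   then show "?p l ## ?i k = (if k = l then Id C (Cod C g) else zero_arr C (Cod C g) (Cod C g))"
    using z by (cases "k = 0"; cases "l = 0") (auto dest!: l2)
  qed auto
  have "hom_plus C f g = d ## h"
   by (rule hom_plus_eq[of f P ?i ?p]) (use bb h d in auto)
  also have "\<dots> = pl ((d ## i) ## (p ## h)) ((d ## j) ## (q ## h))"
   by (subst biprod_decomp[OF b h(1,3)]) (use h(1-3) d(1-3) in \<open>simp add: comp_pl\<close>)
  also have "\<dots> = pl f g" unfolding h d by simp
  finally show ?thesis .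
 qed
 have za: "zero_arr C A B = ze A B" if "A : Obj C" "B : Obj C" for A B
  by (rule zero_arr_ze[OF zo that])
 have "comm_group (hom_monoid C A B)" if AB: "A : Obj C" "B : Obj C" for A B
 proof (rule comm_groupI)
  fix x assume x: "x : carrier (hom_monoid C A B)"
  show "EX y:carrier (hom_monoid C A B). y \<otimes>\<^bsub>hom_monoid C A B\<^esub> x = \<one>\<^bsub>hom_monoid C A B\<^esub>"
   using x AB by (intro bexI[of _ "ng x"]) (auto simp: hom_monoid_def hp za ng_pl)
 qed (use AB in \<open>auto simp: hom_monoid_def hp za pl_assoc intro: pl_comm\<close>)
 then show ?thesis
  using zo nb category_axioms unfolding additive_category_def has_finite_biproducts_def by blast
qed

end

section \<open>Kernels and cokernels\<close>

context category
begin

lemma equalizerD: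
 assumes "is_equalizer C f g m"
 shows "f : Arr C" "g : Arr C" "Dom C f = Dom C g" "Cod C f = Cod C g" "m : Arr C" "Cod C m = Dom C g"
  "f ## m = g ## m"
 using assms unfolding is_equalizer_def parallel_def by (simp_all only: simp_thms)

lemma equalizer_univ:
 assumes "is_equalizer C f g m" "h : Arr C" "Cod C h = Dom C g" "f ## h = g ## h"
 shows "EX! u. u : Hom C (Dom C h) (Dom C m) & m ## u = h"
proof -
 have "ALL T : Obj C. ALL h : Hom C T (Dom C f). f ## h = g ## h \<longrightarrow> (EX! u. u : Hom C T (Dom C m) & m ## u = h)"
  using assms(1) unfolding is_equalizer_def by (elim conjE)
 from this[rule_format, of "Dom C h" h] show ?thesis using assms equalizerD(3)[OF assms(1)] by simp
qed

lemma equalizer_lift: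
 assumes "is_equalizer C f g m" "h : Arr C" "Cod C h = Dom C g" "f ## h = g ## h"
 obtains u where "u : Arr C" "Dom C u = Dom C h" "Cod C u = Dom C m" "m ## u = h"
 using ex1_implies_ex[OF equalizer_univ[OF assms]] by (auto intro: that)

lemma equalizer_mono:
 assumes "is_equalizer C f g m" shows "mono_in C m"
proof (rule monoI)
 note [simp] = equalizerD[OF assms]
 fix u v assume uv: "u : Arr C" "v : Arr C" "Dom C u = Dom C v" "Cod C u = Dom C m" "Cod C v = Dom C m" "m ## u = m ## v"
 have e: "f ## (m ## v) = g ## (m ## v)" using assoc_rewrite[of f m "g ## m" v] uv by simp
 have "EX! w. w : Hom C (Dom C (m ## v)) (Dom C m) & m ## w = m ## v"
  by (rule equalizer_univ[OF assms _ _ e]) (use uv in simp_all)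
 moreover have "u : Hom C (Dom C (m ## v)) (Dom C m) & m ## u = m ## v"
  "v : Hom C (Dom C (m ## v)) (Dom C m) & m ## v = m ## v" using uv by simp_all
 ultimately show "u = v" by blast
qed (rule equalizerD[OF assms])

lemma equalizerI:
 assumes "f : Arr C" "g : Arr C" "Dom C f = Dom C g" "Cod C f = Cod C g" "mono_in C m" "Cod C m = Dom C g"
  "f ## m = g ## m"
  "!!h. h : Arr C ==> Cod C h = Dom C g ==> f ## h = g ## h ==>
   EX u. u : Arr C & Dom C u = Dom C h & Cod C u = Dom C m & m ## u = h"
 shows "is_equalizer C f g m"
 unfolding is_equalizer_def parallel_def
proof (intro conjI ballI impI)
 fix T h assume "h : Hom C T (Dom C f)" "f ## h = g ## h"
 then obtain u where u: "u : Arr C & Dom C u = Dom C h & Cod C u = Dom C m & m ## u = h" "Dom C h = T"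
  using assms(8)[of h] assms(3) by auto
 show "EX! u. u : Hom C T (Dom C m) & m ## u = h"
 proof (rule ex1I[of _ u])
  fix v assume "v : Hom C T (Dom C m) & m ## v = h"
  then show "v = u" using u by (intro monoD[OF assms(5), of v u]) simp_all
 qed (use u in simp)
qed (use assms mono_arr in simp_all)

lemma coequalizerD:
 assumes "is_coequalizer C f g q"
 shows "f : Arr C" "g : Arr C" "Dom C f = Dom C g" "Cod C f = Cod C g" "q : Arr C" "Dom C q = Cod C g"
  "q ## f = q ## g"
 using assms unfolding is_coequalizer_def parallel_def by (simp_all only: simp_thms)

lemma coequalizer_univ:
 assumes "is_coequalizer C f g q" "h : Arr C" "Dom C h = Cod C g" "h ## f = h ## g"
 shows "EX! u. u : Hom C (Cod C q) (Cod C h) & u ## q = h"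
proof -
 have "ALL T : Obj C. ALL h : Hom C (Cod C f) T. h ## f = h ## g \<longrightarrow> (EX! u. u : Hom C (Cod C q) T & u ## q = h)"
  using assms(1) unfolding is_coequalizer_def by (elim conjE)
 from this[rule_format, of "Cod C h" h] show ?thesis using assms coequalizerD(4)[OF assms(1)] by simp
qed

lemma coequalizer_desc:
 assumes "is_coequalizer C f g q" "h : Arr C" "Dom C h = Cod C g" "h ## f = h ## g"
 obtains u where "u : Arr C" "Dom C u = Cod C q" "Cod C u = Cod C h" "u ## q = h"
 using ex1_implies_ex[OF coequalizer_univ[OF assms]] by (auto intro: that)

lemma coequalizer_epi:
 assumes "is_coequalizer C f g q" shows "epi_in C q"
proof (rule epiI)
 note [simp] = coequalizerD[OF assms]
 fix u v assume uv: "u : Arr C" "v : Arr C" "Cod C u = Cod C v" "Dom C u = Cod C q" "Dom C v = Cod C q" "u ## q = v ## q"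
 have e: "(v ## q) ## f = (v ## q) ## g" using uv by simp
 have "EX! w. w : Hom C (Cod C q) (Cod C (v ## q)) & w ## q = v ## q"
  by (rule coequalizer_univ[OF assms _ _ e]) (use uv in simp_all)
 moreover have "u : Hom C (Cod C q) (Cod C (v ## q)) & u ## q = v ## q"
  "v : Hom C (Cod C q) (Cod C (v ## q)) & v ## q = v ## q" using uv by simp_all
 ultimately show "u = v" by blast
qed (rule coequalizerD[OF assms])

lemma coequalizerI:
 assumes "f : Arr C" "g : Arr C" "Dom C f = Dom C g" "Cod C f = Cod C g" "epi_in C q" "Dom C q = Cod C g"
  "q ## f = q ## g"
  "!!h. h : Arr C ==> Dom C h = Cod C g ==> h ## f = h ## g ==>
   EX u. u : Arr C & Dom C u = Cod C q & Cod C u = Cod C h & u ## q = h"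
 shows "is_coequalizer C f g q"
 unfolding is_coequalizer_def parallel_def
proof (intro conjI ballI impI)
 fix T h assume "h : Hom C (Cod C f) T" "h ## f = h ## g"
 then obtain u where u: "u : Arr C & Dom C u = Cod C q & Cod C u = Cod C h & u ## q = h" "Cod C h = T"
  using assms(8)[of h] assms(4) by auto
 show "EX! u. u : Hom C (Cod C q) T & u ## q = h"
 proof (rule ex1I[of _ u])
  fix v assume "v : Hom C (Cod C q) T & v ## q = h"
  then show "v = u" using u by (intro epiD[OF assms(5), of v u]) simp_all
 qed (use u in simp)
qed (use assms epi_arr in simp_all)

lemma mono_retract_iso:
 assumes "mono_in C m" "s : Arr C" "Dom C s = Cod C m" "Cod C s = Dom C m" "m ## s = Id C (Cod C m)"
 shows "iso_in C m"
proof -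
 note [simp] = mono_arr[OF assms(1)] assms(2-5)
 have "s ## m = Id C (Dom C m)"
  by (rule monoD[OF assms(1)]) (use assoc_rewrite[OF assms(5), of m] in simp_all)
 then show ?thesis by (intro isoI[of m s]) simp_all
qed

end

context additive
begin

abbreviation plus (infixl "\<oplus>" 65) where "f \<oplus> g \<equiv> hom_plus C f g"
abbreviation minus (infixl "\<ominus>" 65) where "f \<ominus> g \<equiv> hom_plus C f (hom_neg C g)"
abbreviation zero ("\<zero>") where "\<zero> \<equiv> zero_arr C"

lemma minus_comp: "f : Arr C ==> g : Arr C ==> h : Arr C ==> Dom C f = Dom C g ==> Cod C f = Cod C g ==> Cod C h = Dom C g ==>
 (f \<ominus> g) ## h = f ## h \<ominus> g ## h"
 by (simp add: pl_comp ng_comp)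

lemma comp_minus: "f : Arr C ==> g : Arr C ==> h : Arr C ==> Dom C f = Dom C g ==> Cod C f = Cod C g ==> Dom C h = Cod C g ==>
 h ## (f \<ominus> g) = h ## f \<ominus> h ## g"
 by (simp add: comp_pl comp_ng)

lemma minus_eq_zero_iff: "f : Arr C ==> g : Arr C ==> Dom C f = Dom C g ==> Cod C f = Cod C g ==> A = Dom C g ==> B = Cod C g ==>
 f \<ominus> g = \<zero> A B \<longleftrightarrow> f = g"
 using diff_eq_ze_iff by simp

lemma mono_zeroI:
 assumes "m : Arr C"
  "!!h. h : Arr C ==> Cod C h = Dom C m ==> m ## h = \<zero> (Dom C h) (Cod C m) ==> h = \<zero> (Dom C h) (Dom C m)"
 shows "mono_in C m"
proof (rule monoI[OF assms(1)])
 fix f g assume h: "f : Arr C" "g : Arr C" "Dom C f = Dom C g" "Cod C f = Dom C m" "Cod C g = Dom C m" "m ## f = m ## g"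
 have "f \<ominus> g = \<zero> (Dom C (f \<ominus> g)) (Dom C m)"
  by (rule assms(2)) (use h assms(1) in \<open>simp_all add: comp_minus minus_eq_zero_iff\<close>)
 then show "f = g" using h by (simp add: minus_eq_zero_iff)
qed

lemma epi_zeroI:
 assumes "e : Arr C"
  "!!h. h : Arr C ==> Dom C h = Cod C e ==> h ## e = \<zero> (Dom C e) (Cod C h) ==> h = \<zero> (Cod C e) (Cod C h)"
 shows "epi_in C e"
proof (rule epiI[OF assms(1)])
 fix f g assume h: "f : Arr C" "g : Arr C" "Cod C f = Cod C g" "Dom C f = Cod C e" "Dom C g = Cod C e" "f ## e = g ## e"
 have "f \<ominus> g = \<zero> (Cod C e) (Cod C (f \<ominus> g))"
  by (rule assms(2)) (use h assms(1) in \<open>simp_all add: minus_comp minus_eq_zero_iff\<close>)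
 then show "f = g" using h by (simp add: minus_eq_zero_iff)
qed

lemma mono_zeroD:
 assumes "mono_in C m" "h : Arr C" "Cod C h = Dom C m" "m ## h = \<zero> (Dom C h) (Cod C m)"
 shows "h = \<zero> (Dom C h) (Dom C m)"
 by (rule monoD[OF assms(1)]) (use assms mono_arr in simp_all)

lemma epi_zeroD:
 assumes "epi_in C e" "h : Arr C" "Dom C h = Cod C e" "h ## e = \<zero> (Dom C e) (Cod C h)"
 shows "h = \<zero> (Cod C e) (Cod C h)"
 by (rule epiD[OF assms(1)]) (use assms epi_arr in simp_all)

lemma kernelD:
 assumes "is_kernel C f k"
 shows "f : Arr C" "k : Arr C" "Cod C k = Dom C f" "f ## k = \<zero> (Dom C k) (Cod C f)" "mono_in C k"
proof -
 note e = equalizerD[OF assms[unfolded is_kernel_def]]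
 show f: "f : Arr C" "k : Arr C" using e by simp_all
 show c: "Cod C k = Dom C f" using e(6) f by simp
 show "f ## k = \<zero> (Dom C k) (Cod C f)" using e(7) c f by simp
 show "mono_in C k" using equalizer_mono assms unfolding is_kernel_def by blast
qed

lemma kernel_lift:
 assumes "is_kernel C f k" "h : Arr C" "Cod C h = Dom C f" "f ## h = \<zero> (Dom C h) (Cod C f)"
 obtains u where "u : Arr C" "Dom C u = Dom C h" "Cod C u = Dom C k" "k ## u = h"
proof -
 note [simp] = kernelD[OF assms(1)]
 show thesis
  by (rule equalizer_lift[OF assms(1)[unfolded is_kernel_def], of h]) (use assms that in simp_all)
qed

lemma kernelI:
 assumes "f : Arr C" "mono_in C k" "Cod C k = Dom C f" "f ## k = \<zero> (Dom C k) (Cod C f)"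
  "!!h. h : Arr C ==> Cod C h = Dom C f ==> f ## h = \<zero> (Dom C h) (Cod C f) ==>
   EX u. u : Arr C & Dom C u = Dom C h & Cod C u = Dom C k & k ## u = h"
 shows "is_kernel C f k"
 unfolding is_kernel_def
 by (rule equalizerI) (use assms mono_arr[OF assms(2)] in simp_all)

lemma cokernelD:
 assumes "is_cokernel C f q"
 shows "f : Arr C" "q : Arr C" "Dom C q = Cod C f" "q ## f = \<zero> (Dom C f) (Cod C q)" "epi_in C q"
proof -
 note e = coequalizerD[OF assms[unfolded is_cokernel_def]]
 show f: "f : Arr C" "q : Arr C" using e by simp_all
 show c: "Dom C q = Cod C f" using e(6) f by simp
 show "q ## f = \<zero> (Dom C f) (Cod C q)" using e(7) c f by simp
 show "epi_in C q" using coequalizer_epi assms unfolding is_cokernel_def by blast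
qed

lemma cokernel_desc:
 assumes "is_cokernel C f q" "h : Arr C" "Dom C h = Cod C f" "h ## f = \<zero> (Dom C f) (Cod C h)"
 obtains u where "u : Arr C" "Dom C u = Cod C q" "Cod C u = Cod C h" "u ## q = h"
proof -
 note [simp] = cokernelD[OF assms(1)]
 show thesis
  by (rule coequalizer_desc[OF assms(1)[unfolded is_cokernel_def], of h]) (use assms that in simp_all)
qed

lemma cokernelI:
 assumes "f : Arr C" "epi_in C q" "Dom C q = Cod C f" "q ## f = \<zero> (Dom C f) (Cod C q)"
  "!!h. h : Arr C ==> Dom C h = Cod C f ==> h ## f = \<zero> (Dom C f) (Cod C h) ==>
   EX u. u : Arr C & Dom C u = Cod C q & Cod C u = Cod C h & u ## q = h"
 shows "is_cokernel C f q"
 unfolding is_cokernel_def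
 by (rule coequalizerI) (use assms epi_arr[OF assms(2)] in simp_all)

lemma equalizer_iff_kernel:
 assumes "f : Arr C" "g : Arr C" "Dom C f = Dom C g" "Cod C f = Cod C g"
 shows "is_equalizer C f g m \<longleftrightarrow> is_kernel C (f \<ominus> g) m"
proof
 assume e: "is_equalizer C f g m"
 note [simp] = equalizerD[OF e] assms
 show "is_kernel C (f \<ominus> g) m"
 proof (rule kernelI)
  fix h assume h: "h : Arr C" "Cod C h = Dom C (f \<ominus> g)" "(f \<ominus> g) ## h = \<zero> (Dom C h) (Cod C (f \<ominus> g))"
  then have "f ## h = g ## h" by (simp add: minus_comp minus_eq_zero_iff)
  then obtain u where "u : Arr C" "Dom C u = Dom C h" "Cod C u = Dom C m" "m ## u = h"
   using equalizer_lift[OF e, of h] h by auto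
  then show "EX u. u : Arr C & Dom C u = Dom C h & Cod C u = Dom C m & m ## u = h" by blast
 qed (use equalizer_mono[OF e] in \<open>simp_all add: minus_comp minus_eq_zero_iff\<close>)
next
 assume k: "is_kernel C (f \<ominus> g) m"
 note [simp] = assms kernelD(2,3)[OF k]
 show "is_equalizer C f g m"
 proof (rule equalizerI)
  show "f ## m = g ## m" using kernelD(4)[OF k] by (simp add: minus_comp minus_eq_zero_iff)
  fix h assume h: "h : Arr C" "Cod C h = Dom C g" "f ## h = g ## h"
  have "(f \<ominus> g) ## h = \<zero> (Dom C h) (Cod C (f \<ominus> g))" using h by (simp add: minus_comp minus_eq_zero_iff)
  from kernel_lift[OF k h(1) _ this] h
  show "EX u. u : Arr C & Dom C u = Dom C h & Cod C u = Dom C m & m ## u = h" by auto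
 qed (use kernelD(5)[OF k] in simp_all)
qed

lemma coequalizer_iff_cokernel:
 assumes "f : Arr C" "g : Arr C" "Dom C f = Dom C g" "Cod C f = Cod C g"
 shows "is_coequalizer C f g q \<longleftrightarrow> is_cokernel C (f \<ominus> g) q"
proof
 assume e: "is_coequalizer C f g q"
 note [simp] = coequalizerD[OF e] assms
 show "is_cokernel C (f \<ominus> g) q"
 proof (rule cokernelI)
  fix h assume h: "h : Arr C" "Dom C h = Cod C (f \<ominus> g)" "h ## (f \<ominus> g) = \<zero> (Dom C (f \<ominus> g)) (Cod C h)"
  then have "h ## f = h ## g" by (simp add: comp_minus minus_eq_zero_iff)
  then obtain u where "u : Arr C" "Dom C u = Cod C q" "Cod C u = Cod C h" "u ## q = h"
   using coequalizer_desc[OF e, of h] h by auto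
  then show "EX u. u : Arr C & Dom C u = Cod C q & Cod C u = Cod C h & u ## q = h" by blast
 qed (use coequalizer_epi[OF e] in \<open>simp_all add: comp_minus minus_eq_zero_iff\<close>)
next
 assume k: "is_cokernel C (f \<ominus> g) q"
 note [simp] = assms cokernelD(2,3)[OF k]
 show "is_coequalizer C f g q"
 proof (rule coequalizerI)
  show "q ## f = q ## g" using cokernelD(4)[OF k] by (simp add: comp_minus minus_eq_zero_iff)
  fix h assume h: "h : Arr C" "Dom C h = Cod C g" "h ## f = h ## g"
  have "h ## (f \<ominus> g) = \<zero> (Dom C (f \<ominus> g)) (Cod C h)" using h by (simp add: comp_minus minus_eq_zero_iff)
  from cokernel_desc[OF k h(1) _ this] h
  show "EX u. u : Arr C & Dom C u = Cod C q & Cod C u = Cod C h & u ## q = h" by auto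
 qed (use cokernelD(5)[OF k] in simp_all)
qed

lemma regular_epi_iff: "regular_epi C q \<longleftrightarrow> (EX x. is_cokernel C x q)"
proof
 assume "regular_epi C q"
 then obtain f g where e: "is_coequalizer C f g q" unfolding regular_epi_def by blast
 then show "EX x. is_cokernel C x q" using coequalizer_iff_cokernel[OF coequalizerD(1-4)[OF e]] by blast
next
 assume "EX x. is_cokernel C x q"
 then show "regular_epi C q" unfolding is_cokernel_def regular_epi_def by blast
qed

lemma regular_mono_iff: "regular_mono C m \<longleftrightarrow> (EX x. is_kernel C x m)"
proof
 assume "regular_mono C m"
 then obtain f g where e: "is_equalizer C f g m" unfolding regular_mono_def by blast
 then show "EX x. is_kernel C x m" using equalizer_iff_kernel[OF equalizerD(1-4)[OF e]] by blast
next
 assume "EX x. is_kernel C x m"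
 then show "regular_mono C m" unfolding is_kernel_def regular_mono_def by blast
qed

lemma cokernel_of_kernel:
 assumes "is_cokernel C x q" "is_kernel C q k"
 shows "is_cokernel C k q"
proof -
 note [simp] = cokernelD[OF assms(1)] kernelD[OF assms(2)]
 obtain u where u[simp]: "u : Arr C" "Dom C u = Dom C x" "Cod C u = Dom C k" "k ## u = x"
  by (rule kernel_lift[OF assms(2), of x]) simp_all
 show ?thesis
 proof (rule cokernelI)
  fix h assume h: "h : Arr C" "Dom C h = Cod C k" "h ## k = \<zero> (Dom C k) (Cod C h)"
  have "h ## x = \<zero> (Dom C x) (Cod C h)" using assoc_rewrite[OF h(3), of u] h by simp
  then show "EX u. u : Arr C & Dom C u = Cod C q & Cod C u = Cod C h & u ## q = h"
   using cokernel_desc[OF assms(1), of h] h by auto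
 qed simp_all
qed

lemma kernel_of_cokernel:
 assumes "is_kernel C x k" "is_cokernel C k q"
 shows "is_kernel C q k"
proof -
 note [simp] = kernelD[OF assms(1)] cokernelD[OF assms(2)]
 obtain u where u[simp]: "u : Arr C" "Dom C u = Cod C q" "Cod C u = Cod C x" "u ## q = x"
  by (rule cokernel_desc[OF assms(2), of x]) simp_all
 show ?thesis
 proof (rule kernelI)
  fix h assume h: "h : Arr C" "Cod C h = Dom C q" "q ## h = \<zero> (Dom C h) (Cod C q)"
  have "x ## h = u ## (q ## h)" using assoc_rewrite[OF u(4), of h] h by simp
  then have "x ## h = \<zero> (Dom C h) (Cod C x)" using h by simp
  then show "EX u. u : Arr C & Dom C u = Dom C h & Cod C u = Dom C k & k ## u = h"
   using kernel_lift[OF assms(1), of h] h by auto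
 qed simp_all
qed

lemma cokernel_precomp_epi:
 assumes "epi_in C e" "x : Arr C" "Cod C e = Dom C x"
 shows "is_cokernel C (x ## e) q \<longleftrightarrow> is_cokernel C x q"
proof -
 note [simp] = epi_arr[OF assms(1)] assms(2,3)
 have iff: "h ## (x ## e) = \<zero> (Dom C e) (Cod C h) \<longleftrightarrow> h ## x = \<zero> (Dom C x) (Cod C h)" if [simp]: "h : Arr C" "Dom C h = Cod C x" for h
 proof
  assume "h ## (x ## e) = \<zero> (Dom C e) (Cod C h)"
  then show "h ## x = \<zero> (Dom C x) (Cod C h)" using epi_zeroD[OF assms(1), of "h ## x"] by simp
 next
  assume "h ## x = \<zero> (Dom C x) (Cod C h)"
  from assoc_rewrite[OF this, of e] show "h ## (x ## e) = \<zero> (Dom C e) (Cod C h)" by simp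
 qed
 show ?thesis
 proof
  assume k: "is_cokernel C (x ## e) q"
  then have [simp]: "q : Arr C" "Dom C q = Cod C x" using cokernelD(2,3)[OF k] by simp_all
  show "is_cokernel C x q"
  proof (rule cokernelI)
   fix h assume "h : Arr C" "Dom C h = Cod C x" "h ## x = \<zero> (Dom C x) (Cod C h)"
   then show "EX u. u : Arr C & Dom C u = Cod C q & Cod C u = Cod C h & u ## q = h"
    using cokernel_desc[OF k, of h] iff[of h] by auto
  qed (use cokernelD(4,5)[OF k] iff[of q] in simp_all)
 next
  assume k: "is_cokernel C x q"
  then have [simp]: "q : Arr C" "Dom C q = Cod C x" using cokernelD(2,3)[OF k] by simp_all
  show "is_cokernel C (x ## e) q"
  proof (rule cokernelI)
   fix h assume "h : Arr C" "Dom C h = Cod C (x ## e)" "h ## (x ## e) = \<zero> (Dom C (x ## e)) (Cod C h)"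
   then show "EX u. u : Arr C & Dom C u = Cod C q & Cod C u = Cod C h & u ## q = h"
    using cokernel_desc[OF k, of h] iff[of h] by auto
  qed (use cokernelD(4,5)[OF k] iff[of q] in simp_all)
 qed
qed

lemma kernel_postcomp_mono:
 assumes "mono_in C m" "x : Arr C" "Dom C m = Cod C x"
 shows "is_kernel C (m ## x) k \<longleftrightarrow> is_kernel C x k"
proof -
 note [simp] = mono_arr[OF assms(1)] assms(2,3)
 have iff: "m ## (x ## h) = \<zero> (Dom C h) (Cod C m) \<longleftrightarrow> x ## h = \<zero> (Dom C h) (Cod C x)" if [simp]: "h : Arr C" "Cod C h = Dom C x" for h
 proof
  assume "m ## (x ## h) = \<zero> (Dom C h) (Cod C m)"
  then show "x ## h = \<zero> (Dom C h) (Cod C x)" using mono_zeroD[OF assms(1), of "x ## h"] by simp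
 qed simp
 show ?thesis
 proof
  assume k: "is_kernel C (m ## x) k"
  then have [simp]: "k : Arr C" "Cod C k = Dom C x" using kernelD(2,3)[OF k] by simp_all
  show "is_kernel C x k"
  proof (rule kernelI)
   fix h assume "h : Arr C" "Cod C h = Dom C x" "x ## h = \<zero> (Dom C h) (Cod C x)"
   then show "EX u. u : Arr C & Dom C u = Dom C h & Cod C u = Dom C k & k ## u = h"
    using kernel_lift[OF k, of h] iff[of h] by auto
  qed (use kernelD(4,5)[OF k] iff[of k] in simp_all)
 next
  assume k: "is_kernel C x k"
  then have [simp]: "k : Arr C" "Cod C k = Dom C x" using kernelD(2,3)[OF k] by simp_all
  show "is_kernel C (m ## x) k"
  proof (rule kernelI)
   fix h assume "h : Arr C" "Cod C h = Dom C (m ## x)" "(m ## x) ## h = \<zero> (Dom C h) (Cod C (m ## x))"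
   then show "EX u. u : Arr C & Dom C u = Dom C h & Cod C u = Dom C k & k ## u = h"
    using kernel_lift[OF k, of h] iff[of h] by auto
  qed (use kernelD(4,5)[OF k] iff[of k] in simp_all)
 qed
qed

lemma cokernel_unique:
 assumes "is_cokernel C x q" "is_cokernel C x r"
 obtains i where "iso_in C i" "Dom C i = Cod C q" "Cod C i = Cod C r" "i ## q = r"
proof -
 note [simp] = cokernelD[OF assms(1)] cokernelD[OF assms(2)]
 obtain u where u[simp]: "u : Arr C" "Dom C u = Cod C q" "Cod C u = Cod C r" "u ## q = r"
  by (rule cokernel_desc[OF assms(1), of r]) simp_all
 obtain v where v[simp]: "v : Arr C" "Dom C v = Cod C r" "Cod C v = Cod C q" "v ## r = q"
  by (rule cokernel_desc[OF assms(2), of q]) simp_all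
 have "v ## u = Id C (Dom C u)" by (rule epiD[OF cokernelD(5)[OF assms(1)]]) simp_all
 moreover have "u ## v = Id C (Cod C u)" by (rule epiD[OF cokernelD(5)[OF assms(2)]]) simp_all
 ultimately show thesis by (intro that[of u] isoI[of u v]) simp_all
qed

lemma cokernel_comp_iso:
 assumes q: "is_cokernel C x q" and "iso_in C i" "Dom C i = Cod C q"
 shows "is_cokernel C x (i ## q)"
proof -
 obtain j where j: "i : Arr C" "j : Arr C" "Dom C j = Cod C i" "Cod C j = Dom C i"
  "j ## i = Id C (Dom C i)" "i ## j = Id C (Cod C i)" using assms(2) by (rule isoE)
 note [simp] = cokernelD[OF q] j assms(3)
 show ?thesis
 proof (rule cokernelI)
  show "epi_in C (i ## q)" by (rule epi_comp[OF iso_epi[OF assms(2)] cokernelD(5)[OF q]]) (simp)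
  fix h assume [simp]: "h : Arr C" "Dom C h = Cod C x" and "h ## x = \<zero> (Dom C x) (Cod C h)"
  then obtain u where u: "u : Arr C" "Dom C u = Cod C q" "Cod C u = Cod C h" "u ## q = h"
   using cokernel_desc[OF q, of h] by auto
  have "(u ## j) ## (i ## q) = h" using u assoc_rewrite[OF j(5), of q] by simp
  then show "EX u. u : Arr C & Dom C u = Cod C (i ## q) & Cod C u = Cod C h & u ## (i ## q) = h"
   using u by (intro exI[of _ "u ## j"]) simp
 qed simp_all
qed

lemma coequalizer_of_cokernels:
 assumes "ALL f : Arr C. EX q. is_cokernel C f q" "f : Arr C" "g : Arr C" "Dom C f = Dom C g" "Cod C f = Cod C g"
 obtains q where "is_coequalizer C f g q"
 using assms(1)[rule_format, of "f \<ominus> g"] coequalizer_iff_cokernel[OF assms(2-5)] assms(2-5) that by auto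

end

locale additive_with_kernels = additive +
 assumes kernel_ex: "f : Arr C ==> EX k. is_kernel C f k"
begin

lemma pullback_ex:
 assumes "f : Arr C" "g : Arr C" "Cod C f = Cod C g"
 obtains p q where "is_pullback C f g p q"
proof -
 obtain P i j p q where b: "biprod C (hom_plus C) (zero_arr C) (Dom C f) (Dom C g) P i j p q"
  by (rule biprodE[of "Dom C f" "Dom C g"]) (use assms in simp_all)
 note [simp] = biprod_simps[OF b] assms
 obtain k where k: "is_kernel C (f ## p \<ominus> g ## q) k" using kernel_ex[of "f ## p \<ominus> g ## q"] by auto
 have [simp]: "k : Arr C" "Cod C k = P" using kernelD(2,3)[OF k] by simp_all
 have "is_pullback C f g (p ## k) (q ## k)"
 proof (rule pullbackI)
  show "f ## (p ## k) = g ## (q ## k)"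
   using kernelD(4)[OF k] by (simp add: minus_comp minus_eq_zero_iff)
  fix h l assume hl: "h : Arr C" "l : Arr C" "Dom C h = Dom C l" "Cod C h = Dom C f" "Cod C l = Dom C g" "f ## h = g ## l"
  obtain w where w: "w : Arr C" "Dom C w = Dom C h" "Cod C w = P" "p ## w = h" "q ## w = l"
   by (rule biprod_pair[OF b, of h l]) (use hl in simp_all)
  have "(f ## p \<ominus> g ## q) ## w = \<zero> (Dom C w) (Cod C (f ## p \<ominus> g ## q))"
   using w hl by (simp add: minus_comp minus_eq_zero_iff)
  from kernel_lift[OF k w(1) _ this] obtain u where "u : Arr C" "Dom C u = Dom C w" "Cod C u = Dom C k" "k ## u = w"
   using w by auto
  then show "EX u. u : Arr C & Dom C u = Dom C h & Cod C u = Dom C (p ## k) & (p ## k) ## u = h & (q ## k) ## u = l"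
   using w by (intro exI[of _ u]) simp
 next
  fix u v assume uv: "u : Arr C" "v : Arr C" "Dom C u = Dom C v" "Cod C u = Dom C (p ## k)" "Cod C v = Dom C (p ## k)"
   "(p ## k) ## u = (p ## k) ## v" "(q ## k) ## u = (q ## k) ## v"
  have "k ## u = k ## v" by (rule biprod_unique[OF b]) (use uv in simp_all)
  then show "u = v" by (rule monoD[OF kernelD(5)[OF k]]) (use uv in simp_all)
 qed simp_all
 then show thesis by (rule that)
qed

lemma regular_epi_cokernel:
 assumes "regular_epi C q"
 obtains k where "is_kernel C q k" "is_cokernel C k q"
proof -
 obtain x where x: "is_cokernel C x q" using assms regular_epi_iff by blast
 obtain k where k: "is_kernel C q k" using kernel_ex cokernelD(2)[OF x] by blast
 show thesis by (rule that[OF k cokernel_of_kernel[OF x k]])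
qed

end

context additive
begin

lemma pullback_of_kernel:
 assumes pb: "is_pullback C q f u v" and k: "is_kernel C q k"
 obtains k' where "is_kernel C v k'" "Dom C k' = Dom C k" "u ## k' = k"
proof -
 note [simp] = pullbackD[OF pb] kernelD[OF k]
 obtain k' where k'[simp]: "k' : Arr C" "Dom C k' = Dom C k" "Cod C k' = Dom C u" "u ## k' = k" "v ## k' = \<zero> (Dom C k) (Dom C f)"
  by (rule pullback_lift[OF pb, of k "\<zero> (Dom C k) (Dom C f)"]) simp_all
 have "is_kernel C v k'"
 proof (rule kernelI)
  show "mono_in C k'"
  proof (rule monoI)
   fix a b assume h: "a : Arr C" "b : Arr C" "Dom C a = Dom C b" "Cod C a = Dom C k'" "Cod C b = Dom C k'" "k' ## a = k' ## b"
   have "k ## a = k ## b" using assoc_rewrite[OF k'(4), of a] assoc_rewrite[OF k'(4), of b] h by simp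
   then show "a = b" by (rule monoD[OF kernelD(5)[OF k]]) (use h in simp_all)
  qed simp
  fix h assume h: "h : Arr C" "Cod C h = Dom C v" "v ## h = \<zero> (Dom C h) (Cod C v)"
  have "q ## (u ## h) = \<zero> (Dom C h) (Cod C q)" using assoc_rewrite[of q u "f ## v" h] h by simp
  then obtain w where w: "w : Arr C" "Dom C w = Dom C (u ## h)" "Cod C w = Dom C k" "k ## w = u ## h"
   using kernel_lift[OF k, of "u ## h"] h by auto
  have "k' ## w = h"
   by (rule pullback_unique[OF pb]) (use w h assoc_rewrite[OF k'(4), of w] assoc_rewrite[OF k'(5), of w] in simp_all)
  then show "EX u. u : Arr C & Dom C u = Dom C h & Cod C u = Dom C k' & k' ## u = h" using w h by (intro exI[of _ w]) simp
 qed simp_all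
 then show thesis by (rule that) simp_all
qed

end

locale stable_additive = additive_with_kernels +
 assumes stable: "has_stable_cokernels C"
begin

lemma cokernel_ex: "f : Arr C ==> EX q. is_cokernel C f q"
 using stable unfolding has_stable_cokernels_def stable_cokernel_def by blast

lemma cokernel_stable:
 assumes q: "is_cokernel C x q" and pb: "is_pullback C q f u v"
  and x': "x' : Arr C" "Dom C x' = Dom C x" "Cod C x' = Dom C u" "u ## x' = x" "v ## x' = \<zero> (Dom C x) (Dom C f)"
 shows "is_cokernel C x' v"
proof -
 note [simp] = cokernelD[OF q] pullbackD[OF pb]
 obtain r where r: "stable_cokernel C x r" using stable cokernelD(1)[OF q] unfolding has_stable_cokernels_def by blast
 then have rc: "is_cokernel C x r" by (simp add: stable_cokernel_def)
 note [simp] = cokernelD[OF rc]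
 obtain i where i: "iso_in C i" "Dom C i = Cod C q" "Cod C i = Cod C r" "i ## q = r"
  by (rule cokernel_unique[OF q rc])
 note [simp] = iso_arr[OF i(1)] i(2-4)
 have "is_pullback C r (i ## f) u v"
 proof (rule pullbackI)
  have "r ## u = i ## (q ## u)" using assoc_rewrite[OF i(4), of u] by simp
  then show "r ## u = (i ## f) ## v" using pullbackD(9)[OF pb] by simp
  fix h k assume h: "h : Arr C" "k : Arr C" "Dom C h = Dom C k" "Cod C h = Dom C r" "Cod C k = Dom C (i ## f)" "r ## h = (i ## f) ## k"
  have "i ## (q ## h) = i ## (f ## k)" using assoc_rewrite[OF i(4), of h] h by simp
  then have "q ## h = f ## k" by (rule monoD[OF iso_mono[OF i(1)]]) (use h in simp_all)
  then show "EX w. w : Arr C & Dom C w = Dom C h & Cod C w = Dom C u & u ## w = h & v ## w = k"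
   using pullback_lift[OF pb, of h k] h by auto
 next
  fix a b assume "a : Arr C" "b : Arr C" "Dom C a = Dom C b" "Cod C a = Dom C u" "Cod C b = Dom C u" "u ## a = u ## b" "v ## a = v ## b"
  then show "a = b" by (rule pullback_unique[OF pb])
 qed simp_all
 moreover have st: "ALL f u v x'.
    f : Arr C & Cod C f = Cod C r & is_pullback C r f u v \<and>
    x' : Hom C (Dom C x) (Dom C u) & u ## x' = x & v ## x' = zero_arr C (Dom C x) (Dom C f)
    \<longrightarrow> is_cokernel C x' v"
  using r unfolding stable_cokernel_def by blast
 ultimately show ?thesis using st[rule_format, of "i ## f" u v x'] x' by simp
qed

lemma regular_epi_stable: "regular_epis_pullback_stable C"
 unfolding regular_epis_pullback_stable_def
proof (intro allI impI, elim conjE)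
 fix f g p q assume pb: "is_pullback C f g p q" and "regular_epi C f"
 then obtain k where k: "is_kernel C f k" "is_cokernel C k f" using regular_epi_cokernel by blast
 obtain k' where k': "is_kernel C q k'" "Dom C k' = Dom C k" "p ## k' = k" by (rule pullback_of_kernel[OF pb k(1)])
 have "is_cokernel C k' q"
  by (rule cokernel_stable[OF k(2) pb]) (use kernelD[OF k'(1)] k' pullbackD[OF pb] in simp_all)
 then show "regular_epi C q" using regular_epi_iff by blast
qed

end

section \<open>Finite limits and regularity of additive categories\<close>

lemma (in category) to_zero_object_unique:
 assumes "zero_object C Z" "u : Arr C" "v : Arr C" "Dom C u = Dom C v" "Cod C u = Z" "Cod C v = Z"
 shows "u = v"
proof -
 have "EX! f. f : Hom C (Dom C v) Z" using zero_object_hom(1)[OF assms(1)] assms(3) dom_obj by blast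
 moreover have "u : Hom C (Dom C v) Z" "v : Hom C (Dom C v) Z" using assms by simp_all
 ultimately show ?thesis by blast
qed

definition set_product :: "('o, 'a) cat \<Rightarrow> 'i set \<Rightarrow> ('i \<Rightarrow> 'o) \<Rightarrow> 'o \<Rightarrow> ('i \<Rightarrow> 'a) \<Rightarrow> bool" where
 "set_product C S A P \<pi> \<longleftrightarrow> P : Obj C & (ALL s:S. \<pi> s : Arr C & Dom C (\<pi> s) = P & Cod C (\<pi> s) = A s) \<and>
  (ALL T f. T : Obj C \<longrightarrow> (ALL s:S. f s : Hom C T (A s)) \<longrightarrow> (EX u. u : Hom C T P & (ALL s:S. Comp C (\<pi> s) u = f s))) \<and>
  (ALL u v. u : Arr C \<longrightarrow> v : Arr C \<longrightarrow> Dom C u = Dom C v \<longrightarrow> Cod C u = P \<longrightarrow> Cod C v = P \<longrightarrow>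
    (ALL s:S. Comp C (\<pi> s) u = Comp C (\<pi> s) v) \<longrightarrow> u = v)"

lemma set_productD:
 assumes "set_product C S A P \<pi>"
 shows "P : Obj C" "s : S ==> \<pi> s : Arr C" "s : S ==> Dom C (\<pi> s) = P" "s : S ==> Cod C (\<pi> s) = A s"
  "T : Obj C ==> (!!s. s : S ==> f s : Hom C T (A s)) ==> EX u. u : Hom C T P & (ALL s:S. Comp C (\<pi> s) u = f s)"
  "u : Arr C ==> v : Arr C ==> Dom C u = Dom C v ==> Cod C u = P ==> Cod C v = P ==>
    (!!s. s : S ==> Comp C (\<pi> s) u = Comp C (\<pi> s) v) ==> u = v"
 using assms unfolding set_product_def by blast+

context additive_with_kernels
begin

lemma finite_product:
 assumes "finite S"
 shows "ALL s:S. A s : Obj C ==> EX P \<pi>. set_product C S A P \<pi>"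
 using assms
proof (induction S)
 case empty
 obtain Z where Z: "zero_object C Z" by (rule zero_objectE)
 have "set_product C {} A Z undefined"
  unfolding set_product_def
 proof (intro conjI allI impI)
  show "Z : Obj C" using Z by (simp add: zero_object_def)
  show "u = v" if "u : Arr C" "v : Arr C" "Dom C u = Dom C v" "Cod C u = Z" "Cod C v = Z" for u v
   by (rule to_zero_object_unique[OF Z that])
  show "EX u. u : Hom C T Z & (ALL s:{}. undefined s ## u = f s)" if "T : Obj C" for T f
   using zero_object_hom(1)[OF Z that] by blast
 qed blast
 then show ?case by blast
next
 case (insert x S)
 then obtain P \<pi> where "set_product C S A P \<pi>" by auto
 note P = set_productD[OF this]
 obtain Q i j p q where b: "biprod C (hom_plus C) (zero_arr C) P (A x) Q i j p q"
  by (rule biprodE[of P "A x"]) (use P insert in auto)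
 note [simp] = biprod_simps[OF b] P(1)
 define \<pi>' where "\<pi>' s = (if s = x then q else \<pi> s ## p)" for s
 have ne: "s \<noteq> x" if "s : S" for s using that insert by auto
 have [simp]: "\<pi> s : Arr C" "Dom C (\<pi> s) = P" "Cod C (\<pi> s) = A s" if "s : S" for s using P(2-4) that by auto
 have 1: "ALL s:insert x S. \<pi>' s : Hom C Q (A s)" using ne by (auto simp: \<pi>'_def)
 have "set_product C (insert x S) A Q \<pi>'"
  unfolding set_product_def
 proof (intro conjI allI impI)
  show "Q : Obj C" by simp
  show "ALL s:insert x S. \<pi>' s : Arr C & Dom C (\<pi>' s) = Q & Cod C (\<pi>' s) = A s" using 1 by simp
 next
  fix T f assume T: "T : Obj C" "ALL s:insert x S. f s : Hom C T (A s)"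
  obtain u where u: "u : Hom C T P" "ALL s:S. \<pi> s ## u = f s" using P(5)[of T f] T by auto
  obtain w where w: "w : Arr C" "Dom C w = Dom C u" "Cod C w = Q" "p ## w = u" "q ## w = f x"
   by (rule biprod_pair[OF b, of u "f x"]) (use u T in auto)
  show "EX u. u : Hom C T Q & (ALL s:insert x S. \<pi>' s ## u = f s)"
   using u w ne by (intro exI[of _ w]) (auto simp: \<pi>'_def)
 next
  fix u v assume h: "u : Arr C" "v : Arr C" "Dom C u = Dom C v" "Cod C u = Q" "Cod C v = Q"
   "ALL s:insert x S. \<pi>' s ## u = \<pi>' s ## v"
  show "u = v"
  proof (rule biprod_unique[OF b])
   show "p ## u = p ## v"
   proof (rule P(6))
    fix s assume "s : S"
    then show "\<pi> s ## (p ## u) = \<pi> s ## (p ## v)" using h(6)[rule_format, of s] ne[of s] h(1-5) by (simp add: \<pi>'_def)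
   qed (use h in simp_all)
   show "q ## u = q ## v" using h(6) by (simp add: \<pi>'_def)
  qed (use h in simp_all)
 qed
 then show ?case by blast
qed

lemma finite_limits: "has_finite_limits C"
 unfolding has_finite_limits_def
proof (intro allI impI, elim conjE)
 fix J :: "(nat, nat) cat" and D assume J: "category J" "finite (Obj J)" "finite (Arr J)" and D: "is_functor J C D"
 interpret J: category J by (rule J)
 have DO: "ALL j:Obj J. FObj D j : Obj C" using D by (simp add: is_functor_def)
 have DA: "FArr D u : Arr C" "Dom C (FArr D u) = FObj D (Dom J u)" "Cod C (FArr D u) = FObj D (Cod J u)" if "u : Arr J" for u
 proof -
  have "ALL A : Obj J. ALL B : Obj J. ALL f : Hom J A B. FArr D f : Hom C (FObj D A) (FObj D B)"
   using D unfolding is_functor_def by blast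
  from this[rule_format, of "Dom J u" "Cod J u" u] that show "FArr D u : Arr C"
   "Dom C (FArr D u) = FObj D (Dom J u)" "Cod C (FArr D u) = FObj D (Cod J u)" by simp_all
 qed
 obtain P \<pi> where "set_product C (Obj J) (FObj D) P \<pi>" using finite_product[OF J(2) DO] by blast
 note P = set_productD[OF this]
 have "ALL u:Arr J. FObj D (Cod J u) : Obj C" using DO by simp
 then obtain Q \<rho> where "set_product C (Arr J) (\<lambda>u. FObj D (Cod J u)) Q \<rho>"
  using finite_product[OF J(3), of "\<lambda>u. FObj D (Cod J u)"] by blast
 note Q = set_productD[OF this]
 note [simp] = P(1-4) Q(1-4)
 obtain a where a: "a : Arr C" "Dom C a = P" "Cod C a = Q" "!!u. u : Arr J ==> \<rho> u ## a = \<pi> (Cod J u)"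
  using Q(5)[OF P(1), of "\<lambda>u. \<pi> (Cod J u)"] by auto
 obtain b where b: "b : Arr C" "Dom C b = P" "Cod C b = Q" "!!u. u : Arr J ==> \<rho> u ## b = FArr D u ## \<pi> (Dom J u)"
  using Q(5)[OF P(1), of "\<lambda>u. FArr D u ## \<pi> (Dom J u)"] DA by auto
 obtain m where "is_kernel C (a \<ominus> b) m" using kernel_ex[of "a \<ominus> b"] a b by auto
 then have m: "is_equalizer C a b m" using equalizer_iff_kernel[of a b m] a b by simp
 note md = equalizerD[OF m]
 have cone: "is_cone J C D (Dom C m) (\<lambda>j. \<pi> j ## m)"
  unfolding is_cone_def
 proof (intro conjI ballI)
  fix u assume u: "u : Arr J"
  have "FArr D u ## (\<pi> (Dom J u) ## m) = \<rho> u ## (b ## m)"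
   using assoc_rewrite[OF b(4)[OF u], of m] DA[OF u] u md b by simp
  also have "\<dots> = \<pi> (Cod J u) ## m"
   using assoc_rewrite[OF a(4)[OF u], of m] md(7) u md a by simp
  finally show "FArr D u ## (\<pi> (Dom J u) ## m) = \<pi> (Cod J u) ## m" .
 qed (use md b in auto)
 have "EX! h. h : Hom C B (Dom C m) & (ALL j : Obj J. (\<pi> j ## m) ## h = c j)" if c: "is_cone J C D B c" for B c
 proof -
  have B: "B : Obj C" "ALL j:Obj J. c j : Hom C B (FObj D j)" "!!u. u : Arr J ==> FArr D u ## c (Dom J u) = c (Cod J u)"
   using c by (auto simp: is_cone_def)
  obtain w where w: "w : Arr C" "Dom C w = B" "Cod C w = P" "!!s. s : Obj J ==> \<pi> s ## w = c s" using P(5)[of B c] B(1,2) by auto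
  have "a ## w = b ## w"
  proof (rule Q(6))
    fix s assume s: "s : Arr J"
    show "\<rho> s ## (a ## w) = \<rho> s ## (b ## w)"
     using assoc_rewrite[OF a(4)[OF s], of w] assoc_rewrite[OF b(4)[OF s], of w] s DA[OF s] w a b B(3)[OF s] by simp
  qed (use w a b in simp_all)
  then obtain h where h: "h : Arr C" "Dom C h = B" "Cod C h = Dom C m" "m ## h = w"
   using equalizer_lift[OF m, of w] w b by auto
  show ?thesis
  proof (rule ex1I[of _ h])
   show "h : Hom C B (Dom C m) & (ALL j:Obj J. (\<pi> j ## m) ## h = c j)" using h w md b by simp
   fix k assume k: "k : Hom C B (Dom C m) & (ALL j:Obj J. (\<pi> j ## m) ## k = c j)"
   have "m ## k = m ## h"
   proof (rule P(6))
     fix s assume s: "s : Obj J"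
     then have "(\<pi> s ## m) ## k = c s" using k by blast
     then show "\<pi> s ## (m ## k) = \<pi> s ## (m ## h)" using w(4)[OF s] s h k[THEN conjunct1] md b by simp
   qed (use h w k md b in simp_all)
   then show "k = h" by (rule monoD[OF equalizer_mono[OF m]]) (use h k in simp_all)
  qed
 qed
 then have "is_limit J C D (Dom C m) (\<lambda>j. \<pi> j ## m)" using cone unfolding is_limit_def by blast
 then show "EX A a. is_limit J C D A a" by blast
qed

end

definition parallel_shape :: "(nat, nat) cat" where
 "parallel_shape = \<lparr>Obj = {0, 1}, Arr = {0, 1, 2, 3}, Dom = (\<lambda>u. if u = 1 then 1 else 0),
  Cod = (\<lambda>u. if u = 0 then 0 else 1), Id = (\<lambda>j. j), Comp = (\<lambda>v u. if u < 2 then v else u)\<rparr>"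

lemma category_parallel_shape: "category parallel_shape"
 by unfold_locales (auto simp: parallel_shape_def)

lemma (in additive) kernels_of_finite_limits:
 assumes "has_finite_limits C" "f : Arr C"
 shows "EX k. is_kernel C f k"
proof -
 let ?z = "\<zero> (Dom C f) (Cod C f)"
 define D where "D = \<lparr>FObj = (\<lambda>j::nat. if j = 0 then Dom C f else Cod C f),
  FArr = (\<lambda>u::nat. if u = 0 then Id C (Dom C f) else if u = 1 then Id C (Cod C f) else if u = 2 then f else ?z)\<rparr>"
 have "is_functor parallel_shape C D"
  unfolding is_functor_def
 proof (intro conjI ballI impI)
  fix i assume "i : Obj parallel_shape"
  then have "i = 0 \<or> i = 1" by (simp add: parallel_shape_def)
  then show "FObj D i : Obj C" "FArr D (Id parallel_shape i) = Id C (FObj D i)"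
   using assms(2) by (auto simp: parallel_shape_def D_def)
 next
  fix i j u assume "u : Hom parallel_shape i j"
  then have "u = 0 \<or> u = 1 \<or> u = 2 \<or> u = 3" "i = Dom parallel_shape u" "j = Cod parallel_shape u"
   by (simp_all add: parallel_shape_def)
  then show "FArr D u : Hom C (FObj D i) (FObj D j)"
   using assms(2) by (elim disjE) (simp_all add: parallel_shape_def D_def)
 next
  fix u v assume "u : Arr parallel_shape" "v : Arr parallel_shape" "Cod parallel_shape u = Dom parallel_shape v"
  then have "u = 0 & v = 0 \<or> u = 0 & v = 2 \<or> u = 0 & v = 3 \<or> u = 1 & v = 1 \<or> u = 2 & v = 1 \<or> u = 3 & v = 1"
   by (simp add: parallel_shape_def split: if_splits; linarith)
  then show "FArr D (v ##\<^bsub>parallel_shape\<^esub> u) = FArr D v ## FArr D u"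
   using assms(2) by (elim disjE conjE) (simp_all add: parallel_shape_def D_def)
 qed
 moreover have "finite (Obj parallel_shape)" "finite (Arr parallel_shape)" by (simp_all add: parallel_shape_def)
 ultimately have "EX A a. is_limit parallel_shape C D A a"
  by (intro assms(1)[unfolded has_finite_limits_def, rule_format] conjI category_parallel_shape)
 then obtain A a where l: "is_limit parallel_shape C D A a" by blast
 have c: "is_cone parallel_shape C D B b \<longleftrightarrow> B : Obj C & b 0 : Hom C B (Dom C f) & b 1 : Hom C B (Cod C f) \<and>
  f ## b 0 = b 1 & \<zero> B (Cod C f) = b 1" for B b
  unfolding is_cone_def using assms(2) by (auto simp: parallel_shape_def D_def)
 have a: "A : Obj C" "a 0 : Arr C" "Dom C (a 0) = A" "Cod C (a 0) = Dom C f" "f ## a 0 = \<zero> A (Cod C f)"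
   "a 1 = \<zero> A (Cod C f)"
  using l[unfolded is_limit_def, THEN conjunct1, unfolded c] assms(2) by simp_all
 have u: "EX! h. h : Hom C (Dom C g) A & a 0 ## h = g" if g: "g : Arr C" "Cod C g = Dom C f" "f ## g = \<zero> (Dom C g) (Cod C f)" for g
 proof -
  let ?b = "\<lambda>j::nat. if j = 0 then g else \<zero> (Dom C g) (Cod C f)"
  have "is_cone parallel_shape C D (Dom C g) ?b" unfolding c using g assms(2) by simp
  then have "EX! h. h : Hom C (Dom C g) A & (ALL j : Obj parallel_shape. a j ## h = ?b j)"
   using l unfolding is_limit_def by blast
  moreover have "h : Hom C (Dom C g) A & (ALL j : Obj parallel_shape. a j ## h = ?b j) \<longleftrightarrow> h : Hom C (Dom C g) A & a 0 ## h = g" for h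
   using a assms(2) by (auto simp: parallel_shape_def)
  ultimately show ?thesis by simp
 qed
 have "is_kernel C f (a 0)"
 proof (rule kernelI)
  show "mono_in C (a 0)"
  proof (rule monoI)
   fix v w assume vw: "v : Arr C" "w : Arr C" "Dom C v = Dom C w" "Cod C v = Dom C (a 0)" "Cod C w = Dom C (a 0)"
    "a 0 ## v = a 0 ## w"
   have "f ## (a 0 ## w) = \<zero> (Dom C w) (Cod C f)"
    using assoc_rewrite[OF a(5), of w] a assms(2) vw by simp
   then have "EX! h. h : Hom C (Dom C (a 0 ## w)) A & a 0 ## h = a 0 ## w" by (intro u) (use a vw in simp_all)
   moreover have "v : Hom C (Dom C (a 0 ## w)) A & a 0 ## v = a 0 ## w"
    "w : Hom C (Dom C (a 0 ## w)) A & a 0 ## w = a 0 ## w" using vw a by simp_all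
   ultimately show "v = w" by blast
  qed (rule a(2))
  fix h assume "h : Arr C" "Cod C h = Dom C f" "f ## h = \<zero> (Dom C h) (Cod C f)"
  from ex1_implies_ex[OF u[OF this]]
  show "EX u. u : Arr C & Dom C u = Dom C h & Cod C u = Dom C (a 0) & a 0 ## u = h" using a by auto
 qed (use a assms(2) in simp_all)
 then show ?thesis ..
qed

locale regular_additive = additive_with_kernels +
 assumes regular_epi_stable: "regular_epis_pullback_stable C"
  and factor_ex: "f : Arr C ==> EX e m. regular_epi C e & mono_in C m & Cod C e = Dom C m & f = m ## e"

lemma (in additive) regular_additiveI:
 assumes "regular_category C"
 shows "regular_additive C"
proof -
 have fl: "has_finite_limits C" and st: "regular_epis_pullback_stable C"
  and kp: "!!f p q. is_pullback C f f p q ==> EX e. is_coequalizer C p q e"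
  using assms unfolding regular_category_def by blast+
 interpret additive_with_kernels C by unfold_locales (rule kernels_of_finite_limits[OF fl])
 show ?thesis
 proof (unfold_locales)
  fix f assume f[simp]: "f : Arr C"
  obtain p q where pb: "is_pullback C f f p q" using pullback_ex[of f f] by auto
  note [simp] = pullbackD(3,4,6-9)[OF pb]
  obtain e where e: "is_coequalizer C p q e" using kp[OF pb] by blast
  note [simp] = coequalizerD[OF e]
  obtain m where m[simp]: "m : Arr C" "Dom C m = Cod C e" "Cod C m = Cod C f" "m ## e = f"
   by (rule coequalizer_desc[OF e, of f]) simp_all
  obtain k where k: "is_kernel C f k" using kernel_ex[OF f] by blast
  note [simp] = kernelD[OF k]
  have ek: "e ## k = \<zero> (Dom C k) (Cod C e)"
  proof -
   obtain w where w[simp]: "w : Arr C" "Dom C w = Dom C k" "Cod C w = Dom C p" "p ## w = k" "q ## w = \<zero> (Dom C k) (Dom C f)"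
    by (rule pullback_lift[OF pb, of k "\<zero> (Dom C k) (Dom C f)"]; (rule that)?; simp)
   have "e ## (p ## w) = e ## (q ## w)" using assoc_rewrite[OF coequalizerD(7)[OF e], of w] by simp
   then show ?thesis by simp
  qed
  have "mono_in C m"
  proof (rule mono_zeroI)
   fix t assume t[simp]: "t : Arr C" "Cod C t = Dom C m" and mt: "m ## t = \<zero> (Dom C t) (Cod C m)"
   obtain t' e' where pb': "is_pullback C e t t' e'" using pullback_ex[of e t] by auto
   note [simp] = pullbackD(3,4,6-9)[OF pb']
   have re: "regular_epi C e" using e unfolding regular_epi_def by blast
   have "regular_epi C e'" using st pb' re unfolding regular_epis_pullback_stable_def by blast
   then have ep: "epi_in C e'" using regular_epi_iff cokernelD(5) by blast
   have "f ## t' = m ## (t ## e')" using assoc_rewrite[OF m(4), of t'] by simp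
   also have "\<dots> = \<zero> (Dom C e') (Cod C m)" using assoc_rewrite[OF mt, of e'] by simp
   finally obtain w where w: "w : Arr C" "Dom C w = Dom C t'" "Cod C w = Dom C k" "k ## w = t'"
    using kernel_lift[OF k, of t'] by auto
   have "e ## t' = \<zero> (Dom C w) (Cod C e)" using assoc_rewrite[OF ek, of w] w by simp
   then have "t ## e' = \<zero> (Dom C e') (Cod C t)" using pullbackD(9)[OF pb'] w by simp
   then show "t = \<zero> (Dom C t) (Dom C m)" using epi_zeroD[OF ep, of t] by simp
  qed simp
  then show "EX e m. regular_epi C e & mono_in C m & Cod C e = Dom C m & f = m ## e"
   using e unfolding regular_epi_def by (intro exI[of _ e] exI[of _ m]) auto
 qed (rule st)
qed

lemma (in stable_additive) regular: "regular_category C"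
 unfolding regular_category_def
proof (intro conjI allI impI)
 fix f p q assume "is_pullback C f f p q"
 note d = pullbackD(1-4,6-8)[OF this]
 have "ALL f : Arr C. EX q. is_cokernel C f q" using cokernel_ex by blast
 then show "EX e. is_coequalizer C p q e" using coequalizer_of_cokernels[of p q] d by metis
qed (fact category_axioms finite_limits regular_epi_stable)+

sublocale stable_additive \<subseteq> regular_additive
 by (rule regular_additiveI[OF regular])

lemma stable_additive_iff:
 "stable_additive C \<longleftrightarrow> regular_category C & additive_category C & has_stable_cokernels C"
proof
 assume "stable_additive C"
 then interpret stable_additive C .
 show "regular_category C & additive_category C & has_stable_cokernels C"
  using regular additive stable by blast
next
 assume h: "regular_category C & additive_category C & has_stable_cokernels C"
 interpret additive C using h by unfold_locales blast
 interpret regular_additive C using h by (intro regular_additiveI) blast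
 show "stable_additive C" by unfold_locales (use h in blast)
qed

section \<open>Stable coequalizers and stable cokernels\<close>

lemma (in regular_additive) stable_cokernels_of_stable_coequalizers:
 assumes stab: "has_stable_coequalizers_of_equivalence_relations C"
 shows "has_stable_cokernels C"
 unfolding has_stable_cokernels_def
proof
 fix x assume x: "x : Arr C"
 obtain e m where e: "regular_epi C e" and m: "mono_in C m" and em: "Cod C e = Dom C m" and xm: "x = m ## e"
  using factor_ex[OF x] by blast
 obtain e0 where "is_cokernel C e0 e" using e regular_epi_iff by blast
 then have epi: "epi_in C e" by (rule cokernelD)
 note [simp] = mono_arr[OF m] epi_arr[OF epi] em
 obtain P i j p s where b: "biprod C (hom_plus C) (zero_arr C) (Cod C m) (Dom C m) P i j p s"
  by (rule biprodE[of "Cod C m" "Dom C m"]) simp_all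
 note [simp] = biprod_simps[OF b]
 define r where "r = p \<oplus> m ## s"
 have r[simp]: "r : Arr C" "Dom C r = P" "Cod C r = Cod C m" by (simp_all add: r_def)
 have rc: "r ## h = p ## h \<oplus> m ## (s ## h)" if "h : Arr C" "Cod C h = P" for h using that by (simp add: r_def pl_comp)
 have jm: "jointly_monic C p r"
  unfolding jointly_monic_def
 proof (intro conjI ballI impI)
  fix T f g assume h': "f : Hom C T (Dom C p)" "g : Hom C T (Dom C p)" "p ## f = p ## g & r ## f = r ## g"
  then have h: "f : Hom C T (Dom C p)" "g : Hom C T (Dom C p)" "p ## f = p ## g" "r ## f = r ## g" by blast+
  have "m ## (s ## f) = m ## (s ## g)"
   by (rule pl_cancel[of "p ## g"]) (use h rc[of f] rc[of g] in simp_all)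
  then have "s ## f = s ## g" by (rule monoD[OF m]) (use h in simp_all)
  then show "f = g" by (intro biprod_unique[OF b _ _ _ _ h(3)]) (use h in simp_all)
 qed simp_all
 have E: "(c, c') : {(p ## h, r ## h) |h. h : Hom C T (Dom C p)} \<longleftrightarrow>
  c : Hom C T (Cod C m) & (EX w : Hom C T (Dom C m). c' = c \<oplus> m ## w)" if T: "T : Obj C" for c c' T
 proof
  assume "(c, c') : {(p ## h, r ## h) |h. h : Hom C T (Dom C p)}"
  then obtain h where h: "h : Hom C T P" "c = p ## h" "c' = r ## h" by auto
  then show "c : Hom C T (Cod C m) & (EX w : Hom C T (Dom C m). c' = c \<oplus> m ## w)"
   using rc[of h] by (intro conjI bexI[of _ "s ## h"]) simp_all
 next
  assume "c : Hom C T (Cod C m) & (EX w : Hom C T (Dom C m). c' = c \<oplus> m ## w)"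
  then obtain w where w: "c : Hom C T (Cod C m)" "w : Hom C T (Dom C m)" "c' = c \<oplus> m ## w" by blast
  obtain h where h: "h : Arr C" "Dom C h = Dom C c" "Cod C h = P" "p ## h = c" "s ## h = w"
   by (rule biprod_pair[OF b, of c w]) (use w in simp_all)
  then have "c' = r ## h" using rc[of h] w by simp
  then show "(c, c') : {(p ## h, r ## h) |h. h : Hom C T (Dom C p)}" using h w by auto
 qed
 have eq: "equiv (Hom C T (Cod C m)) {(p ## h, r ## h) |h. h : Hom C T (Dom C p)}" (is "equiv _ ?E") if T: "T : Obj C" for T
 proof (rule equivI)
  show "?E \<subseteq> Hom C T (Cod C m) \<times> Hom C T (Cod C m)" by auto
  show "refl_on (Hom C T (Cod C m)) ?E"
  proof (rule refl_onI)
   fix c assume "c : Hom C T (Cod C m)"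
   then show "(c, c) : ?E" unfolding E[OF T] using T
    by (intro conjI bexI[of _ "\<zero> T (Dom C m)"]) simp_all
  qed
  show "sym ?E"
  proof (rule symI)
   fix c c' assume "(c, c') : ?E"
   then obtain w where w: "c : Hom C T (Cod C m)" "w : Hom C T (Dom C m)" "c' = c \<oplus> m ## w" unfolding E[OF T] by blast
   then have "c = c' \<oplus> m ## hom_neg C w" using T by (simp add: pl_assoc comp_pl[symmetric] pl_ng)
   then show "(c', c) : ?E" unfolding E[OF T] using w by (intro conjI bexI[of _ "hom_neg C w"]) simp_all
  qed
  show "trans ?E"
  proof (rule transI)
   fix c c' c'' assume "(c, c') : ?E" "(c', c'') : ?E"
   then obtain w v where w: "c : Hom C T (Cod C m)" "w : Hom C T (Dom C m)" "c' = c \<oplus> m ## w"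
    "v : Hom C T (Dom C m)" "c'' = c' \<oplus> m ## v" unfolding E[OF T] by blast
   then have "c'' = c \<oplus> m ## (w \<oplus> v)" by (simp add: pl_assoc comp_pl)
   then show "(c, c'') : ?E" unfolding E[OF T] using w by (intro conjI bexI[of _ "w \<oplus> v"]) simp_all
  qed
 qed
 have er: "equivalence_relation C (Cod C m) p r"
  unfolding equivalence_relation_def using jm eq by (intro conjI ballI) simp_all
 have "ALL X : Obj C. ALL r0 r1. equivalence_relation C X r0 r1 \<longrightarrow> (EX q. stable_coequalizer C r0 r1 q)"
  using stab unfolding has_stable_coequalizers_of_equivalence_relations_def .
 from this[rule_format, OF cod_obj er] obtain q where q: "stable_coequalizer C p r q" by auto
 then have qc: "is_coequalizer C p r q" by (simp add: stable_coequalizer_def)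
 note [simp] = coequalizerD(5,6)[OF qc]
 have rj: "r ## j = m" using rc[of j] by simp
 have "q ## (r ## j) = q ## (p ## j)" using assoc_rewrite[OF coequalizerD(7)[OF qc], of j] by simp
 then have qm: "q ## m = \<zero> (Dom C m) (Cod C q)" unfolding rj by simp
 have "is_cokernel C x q" unfolding xm cokernel_precomp_epi[OF epi mono_arr[OF m] em]
 proof (rule cokernelI)
  fix h assume h: "h : Arr C" "Dom C h = Cod C m" "h ## m = \<zero> (Dom C m) (Cod C h)"
  have "h ## p = h ## r" using h assoc_rewrite[OF h(3), of s] by (simp add: r_def comp_pl)
  then show "EX u. u : Arr C & Dom C u = Cod C q & Cod C u = Cod C h & u ## q = h"
   using coequalizer_desc[OF qc, of h] h by auto
 qed (use coequalizer_epi[OF qc] qm in simp_all)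
 moreover have "is_cokernel C x' v" if f: "f : Arr C" "Cod C f = Cod C q" and pb: "is_pullback C q f u v"
    and x': "x' : Hom C (Dom C x) (Dom C u)" "u ## x' = x" "v ## x' = \<zero> (Dom C x) (Dom C f)" for f u v x'
 proof -
  note [simp] = f pullbackD(1-4,6-8)[OF pb] x'[unfolded in_Hom]
  have [simp]: "x : Arr C" "Dom C x = Dom C e" "Cod C x = Cod C m" by (simp_all add: xm)
  have c: "Cod C (q ## p) = Cod C f" by simp
  obtain a t where pb2: "is_pullback C (q ## p) f a t" using pullback_ex[OF _ f(1) c] by auto
  note [simp] = pullbackD(1-4,6-8)[OF pb2]
  have ta: "q ## (p ## a) = f ## t" using pullbackD(9)[OF pb2] pullbackD(3,7)[OF pb2] by simp
  have ra: "q ## (r ## a) = f ## t"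
   using assoc_rewrite[OF coequalizerD(7)[OF qc, symmetric], of a] pullbackD(3,7)[OF pb2] ta by simp
  have [simp]: "Cod C a = P" using pullbackD(7)[OF pb2] by simp
  obtain s0 where s0: "s0 : Arr C" "Dom C s0 = Dom C (p ## a)" "Cod C s0 = Dom C u" "u ## s0 = p ## a" "v ## s0 = t"
   by (rule pullback_lift[OF pb _ _ _ _ _ ta]; (rule that)?; simp)
  obtain s1 where s1: "s1 : Arr C" "Dom C s1 = Dom C (r ## a)" "Cod C s1 = Dom C u" "u ## s1 = r ## a" "v ## s1 = t"
   by (rule pullback_lift[OF pb _ _ _ _ _ ra]; (rule that)?; simp)
  note [simp] = s0 s1
  have "ALL f x q' a b s0 s1.
    f : Arr C & Cod C f = Cod C q \<and>
    is_pullback C q f x q' \<and>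
    is_pullback C (q ## p) f a b \<and>
    s0 : Hom C (Dom C a) (Dom C x) & x ## s0 = p ## a & q' ## s0 = b \<and>
    s1 : Hom C (Dom C a) (Dom C x) & x ## s1 = r ## a & q' ## s1 = b
    \<longrightarrow> is_coequalizer C s0 s1 q'"
   using q unfolding stable_coequalizer_def by blast
  from this[rule_format, of f u v a t s0 s1] have co: "is_coequalizer C s0 s1 v" using pb pb2 by simp
  obtain m' where m': "m' : Arr C" "Dom C m' = Dom C m" "Cod C m' = Dom C u" "u ## m' = m" "v ## m' = \<zero> (Dom C m) (Dom C f)"
   by (rule pullback_lift[OF pb, of m "\<zero> (Dom C m) (Dom C f)"]) (simp_all add: qm)
  note [simp] = m'
  have x'm: "x' = m' ## e"
   by (rule pullback_unique[OF pb]) (simp_all add: assoc_rewrite[OF m'(4), of e] assoc_rewrite[OF m'(5), of e] xm)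
  have s1m: "s1 = s0 \<oplus> m' ## (s ## a)"
   by (rule pullback_unique[OF pb])
    (simp_all add: comp_pl assoc_rewrite[OF m'(4), of "s ## a"] assoc_rewrite[OF m'(5), of "s ## a"] rc)
  show ?thesis unfolding x'm
  proof (subst cokernel_precomp_epi[OF epi])
   show "is_cokernel C m' v"
   proof (rule cokernelI)
    fix h assume h: "h : Arr C" "Dom C h = Cod C m'" "h ## m' = \<zero> (Dom C m') (Cod C h)"
    have "h ## s0 = h ## s1" unfolding s1m using h(1,2) assoc_rewrite[OF h(3), of "s ## a"] by (simp add: comp_pl)
    then show "EX u. u : Arr C & Dom C u = Cod C v & Cod C u = Cod C h & u ## v = h"
     using coequalizer_desc[OF co, of h] h by auto
   qed (use coequalizer_epi[OF co] in simp_all)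
  qed simp_all
 qed
 ultimately have "stable_cokernel C x q" unfolding stable_cokernel_def by blast
 then show "EX q. stable_cokernel C x q" ..
qed

lemma (in stable_additive) stable_coequalizers:
 "has_stable_coequalizers_of_equivalence_relations C"
 unfolding has_stable_coequalizers_of_equivalence_relations_def
proof (intro ballI allI impI)
 fix X r0 r1 assume X: "X : Obj C" and er: "equivalence_relation C X r0 r1"
 then have jm: "jointly_monic C r0 r1" and [simp]: "Cod C r0 = X" "Cod C r1 = X" and
  eq: "equiv (Hom C X X) {(r0 ## h, r1 ## h) | h. h : Hom C X (Dom C r0)}" unfolding equivalence_relation_def by blast+
 have [simp]: "r0 : Arr C" "r1 : Arr C" "Dom C r1 = Dom C r0" using jm by (simp_all add: jointly_monic_def)
 note [simp] = X
 have "(Id C X, Id C X) : {(r0 ## h, r1 ## h) | h. h : Hom C X (Dom C r0)}"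
  using equiv_class_self[OF eq, of "Id C X"] X by auto
 then obtain d where d[simp]: "d : Arr C" "Dom C d = X" "Cod C d = Dom C r0" "r0 ## d = Id C X" "r1 ## d = Id C X" by force
 obtain n where n: "is_kernel C r0 n" using kernel_ex by fastforce
 note [simp] = kernelD[OF n]
 let ?w = "Id C (Dom C r0) \<ominus> d ## r0"
 have "r0 ## ?w = \<zero> (Dom C r0) X"
  using assoc_rewrite[OF d(4), of r0] by (simp add: comp_minus pl_ng)
 then obtain t where t[simp]: "t : Arr C" "Dom C t = Dom C r0" "Cod C t = Dom C n" "n ## t = ?w"
  using kernel_lift[OF n, of ?w] by auto
 define j where "j = r1 ## n"
 have j[simp]: "j : Arr C" "Dom C j = Dom C n" "Cod C j = X" by (simp_all add: j_def)
 have jt: "j ## t = r1 \<ominus> r0"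
  using assoc_rewrite[OF d(5), of r0] by (simp add: j_def comp_minus)
 have iff: "h ## r0 = h ## r1 \<longleftrightarrow> h ## j = \<zero> (Dom C n) (Cod C h)" if [simp]: "h : Arr C" "Dom C h = X" for h
 proof
  assume e: "h ## r0 = h ## r1"
  have "h ## j = h ## (r0 ## n)" unfolding j_def using assoc_rewrite[OF e, of n] by simp
  then show "h ## j = \<zero> (Dom C n) (Cod C h)" by simp
 next
  assume e: "h ## j = \<zero> (Dom C n) (Cod C h)"
  have "h ## (r1 \<ominus> r0) = \<zero> (Dom C r0) (Cod C h)" using assoc_rewrite[OF e, of t] jt by simp
  then show "h ## r0 = h ## r1" by (simp add: comp_minus minus_eq_zero_iff)
 qed
 obtain q where q: "is_cokernel C j q" using cokernel_ex[OF j(1)] by blast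
 note [simp] = cokernelD[OF q]
 have co: "is_coequalizer C r0 r1 q"
 proof (rule coequalizerI)
  show "q ## r0 = q ## r1" using iff[of q] by simp
  fix h assume "h : Arr C" "Dom C h = Cod C r1" "h ## r0 = h ## r1"
  then show "EX u. u : Arr C & Dom C u = Cod C q & Cod C u = Cod C h & u ## q = h"
   using cokernel_desc[OF q, of h] iff[of h] by auto
 qed simp_all
 have "is_coequalizer C s0 s1 v"
  if f: "f : Arr C" "Cod C f = Cod C q" and pb: "is_pullback C q f u v" and pb2: "is_pullback C (q ## r0) f a b"
   and s: "s0 : Hom C (Dom C a) (Dom C u)" "u ## s0 = r0 ## a" "v ## s0 = b"
    "s1 : Hom C (Dom C a) (Dom C u)" "u ## s1 = r1 ## a" "v ## s1 = b" for f u v a b s0 s1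
 proof -
  note pd = pullbackD(3,4,6,7,8)[OF pb] and pd2 = pullbackD(3,4,6,7,8)[OF pb2]
  note [simp] = f pd pd2 s[unfolded in_Hom]
  obtain j' where j': "j' : Arr C" "Dom C j' = Dom C j" "Cod C j' = Dom C u" "u ## j' = j" "v ## j' = \<zero> (Dom C n) (Dom C f)"
   by (rule pullback_lift[OF pb, of j "\<zero> (Dom C n) (Dom C f)"]; (rule that)?; simp)
  note [simp] = j'
  have cj: "is_cokernel C j' v" by (rule cokernel_stable[OF q pb]) simp_all
  obtain w where w: "w : Arr C" "Dom C w = Dom C n" "Cod C w = Dom C a" "a ## w = n" "b ## w = \<zero> (Dom C n) (Dom C f)"
   by (rule pullback_lift[OF pb2, of n "\<zero> (Dom C n) (Dom C f)"]; (rule that)?; simp)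
  note [simp] = w
  have s1w: "s1 ## w = j'"
   by (rule pullback_unique[OF pb]) (simp_all add: assoc_rewrite[OF s(5), of w] assoc_rewrite[OF s(6), of w] j_def)
  have s0w: "s0 ## w = \<zero> (Dom C n) (Dom C u)"
   by (rule pullback_unique[OF pb]) (simp_all add: assoc_rewrite[OF s(2), of w] assoc_rewrite[OF s(3), of w])
  show ?thesis
  proof (rule coequalizerI)
   fix h assume h: "h : Arr C" "Dom C h = Cod C s1" "h ## s0 = h ## s1"
   have "h ## j' = \<zero> (Dom C j') (Cod C h)" using assoc_rewrite[OF h(3), of w] s0w s1w h(1,2) by simp
   then show "EX u. u : Arr C & Dom C u = Cod C v & Cod C u = Cod C h & u ## v = h"
    using cokernel_desc[OF cj, of h] h by auto
  qed (use cokernelD(5)[OF cj] in simp_all)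
 qed
 then have "stable_coequalizer C r0 r1 q" unfolding stable_coequalizer_def using co by blast
 then show "EX q. stable_coequalizer C r0 r1 q" ..
qed

section \<open>Factorizations\<close>

text \<open>Pull the cokernel back along \<open>0 \<rightarrow> Cod c\<close>.\<close>

lemma (in stable_additive) lift_to_kernel_of_cokernel_epi:
 assumes c: "is_cokernel C m c" and k: "is_kernel C c k"
  and g: "g : Arr C" "Dom C g = Dom C m" "Cod C g = Dom C k" "k ## g = m"
 shows "epi_in C g"
proof -
 note [simp] = cokernelD[OF c] kernelD[OF k] g
 obtain Z where Z: "zero_object C Z" by (rule zero_objectE)
 then have [simp]: "Z : Obj C" by (simp add: zero_object_def)
 have pb: "is_pullback C c (\<zero> Z (Cod C c)) k (\<zero> (Dom C k) Z)"
 proof (rule pullbackI)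
  fix h l assume h: "h : Arr C" "l : Arr C" "Dom C h = Dom C l" "Cod C h = Dom C c" "Cod C l = Dom C (\<zero> Z (Cod C c))"
   "c ## h = \<zero> Z (Cod C c) ## l"
  have ch: "c ## h = \<zero> (Dom C h) (Cod C c)" using h by simp
  obtain u where u: "u : Arr C" "Dom C u = Dom C h" "Cod C u = Dom C k" "k ## u = h"
   by (rule kernel_lift[OF k h(1,4) ch])
  have "\<zero> (Dom C k) Z ## u = l"
   by (rule to_zero_object_unique[OF Z]) (use h(1-5) u(1-3) in simp_all)
  with u show "EX u. u : Arr C & Dom C u = Dom C h & Cod C u = Dom C k & k ## u = h & \<zero> (Dom C k) Z ## u = l"
   by blast
 next
  fix u v assume "u : Arr C" "v : Arr C" "Dom C u = Dom C v" "Cod C u = Dom C k" "Cod C v = Dom C k" "k ## u = k ## v"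
  then show "u = v" by (rule monoD[OF kernelD(5)[OF k], rotated 1])
 qed simp_all
 have gz: "is_cokernel C g (\<zero> (Dom C k) Z)" by (rule cokernel_stable[OF c pb]) simp_all
 show ?thesis
 proof (rule epi_zeroI)
  fix h assume h: "h : Arr C" "Dom C h = Cod C g" "h ## g = \<zero> (Dom C g) (Cod C h)"
  then obtain u where "u : Arr C" "Dom C u = Z" "Cod C u = Cod C h" "u ## \<zero> (Dom C k) Z = h"
   using cokernel_desc[OF gz, of h] by auto
  then show "h = \<zero> (Cod C g) (Cod C h)" using h by auto
 qed simp
qed

lemma (in stable_additive) factorizations: "has_factorizations C"
 unfolding has_factorizations_def
proof
 fix f assume f[simp]: "f : Arr C"
 obtain e m where e: "regular_epi C e" and m: "mono_in C m" and em[simp]: "Cod C e = Dom C m" and fm: "f = m ## e"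
  using factor_ex[OF f] by blast
 obtain e0 where "is_cokernel C e0 e" using e regular_epi_iff by blast
 then have epi: "epi_in C e" by (rule cokernelD)
 obtain c where c: "is_cokernel C f c" using cokernel_ex by fastforce
 obtain k where k: "is_kernel C c k" using kernel_ex cokernelD(2)[OF c] by blast
 note [simp] = mono_arr[OF m] epi_arr[OF epi] cokernelD[OF c] kernelD[OF k]
 have fd[simp]: "Dom C f = Dom C e" "Cod C f = Cod C m" by (simp_all add: fm)
 have cm: "is_cokernel C m c" using c unfolding fm using cokernel_precomp_epi[OF epi] by simp
 obtain g where g[simp]: "g : Arr C" "Dom C g = Dom C m" "Cod C g = Dom C k" "k ## g = m"
  using kernel_lift[OF k, of m] cokernelD[OF cm] by auto
 have "mono_in C g"
 proof (rule monoI)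
  fix a b assume h: "a : Arr C" "b : Arr C" "Dom C a = Dom C b" "Cod C a = Dom C g" "Cod C b = Dom C g" "g ## a = g ## b"
  have "m ## a = m ## b" using assoc_rewrite[OF g(4), of a] assoc_rewrite[OF g(4), of b] h by simp
  then show "a = b" by (rule monoD[OF m]) (use h in simp_all)
 qed simp
 moreover have "epi_in C g"
  by (rule lift_to_kernel_of_cokernel_epi[OF cm k]) simp_all
 moreover have "regular_mono C k" using k regular_mono_iff by blast
 ultimately show "EX q g k. regular_epi C q & epi_in C g & mono_in C g & regular_mono C k \<and>
    Dom C q = Dom C f & Dom C g = Cod C q & Dom C k = Cod C g & Cod C k = Cod C f & f = k ## (g ## q)"
  using e assoc_rewrite[OF g(4), of e] fm by (intro exI[of _ e] exI[of _ g] exI[of _ k]) simp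
qed

lemma (in additive) stable_additive_of_factorizations:
 assumes fac: "has_factorizations C" and st: "regular_epis_pullback_stable C"
 shows "stable_additive C"
proof -
 have fac: "EX q g k. regular_epi C q & epi_in C g & mono_in C g & regular_mono C k \<and>
    Dom C q = Dom C f & Dom C g = Cod C q & Dom C k = Cod C g & Cod C k = Cod C f & f = k ## (g ## q)"
  if "f : Arr C" for f using fac that unfolding has_factorizations_def by blast
 have arr: "regular_epi C q ==> q : Arr C & epi_in C q" "regular_mono C k ==> k : Arr C & mono_in C k" for q k
  using regular_epi_iff regular_mono_iff cokernelD(2,5) kernelD(2,5) by blast+
 have ker_q: "EX k. is_kernel C q k & is_cokernel C k q" if q: "regular_epi C q" for q
 proof -
  obtain x where x: "is_cokernel C x q" using q regular_epi_iff by blast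
  obtain q' g' k' where f: "regular_epi C q'" "epi_in C g'" "mono_in C g'" "regular_mono C k'"
   "Dom C g' = Cod C q'" "Dom C k' = Cod C g'" "x = k' ## (g' ## q')" using fac[OF cokernelD(1)[OF x]] by blast
  have "epi_in C (g' ## q')" using epi_comp[OF f(2)] arr(1)[OF f(1)] f by simp
  from cokernel_precomp_epi[OF this, of k' q] have kc: "is_cokernel C k' q"
   using x f arr(2)[OF f(4)] arr(1)[OF f(1)] epi_arr[OF f(2)] by simp
  obtain y where "is_kernel C y k'" using f(4) regular_mono_iff by blast
  from kernel_of_cokernel[OF this kc] kc show ?thesis by blast
 qed
 have coker_k: "EX q. is_cokernel C k q" if k: "regular_mono C k" for k
 proof -
  obtain x where x: "is_kernel C x k" using k regular_mono_iff by blast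
  obtain q' g' k' where f: "regular_epi C q'" "epi_in C g'" "mono_in C g'" "regular_mono C k'"
   "Dom C g' = Cod C q'" "Dom C k' = Cod C g'" "x = k' ## (g' ## q')" using fac[OF kernelD(1)[OF x]] by blast
  have m: "mono_in C (k' ## g')" using mono_comp[OF _ f(3)] arr(2)[OF f(4)] f by simp
  have "x = (k' ## g') ## q'" using f arr(2)[OF f(4)] arr(1)[OF f(1)] epi_arr[OF f(2)] by simp
  with kernel_postcomp_mono[OF m, of q' k] have kq: "is_kernel C q' k"
   using x f arr(2)[OF f(4)] arr(1)[OF f(1)] epi_arr[OF f(2)] by simp
  obtain y where "is_cokernel C y q'" using f(1) regular_epi_iff by blast
  from cokernel_of_kernel[OF this kq] show ?thesis by blast
 qed
 have ker: "EX k. is_kernel C f k" if f: "f : Arr C" for f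
 proof -
  obtain q g k where d: "regular_epi C q" "epi_in C g" "mono_in C g" "regular_mono C k"
   "Dom C g = Cod C q" "Dom C k = Cod C g" "f = k ## (g ## q)" using fac[OF f] by blast
  have m: "mono_in C (k ## g)" using mono_comp[OF _ d(3)] arr(2)[OF d(4)] d by simp
  have "f = (k ## g) ## q" using d arr(2)[OF d(4)] arr(1)[OF d(1)] epi_arr[OF d(2)] by simp
  with kernel_postcomp_mono[OF m, of q] ker_q[OF d(1)] show ?thesis
   using d arr(2)[OF d(4)] arr(1)[OF d(1)] epi_arr[OF d(2)] by auto
 qed
 interpret additive_with_kernels C by unfold_locales (rule ker)
 have "EX q. stable_cokernel C x q" if x: "x : Arr C" for x
 proof -
  obtain q g k where d: "regular_epi C q" "epi_in C g" "mono_in C g" "regular_mono C k"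
   "Dom C g = Cod C q" "Dom C k = Cod C g" "x = k ## (g ## q)" using fac[OF x] by blast
  note [simp] = arr(2)[OF d(4), THEN conjunct1] arr(1)[OF d(1), THEN conjunct1] epi_arr[OF d(2)] d(5,6)
  let ?e = "g ## q"
  have e: "epi_in C ?e" using epi_comp[OF d(2)] arr(1)[OF d(1)] d by simp
  obtain c where c: "is_cokernel C k c" using coker_k[OF d(4)] by blast
  obtain y where "is_kernel C y k" using d(4) regular_mono_iff by blast
  from kernel_of_cokernel[OF this c] have k: "is_kernel C c k" .
  have xc: "is_cokernel C x c" unfolding d(7) using cokernel_precomp_epi[OF e, of k c] c by simp
  have "is_cokernel C x' v" if f: "f : Arr C" "Cod C f = Cod C c" and pb: "is_pullback C c f u v"
    and x': "x' : Hom C (Dom C x) (Dom C u)" "u ## x' = x" "v ## x' = \<zero> (Dom C x) (Dom C f)" for f u v x'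
  proof -
   note [simp] = f pullbackD(1-4,6-8)[OF pb] x'[unfolded in_Hom]
   obtain k' where k': "is_kernel C v k'" "Dom C k' = Dom C k" "u ## k' = k" by (rule pullback_of_kernel[OF pb k])
   note [simp] = kernelD[OF k'(1)]
   have dx: "Dom C x = Dom C q" by (simp add: d(7))
   have "x' = k' ## ?e"
   proof (rule pullback_unique[OF pb])
    show "u ## x' = u ## (k' ## (g ## q))" using assoc_rewrite[OF k'(3), of "g ## q"] k'(2) by (simp add: d(7))
    show "v ## x' = v ## (k' ## (g ## q))"
     using assoc_rewrite[OF kernelD(4)[OF k'(1)], of "g ## q"] k'(2) dx by simp
   qed (use k' dx in simp_all)
   moreover have "is_cokernel C k' v"
   proof -
    have "regular_epi C c" using c regular_epi_iff by blast
    then have "regular_epi C v" using st pb unfolding regular_epis_pullback_stable_def by blast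
    then obtain y where "is_cokernel C y v" using regular_epi_iff by blast
    then show ?thesis using cokernel_of_kernel k'(1) by blast
   qed
   ultimately show ?thesis using cokernel_precomp_epi[OF e, of k' v] k' by simp
  qed
  then have "stable_cokernel C x c" unfolding stable_cokernel_def using xc by blast
  then show ?thesis ..
 qed
 then show ?thesis by unfold_locales (simp add: has_stable_cokernels_def)
qed

lemma (in preadd) ng_ze [simp]: "A : Obj C ==> B : Obj C ==> ng (ze A B) = ze A B"
 by (rule ng_unique[symmetric]) simp_all

section \<open>Abelian categories have stable cokernels\<close>

lemma stable_additive_of_abelian:
 assumes ab: "abelian_category C"
 shows "stable_additive C"
proof -
 interpret additive C using ab by unfold_locales (simp add: abelian_category_def)
 have ker: "EX k. is_kernel C f k" and coker: "EX q. is_cokernel C f q" if "f : Arr C" for f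
  using ab that unfolding abelian_category_def by blast+
 have mker: "EX f. is_kernel C f m" if "mono_in C m" for m
  using ab that unfolding abelian_category_def by blast
 have ecoker: "EX f. is_cokernel C f e" if "epi_in C e" for e
  using ab that unfolding abelian_category_def by blast
 interpret additive_with_kernels C by unfold_locales (rule ker)
 have "EX q. stable_cokernel C x q" if x: "x : Arr C" for x
 proof -
  obtain c where c: "is_cokernel C x c" using coker[OF x] by blast
  obtain k where k: "is_kernel C c k" using ker[OF cokernelD(2)[OF c]] by blast
  note [simp] = x cokernelD[OF c] kernelD[OF k]
  obtain t where t[simp]: "t : Arr C" "Dom C t = Dom C x" "Cod C t = Dom C k" "k ##\<^bsub>C\<^esub> t = x"
   by (rule kernel_lift[OF k, of x]) simp_all
  have epi_t: "epi_in C t"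
  proof (rule epi_zeroI)
   fix h assume h: "h : Arr C" "Dom C h = Cod C t" "h ##\<^bsub>C\<^esub> t = \<zero> (Dom C t) (Cod C h)"
   obtain l where l: "is_kernel C h l" using ker[OF h(1)] by blast
   note [simp] = h(1,2) kernelD[OF l]
   obtain t' where t'[simp]: "t' : Arr C" "Dom C t' = Dom C t" "Cod C t' = Dom C l" "l ##\<^bsub>C\<^esub> t' = t"
    by (rule kernel_lift[OF l, of t]) (use h in simp_all)
   have "mono_in C (k ##\<^bsub>C\<^esub> l)" by (rule mono_comp) simp_all
   then obtain y where y: "is_kernel C y (k ##\<^bsub>C\<^esub> l)" using mker by blast
   note yd = kernelD[OF y]
   have [simp]: "y : Arr C" "Dom C y = Cod C x" using yd(1,3) by simp_all
   have ykl: "y ##\<^bsub>C\<^esub> (k ##\<^bsub>C\<^esub> l) = \<zero> (Dom C l) (Cod C y)" using yd(4) by simp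
   have "y ##\<^bsub>C\<^esub> (k ##\<^bsub>C\<^esub> (l ##\<^bsub>C\<^esub> t')) = \<zero> (Dom C x) (Cod C y)"
    using assoc_rewrite[OF ykl, of t'] by simp
   then have "y ##\<^bsub>C\<^esub> x = \<zero> (Dom C x) (Cod C y)" by simp
   then obtain y' where y': "y' : Arr C" "Dom C y' = Cod C c" "Cod C y' = Cod C y" "y' ##\<^bsub>C\<^esub> c = y"
    using cokernel_desc[OF c, of y] by auto
   have "y ##\<^bsub>C\<^esub> k = \<zero> (Dom C k) (Cod C y)" using assoc_rewrite[OF y'(4), of k] y'(1-3) by simp
   then obtain s where s: "s : Arr C" "Dom C s = Dom C k" "Cod C s = Dom C l" "(k ##\<^bsub>C\<^esub> l) ##\<^bsub>C\<^esub> s = k"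
    using kernel_lift[OF y, of k] by auto
   have "l ##\<^bsub>C\<^esub> s = Id C (Dom C k)"
    by (rule monoD[OF kernelD(5)[OF k]]) (use s in simp_all)
   then have "h = h ##\<^bsub>C\<^esub> (l ##\<^bsub>C\<^esub> s)" by simp
   also have "\<dots> = \<zero> (Cod C t) (Cod C h)" using assoc_rewrite[OF kernelD(4)[OF l], of s] s by simp
   finally show "h = \<zero> (Cod C t) (Cod C h)" .
  qed simp
  have "is_cokernel C x' v" if f: "f : Arr C" "Cod C f = Cod C c" and pb: "is_pullback C c f u v"
    and x': "x' : Hom C (Dom C x) (Dom C u)" "u ##\<^bsub>C\<^esub> x' = x" "v ##\<^bsub>C\<^esub> x' = \<zero> (Dom C x) (Dom C f)" for f u v x'
  proof -
   note [simp] = f pullbackD(1-4,6-8)[OF pb] x'[unfolded in_Hom]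
   obtain P i j p q where b: "biprod C (hom_plus C) (zero_arr C) (Dom C c) (Dom C f) P i j p q"
    by (rule biprodE[of "Dom C c" "Dom C f"]) simp_all
   note [simp] = biprod_simps[OF b]
   let ?w = "c ##\<^bsub>C\<^esub> p \<ominus> f ##\<^bsub>C\<^esub> q"
   have wi: "?w ##\<^bsub>C\<^esub> i = c" by (simp add: minus_comp)
   have w[simp]: "?w : Arr C" "Dom C ?w = P" "Cod C ?w = Cod C c" by simp_all
   have epi_w: "epi_in C ?w"
   proof (rule epi_zeroI)
    fix h assume h: "h : Arr C" "Dom C h = Cod C ?w" "h ##\<^bsub>C\<^esub> ?w = \<zero> (Dom C ?w) (Cod C h)"
    have "h ##\<^bsub>C\<^esub> c = h ##\<^bsub>C\<^esub> (?w ##\<^bsub>C\<^esub> i)" unfolding wi ..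
    also have "\<dots> = \<zero> (Dom C c) (Cod C h)" using assoc_rewrite[OF h(3), of i] h(1,2) w by simp
    finally have "h = \<zero> (Cod C c) (Cod C h)" using epi_zeroD[OF cokernelD(5)[OF c], of h] h(1,2) w by simp
    then show "h = \<zero> (Cod C ?w) (Cod C h)" using w(3) by metis
   qed (rule w)
   obtain y where y: "is_cokernel C y ?w" using ecoker[OF epi_w] by blast
   have [simp]: "y : Arr C" "Cod C y = P" using cokernelD(1,3)[OF y] w by simp_all
   have "?w ##\<^bsub>C\<^esub> y = \<zero> (Dom C y) (Cod C c)" using cokernelD(4)[OF y] w by simp
   then have "c ##\<^bsub>C\<^esub> (p ##\<^bsub>C\<^esub> y) = f ##\<^bsub>C\<^esub> (q ##\<^bsub>C\<^esub> y)" by (simp add: minus_comp minus_eq_zero_iff)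
   then obtain y' where y': "y' : Arr C" "Dom C y' = Dom C y" "Cod C y' = Dom C u" "u ##\<^bsub>C\<^esub> y' = p ##\<^bsub>C\<^esub> y" "v ##\<^bsub>C\<^esub> y' = q ##\<^bsub>C\<^esub> y"
    using pullback_lift[OF pb, of "p ##\<^bsub>C\<^esub> y" "q ##\<^bsub>C\<^esub> y"] by auto
   have epi_v: "epi_in C v"
   proof (rule epi_zeroI)
    fix h assume h: "h : Arr C" "Dom C h = Cod C v" "h ##\<^bsub>C\<^esub> v = \<zero> (Dom C v) (Cod C h)"
    have hq: "(h ##\<^bsub>C\<^esub> q) ##\<^bsub>C\<^esub> y = \<zero> (Dom C y) (Cod C (h ##\<^bsub>C\<^esub> q))"
     using assoc_rewrite[OF h(3), of y'] y' h(1,2) by simp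
    obtain z where z: "z : Arr C" "Dom C z = Cod C ?w" "Cod C z = Cod C (h ##\<^bsub>C\<^esub> q)" "z ##\<^bsub>C\<^esub> ?w = h ##\<^bsub>C\<^esub> q"
     by (rule cokernel_desc[OF y _ _ hq]) (use h(1,2) in simp_all)
    have "z ##\<^bsub>C\<^esub> c = z ##\<^bsub>C\<^esub> (?w ##\<^bsub>C\<^esub> i)" unfolding wi ..
    also have "\<dots> = (h ##\<^bsub>C\<^esub> q) ##\<^bsub>C\<^esub> i" by (rule assoc_rewrite[OF z(4)]) (use z(1,2) w in simp_all)
    finally have "z ##\<^bsub>C\<^esub> c = \<zero> (Dom C c) (Cod C z)" using z(3) h(1,2) by simp
    then have z0: "z = \<zero> (Cod C c) (Cod C z)" using epi_zeroD[OF cokernelD(5)[OF c], of z] z(1,2) w by simp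
    have "h = (h ##\<^bsub>C\<^esub> q) ##\<^bsub>C\<^esub> j" using h(1,2) by simp
    also have "\<dots> = (z ##\<^bsub>C\<^esub> ?w) ##\<^bsub>C\<^esub> j" unfolding z(4) ..
    also have "\<dots> = \<zero> (Cod C v) (Cod C h)" by (subst z0) (use z(3) h(1,2) w in simp)
    finally show "h = \<zero> (Cod C v) (Cod C h)" .
   qed simp
   obtain k' where k': "is_kernel C v k'" "Dom C k' = Dom C k" "u ##\<^bsub>C\<^esub> k' = k" by (rule pullback_of_kernel[OF pb k])
   note kd = kernelD[OF k'(1)]
   have x'k: "x' = k' ##\<^bsub>C\<^esub> t"
    by (rule pullback_unique[OF pb])
     (use assoc_rewrite[OF k'(3), of t] assoc_rewrite[OF kd(4), of t] k'(2) kd(2,3) in simp_all)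
   obtain z where "is_cokernel C z v" using ecoker[OF epi_v] by blast
   then have "is_cokernel C k' v" by (rule cokernel_of_kernel[OF _ k'(1)])
   then show ?thesis unfolding x'k using cokernel_precomp_epi[OF epi_t, of k' v] k'(2) kd(2) by simp
  qed
  then have "stable_cokernel C x c" unfolding stable_cokernel_def using c by blast
  then show ?thesis ..
 qed
 then show ?thesis by unfold_locales (simp add: has_stable_cokernels_def)
qed

section \<open>Fully faithful functors\<close>

locale full_functor = X: category X + C: category C
 for X :: "('o, 'a) cat" and C :: "('p, 'b) cat" and U :: "('o, 'a, 'p, 'b) Fun" +
 assumes is_functor: "is_functor X C U" and fully_faithful: "fully_faithful X C U"
begin

lemma U_obj [simp]: "A : Obj X ==> FObj U A : Obj C"
 using is_functor unfolding is_functor_def by blast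

lemma U_arr [simp]:
 assumes "f : Arr X"
 shows "FArr U f : Arr C" "Dom C (FArr U f) = FObj U (Dom X f)" "Cod C (FArr U f) = FObj U (Cod X f)"
proof -
 have "ALL A : Obj X. ALL B : Obj X. ALL f : Hom X A B. FArr U f : Hom C (FObj U A) (FObj U B)"
  using is_functor unfolding is_functor_def by blast
 from this[rule_format, of "Dom X f" "Cod X f" f] assms
 show "FArr U f : Arr C" "Dom C (FArr U f) = FObj U (Dom X f)" "Cod C (FArr U f) = FObj U (Cod X f)" by simp_all
qed

lemma U_id [simp]: "A : Obj X ==> FArr U (Id X A) = Id C (FObj U A)"
 using is_functor unfolding is_functor_def by blast

lemma U_comp [simp]: "f : Arr X ==> g : Arr X ==> Cod X f = Dom X g ==> FArr U (g ##\<^bsub>X\<^esub> f) = FArr U g ##\<^bsub>C\<^esub> FArr U f"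
 using is_functor unfolding is_functor_def by blast

lemma U_bij: "A : Obj X ==> B : Obj X ==> bij_betw (FArr U) (Hom X A B) (Hom C (FObj U A) (FObj U B))"
 using fully_faithful unfolding fully_faithful_def by blast

lemma U_eqI:
 assumes "FArr U f = FArr U g" "f : Arr X" "g : Arr X" "Dom X f = Dom X g" "Cod X f = Cod X g"
 shows "f = g"
 using bij_betw_imp_inj_on[OF U_bij[of "Dom X g" "Cod X g"]] assms by (auto dest: inj_onD)

lemma U_full:
 assumes "h : Arr C" "Dom C h = FObj U A" "Cod C h = FObj U B" "A : Obj X" "B : Obj X"
 obtains f where "f : Arr X" "Dom X f = A" "Cod X f = B" "FArr U f = h"
proof -
 have "h : FArr U ` Hom X A B" using bij_betw_imp_surj_on[OF U_bij[OF assms(4,5)]] assms(1-3) by simp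
 then show thesis using that by auto
qed

lemma U_iso_reflect:
 assumes "iso_in C (FArr U f)" "f : Arr X"
 shows "iso_in X f"
proof -
 obtain g where g: "g : Arr C" "Dom C g = Cod C (FArr U f)" "Cod C g = Dom C (FArr U f)"
  "g ##\<^bsub>C\<^esub> FArr U f = Id C (Dom C (FArr U f))" "FArr U f ##\<^bsub>C\<^esub> g = Id C (Cod C (FArr U f))"
  using assms(1) by (rule C.isoE)
 obtain h where h: "h : Arr X" "Dom X h = Cod X f" "Cod X h = Dom X f" "FArr U h = g"
  by (rule U_full[of g "Cod X f" "Dom X f"]) (use g assms(2) in simp_all)
 show ?thesis
  by (rule X.isoI[of f h]) (use h g assms(2) in \<open>auto intro: U_eqI\<close>)
qed

lemma U_iso:
 assumes "iso_in X f"
 shows "iso_in C (FArr U f)"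
proof -
 obtain g where g: "f : Arr X" "g : Arr X" "Dom X g = Cod X f" "Cod X g = Dom X f"
  "g ##\<^bsub>X\<^esub> f = Id X (Dom X f)" "f ##\<^bsub>X\<^esub> g = Id X (Cod X f)" using assms by (rule X.isoE)
 have "FArr U g ##\<^bsub>C\<^esub> FArr U f = Id C (FObj U (Dom X f))" "FArr U f ##\<^bsub>C\<^esub> FArr U g = Id C (FObj U (Cod X f))"
  by (subst U_comp[symmetric], (simp add: g)+)+
 then show ?thesis using g by (intro C.isoI[of "FArr U f" "FArr U g"]) simp_all
qed

end

lemma (in category) category_full_sub:
 assumes "S \<subseteq> Obj C" shows "category (full_sub C S)"
 using assms by unfold_locales (auto simp: full_sub_def)

lemma full_sub_simps [simp]:
 "Obj (full_sub C S) = S" "Dom (full_sub C S) = Dom C" "Cod (full_sub C S) = Cod C" "Id (full_sub C S) = Id C"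
 "Comp (full_sub C S) = Comp C" "f : Arr (full_sub C S) \<longleftrightarrow> f : Arr C & Dom C f : S & Cod C f : S"
 by (simp_all add: full_sub_def)

lemma (in category) full_functor_inclusion:
 assumes "S \<subseteq> Obj C" shows "full_functor (full_sub C S) C id_fun"
proof -
 interpret S: category "full_sub C S" by (rule category_full_sub[OF assms])
 have "Hom (full_sub C S) A B = Hom C A B" if "A : S" "B : S" for A B using that by auto
 then have "fully_faithful (full_sub C S) C id_fun"
  unfolding fully_faithful_def by (simp add: id_fun_def bij_betw_def)
 moreover have "is_functor (full_sub C S) C id_fun"
  using assms unfolding is_functor_def by (auto simp: id_fun_def)
 ultimately show ?thesis by unfold_locales
qed

lemma (in category) iso_full_sub:
 "iso_in (full_sub C S) f \<longleftrightarrow> iso_in C f & Dom C f : S & Cod C f : S"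
 unfolding iso_in_def by auto

lemma (in category) equivalence_full_functor:
 assumes S: "S \<subseteq> Obj C" and X: "category X" and eq: "equivalent_cats X (full_sub C S)"
 obtains U where "full_functor X C U" "FObj U ` Obj X \<subseteq> S"
  "!!B. B : S ==> EX i. iso_in C i & Dom C i = B & Cod C i : FObj U ` Obj X"
proof -
 interpret X: category X by (rule X)
 interpret S: category "full_sub C S" by (rule category_full_sub[OF S])
 obtain F G \<alpha> \<beta> where F: "is_functor X (full_sub C S) F" and G: "is_functor (full_sub C S) X G" and
  \<alpha>: "natural_iso X X (comp_fun G F) id_fun \<alpha>" and \<beta>: "natural_iso (full_sub C S) (full_sub C S) (comp_fun F G) id_fun \<beta>"
  using eq unfolding equivalent_cats_def by blast
 have Fo: "FObj F A : S" if "A : Obj X" for A using F that unfolding is_functor_def by simp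
 have Go: "FObj G A : Obj X" if "A : S" for A using G that unfolding is_functor_def by simp
 have Fa: "FArr F f : Hom (full_sub C S) (FObj F (Dom X f)) (FObj F (Cod X f))" if "f : Arr X" for f
 proof -
  have "ALL A : Obj X. ALL B : Obj X. ALL f : Hom X A B. FArr F f : Hom (full_sub C S) (FObj F A) (FObj F B)"
   using F unfolding is_functor_def by blast
  from this[rule_format, of "Dom X f" "Cod X f" f] that show ?thesis using Fo by simp
 qed
 have Ga: "FArr G f : Hom X (FObj G (Dom C f)) (FObj G (Cod C f))" if "f : Arr (full_sub C S)" for f
 proof -
  have "ALL A : Obj (full_sub C S). ALL B : Obj (full_sub C S). ALL f : Hom (full_sub C S) A B. FArr G f : Hom X (FObj G A) (FObj G B)"
   using G unfolding is_functor_def by blast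
  from this[rule_format, of "Dom C f" "Cod C f" f] that show ?thesis by simp
 qed
 have \<alpha>i: "iso_in X (\<alpha> A)" "\<alpha> A : Arr X" "Dom X (\<alpha> A) = FObj G (FObj F A)" "Cod X (\<alpha> A) = A" if "A : Obj X" for A
  using \<alpha> that unfolding natural_iso_def natural_trans_def by (simp_all add: comp_fun_def id_fun_def)
 have \<alpha>n: "f ##\<^bsub>X\<^esub> \<alpha> (Dom X f) = \<alpha> (Cod X f) ##\<^bsub>X\<^esub> FArr G (FArr F f)" if "f : Arr X" for f
 proof -
  from \<alpha>[unfolded natural_iso_def natural_trans_def, THEN conjunct1, THEN conjunct2, rule_format, of "Dom X f" "Cod X f" f] that
  show ?thesis by (simp add: comp_fun_def id_fun_def)
 qed
 have \<beta>i: "iso_in (full_sub C S) (\<beta> A)" "\<beta> A : Arr C" "Dom C (\<beta> A) = FObj F (FObj G A)" "Cod C (\<beta> A) = A" if "A : S" for A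
  using \<beta> that unfolding natural_iso_def natural_trans_def by (simp_all add: comp_fun_def id_fun_def)
 have \<beta>n: "f ##\<^bsub>C\<^esub> \<beta> (Dom C f) = \<beta> (Cod C f) ##\<^bsub>C\<^esub> FArr F (FArr G f)" if "f : Arr (full_sub C S)" for f
 proof -
  from \<beta>[unfolded natural_iso_def natural_trans_def, THEN conjunct1, THEN conjunct2, rule_format, of "Dom C f" "Cod C f" f] that
  show ?thesis by (simp add: comp_fun_def id_fun_def)
 qed
 have G_faithful: "f = g" if "f : Hom (full_sub C S) A B" "g : Hom (full_sub C S) A B" "FArr G f = FArr G g" for f g A B
 proof -
  have S: "A : S" "B : S" using that by auto
  have "f ##\<^bsub>C\<^esub> \<beta> A = g ##\<^bsub>C\<^esub> \<beta> A" using \<beta>n[of f] \<beta>n[of g] that S by simp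
  moreover have "epi_in C (\<beta> A)" using \<beta>i(1)[OF S(1)] iso_epi iso_full_sub by blast
  ultimately show ?thesis using \<beta>i[OF S(1)] that epiD[of "\<beta> A" f g] by simp
 qed
 have FF: "fully_faithful X C F"
  unfolding fully_faithful_def
 proof (intro ballI bij_betwI')
  fix A B f g assume AB: "A : Obj X" "B : Obj X" and fg: "f : Hom X A B" "g : Hom X A B"
  have "f = g" if e: "FArr F f = FArr F g"
  proof -
   have "f ##\<^bsub>X\<^esub> \<alpha> A = g ##\<^bsub>X\<^esub> \<alpha> A" using \<alpha>n[of f] \<alpha>n[of g] fg e by simp
   then show ?thesis using X.epiD[OF X.iso_epi[OF \<alpha>i(1)[OF AB(1)]], of f g] fg \<alpha>i[OF AB(1)] by simp
  qed
  then show "(FArr F f = FArr F g) = (f = g)" by blast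
 next
  fix A B f assume AB: "A : Obj X" "B : Obj X" and f: "f : Hom X A B"
  then show "FArr F f : Hom C (FObj F A) (FObj F B)" using Fa[of f] by simp
 next
  fix A B h assume AB: "A : Obj X" "B : Obj X" and h: "h : Hom C (FObj F A) (FObj F B)"
  obtain a where a: "a : Arr X" "Dom X a = A" "Cod X a = FObj G (FObj F A)"
   "a ##\<^bsub>X\<^esub> \<alpha> A = Id X (FObj G (FObj F A))" "\<alpha> A ##\<^bsub>X\<^esub> a = Id X A"
   using X.isoE[OF \<alpha>i(1)[OF AB(1)]] \<alpha>i[OF AB(1)] by metis
  have hS: "h : Arr (full_sub C S)" using h Fo AB by simp
  have Gh: "FArr G h : Arr X" "Dom X (FArr G h) = FObj G (FObj F A)" "Cod X (FArr G h) = FObj G (FObj F B)"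
   using Ga[OF hS] h by simp_all
  define f where "f = \<alpha> B ##\<^bsub>X\<^esub> (FArr G h ##\<^bsub>X\<^esub> a)"
  have f: "f : Arr X" "Dom X f = A" "Cod X f = B" using a Gh \<alpha>i[OF AB(2)] by (simp_all add: f_def)
  have "\<alpha> B ##\<^bsub>X\<^esub> FArr G (FArr F f) = f ##\<^bsub>X\<^esub> \<alpha> A" using \<alpha>n[of f] f by simp
  also have "\<dots> = \<alpha> B ##\<^bsub>X\<^esub> FArr G h" using a Gh \<alpha>i[OF AB(1)] \<alpha>i[OF AB(2)] by (simp add: f_def)
  finally have "FArr G (FArr F f) = FArr G h"
   by (rule X.monoD[OF X.iso_mono[OF \<alpha>i(1)[OF AB(2)]]])
    (use Gh \<alpha>i[OF AB(2)] Ga[of "FArr F f"] Fa[OF f(1)] f Fo[OF AB(1)] Fo[OF AB(2)] in simp_all)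
  then have "FArr F f = h" by (intro G_faithful[of _ "FObj F A" "FObj F B"]) (use hS h Fa[OF f(1)] f Fo[OF AB(1)] Fo[OF AB(2)] in simp_all)
  then show "EX f:Hom X A B. h = FArr F f" using f by (intro bexI[of _ f]) simp_all
 qed
 have "is_functor X C F" using F S unfolding is_functor_def by auto
 then have 1: "full_functor X C F" using FF by unfold_locales
 have 2: "EX i. iso_in C i & Dom C i = B & Cod C i : FObj F ` Obj X" if B: "B : S" for B
 proof -
  have "iso_in C (\<beta> B)" using \<beta>i(1)[OF B] iso_full_sub by blast
  then obtain i where "iso_in C i" "Dom C i = Cod C (\<beta> B)" "Cod C i = Dom C (\<beta> B)" by (rule iso_inverse)
  then show ?thesis using \<beta>i[OF B] Go[OF B] by auto
 qed
 show thesis by (rule that[OF 1 _ 2]) (use Fo in auto)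
qed

lemma (in full_functor) equivalence:
 assumes S: "S \<subseteq> Obj C" "FObj U ` Obj X \<subseteq> S" and
  ess: "!!B. B : S ==> EX i. iso_in C i & Dom C i = B & Cod C i : FObj U ` Obj X"
 shows "equivalent_cats X (full_sub C S)"
proof -
 define P where "P B i A j \<longleftrightarrow> A : Obj X & i : Arr C & j : Arr C & Dom C i = B & Cod C i = FObj U A & Dom C j = FObj U A \<and>
  Cod C j = B & j ##\<^bsub>C\<^esub> i = Id C B & i ##\<^bsub>C\<^esub> j = Id C (FObj U A)" for B i A j
 have ex: "EX i A j. P B i A j" if B: "B : S" for B
 proof -
  obtain i where i: "iso_in C i" "Dom C i = B" "Cod C i : FObj U ` Obj X" using ess[OF B] by blast
  then obtain A where A: "A : Obj X" "Cod C i = FObj U A" by blast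
  obtain j where "j : Arr C" "Dom C j = Cod C i" "Cod C j = Dom C i" "j ##\<^bsub>C\<^esub> i = Id C (Dom C i)" "i ##\<^bsub>C\<^esub> j = Id C (Cod C i)"
   using i(1) by (rule C.isoE)
  then show ?thesis using i A C.iso_arr[OF i(1)] unfolding P_def by auto
 qed
 then obtain \<iota> where "ALL B:S. EX A j. P B (\<iota> B) A j" by metis
 then obtain g where "ALL B:S. EX j. P B (\<iota> B) (g B) j" by metis
 then obtain \<kappa> where PP: "ALL B:S. P B (\<iota> B) (g B) (\<kappa> B)" by metis
 have g: "g B : Obj X" "\<iota> B : Arr C" "\<kappa> B : Arr C" "Dom C (\<iota> B) = B" "Cod C (\<iota> B) = FObj U (g B)" "Dom C (\<kappa> B) = FObj U (g B)"
  "Cod C (\<kappa> B) = B" "\<kappa> B ##\<^bsub>C\<^esub> \<iota> B = Id C B" "\<iota> B ##\<^bsub>C\<^esub> \<kappa> B = Id C (FObj U (g B))" if "B : S" for B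
  using PP that unfolding P_def by blast+
 have \<kappa>\<iota>: "\<kappa> B ##\<^bsub>C\<^esub> (\<iota> B ##\<^bsub>C\<^esub> h) = h" if "B : S" "h : Arr C" "Cod C h = B" for B h
  using C.assoc_rewrite[OF g(8)[OF that(1)], of h] g[OF that(1)] that by simp
 have \<iota>\<kappa>: "\<iota> B ##\<^bsub>C\<^esub> (\<kappa> B ##\<^bsub>C\<^esub> h) = h" if "B : S" "h : Arr C" "Cod C h = FObj U (g B)" for B h
  using C.assoc_rewrite[OF g(9)[OF that(1)], of h] g[OF that(1)] that by simp
 have US: "FObj U A : S" if "A : Obj X" for A using S that by auto
 define G where "G = \<lparr>FObj = g, FArr = (\<lambda>h. SOME f. f : Hom X (g (Dom C h)) (g (Cod C h)) \<and>
  FArr U f = \<iota> (Cod C h) ##\<^bsub>C\<^esub> (h ##\<^bsub>C\<^esub> \<kappa> (Dom C h)))\<rparr>"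
 have Ga: "FArr G h : Arr X" "Dom X (FArr G h) = g (Dom C h)" "Cod X (FArr G h) = g (Cod C h)"
  "FArr U (FArr G h) = \<iota> (Cod C h) ##\<^bsub>C\<^esub> (h ##\<^bsub>C\<^esub> \<kappa> (Dom C h))"
  if h: "h : Arr C" "Dom C h : S" "Cod C h : S" for h
 proof -
  obtain f where "f : Arr X" "Dom X f = g (Dom C h)" "Cod X f = g (Cod C h)" "FArr U f = \<iota> (Cod C h) ##\<^bsub>C\<^esub> (h ##\<^bsub>C\<^esub> \<kappa> (Dom C h))"
   by (rule U_full[of "\<iota> (Cod C h) ##\<^bsub>C\<^esub> (h ##\<^bsub>C\<^esub> \<kappa> (Dom C h))" "g (Dom C h)" "g (Cod C h)"]) (use h g in simp_all)
  then have "EX f. f : Hom X (g (Dom C h)) (g (Cod C h)) & FArr U f = \<iota> (Cod C h) ##\<^bsub>C\<^esub> (h ##\<^bsub>C\<^esub> \<kappa> (Dom C h))" by auto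
  from someI_ex[OF this]
  show "FArr G h : Arr X" "Dom X (FArr G h) = g (Dom C h)" "Cod X (FArr G h) = g (Cod C h)"
  "FArr U (FArr G h) = \<iota> (Cod C h) ##\<^bsub>C\<^esub> (h ##\<^bsub>C\<^esub> \<kappa> (Dom C h))" unfolding G_def by simp_all
 qed
 have Go: "FObj G = g" by (simp add: G_def)
 have F1: "is_functor X (full_sub C S) U" using US unfolding is_functor_def by auto
 have F2: "is_functor (full_sub C S) X G"
  unfolding is_functor_def
 proof (intro conjI ballI impI)
  fix A assume A: "A : Obj (full_sub C S)"
  then have [simp]: "A : Obj C" using S by auto
  show "FObj G A : Obj X" using A g by (simp add: Go)
  show "FArr G (Id (full_sub C S) A) = Id X (FObj G A)"
   by (rule U_eqI) (use A g Ga[of "Id C A"] in \<open>simp_all add: Go\<close>)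
 next
  fix A B f assume "f : Hom (full_sub C S) A B"
  then show "FArr G f : Hom X (FObj G A) (FObj G B)" using Ga[of f] by (auto simp: Go)
 next
  fix f h assume fh: "f : Arr (full_sub C S)" "h : Arr (full_sub C S)" "Cod (full_sub C S) f = Dom (full_sub C S) h"
  show "FArr G (h ##\<^bsub>full_sub C S\<^esub> f) = FArr G h ##\<^bsub>X\<^esub> FArr G f"
   by (rule U_eqI) (use fh g Ga[of f] Ga[of h] Ga[of "h ##\<^bsub>C\<^esub> f"] \<kappa>\<iota> in simp_all)
 qed
 define \<alpha> where "\<alpha> A = (SOME f. f : Hom X (g (FObj U A)) A & FArr U f = \<kappa> (FObj U A))" for A
 have \<alpha>: "\<alpha> A : Arr X" "Dom X (\<alpha> A) = g (FObj U A)" "Cod X (\<alpha> A) = A" "FArr U (\<alpha> A) = \<kappa> (FObj U A)" if A: "A : Obj X" for A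
 proof -
  obtain f where "f : Arr X" "Dom X f = g (FObj U A)" "Cod X f = A" "FArr U f = \<kappa> (FObj U A)"
   by (rule U_full[of "\<kappa> (FObj U A)" "g (FObj U A)" A]) (use g[OF US[OF A]] A in simp_all)
  then have "EX f. f : Hom X (g (FObj U A)) A & FArr U f = \<kappa> (FObj U A)" by auto
  from someI_ex[OF this] show "\<alpha> A : Arr X" "Dom X (\<alpha> A) = g (FObj U A)" "Cod X (\<alpha> A) = A" "FArr U (\<alpha> A) = \<kappa> (FObj U A)"
   unfolding \<alpha>_def by simp_all
 qed
 have \<kappa>iso: "iso_in C (\<kappa> B)" if "B : S" for B
  using g[OF that] by (intro C.isoI[of "\<kappa> B" "\<iota> B"]) simp_all
 have N1: "natural_iso X X (comp_fun G U) id_fun \<alpha>"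
  unfolding natural_iso_def natural_trans_def
 proof (intro conjI ballI)
  fix A assume A: "A : Obj X"
  show "\<alpha> A : Hom X (FObj (comp_fun G U) A) (FObj id_fun A)" using \<alpha>[OF A] by (simp add: comp_fun_def id_fun_def Go)
  show "iso_in X (\<alpha> A)" using \<alpha>[OF A] \<kappa>iso[OF US[OF A]] by (intro U_iso_reflect) simp_all
 next
  fix A B f assume "A : Obj X" "B : Obj X" and f: "f : Hom X A B"
  then show "FArr id_fun f ##\<^bsub>X\<^esub> \<alpha> A = \<alpha> B ##\<^bsub>X\<^esub> FArr (comp_fun G U) f"
   using \<alpha>[of A] \<alpha>[of B] Ga[of "FArr U f"] US g \<kappa>\<iota>
   by (intro U_eqI) (simp_all add: comp_fun_def id_fun_def)
 qed
 have N2: "natural_iso (full_sub C S) (full_sub C S) (comp_fun U G) id_fun \<kappa>"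
  unfolding natural_iso_def natural_trans_def
 proof (intro conjI ballI)
  fix A assume A: "A : Obj (full_sub C S)"
  show "\<kappa> A : Hom (full_sub C S) (FObj (comp_fun U G) A) (FObj id_fun A)" using g[of A] A US by (simp add: comp_fun_def id_fun_def Go)
  show "iso_in (full_sub C S) (\<kappa> A)" using \<kappa>iso[of A] A g[of A] US by (simp add: C.iso_full_sub)
 next
  fix A B f assume "A : Obj (full_sub C S)" "B : Obj (full_sub C S)" and f: "f : Hom (full_sub C S) A B"
  then show "FArr id_fun f ##\<^bsub>full_sub C S\<^esub> \<kappa> A = \<kappa> B ##\<^bsub>full_sub C S\<^esub> FArr (comp_fun U G) f"
   using Ga[of f] \<kappa>\<iota>[of B] g[of A] by (simp add: comp_fun_def id_fun_def)
 qed
 show ?thesis unfolding equivalent_cats_def using F1 F2 N1 N2 by blast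
qed

section \<open>Semi-left-exact reflections\<close>

definition universal :: "('p, 'b) cat \<Rightarrow> 'p set \<Rightarrow> 'b \<Rightarrow> bool" where
 "universal C S u \<longleftrightarrow> u : Arr C & Cod C u : S \<and>
  (ALL h : Arr C. Dom C h = Dom C u \<longrightarrow> Cod C h : S \<longrightarrow>
    (EX! g. g : Hom C (Cod C u) (Cod C h) & Comp C g u = h))"

definition semi_reflective :: "('p, 'b) cat \<Rightarrow> 'p set \<Rightarrow> bool" where
 "semi_reflective C S \<longleftrightarrow> S \<subseteq> Obj C & (ALL Q : Obj C. EX u. Dom C u = Q & universal C S u \<and>
  (ALL f p q. Dom C f : S \<longrightarrow> is_pullback C f u p q \<longrightarrow> universal C S p))"

context category
begin

lemma universalD:
 assumes "universal C S u"
 shows "u : Arr C" "Cod C u : S"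
 using assms unfolding universal_def by blast+

lemma universal_ext:
 assumes "universal C S u" "h : Arr C" "Dom C h = Dom C u" "Cod C h : S"
 obtains g where "g : Arr C" "Dom C g = Cod C u" "Cod C g = Cod C h" "g ## u = h"
proof -
 have "EX! g. g : Hom C (Cod C u) (Cod C h) & g ## u = h"
  using assms unfolding universal_def by blast
 then show thesis using that by auto
qed

lemma universal_unique:
 assumes "universal C S u" "f : Arr C" "g : Arr C" "Dom C f = Cod C u" "Dom C g = Cod C u" "Cod C f = Cod C g"
  "Cod C g : S" "f ## u = g ## u"
 shows "f = g"
proof -
 have "ALL h : Arr C. Dom C h = Dom C u \<longrightarrow> Cod C h : S \<longrightarrow> (EX! g. g : Hom C (Cod C u) (Cod C h) & g ## u = h)"
  using assms(1) unfolding universal_def by blast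
 from this[rule_format, of "g ## u"] have "EX! k. k : Hom C (Cod C u) (Cod C g) & k ## u = g ## u"
  using assms universalD(1)[OF assms(1)] by simp
 moreover have "f : Hom C (Cod C u) (Cod C g) & f ## u = g ## u" "g : Hom C (Cod C u) (Cod C g) & g ## u = g ## u"
  using assms by simp_all
 ultimately show ?thesis by blast
qed

lemma universalI:
 assumes "u : Arr C" "Cod C u : S"
  "!!h. h : Arr C ==> Dom C h = Dom C u ==> Cod C h : S ==>
   EX g. g : Arr C & Dom C g = Cod C u & Cod C g = Cod C h & g ## u = h"
  "!!f g. f : Arr C ==> g : Arr C ==> Dom C f = Cod C u ==> Dom C g = Cod C u ==> Cod C f = Cod C g ==>
   Cod C g : S ==> f ## u = g ## u ==> f = g"
 shows "universal C S u"
 unfolding universal_def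
proof (intro conjI ballI impI)
 fix h assume h: "h : Arr C" "Dom C h = Dom C u" "Cod C h : S"
 obtain g where g: "g : Arr C" "Dom C g = Cod C u" "Cod C g = Cod C h" "g ## u = h" using assms(3)[OF h] by blast
 show "EX! g. g : Hom C (Cod C u) (Cod C h) & g ## u = h"
 proof (rule ex1I[of _ g])
  fix k assume "k : Hom C (Cod C u) (Cod C h) & k ## u = h"
  then show "k = g" using g h by (intro assms(4)[of k g]) simp_all
 qed (use g in simp)
qed (fact assms)+

lemma universal_comp_iso:
 assumes u: "universal C S u" and i: "iso_in C i" "Dom C i = Cod C u" and S': "Cod C i : S'" "S' \<subseteq> S"
 shows "universal C S' (i ## u)"
proof -
 obtain j where j: "i : Arr C" "j : Arr C" "Dom C j = Cod C i" "Cod C j = Dom C i"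
  "j ## i = Id C (Dom C i)" "i ## j = Id C (Cod C i)" using i(1) by (rule isoE)
 note [simp] = j i(2) universalD(1)[OF u]
 show ?thesis
 proof (rule universalI)
  fix h assume h: "h : Arr C" "Dom C h = Dom C (i ## u)" "Cod C h : S'"
  obtain g where g: "g : Arr C" "Dom C g = Cod C u" "Cod C g = Cod C h" "g ## u = h"
   by (rule universal_ext[OF u, of h]) (use h S' in auto)
  have "(g ## j) ## (i ## u) = h" using g assoc_rewrite[OF j(5), of u] by simp
  then show "EX g. g : Arr C & Dom C g = Cod C (i ## u) & Cod C g = Cod C h & g ## (i ## u) = h"
   using g by (intro exI[of _ "g ## j"]) simp
 next
  fix f g assume h: "f : Arr C" "g : Arr C" "Dom C f = Cod C (i ## u)" "Dom C g = Cod C (i ## u)" "Cod C f = Cod C g"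
   "Cod C g : S'" "f ## (i ## u) = g ## (i ## u)"
  have "f ## i = g ## i" by (rule universal_unique[OF u]) (use h S' in auto)
  then show "f = g" by (rule epiD[OF iso_epi[OF i(1)]]) (use h in simp_all)
 qed (use S' in simp_all)
qed

lemma universal_iso:
 assumes u: "universal C S u" and v: "universal C S v" and d: "Dom C u = Dom C v"
  and i: "i : Arr C" "Dom C i = Cod C u" "Cod C i = Cod C v" "i ## u = v"
 shows "iso_in C i"
proof -
 note [simp] = universalD[OF u] universalD[OF v] i
 obtain j where j[simp]: "j : Arr C" "Dom C j = Cod C v" "Cod C j = Cod C u" "j ## v = u"
  by (rule universal_ext[OF v, of u]) (use d in simp_all)
 have "j ## i = Id C (Dom C i)" by (rule universal_unique[OF u]) simp_all
 moreover have "i ## j = Id C (Cod C i)" by (rule universal_unique[OF v]) (use d in simp_all)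
 ultimately show ?thesis by (intro isoI[of i j]) simp_all
qed

lemma universal_id: "A : S ==> S \<subseteq> Obj C ==> universal C S (Id C A)"
proof (rule universalI)
 fix h assume "A : S" "S \<subseteq> Obj C" "h : Arr C" "Dom C h = Dom C (Id C A)"
 then show "EX g. g : Arr C & Dom C g = Cod C (Id C A) & Cod C g = Cod C h & g ## Id C A = h"
  by (intro exI[of _ h]) auto
qed auto

lemma universal_from_S_iso:
 assumes u: "universal C S u" and d: "Dom C u : S" and S: "S \<subseteq> Obj C"
 shows "iso_in C u"
 by (rule universal_iso[OF universal_id[OF d S] u]) (use universalD[OF u] in simp_all)

lemma universal_iff_comp_iso:
 assumes "iso_in C i" "Dom C i = Cod C u" "u : Arr C" "Cod C u : S" "Cod C i : S"
 shows "universal C S (i ## u) \<longleftrightarrow> universal C S u"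
proof
 assume u: "universal C S (i ## u)"
 obtain j where j: "iso_in C j" "i : Arr C" "j : Arr C" "Dom C j = Cod C i" "Cod C j = Dom C i"
  "j ## i = Id C (Dom C i)" "i ## j = Id C (Cod C i)" using assms(1) by (rule iso_inverse)
 have "universal C S (j ## (i ## u))" by (rule universal_comp_iso[OF u j(1)]) (use j assms in simp_all)
 then show "universal C S u" using assoc_rewrite[OF j(6), of u] j assms by simp
qed (use assms universal_comp_iso in simp)

lemma semi_reflective_transfer:
 assumes S: "semi_reflective C S" and S': "S' \<subseteq> S"
  and ess: "!!B. B : S ==> EX i. iso_in C i & Dom C i = B & Cod C i : S'"
 shows "semi_reflective C S'"
proof -
 have SO: "S \<subseteq> Obj C" using S by (simp add: semi_reflective_def)
 have "EX u. Dom C u = Q & universal C S' u & (ALL f p q. Dom C f : S' \<longrightarrow> is_pullback C f u p q \<longrightarrow> universal C S' p)"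
  if Q: "Q : Obj C" for Q
 proof -
  obtain u where u: "Dom C u = Q" "universal C S u"
   and st: "!!f p q. Dom C f : S ==> is_pullback C f u p q ==> universal C S p"
   using S Q unfolding semi_reflective_def by blast
  obtain i where i: "iso_in C i" "Dom C i = Cod C u" "Cod C i : S'" using ess universalD(2)[OF u(2)] by blast
  obtain j where j: "i : Arr C" "j : Arr C" "Dom C j = Cod C i" "Cod C j = Dom C i"
   "j ## i = Id C (Dom C i)" "i ## j = Id C (Cod C i)" using i(1) by (rule isoE)
  note [simp] = j(1-4) i(2) universalD(1)[OF u(2)]
  have "universal C S' p" if f: "Dom C f : S'" and pb: "is_pullback C f (i ## u) p q" for f p q
  proof -
   note pd = pullbackD[OF pb]
   have cf: "Cod C f = Cod C i" using pd(5) by simp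
   note [simp] = pd(1,3,4,6,7)
   have cq: "Cod C q = Dom C u" using pd(8) by simp
   have "is_pullback C (j ## f) u p q"
   proof (rule pullbackI)
    have "j ## (f ## p) = j ## ((i ## u) ## q)" using pd(9) by simp
    also have "\<dots> = u ## q" using assoc_rewrite[OF j(5), of "u ## q"] cq by simp
    finally show "(j ## f) ## p = u ## q" using cf by simp
    fix h k assume h: "h : Arr C" "k : Arr C" "Dom C h = Dom C k" "Cod C h = Dom C (j ## f)" "Cod C k = Dom C u" "(j ## f) ## h = u ## k"
    have "i ## ((j ## f) ## h) = (i ## u) ## k" using h cf by simp
    then have "f ## h = (i ## u) ## k" using assoc_rewrite[OF j(6), of "f ## h"] h cf by simp
    from pullback_lift[OF pb h(1,2,3) _ _ this] h cf
    show "EX w. w : Arr C & Dom C w = Dom C h & Cod C w = Dom C p & p ## w = h & q ## w = k" by auto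
   next
    fix a b assume "a : Arr C" "b : Arr C" "Dom C a = Dom C b" "Cod C a = Dom C p" "Cod C b = Dom C p" "p ## a = p ## b" "q ## a = q ## b"
    then show "a = b" by (rule pullback_unique[OF pb])
   qed (use cf cq in simp_all)
   then have "universal C S p" using st[of "j ## f" p q] f S' cf by auto
   from universal_comp_iso[OF this iso_id, of "Cod C p" S'] f S' SO show ?thesis by auto
  qed
  moreover have "universal C S' (i ## u)" by (rule universal_comp_iso[OF u(2) i S'])
  ultimately show ?thesis using u(1) by (intro exI[of _ "i ## u"]) auto
 qed
 then show ?thesis using S' SO unfolding semi_reflective_def by blast
qed

end

locale reflection = full_functor X C U
 for X :: "('o, 'a) cat" and C :: "('p, 'b) cat" and U :: "('o, 'a, 'p, 'b) Fun" +
 fixes L :: "('p, 'b, 'o, 'a) Fun" and \<eta> :: "'p \<Rightarrow> 'b"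
 assumes L_obj [simp]: "Q : Obj C ==> FObj L Q : Obj X"
  and L_arr [simp]: "f : Arr C ==> FArr L f : Arr X" "f : Arr C ==> Dom X (FArr L f) = FObj L (Dom C f)"
   "f : Arr C ==> Cod X (FArr L f) = FObj L (Cod C f)"
  and \<eta>_arr [simp]: "Q : Obj C ==> \<eta> Q : Arr C" "Q : Obj C ==> Dom C (\<eta> Q) = Q" "Q : Obj C ==> Cod C (\<eta> Q) = FObj U (FObj L Q)"
  and \<eta>_nat: "f : Arr C ==> FArr U (FArr L f) ##\<^bsub>C\<^esub> \<eta> (Dom C f) = \<eta> (Cod C f) ##\<^bsub>C\<^esub> f"
  and \<eta>_universal: "Q : Obj C ==> universal C (FObj U ` Obj X) (\<eta> Q)"
begin

abbreviation "S \<equiv> FObj U ` Obj X"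

lemma S_obj: "S \<subseteq> Obj C" by auto

lemma L_iso_iff:
 assumes [simp]: "g : Arr C"
 shows "iso_in X (FArr L g) \<longleftrightarrow> universal C S (\<eta> (Cod C g) ##\<^bsub>C\<^esub> g)"
proof
 assume "iso_in X (FArr L g)"
 then have i: "iso_in C (FArr U (FArr L g))" by (rule U_iso)
 show "universal C S (\<eta> (Cod C g) ##\<^bsub>C\<^esub> g)"
  unfolding \<eta>_nat[OF assms, symmetric]
  by (rule C.universal_comp_iso[OF \<eta>_universal i]) auto
next
 assume u: "universal C S (\<eta> (Cod C g) ##\<^bsub>C\<^esub> g)"
 have "iso_in C (FArr U (FArr L g))"
  by (rule C.universal_iso[OF \<eta>_universal[of "Dom C g"] u]) (simp_all add: \<eta>_nat)
 then show "iso_in X (FArr L g)" by (rule U_iso_reflect) simp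
qed

lemma \<eta>_S_iso: "A : S ==> iso_in C (\<eta> A)"
 using C.universal_from_S_iso[OF \<eta>_universal[of A] _ S_obj] by auto

lemma L_iso_iff_universal:
 assumes "p : Arr C" "Cod C p : S"
 shows "iso_in X (FArr L p) \<longleftrightarrow> universal C S p"
proof -
 have "Cod C p : Obj C" using assms(1) by simp
 then show ?thesis unfolding L_iso_iff[OF assms(1)]
  using assms \<eta>_S_iso[OF assms(2)] by (intro C.universal_iff_comp_iso) auto
qed

lemma L_\<eta>_iso: "Q : Obj C ==> iso_in X (FArr L (\<eta> Q))"
 using L_iso_iff_universal[of "\<eta> Q"] \<eta>_universal[of Q] by auto

end

lemma (in full_functor) reflectionI:
 assumes r: "is_reflection X C U L \<eta>"
 shows "reflection X C U L \<eta>"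
proof -
 have L: "is_functor C X L" and n: "natural_trans C C id_fun (comp_fun U L) \<eta>" and
  un: "ALL Q : Obj C. ALL Y : Obj X. ALL f : Hom C Q (FObj U Y). EX! g. g : Hom X (FObj L Q) Y & FArr U g ##\<^bsub>C\<^esub> \<eta> Q = f"
  using r unfolding is_reflection_def by blast+
 have Lo: "FObj L Q : Obj X" if "Q : Obj C" for Q using L that unfolding is_functor_def by blast
 have La: "FArr L f : Hom X (FObj L (Dom C f)) (FObj L (Cod C f))" if "f : Arr C" for f
 proof -
  have "ALL A : Obj C. ALL B : Obj C. ALL f : Hom C A B. FArr L f : Hom X (FObj L A) (FObj L B)"
   using L unfolding is_functor_def by blast
  from this[rule_format, of "Dom C f" "Cod C f" f] that show ?thesis by simp
 qed
 have \<eta>: "\<eta> Q : Arr C" "Dom C (\<eta> Q) = Q" "Cod C (\<eta> Q) = FObj U (FObj L Q)" if "Q : Obj C" for Q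
  using n[unfolded natural_trans_def, THEN conjunct1, rule_format, OF that] by (simp_all add: comp_fun_def id_fun_def)
 have nat: "FArr U (FArr L f) ##\<^bsub>C\<^esub> \<eta> (Dom C f) = \<eta> (Cod C f) ##\<^bsub>C\<^esub> f" if "f : Arr C" for f
  using n[unfolded natural_trans_def, THEN conjunct2, rule_format, of "Dom C f" "Cod C f" f] that
  by (simp add: comp_fun_def id_fun_def)
 have "universal C (FObj U ` Obj X) (\<eta> Q)" if Q: "Q : Obj C" for Q
 proof (rule C.universalI)
  fix h assume h: "h : Arr C" "Dom C h = Dom C (\<eta> Q)" "Cod C h : FObj U ` Obj X"
  then obtain Y where Y: "Y : Obj X" "Cod C h = FObj U Y" by blast
  obtain g where "g : Hom X (FObj L Q) Y" "FArr U g ##\<^bsub>C\<^esub> \<eta> Q = h"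
   using un[rule_format, OF Q Y(1), of h] h Y \<eta>[OF Q] by auto
  then show "EX g. g : Arr C & Dom C g = Cod C (\<eta> Q) & Cod C g = Cod C h & g ##\<^bsub>C\<^esub> \<eta> Q = h"
   using Y \<eta>[OF Q] by (intro exI[of _ "FArr U g"]) simp
 next
  fix f g assume h: "f : Arr C" "g : Arr C" "Dom C f = Cod C (\<eta> Q)" "Dom C g = Cod C (\<eta> Q)" "Cod C f = Cod C g"
   "Cod C g : FObj U ` Obj X" "f ##\<^bsub>C\<^esub> \<eta> Q = g ##\<^bsub>C\<^esub> \<eta> Q"
  then obtain Y where Y: "Y : Obj X" "Cod C g = FObj U Y" by blast
  obtain f' where f': "f' : Arr X" "Dom X f' = FObj L Q" "Cod X f' = Y" "FArr U f' = f"
   by (rule U_full[of f "FObj L Q" Y]) (use h Y \<eta>[OF Q] Lo[OF Q] in simp_all)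
  obtain g' where g': "g' : Arr X" "Dom X g' = FObj L Q" "Cod X g' = Y" "FArr U g' = g"
   by (rule U_full[of g "FObj L Q" Y]) (use h Y \<eta>[OF Q] Lo[OF Q] in simp_all)
  have "g ##\<^bsub>C\<^esub> \<eta> Q : Hom C Q (FObj U Y)" using h Y \<eta>[OF Q] by simp
  from un[rule_format, OF Q Y(1) this]
  have "EX! k. k : Hom X (FObj L Q) Y & FArr U k ##\<^bsub>C\<^esub> \<eta> Q = g ##\<^bsub>C\<^esub> \<eta> Q" .
  moreover have "f' : Hom X (FObj L Q) Y & FArr U f' ##\<^bsub>C\<^esub> \<eta> Q = g ##\<^bsub>C\<^esub> \<eta> Q"
   "g' : Hom X (FObj L Q) Y & FArr U g' ##\<^bsub>C\<^esub> \<eta> Q = g ##\<^bsub>C\<^esub> \<eta> Q" using f' g' h by simp_all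
  ultimately have "f' = g'" by blast
  then show "f = g" using f' g' by simp
 qed (use \<eta>[OF Q] Lo[OF Q] in auto)
 then show ?thesis by unfold_locales (use Lo La \<eta> nat in simp_all)
qed

lemma full_functor_of_reflection:
 assumes "category X" "category C" "is_reflection X C U L \<eta>"
 shows "full_functor X C U"
proof -
 interpret X: category X by (rule assms)
 interpret C: category C by (rule assms)
 show ?thesis using assms(3) by unfold_locales (auto simp: is_reflection_def)
qed

lemma semi_reflective_of_semi_localization:
 assumes "category X" "category C" and s: "semi_localization X C U L \<eta>"
 shows "semi_reflective C (FObj U ` Obj X)"
proof -
 have r: "is_reflection X C U L \<eta>" and sl: "semi_left_exact X C U L \<eta>" using s by (simp_all add: semi_localization_def)
 interpret full_functor X C U by (rule full_functor_of_reflection[OF assms(1,2) r])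
 interpret reflection X C U L \<eta> by (rule reflectionI[OF r])
 have "universal C S p" if Q: "Q : Obj C" and f: "Dom C f : S" and pb: "is_pullback C f (\<eta> Q) p q" for Q f p q
 proof -
  note pd = C.pullbackD[OF pb]
  obtain A where A: "A : Obj X" "Dom C f = FObj U A" using f by blast
  obtain f' where f': "f' : Arr X" "Dom X f' = A" "Cod X f' = FObj L Q" "FArr U f' = f"
   by (rule U_full[of f A "FObj L Q"]) (use pd A Q in simp_all)
  have "is_pullback X (FArr L (FArr U f')) (FArr L (\<eta> Q)) (FArr L p) (FArr L q)"
   using sl[unfolded semi_left_exact_def, rule_format, OF Q A(1), of f' p q] f' pb by simp
  from X.pullback_of_iso[OF this L_\<eta>_iso[OF Q]]
  have "iso_in X (FArr L p)" .
  then show ?thesis using L_iso_iff_universal[of p] pd f by simp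
 qed
 then show ?thesis unfolding semi_reflective_def using S_obj \<eta>_universal by (metis (no_types) \<eta>_arr(2))
qed

lemma (in full_functor) semi_localization_of_semi_reflective:
 assumes sr: "semi_reflective C (FObj U ` Obj X)"
 obtains L \<eta> where "semi_localization X C U L \<eta>" "!!Q. Q : Obj C ==> Dom C (\<eta> Q) = Q & universal C (FObj U ` Obj X) (\<eta> Q)"
proof -
 let ?S = "FObj U ` Obj X"
 have ex: "EX u. Dom C u = Q & universal C ?S u & (ALL f p q. Dom C f : ?S \<longrightarrow> is_pullback C f u p q \<longrightarrow> universal C ?S p)"
  if "Q : Obj C" for Q using sr that unfolding semi_reflective_def by blast
 define \<eta> where "\<eta> Q = (SOME u. Dom C u = Q & universal C ?S u & (ALL f p q. Dom C f : ?S \<longrightarrow> is_pullback C f u p q \<longrightarrow> universal C ?S p))" for Q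
 have \<eta>: "Dom C (\<eta> Q) = Q" "universal C ?S (\<eta> Q)" "!!f p q. Dom C f : ?S ==> is_pullback C f (\<eta> Q) p q ==> universal C ?S p"
  if "Q : Obj C" for Q using someI_ex[OF ex[OF that]] unfolding \<eta>_def by blast+
 define Lo where "Lo Q = (SOME Y. Y : Obj X & Cod C (\<eta> Q) = FObj U Y)" for Q
 have Lo: "Lo Q : Obj X" "Cod C (\<eta> Q) = FObj U (Lo Q)" if "Q : Obj C" for Q
 proof -
  have "EX Y. Y : Obj X & Cod C (\<eta> Q) = FObj U Y" using C.universalD(2)[OF \<eta>(2)[OF that]] by blast
  from someI_ex[OF this] show "Lo Q : Obj X" "Cod C (\<eta> Q) = FObj U (Lo Q)" unfolding Lo_def by blast+
 qed
 have \<eta>a: "\<eta> Q : Arr C" if "Q : Obj C" for Q using C.universalD(1)[OF \<eta>(2)[OF that]] .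
 define La where "La f = (SOME l. l : Hom X (Lo (Dom C f)) (Lo (Cod C f)) & FArr U l ##\<^bsub>C\<^esub> \<eta> (Dom C f) = \<eta> (Cod C f) ##\<^bsub>C\<^esub> f)" for f
 have La: "La f : Arr X" "Dom X (La f) = Lo (Dom C f)" "Cod X (La f) = Lo (Cod C f)"
  "FArr U (La f) ##\<^bsub>C\<^esub> \<eta> (Dom C f) = \<eta> (Cod C f) ##\<^bsub>C\<^esub> f" if f: "f : Arr C" for f
 proof -
  have d: "Dom C f : Obj C" "Cod C f : Obj C" using f by simp_all
  obtain g where g: "g : Arr C" "Dom C g = Cod C (\<eta> (Dom C f))" "Cod C g = Cod C (\<eta> (Cod C f) ##\<^bsub>C\<^esub> f)" "g ##\<^bsub>C\<^esub> \<eta> (Dom C f) = \<eta> (Cod C f) ##\<^bsub>C\<^esub> f"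
   by (rule C.universal_ext[OF \<eta>(2)[OF d(1)], of "\<eta> (Cod C f) ##\<^bsub>C\<^esub> f"]) (use f d \<eta> \<eta>a Lo in simp_all)
  obtain l where "l : Arr X" "Dom X l = Lo (Dom C f)" "Cod X l = Lo (Cod C f)" "FArr U l = g"
   by (rule U_full[of g "Lo (Dom C f)" "Lo (Cod C f)"]) (use g f d \<eta> \<eta>a Lo in simp_all)
  then have "EX l. l : Hom X (Lo (Dom C f)) (Lo (Cod C f)) & FArr U l ##\<^bsub>C\<^esub> \<eta> (Dom C f) = \<eta> (Cod C f) ##\<^bsub>C\<^esub> f" using g by auto
  from someI_ex[OF this] show "La f : Arr X" "Dom X (La f) = Lo (Dom C f)" "Cod X (La f) = Lo (Cod C f)"
   "FArr U (La f) ##\<^bsub>C\<^esub> \<eta> (Dom C f) = \<eta> (Cod C f) ##\<^bsub>C\<^esub> f" unfolding La_def by simp_all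
 qed
 have Lunique: "l = l'" if "l : Arr X" "l' : Arr X" "Dom X l = Lo Q" "Dom X l' = Lo Q" "Cod X l = Cod X l'"
  "FArr U l ##\<^bsub>C\<^esub> \<eta> Q = FArr U l' ##\<^bsub>C\<^esub> \<eta> Q" "Q : Obj C" for l l' Q
 proof -
  have "FArr U l = FArr U l'" by (rule C.universal_unique[OF \<eta>(2)[OF that(7)]]) (use that Lo in simp_all)
  then show ?thesis by (rule U_eqI) (use that in simp_all)
 qed
 define L where "L = \<lparr>FObj = Lo, FArr = La\<rparr>"
 have L: "FObj L = Lo" "FArr L = La" by (simp_all add: L_def)
 have LF: "is_functor C X L"
  unfolding is_functor_def L
 proof (intro conjI ballI impI)
  fix A assume A: "A : Obj C"
  show "Lo A : Obj X" using Lo[OF A] by simp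
  show "La (Id C A) = Id X (Lo A)" by (rule Lunique[where Q = A]) (use La[of "Id C A"] A Lo \<eta>a \<eta> in simp_all)
 next
  fix A B f assume "f : Hom C A B"
  then show "La f : Hom X (Lo A) (Lo B)" using La[of f] by simp
 next
  fix f g assume fg: "f : Arr C" "g : Arr C" "Cod C f = Dom C g"
  have d: "Dom C f : Obj C" "Dom C g : Obj C" "Cod C g : Obj C" using fg by simp_all
  have "FArr U (La g) ##\<^bsub>C\<^esub> (FArr U (La f) ##\<^bsub>C\<^esub> \<eta> (Dom C f)) = FArr U (La g) ##\<^bsub>C\<^esub> (\<eta> (Dom C g) ##\<^bsub>C\<^esub> f)"
   using La(4)[OF fg(1)] fg by simp
  also have "\<dots> = (\<eta> (Cod C g) ##\<^bsub>C\<^esub> g) ##\<^bsub>C\<^esub> f"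
   by (rule C.assoc_rewrite[OF La(4)[OF fg(2)]]) (use fg d La(1-3)[OF fg(2)] \<eta>(1) \<eta>a Lo in simp_all)
  also have "\<dots> = \<eta> (Cod C g) ##\<^bsub>C\<^esub> (g ##\<^bsub>C\<^esub> f)" using fg d \<eta>(1) \<eta>a by simp
  finally show "La (g ##\<^bsub>C\<^esub> f) = La g ##\<^bsub>X\<^esub> La f"
   by (intro Lunique[where Q = "Dom C f"]) (use fg d La[OF fg(1)] La[OF fg(2)] La[of "g ##\<^bsub>C\<^esub> f"] Lo \<eta> \<eta>a in simp_all)
 qed
 have nat: "natural_trans C C id_fun (comp_fun U L) \<eta>"
  unfolding natural_trans_def using La Lo \<eta> \<eta>a by (auto simp: comp_fun_def id_fun_def L)
 have un: "EX! g. g : Hom X (Lo Q) Y & FArr U g ##\<^bsub>C\<^esub> \<eta> Q = f" if Q: "Q : Obj C" "Y : Obj X" "f : Hom C Q (FObj U Y)" for Q Y f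
 proof -
  obtain g where g: "g : Arr C" "Dom C g = Cod C (\<eta> Q)" "Cod C g = Cod C f" "g ##\<^bsub>C\<^esub> \<eta> Q = f"
   by (rule C.universal_ext[OF \<eta>(2)[OF Q(1)], of f]) (use Q \<eta> in auto)
  obtain l where "l : Arr X" "Dom X l = Lo Q" "Cod X l = Y" "FArr U l = g"
   by (rule U_full[of g "Lo Q" Y]) (use g Q Lo in simp_all)
  then have l: "l : Hom X (Lo Q) Y & FArr U l ##\<^bsub>C\<^esub> \<eta> Q = f" using g by simp
  show ?thesis
  proof (rule ex1I[of _ l])
   show "l : Hom X (Lo Q) Y & FArr U l ##\<^bsub>C\<^esub> \<eta> Q = f" by (rule l)
   fix m assume "m : Hom X (Lo Q) Y & FArr U m ##\<^bsub>C\<^esub> \<eta> Q = f"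
   then show "m = l" using l Q by (intro Lunique[of m l Q]) simp_all
  qed
 qed
 have r: "is_reflection X C U L \<eta>"
  unfolding is_reflection_def
 proof (intro conjI ballI)
  show "EX! g. g : Hom X (FObj L Q) Y & FArr U g ##\<^bsub>C\<^esub> \<eta> Q = f" if "Q : Obj C" "Y : Obj X" "f : Hom C Q (FObj U Y)" for Q Y f
   unfolding L by (rule un[OF that])
 qed (fact is_functor fully_faithful LF nat)+
 interpret reflection X C U L \<eta> by (rule reflectionI[OF r])
 have "semi_left_exact X C U L \<eta>"
  unfolding semi_left_exact_def
 proof (intro ballI allI impI)
  fix Q A f p q assume Q: "Q : Obj C" and A: "A : Obj X" and f: "f : Hom X A (FObj L Q)" and pb: "is_pullback C (FArr U f) (\<eta> Q) p q"
  note pd = C.pullbackD[OF pb]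
  have "universal C S p" by (rule \<eta>(3)[OF Q _ pb]) (use f A in auto)
  then have i: "iso_in X (FArr L p)" using L_iso_iff_universal[of p] pd f A by auto
  have Lcomp: "FArr L (g ##\<^bsub>C\<^esub> f) = FArr L g ##\<^bsub>X\<^esub> FArr L f" if "f : Arr C" "g : Arr C" "Cod C f = Dom C g" for f g
   using LF that unfolding is_functor_def by blast
  show "is_pullback X (FArr L (FArr U f)) (FArr L (\<eta> Q)) (FArr L p) (FArr L q)"
  proof (rule X.pullback_of_isos[OF _ _ L_\<eta>_iso[OF Q] i])
   show "FArr L (FArr U f) ##\<^bsub>X\<^esub> FArr L p = FArr L (\<eta> Q) ##\<^bsub>X\<^esub> FArr L q"
    using Lcomp[of p "FArr U f"] Lcomp[of q "\<eta> Q"] pd Q f by simp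
  qed (use pd Q f in simp_all)
 qed
 then have "semi_localization X C U L \<eta>" using r by (simp add: semi_localization_def)
 then show thesis by (rule that) (use \<eta> in blast)
qed

section \<open>Semi-localizations of additive categories\<close>

locale semi_reflective_functor = full_functor X C U
 for X :: "('o, 'a) cat" and C :: "('p, 'b) cat" and U :: "('o, 'a, 'p, 'b) Fun" +
 assumes add_C: "additive_category C" and semi_refl: "semi_reflective C (FObj U ` Obj X)"
begin

sublocale C: additive C by unfold_locales (rule add_C)

abbreviation "S \<equiv> FObj U ` Obj X"

lemma semi_reflE:
 assumes "Q : Obj C"
 obtains u B where "B : Obj X" "u : Arr C" "Dom C u = Q" "Cod C u = FObj U B" "universal C S u"
  "!!f p q. Dom C f : S ==> is_pullback C f u p q ==> universal C S p"
proof -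
 obtain u where u: "Dom C u = Q" "universal C S u" "!!f p q. Dom C f : S ==> is_pullback C f u p q ==> universal C S p"
  using semi_refl[unfolded semi_reflective_def, THEN conjunct2, rule_format, OF assms] by (elim exE conjE) metis
 obtain B where B: "B : Obj X" "Cod C u = FObj U B" using C.universalD(2)[OF u(2)] by blast
 show thesis by (rule that[OF B(1) C.universalD(1)[OF u(2)] u(1) B(2) u(2) u(3)])
qed

definition lift :: "'o \<Rightarrow> 'o \<Rightarrow> 'b \<Rightarrow> 'a" where
 "lift A B h = (SOME f. f : Hom X A B & FArr U f = h)"

lemma lift:
 assumes "h : Arr C" "Dom C h = FObj U A" "Cod C h = FObj U B" "A : Obj X" "B : Obj X"
 shows "lift A B h : Arr X" "Dom X (lift A B h) = A" "Cod X (lift A B h) = B" "FArr U (lift A B h) = h"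
proof -
 have "EX f. f : Hom X A B & FArr U f = h" by (rule U_full[OF assms]) auto
 from someI_ex[OF this] show "lift A B h : Arr X" "Dom X (lift A B h) = A" "Cod X (lift A B h) = B" "FArr U (lift A B h) = h"
  unfolding lift_def by simp_all
qed

definition "plX f g = lift (Dom X f) (Cod X f) (hom_plus C (FArr U f) (FArr U g))"
definition "zeX A B = lift A B (zero_arr C (FObj U A) (FObj U B))"
definition "ngX f = lift (Dom X f) (Cod X f) (hom_neg C (FArr U f))"

lemma plX:
 assumes "f : Arr X" "g : Arr X" "Dom X f = Dom X g" "Cod X f = Cod X g"
 shows "plX f g : Arr X" "Dom X (plX f g) = Dom X f" "Cod X (plX f g) = Cod X f"
  "FArr U (plX f g) = hom_plus C (FArr U f) (FArr U g)"
 unfolding plX_def using assms lift[of "hom_plus C (FArr U f) (FArr U g)" "Dom X f" "Cod X f"] by simp_all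

lemma zeX:
 assumes "A : Obj X" "B : Obj X"
 shows "zeX A B : Arr X" "Dom X (zeX A B) = A" "Cod X (zeX A B) = B" "FArr U (zeX A B) = zero_arr C (FObj U A) (FObj U B)"
 unfolding zeX_def using assms lift[of "zero_arr C (FObj U A) (FObj U B)" A B] by simp_all

lemma ngX:
 assumes "f : Arr X"
 shows "ngX f : Arr X" "Dom X (ngX f) = Dom X f" "Cod X (ngX f) = Cod X f" "FArr U (ngX f) = hom_neg C (FArr U f)"
 unfolding ngX_def using assms lift[of "hom_neg C (FArr U f)" "Dom X f" "Cod X f"] by simp_all

sublocale XA: preadd X plX zeX ngX
proof
 fix f g h assume h: "f : Arr X" "g : Arr X" "h : Arr X" "Dom X f = Dom X g" "Cod X f = Cod X g" "Dom X g = Dom X h" "Cod X g = Cod X h"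
 show "plX (plX f g) h = plX f (plX g h)"
  by (rule U_eqI) (use h in \<open>simp_all add: plX C.pl_assoc\<close>)
next
 fix f g assume h: "f : Arr X" "g : Arr X" "Dom X f = Dom X g" "Cod X f = Cod X g"
 show "plX f g = plX g f" by (rule U_eqI) (use h in \<open>simp_all add: plX C.pl_comm[of "FArr U f" "FArr U g"]\<close>)
next
 fix f g h assume h: "f : Arr X" "g : Arr X" "h : Arr X" "Dom X f = Dom X g" "Cod X f = Dom X h" "Cod X g = Dom X h"
 show "h ##\<^bsub>X\<^esub> plX f g = plX (h ##\<^bsub>X\<^esub> f) (h ##\<^bsub>X\<^esub> g)"
  by (rule U_eqI) (use h in \<open>simp_all add: plX C.comp_pl\<close>)
next
 fix f g h assume h: "f : Arr X" "g : Arr X" "h : Arr X" "Cod X f = Cod X g" "Cod X h = Dom X f" "Cod X h = Dom X g"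
 then have "Dom X f = Dom X g" by simp
 then show "plX f g ##\<^bsub>X\<^esub> h = plX (f ##\<^bsub>X\<^esub> h) (g ##\<^bsub>X\<^esub> h)"
  by (intro U_eqI) (use h in \<open>simp_all add: plX C.pl_comp\<close>)
next
 fix f assume f: "f : Arr X"
 show "plX f (zeX (Dom X f) (Cod X f)) = f" by (rule U_eqI) (use f in \<open>simp_all add: plX zeX\<close>)
 show "plX f (ngX f) = zeX (Dom X f) (Cod X f)" by (rule U_eqI) (use f in \<open>simp_all add: plX zeX ngX C.pl_ng\<close>)
qed (simp_all add: plX zeX ngX)

lemma S_memI [simp]: "A : Obj X ==> FObj U A : S" by blast

lemma additive_X: "additive_category X"
proof (rule XA.additiveI)
 obtain Z where Z: "zero_object C Z" by (rule C.zero_objectE)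
 then have Zo[simp]: "Z : Obj C" by (simp add: zero_object_def)
 obtain u B where u: "B : Obj X" "u : Arr C" "Dom C u = Z" "Cod C u = FObj U B" "universal C S u"
  by (rule semi_reflE[OF Zo]) blast
 show "(SOME B. B : Obj X & Id X B = zeX B B) : Obj X"
  "Id X (SOME B. B : Obj X & Id X B = zeX B B) = zeX (SOME B. B : Obj X & Id X B = zeX B B) (SOME B. B : Obj X & Id X B = zeX B B)"
 proof -
  have "v = w" if "v : Hom C Z D" "w : Hom C Z D" "D : Obj C" for v w D
   using C.zero_object_hom(2)[OF Z that(3)] that by blast
  then have "u = zero_arr C Z (FObj U B)" using u by auto
  then have "Id C (FObj U B) ##\<^bsub>C\<^esub> u = zero_arr C (FObj U B) (FObj U B) ##\<^bsub>C\<^esub> u" using u by simp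
  then have "Id C (FObj U B) = zero_arr C (FObj U B) (FObj U B)"
   by (rule C.universal_unique[OF u(5), rotated -1]) (use u in simp_all)
  then have "Id X B = zeX B B" by (intro U_eqI) (use u in \<open>simp_all add: zeX\<close>)
  then have "EX B. B : Obj X & Id X B = zeX B B" using u(1) by blast
  from someI_ex[OF this] show "(SOME B. B : Obj X & Id X B = zeX B B) : Obj X"
  "Id X (SOME B. B : Obj X & Id X B = zeX B B) = zeX (SOME B. B : Obj X & Id X B = zeX B B) (SOME B. B : Obj X & Id X B = zeX B B)"
   by blast+
 qed
next
 fix A B assume AB: "A : Obj X" "B : Obj X"
 obtain P i j p q where b: "biprod C (hom_plus C) (zero_arr C) (FObj U A) (FObj U B) P i j p q"
  by (rule C.biprodE[of "FObj U A" "FObj U B"]) (use AB in simp_all)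
 note [simp] = C.biprod_simps[OF b] AB
 obtain u Q where u: "Q : Obj X" "u : Arr C" "Dom C u = P" "Cod C u = FObj U Q" "universal C S u"
  by (rule semi_reflE[of P]) simp_all
 note [simp] = u(1-4)
 obtain p' where p': "p' : Arr C" "Dom C p' = Cod C u" "Cod C p' = Cod C p" "p' ##\<^bsub>C\<^esub> u = p"
  by (rule C.universal_ext[OF u(5), of p]) simp_all
 obtain q' where q': "q' : Arr C" "Dom C q' = Cod C u" "Cod C q' = Cod C q" "q' ##\<^bsub>C\<^esub> u = q"
  by (rule C.universal_ext[OF u(5), of q]) simp_all
 note [simp] = p' q'
 have pq: "hom_plus C (i ##\<^bsub>C\<^esub> p) (j ##\<^bsub>C\<^esub> q) = Id C P" using b unfolding biprod_def by blast
 have s: "hom_plus C ((u ##\<^bsub>C\<^esub> i) ##\<^bsub>C\<^esub> p') ((u ##\<^bsub>C\<^esub> j) ##\<^bsub>C\<^esub> q') = Id C (FObj U Q)"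
 proof (rule C.universal_unique[OF u(5)])
  have "hom_plus C ((u ##\<^bsub>C\<^esub> i) ##\<^bsub>C\<^esub> p') ((u ##\<^bsub>C\<^esub> j) ##\<^bsub>C\<^esub> q') ##\<^bsub>C\<^esub> u = u ##\<^bsub>C\<^esub> hom_plus C (i ##\<^bsub>C\<^esub> p) (j ##\<^bsub>C\<^esub> q)"
   by (simp add: C.pl_comp C.comp_pl)
  also have "\<dots> = u" by (simp add: pq)
  finally show "hom_plus C ((u ##\<^bsub>C\<^esub> i) ##\<^bsub>C\<^esub> p') ((u ##\<^bsub>C\<^esub> j) ##\<^bsub>C\<^esub> q') ##\<^bsub>C\<^esub> u = Id C (FObj U Q) ##\<^bsub>C\<^esub> u" by simp
 qed simp_all
 let ?i = "lift A Q (u ##\<^bsub>C\<^esub> i)" and ?j = "lift B Q (u ##\<^bsub>C\<^esub> j)" and ?p = "lift Q A p'" and ?q = "lift Q B q'"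
 have l[simp]: "?i : Arr X" "Dom X ?i = A" "Cod X ?i = Q" "FArr U ?i = u ##\<^bsub>C\<^esub> i"
  "?j : Arr X" "Dom X ?j = B" "Cod X ?j = Q" "FArr U ?j = u ##\<^bsub>C\<^esub> j"
  "?p : Arr X" "Dom X ?p = Q" "Cod X ?p = A" "FArr U ?p = p'"
  "?q : Arr X" "Dom X ?q = Q" "Cod X ?q = B" "FArr U ?q = q'"
  using lift[of "u ##\<^bsub>C\<^esub> i" A Q] lift[of "u ##\<^bsub>C\<^esub> j" B Q] lift[of p' Q A] lift[of q' Q B] by simp_all
 have pu: "p' ##\<^bsub>C\<^esub> (u ##\<^bsub>C\<^esub> h) = p ##\<^bsub>C\<^esub> h" "q' ##\<^bsub>C\<^esub> (u ##\<^bsub>C\<^esub> h) = q ##\<^bsub>C\<^esub> h" if "h : Arr C" "Cod C h = P" for h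
  using C.assoc_rewrite[OF p'(4), of h] C.assoc_rewrite[OF q'(4), of h] that by simp_all
 have e: "?p ##\<^bsub>X\<^esub> ?i = Id X A" "?q ##\<^bsub>X\<^esub> ?j = Id X B" "?q ##\<^bsub>X\<^esub> ?i = zeX A B" "?p ##\<^bsub>X\<^esub> ?j = zeX B A"
  "plX (?i ##\<^bsub>X\<^esub> ?p) (?j ##\<^bsub>X\<^esub> ?q) = Id X Q"
  by (rule U_eqI; use s in \<open>simp add: pu zeX plX\<close>)+
 have "biprod X plX zeX A B Q ?i ?j ?p ?q" unfolding biprod_def by (simp add: e)
 then show "EX P i j p q. biprod X plX zeX A B P i j p q" by blast
qed

sublocale X: additive X by unfold_locales (rule additive_X)

lemma U_zero [simp]:
 assumes "A : Obj X" "B : Obj X"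
 shows "FArr U (zero_arr X A B) = zero_arr C (FObj U A) (FObj U B)"
proof -
 obtain Z where "zero_object X Z" by (rule X.zero_objectE)
 then show ?thesis using XA.zero_arr_ze assms zeX by simp
qed

lemma reflect_kernel:
 assumes k: "is_kernel C (FArr U f) (FArr U k)" and f: "f : Arr X" "k : Arr X" "Cod X k = Dom X f"
 shows "is_kernel X f k"
proof (rule X.kernelI)
 note kd = C.kernelD[OF k]
 show "mono_in X k"
 proof (rule X.monoI)
  fix a b assume h: "a : Arr X" "b : Arr X" "Dom X a = Dom X b" "Cod X a = Dom X k" "Cod X b = Dom X k" "k ##\<^bsub>X\<^esub> a = k ##\<^bsub>X\<^esub> b"
  have "FArr U k ##\<^bsub>C\<^esub> FArr U a = FArr U k ##\<^bsub>C\<^esub> FArr U b" using h f U_comp[of a k] U_comp[of b k] by simp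
  then have "FArr U a = FArr U b" by (rule C.monoD[OF kd(5)]) (use h f in simp_all)
  then show "a = b" by (rule U_eqI) (use h in simp_all)
 qed (rule f)
 show "f ##\<^bsub>X\<^esub> k = zero_arr X (Dom X k) (Cod X f)" by (rule U_eqI) (use kd f in simp_all)
 fix h assume h: "h : Arr X" "Cod X h = Dom X f" "f ##\<^bsub>X\<^esub> h = zero_arr X (Dom X h) (Cod X f)"
 have z: "FArr U f ##\<^bsub>C\<^esub> FArr U h = zero_arr C (Dom C (FArr U h)) (Cod C (FArr U f))"
  using U_comp[of h f] h f by simp
 obtain w where w: "w : Arr C" "Dom C w = Dom C (FArr U h)" "Cod C w = Dom C (FArr U k)" "FArr U k ##\<^bsub>C\<^esub> w = FArr U h"
  by (rule C.kernel_lift[OF k _ _ z]) (use h f in simp_all)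
 obtain v where v: "v : Arr X" "Dom X v = Dom X h" "Cod X v = Dom X k" "FArr U v = w"
  by (rule U_full[of w "Dom X h" "Dom X k"]) (use w h f in simp_all)
 have "k ##\<^bsub>X\<^esub> v = h" by (rule U_eqI) (use v w h f in simp_all)
 then show "EX u. u : Arr X & Dom X u = Dom X h & Cod X u = Dom X k & k ##\<^bsub>X\<^esub> u = h" using v by blast
qed (rule f)+

lemma preserve_pullback:
 assumes pb: "is_pullback X f g p q"
 shows "is_pullback C (FArr U f) (FArr U g) (FArr U p) (FArr U q)"
proof (rule C.pullbackI)
 note pd = X.pullbackD[OF pb]
 note [simp] = pd(1-4,6-8)
 show "FArr U f ##\<^bsub>C\<^esub> FArr U p = FArr U g ##\<^bsub>C\<^esub> FArr U q"
  using U_comp[of p f] U_comp[of q g] pd(9) by simp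
 show "Cod C (FArr U f) = Cod C (FArr U g)" using pd(5) by simp
 fix h k assume h: "h : Arr C" "k : Arr C" "Dom C h = Dom C k" "Cod C h = Dom C (FArr U f)" "Cod C k = Dom C (FArr U g)"
  "FArr U f ##\<^bsub>C\<^esub> h = FArr U g ##\<^bsub>C\<^esub> k"
 have "Dom C k : Obj C" using h by simp
 then obtain u B where u: "B : Obj X" "u : Arr C" "Dom C u = Dom C k" "Cod C u = FObj U B" "universal C S u"
  by (rule semi_reflE)
 obtain h' where h': "h' : Arr C" "Dom C h' = Cod C u" "Cod C h' = Cod C h" "h' ##\<^bsub>C\<^esub> u = h"
  by (rule C.universal_ext[OF u(5), of h]) (use h u in simp_all)
 obtain k' where k': "k' : Arr C" "Dom C k' = Cod C u" "Cod C k' = Cod C k" "k' ##\<^bsub>C\<^esub> u = k"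
  by (rule C.universal_ext[OF u(5), of k]) (use h u in simp_all)
 have e: "FArr U f ##\<^bsub>C\<^esub> h' = FArr U g ##\<^bsub>C\<^esub> k'"
  by (rule C.universal_unique[OF u(5)]) (use h h' k' u pd(5) in simp_all)
 obtain h1 where h1: "h1 : Arr X" "Dom X h1 = B" "Cod X h1 = Dom X f" "FArr U h1 = h'"
  by (rule U_full[of h' B "Dom X f"]) (use h h' u in simp_all)
 obtain k1 where k1: "k1 : Arr X" "Dom X k1 = B" "Cod X k1 = Dom X g" "FArr U k1 = k'"
  by (rule U_full[of k' B "Dom X g"]) (use h k' u in simp_all)
 have e1: "f ##\<^bsub>X\<^esub> h1 = g ##\<^bsub>X\<^esub> k1" by (rule U_eqI) (use e h1 k1 pd(5) in simp_all)
 obtain w where w: "w : Arr X" "Dom X w = Dom X h1" "Cod X w = Dom X p" "p ##\<^bsub>X\<^esub> w = h1" "q ##\<^bsub>X\<^esub> w = k1"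
  by (rule X.pullback_lift[OF pb h1(1) k1(1) _ _ _ e1]) (simp add: h1 k1, simp add: h1, simp add: k1, blast intro: that)
 have e2: "FArr U p ##\<^bsub>C\<^esub> FArr U w = h'" by (subst U_comp[symmetric]) (simp_all add: w h1(4))
 have e3: "FArr U q ##\<^bsub>C\<^esub> FArr U w = k'" by (subst U_comp[symmetric]) (simp_all add: w k1(4))
 have "FArr U p ##\<^bsub>C\<^esub> (FArr U w ##\<^bsub>C\<^esub> u) = h' ##\<^bsub>C\<^esub> u" "FArr U q ##\<^bsub>C\<^esub> (FArr U w ##\<^bsub>C\<^esub> u) = k' ##\<^bsub>C\<^esub> u"
  by (rule C.assoc_rewrite[OF e2], simp_all add: w u h1(2)) (rule C.assoc_rewrite[OF e3], simp_all add: w u h1(2))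
 then have "FArr U p ##\<^bsub>C\<^esub> (FArr U w ##\<^bsub>C\<^esub> u) = h" "FArr U q ##\<^bsub>C\<^esub> (FArr U w ##\<^bsub>C\<^esub> u) = k" by (simp_all only: h'(4) k'(4))
 then show "EX v. v : Arr C & Dom C v = Dom C h & Cod C v = Dom C (FArr U p) & FArr U p ##\<^bsub>C\<^esub> v = h & FArr U q ##\<^bsub>C\<^esub> v = k"
  by (intro exI[of _ "FArr U w ##\<^bsub>C\<^esub> u"]) (simp add: w(1-3) u(1-4) h(3) h1(2))
next
 note pd = X.pullbackD[OF pb]
 note [simp] = pd(1-4,6-8)
 fix a b assume h: "a : Arr C" "b : Arr C" "Dom C a = Dom C b" "Cod C a = Dom C (FArr U p)" "Cod C b = Dom C (FArr U p)"
  "FArr U p ##\<^bsub>C\<^esub> a = FArr U p ##\<^bsub>C\<^esub> b" "FArr U q ##\<^bsub>C\<^esub> a = FArr U q ##\<^bsub>C\<^esub> b"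
 have "Dom C b : Obj C" using h by simp
 then obtain u B where u: "B : Obj X" "u : Arr C" "Dom C u = Dom C b" "Cod C u = FObj U B" "universal C S u"
  by (rule semi_reflE)
 obtain a' where a': "a' : Arr C" "Dom C a' = Cod C u" "Cod C a' = Cod C a" "a' ##\<^bsub>C\<^esub> u = a"
  by (rule C.universal_ext[OF u(5), of a]) (use h u in simp_all)
 obtain b' where b': "b' : Arr C" "Dom C b' = Cod C u" "Cod C b' = Cod C b" "b' ##\<^bsub>C\<^esub> u = b"
  by (rule C.universal_ext[OF u(5), of b]) (use h u in simp_all)
 obtain a1 where a1: "a1 : Arr X" "Dom X a1 = B" "Cod X a1 = Dom X p" "FArr U a1 = a'"
  by (rule U_full[of a' B "Dom X p"]) (use h a' u in simp_all)
 obtain b1 where b1: "b1 : Arr X" "Dom X b1 = B" "Cod X b1 = Dom X p" "FArr U b1 = b'"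
  by (rule U_full[of b' B "Dom X p"]) (use h b' u in simp_all)
 have "FArr U p ##\<^bsub>C\<^esub> a' = FArr U p ##\<^bsub>C\<^esub> b'"
  by (rule C.universal_unique[OF u(5)]) (simp_all add: h(1-5) a' b' u(1-4), rule h(6))
 then have "FArr U (p ##\<^bsub>X\<^esub> a1) = FArr U (p ##\<^bsub>X\<^esub> b1)" by (simp add: a1 b1)
 then have e1: "p ##\<^bsub>X\<^esub> a1 = p ##\<^bsub>X\<^esub> b1" by (rule U_eqI) (simp_all add: a1 b1)
 have "FArr U q ##\<^bsub>C\<^esub> a' = FArr U q ##\<^bsub>C\<^esub> b'"
  by (rule C.universal_unique[OF u(5)]) (simp_all add: h(1-5) a' b' u(1-4), rule h(7))
 then have "FArr U (q ##\<^bsub>X\<^esub> a1) = FArr U (q ##\<^bsub>X\<^esub> b1)" by (simp add: a1 b1)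
 then have e2: "q ##\<^bsub>X\<^esub> a1 = q ##\<^bsub>X\<^esub> b1" by (rule U_eqI) (simp_all add: a1 b1)
 have "a1 = b1" by (rule X.pullback_unique[OF pb _ _ _ _ _ e1 e2]) (simp_all add: a1 b1)
 then show "a = b" using a1 b1 a' b' by simp
qed (use X.pullbackD[OF pb] in simp_all)

lemma stable_additive_X:
 assumes st: "stable_additive C"
 shows "stable_additive X"
proof -
 interpret C: stable_additive C by (rule st)
 have "EX k. is_kernel X f k" if f: "f : Arr X" for f
 proof -
  note [simp] = f
  obtain k where k: "is_kernel C (FArr U f) k" using C.kernel_ex[of "FArr U f"] by auto
  note kd = C.kernelD[OF k]
  have kd3: "Cod C k = FObj U (Dom X f)" using kd(3) by simp
  obtain u K where u: "K : Obj X" "u : Arr C" "Dom C u = Dom C k" "Cod C u = FObj U K" "universal C S u"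
   by (rule semi_reflE[of "Dom C k"]) (use kd in simp_all)
  obtain k' where k': "k' : Arr C" "Dom C k' = Cod C u" "Cod C k' = Cod C k" "k' ##\<^bsub>C\<^esub> u = k"
   by (rule C.universal_ext[OF u(5), of k]) (use kd kd3 u in simp_all)
  note [simp] = kd(2) kd3 u(1-4) k'
  have z: "FArr U f ##\<^bsub>C\<^esub> k' = zero_arr C (FObj U K) (FObj U (Cod X f))"
   by (rule C.universal_unique[OF u(5)]) (use kd(4) in simp_all)
  obtain w where w[simp]: "w : Arr C" "Dom C w = FObj U K" "Cod C w = Dom C k" "k ##\<^bsub>C\<^esub> w = k'"
   using C.kernel_lift[OF k, of k'] z by auto
  have wu: "w ##\<^bsub>C\<^esub> u = Id C (Dom C k)"
   by (rule C.monoD[OF kd(5)]) (use C.assoc_rewrite[OF w(4), of u] in simp_all)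
  have uw: "u ##\<^bsub>C\<^esub> w = Id C (FObj U K)"
   by (rule C.universal_unique[OF u(5)]) (use wu in simp_all)
  have "is_kernel C (FArr U f) k'"
  proof (rule C.kernelI)
   have "iso_in C w" by (rule C.isoI[of w u]) (use wu uw in simp_all)
   from C.mono_comp[OF kd(5) C.iso_mono[OF this]] show "mono_in C k'" by simp
   fix h assume h: "h : Arr C" "Cod C h = Dom C (FArr U f)" "FArr U f ##\<^bsub>C\<^esub> h = zero_arr C (Dom C h) (Cod C (FArr U f))"
   obtain a where a: "a : Arr C" "Dom C a = Dom C h" "Cod C a = Dom C k" "k ##\<^bsub>C\<^esub> a = h" by (rule C.kernel_lift[OF k h])
   have "k' ##\<^bsub>C\<^esub> (u ##\<^bsub>C\<^esub> a) = h" using C.assoc_rewrite[OF k'(4), of a] a by simp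
   then show "EX v. v : Arr C & Dom C v = Dom C h & Cod C v = Dom C k' & k' ##\<^bsub>C\<^esub> v = h"
    using a by (intro exI[of _ "u ##\<^bsub>C\<^esub> a"]) simp
  qed (use z in simp_all)
  moreover obtain k0 where "k0 : Arr X" "Dom X k0 = K" "Cod X k0 = Dom X f" "FArr U k0 = k'"
   by (rule U_full[of k' K "Dom X f"]) simp_all
  ultimately show ?thesis using reflect_kernel[of f k0] by auto
 qed
 moreover have "EX q. stable_cokernel X x q" if x: "x : Arr X" for x
 proof -
  note [simp] = x
  obtain c where c: "is_cokernel C (FArr U x) c" using C.cokernel_ex[of "FArr U x"] by auto
  note cd = C.cokernelD[OF c]
  have cd3: "Dom C c = FObj U (Cod X x)" using cd(3) by simp
  obtain u B where u: "B : Obj X" "u : Arr C" "Dom C u = Cod C c" "Cod C u = FObj U B" "universal C S u"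
   and ust: "!!f p q. Dom C f : S ==> is_pullback C f u p q ==> universal C S p"
   by (rule semi_reflE[of "Cod C c"]) (use cd in simp_all)
  note [simp] = cd(2) cd3 u(1-4)
  obtain q where q: "q : Arr X" "Dom X q = Cod X x" "Cod X q = B" "FArr U q = u ##\<^bsub>C\<^esub> c"
   by (rule U_full[of "u ##\<^bsub>C\<^esub> c" "Cod X x" B]) simp_all
  note [simp] = q
  have cok: "is_cokernel X z v" if z: "z : Arr X" and v: "v : Arr X" "Dom X v = Cod X z"
   and t: "is_cokernel C (FArr U z) t" and p: "universal C S p" "Dom C p = Cod C t" and e: "FArr U v = p ##\<^bsub>C\<^esub> t" for z v t p
  proof -
   note td = C.cokernelD[OF t]
   have pc: "Cod C p = FObj U (Cod X v)" using arg_cong[OF e, of "Cod C"] v td C.universalD(1)[OF p(1)] p(2) by simp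
   have td3: "Dom C t = FObj U (Cod X z)" using td(3) z by simp
   have tz: "t ##\<^bsub>C\<^esub> FArr U z = zero_arr C (FObj U (Dom X z)) (Cod C t)" using td(4) z by simp
   note [simp] = z v td(2) td3 p(2) pc C.universalD(1)[OF p(1)]
   show ?thesis
   proof (rule X.cokernelI)
    show "v ##\<^bsub>X\<^esub> z = zero_arr X (Dom X z) (Cod X v)" by (rule U_eqI) (simp_all add: e tz)
    show "epi_in X v"
    proof (rule X.epiI)
     fix a b assume h: "a : Arr X" "b : Arr X" "Cod X a = Cod X b" "Dom X a = Cod X v" "Dom X b = Cod X v" "a ##\<^bsub>X\<^esub> v = b ##\<^bsub>X\<^esub> v"
     have "FArr U a ##\<^bsub>C\<^esub> (p ##\<^bsub>C\<^esub> t) = FArr U b ##\<^bsub>C\<^esub> (p ##\<^bsub>C\<^esub> t)"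
      using U_comp[of v a] U_comp[of v b] h by (simp add: e)
     then have "(FArr U a ##\<^bsub>C\<^esub> p) ##\<^bsub>C\<^esub> t = (FArr U b ##\<^bsub>C\<^esub> p) ##\<^bsub>C\<^esub> t" using h by simp
     then have "FArr U a ##\<^bsub>C\<^esub> p = FArr U b ##\<^bsub>C\<^esub> p" by (rule C.epiD[OF td(5)]) (use h in simp_all)
     then have "FArr U a = FArr U b" by (rule C.universal_unique[OF p(1), rotated -1]) (use h in simp_all)
     then show "a = b" by (rule U_eqI) (use h in simp_all)
    qed simp
    fix h assume h: "h : Arr X" "Dom X h = Cod X z" "h ##\<^bsub>X\<^esub> z = zero_arr X (Dom X z) (Cod X h)"
    have hz: "FArr U h ##\<^bsub>C\<^esub> FArr U z = zero_arr C (Dom C (FArr U z)) (Cod C (FArr U h))"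
     using U_comp[of z h] h by simp
    obtain y where y: "y : Arr C" "Dom C y = Cod C t" "Cod C y = Cod C (FArr U h)" "y ##\<^bsub>C\<^esub> t = FArr U h"
     by (rule C.cokernel_desc[OF t _ _ hz]) (use h in simp_all)
    obtain g where g: "g : Arr C" "Dom C g = Cod C p" "Cod C g = Cod C y" "g ##\<^bsub>C\<^esub> p = y"
     by (rule C.universal_ext[OF p(1), of y]) (use y h in simp_all)
    obtain g' where g': "g' : Arr X" "Dom X g' = Cod X v" "Cod X g' = Cod X h" "FArr U g' = g"
     by (rule U_full[of g "Cod X v" "Cod X h"]) (use g y h in simp_all)
    have "g' ##\<^bsub>X\<^esub> v = h"
     by (rule U_eqI) (use g g' y h C.assoc_rewrite[OF g(4), of t] in \<open>simp_all add: e\<close>)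
    then show "EX u. u : Arr X & Dom X u = Cod X v & Cod X u = Cod X h & u ##\<^bsub>X\<^esub> v = h" using g' by blast
   qed simp_all
  qed
  have "is_cokernel X x q" by (rule cok[OF x _ _ c u(5)]) simp_all
  moreover have "is_cokernel X x' v" if f: "f : Arr X" "Cod X f = Cod X q" and pb: "is_pullback X q f a v"
   and x': "x' : Hom X (Dom X x) (Dom X a)" "a ##\<^bsub>X\<^esub> x' = x" "v ##\<^bsub>X\<^esub> x' = zero_arr X (Dom X x) (Dom X f)" for f a v x'
  proof -
   note pd = X.pullbackD[OF pb]
   note [simp] = f pd(3,4,6-8) x'(1)[unfolded in_Hom]
   have pbC: "is_pullback C (u ##\<^bsub>C\<^esub> c) (FArr U f) (FArr U a) (FArr U v)" using preserve_pullback[OF pb] by simp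
   obtain p r where pr: "is_pullback C (FArr U f) u p r" using C.pullback_ex[of "FArr U f" u] by auto
   have pu: "universal C S p" by (rule ust[OF _ pr]) simp
   have prd: "p : Arr C" "r : Arr C" "Dom C p = Dom C r" "Cod C p = FObj U (Dom X f)" "Cod C r = Cod C c" "FArr U f ##\<^bsub>C\<^esub> p = u ##\<^bsub>C\<^esub> r"
    using C.pullbackD[OF pr] by simp_all
   note [simp] = prd(1-5)
   have fv: "FArr U f ##\<^bsub>C\<^esub> FArr U v = u ##\<^bsub>C\<^esub> (c ##\<^bsub>C\<^esub> FArr U a)" using C.pullbackD(9)[OF pbC] by simp
   obtain t where t: "t : Arr C" "Dom C t = Dom C (FArr U v)" "Cod C t = Dom C p" "p ##\<^bsub>C\<^esub> t = FArr U v" "r ##\<^bsub>C\<^esub> t = c ##\<^bsub>C\<^esub> FArr U a"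
    by (rule C.pullback_lift[OF pr _ _ _ _ _ fv]) simp_all
   note [simp] = t(1-3)
   have pb2: "is_pullback C c r (FArr U a) t"
   proof (rule C.pullbackI)
    show "c ##\<^bsub>C\<^esub> FArr U a = r ##\<^bsub>C\<^esub> t" using t(5) by simp
    fix h k assume h: "h : Arr C" "k : Arr C" "Dom C h = Dom C k" "Cod C h = Dom C c" "Cod C k = Dom C r" "c ##\<^bsub>C\<^esub> h = r ##\<^bsub>C\<^esub> k"
    have "(u ##\<^bsub>C\<^esub> c) ##\<^bsub>C\<^esub> h = FArr U f ##\<^bsub>C\<^esub> (p ##\<^bsub>C\<^esub> k)" using C.assoc_rewrite[OF prd(6), of k] h by simp
    then obtain w where w: "w : Arr C" "Dom C w = Dom C h" "Cod C w = Dom C (FArr U a)" "FArr U a ##\<^bsub>C\<^esub> w = h" "FArr U v ##\<^bsub>C\<^esub> w = p ##\<^bsub>C\<^esub> k"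
     using C.pullback_lift[OF pbC, of h "p ##\<^bsub>C\<^esub> k"] h by auto
    have "t ##\<^bsub>C\<^esub> w = k"
    proof (rule C.pullback_unique[OF pr])
     show "p ##\<^bsub>C\<^esub> (t ##\<^bsub>C\<^esub> w) = p ##\<^bsub>C\<^esub> k" using C.assoc_rewrite[OF t(4), of w] w h by simp
     show "r ##\<^bsub>C\<^esub> (t ##\<^bsub>C\<^esub> w) = r ##\<^bsub>C\<^esub> k" using C.assoc_rewrite[OF t(5), of w] w h by simp
    qed (use w h in simp_all)
    then show "EX w. w : Arr C & Dom C w = Dom C h & Cod C w = Dom C (FArr U a) & FArr U a ##\<^bsub>C\<^esub> w = h & t ##\<^bsub>C\<^esub> w = k"
     using w by blast
   next
    fix y z assume h: "y : Arr C" "z : Arr C" "Dom C y = Dom C z" "Cod C y = Dom C (FArr U a)" "Cod C z = Dom C (FArr U a)"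
     "FArr U a ##\<^bsub>C\<^esub> y = FArr U a ##\<^bsub>C\<^esub> z" "t ##\<^bsub>C\<^esub> y = t ##\<^bsub>C\<^esub> z"
    have "FArr U v ##\<^bsub>C\<^esub> y = FArr U v ##\<^bsub>C\<^esub> z"
     using C.assoc_rewrite[OF t(4), of y] C.assoc_rewrite[OF t(4), of z] h by simp
    then show "y = z" by (rule C.pullback_unique[OF pbC h(1-6)])
   qed simp_all
   have Ux: "FArr U a ##\<^bsub>C\<^esub> FArr U x' = FArr U x" using U_comp[of x' a] x'(2) by simp
   have Uv: "FArr U v ##\<^bsub>C\<^esub> FArr U x' = zero_arr C (FObj U (Dom X x)) (FObj U (Dom X f))" using U_comp[of x' v] x'(3) by simp
   have tx: "t ##\<^bsub>C\<^esub> FArr U x' = zero_arr C (FObj U (Dom X x)) (Dom C r)"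
   proof (rule C.pullback_unique[OF pr])
    show "p ##\<^bsub>C\<^esub> (t ##\<^bsub>C\<^esub> FArr U x') = p ##\<^bsub>C\<^esub> zero_arr C (FObj U (Dom X x)) (Dom C r)"
     using C.assoc_rewrite[OF t(4), of "FArr U x'"] Uv by simp
    have "c ##\<^bsub>C\<^esub> (FArr U a ##\<^bsub>C\<^esub> FArr U x') = zero_arr C (FObj U (Dom X x)) (Cod C c)" using cd(4) by (simp add: Ux)
    then show "r ##\<^bsub>C\<^esub> (t ##\<^bsub>C\<^esub> FArr U x') = r ##\<^bsub>C\<^esub> zero_arr C (FObj U (Dom X x)) (Dom C r)"
     using C.assoc_rewrite[OF t(5), of "FArr U x'"] by simp
   qed simp_all
   have ct: "is_cokernel C (FArr U x') t"
    by (rule C.cokernel_stable[OF c pb2]) (use Ux tx in simp_all)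
   show ?thesis by (rule cok[OF _ _ _ ct pu]) (simp_all add: t(4))
  qed
  ultimately have "stable_cokernel X x q" unfolding stable_cokernel_def by blast
  then show ?thesis ..
 qed
 ultimately show ?thesis by unfold_locales (simp_all add: has_stable_cokernels_def)
qed

end

section \<open>Torsion theories\<close>

lemma (in stable_additive) torsion_theory_semi_reflective:
 assumes tt: "torsion_theory C \<T> \<F>"
 shows "semi_reflective C \<F>"
  "!!Q u. universal C \<F> u ==> regular_epi C u"
proof -
 have F: "\<F> \<subseteq> Obj C" and hom0: "!!A B f. A : \<T> ==> B : \<F> ==> f : Hom C A B ==> f = zero_arr C A B"
  and seq: "!!B. B : Obj C ==> EX k q. Cod C k = B & Dom C q = B & Dom C k : \<T> & Cod C q : \<F> \<and>
    is_kernel C q k & is_cokernel C k q"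
  using tt unfolding torsion_theory_def replete_def by blast+
 have un: "universal C \<F> v" if k: "is_cokernel C k v" "Dom C k : \<T>" "Cod C v : \<F>" for k v
 proof (rule universalI)
  note d = cokernelD[OF k(1)]
  show "v : Arr C" "Cod C v : \<F>" using d k by blast+
  fix h assume h: "h : Arr C" "Dom C h = Dom C v" "Cod C h : \<F>"
  have "h ## k = \<zero> (Dom C k) (Cod C h)" by (rule hom0[OF k(2) h(3)]) (use h d in simp)
  then obtain g where "g : Arr C" "Dom C g = Cod C v" "Cod C g = Cod C h" "g ## v = h"
   using cokernel_desc[OF k(1), of h] h d by auto
  then show "EX g. g : Arr C & Dom C g = Cod C v & Cod C g = Cod C h & g ## v = h" by blast
 next
  fix f g assume "f : Arr C" "g : Arr C" "Dom C f = Cod C v" "Dom C g = Cod C v" "Cod C f = Cod C g" "f ## v = g ## v"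
  then show "f = g" by (intro epiD[OF cokernelD(5)[OF k(1)], of f g])
 qed
 have "EX u. Dom C u = Q & universal C \<F> u & (ALL f p q. Dom C f : \<F> \<longrightarrow> is_pullback C f u p q \<longrightarrow> universal C \<F> p)"
  if Q: "Q : Obj C" for Q
 proof -
  obtain k u where ku: "Cod C k = Q" "Dom C u = Q" "Dom C k : \<T>" "Cod C u : \<F>" "is_kernel C u k" "is_cokernel C k u"
   using seq[OF Q] by blast
  note kd = kernelD[OF ku(5)]
  have "universal C \<F> p" if f: "Dom C f : \<F>" and pb: "is_pullback C f u p q" for f p q
  proof -
   note pd = pullbackD[OF pb]
   have pb': "is_pullback C u f q p"
   proof (rule pullbackI)
    fix h l assume "h : Arr C" "l : Arr C" "Dom C h = Dom C l" "Cod C h = Dom C u" "Cod C l = Dom C f" "u ## h = f ## l"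
    then show "EX w. w : Arr C & Dom C w = Dom C h & Cod C w = Dom C q & q ## w = h & p ## w = l"
     using pullback_lift[OF pb, of l h] pd(6) by metis
   next
    fix a b assume "a : Arr C" "b : Arr C" "Dom C a = Dom C b" "Cod C a = Dom C q" "Cod C b = Dom C q" "q ## a = q ## b" "p ## a = p ## b"
    then show "a = b" using pullback_unique[OF pb, of a b] pd(6) by metis
   qed (use pd in simp_all)
   obtain k' where k': "is_kernel C p k'" "Dom C k' = Dom C k" "q ## k' = k" by (rule pullback_of_kernel[OF pb' ku(5)])
   note kd' = kernelD[OF k'(1)]
   have "is_cokernel C k' p"
    by (rule cokernel_stable[OF ku(6) pb']) (use kd' k' pd in simp_all)
   then show ?thesis by (rule un) (use k' ku f pd in simp_all)
  qed
  then show ?thesis using un[OF ku(6,3,4)] ku(2) by blast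
 qed
 then show "semi_reflective C \<F>" using F unfolding semi_reflective_def by blast
 fix Q u assume u: "universal C \<F> u"
 have Q: "Dom C u : Obj C" using universalD(1)[OF u] by simp
 obtain k v where ku: "Cod C k = Dom C u" "Dom C v = Dom C u" "Dom C k : \<T>" "Cod C v : \<F>" "is_cokernel C k v"
   using seq[OF Q] by blast
 have v: "universal C \<F> v" by (rule un[OF ku(5,3,4)])
 obtain i where i: "i : Arr C" "Dom C i = Cod C v" "Cod C i = Cod C u" "i ## v = u"
  by (rule universal_ext[OF v, of u]) (use universalD[OF u] ku in simp_all)
 have "iso_in C i" by (rule universal_iso[OF v u ku(2) i])
 from cokernel_comp_iso[OF ku(5) this i(2)] i(4) show "regular_epi C u" using regular_epi_iff by auto
qed

section \<open>Covers\<close>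

context regular_additive
begin

lemma coverD: "regular_epi C e ==> e : Arr C" "regular_epi C e ==> epi_in C e"
 using regular_epi_iff cokernelD(2,5) by blast+

lemma cover_desc:
 assumes e: "regular_epi C e" and h: "h : Arr C" "Dom C h = Dom C e"
  and kill: "!!k. k : Arr C ==> Cod C k = Dom C e ==> e ## k = \<zero> (Dom C k) (Cod C e) ==> h ## k = \<zero> (Dom C k) (Cod C h)"
 obtains u where "u : Arr C" "Dom C u = Cod C e" "Cod C u = Cod C h" "u ## e = h"
proof -
 obtain x where x: "is_cokernel C x e" using e regular_epi_iff by blast
 have "h ## x = \<zero> (Dom C x) (Cod C h)" by (rule kill) (use cokernelD[OF x] in simp_all)
 then show thesis using that cokernel_desc[OF x h(1)] h(2) cokernelD(3)[OF x] by auto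
qed

lemma cover_id: "A : Obj C ==> regular_epi C (Id C A)"
proof -
 assume A: "A : Obj C"
 have "is_cokernel C (\<zero> A A) (Id C A)"
 proof (rule cokernelI)
  fix h assume "h : Arr C" "Dom C h = Cod C (\<zero> A A)"
  then show "EX u. u : Arr C & Dom C u = Cod C (Id C A) & Cod C u = Cod C h & u ## Id C A = h"
   using A by (intro exI[of _ h]) simp
 qed (use A iso_epi[OF iso_id[OF A]] in simp_all)
 then show ?thesis using regular_epi_iff by blast
qed

lemma mono_cover_iso:
 assumes m: "mono_in C m" and h: "h : Arr C" "Cod C h = Dom C m" and c: "regular_epi C (m ## h)"
 shows "iso_in C m"
proof -
 note [simp] = mono_arr[OF m] h
 obtain s where s: "s : Arr C" "Dom C s = Cod C (m ## h)" "Cod C s = Cod C h" "s ## (m ## h) = h"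
 proof (rule cover_desc[OF c, of h])
  fix k assume k: "k : Arr C" "Cod C k = Dom C (m ## h)" "(m ## h) ## k = \<zero> (Dom C k) (Cod C (m ## h))"
  show "h ## k = \<zero> (Dom C k) (Cod C h)"
   using mono_zeroD[OF m, of "h ## k"] k by simp
 qed simp_all
 have "m ## s = Id C (Cod C m)"
  by (rule epiD[OF coverD(2)[OF c]]) (use s in simp_all)
 then show ?thesis by (intro mono_retract_iso[OF m s(1)]) (use s in simp_all)
qed

lemma cover_comp:
 assumes d: "regular_epi C d" and e: "regular_epi C e" and de: "Cod C e = Dom C d"
 shows "regular_epi C (d ## e)"
proof -
 note [simp] = coverD(1)[OF d] coverD(1)[OF e] de
 obtain q m where q: "regular_epi C q" and m: "mono_in C m" and qm: "Cod C q = Dom C m" and f: "d ## e = m ## q"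
  using factor_ex[of "d ## e"] by auto
 note [simp] = coverD(1)[OF q] mono_arr[OF m] qm
 have cm: "Cod C m = Cod C d" using arg_cong[OF f, of "Cod C"] by simp
 have dq: "Dom C q = Dom C e" using arg_cong[OF f, of "Dom C"] by simp
 obtain s where s: "s : Arr C" "Dom C s = Cod C e" "Cod C s = Cod C q" "s ## e = q"
 proof (rule cover_desc[OF e, of q])
  fix k assume k: "k : Arr C" "Cod C k = Dom C e" "e ## k = \<zero> (Dom C k) (Cod C e)"
  have "m ## (q ## k) = (d ## e) ## k" using f k dq by simp
  also have "\<dots> = \<zero> (Dom C k) (Cod C m)" using k cm by simp
  finally show "q ## k = \<zero> (Dom C k) (Cod C q)" using mono_zeroD[OF m, of "q ## k"] k dq by simp
 qed (simp_all add: dq)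
 have ms: "m ## s = d"
  by (rule epiD[OF coverD(2)[OF e]]) (use s f cm in simp_all)
 then have "regular_epi C (m ## s)" using d by simp
 then have "iso_in C m" using mono_cover_iso[OF m s(1)] s(3) by simp
 obtain x where x: "is_cokernel C x q" using q regular_epi_iff by blast
 from cokernel_comp_iso[OF x \<open>iso_in C m\<close>] qm have "is_cokernel C x (m ## q)" by simp
 then show ?thesis unfolding f using regular_epi_iff by blast
qed

lemma cover_pullback:
 assumes e: "regular_epi C e" and f: "f : Arr C" "Cod C f = Cod C e"
 obtains e' f' where "regular_epi C e'" "e' : Arr C" "Cod C e' = Dom C f" "f' : Arr C" "Dom C f' = Dom C e'" "Cod C f' = Dom C e"
  "e ## f' = f ## e'"
proof -
 obtain p q where pb: "is_pullback C e f p q" using pullback_ex[of e f] coverD(1)[OF e] f by auto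
 note d = pullbackD[OF pb]
 have "regular_epi C q" using regular_epi_stable pb e unfolding regular_epis_pullback_stable_def by blast
 then show thesis by (rule that) (use d in simp_all)
qed

lemma cover_common:
 assumes d: "regular_epi C d" and e: "regular_epi C e" and de: "Cod C d = Cod C e"
 obtains a b where "a : Arr C" "b : Arr C" "Dom C a = Dom C b" "Cod C a = Dom C d" "Cod C b = Dom C e"
  "d ## a = e ## b" "regular_epi C (e ## b)"
proof -
 obtain b a where b: "regular_epi C b" "b : Arr C" "Cod C b = Dom C e" "a : Arr C" "Dom C a = Dom C b" "Cod C a = Dom C d" "d ## a = e ## b"
  by (rule cover_pullback[OF d coverD(1)[OF e]]) (use de in simp_all)
 show thesis by (rule that[OF b(4,2,5,6,3,7) cover_comp[OF e b(1,3)]])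
qed

end

section \<open>Relations as sets of pairs of generalized elements\<close>

definition El :: "('o, 'a) cat \<Rightarrow> 'a \<Rightarrow> 'a \<Rightarrow> 'a rel_class" where
 "El C r0 r1 = {(Comp C r0 h, Comp C r1 h) | h. h : Arr C & Cod C h = Dom C r0}"

definition rep :: "('o, 'a) cat \<Rightarrow> 'o \<Rightarrow> 'o \<Rightarrow> 'a rel_class \<Rightarrow> bool" where
 "rep C A B F \<longleftrightarrow> (EX r0 r1. jointly_monic C r0 r1 & Cod C r0 = A & Cod C r1 = B & F = El C r0 r1)"

definition spans :: "('o, 'a) cat \<Rightarrow> 'a rel_class \<Rightarrow> 'a rel_class" where
 "spans C F = {(t0, t1). jointly_monic C t0 t1 & El C t0 t1 = F}"

definition rcomp :: "('o, 'a) cat \<Rightarrow> 'a rel_class \<Rightarrow> 'a rel_class \<Rightarrow> 'a rel_class" where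
 "rcomp C G F = {(f, g). f : Arr C & g : Arr C & Dom C f = Dom C g \<and>
  (EX e y. regular_epi C e & Cod C e = Dom C g & (Comp C f e, y) : F & (y, Comp C g e) : G)}"

definition elems :: "('o, 'a) cat \<Rightarrow> 'a rel_class \<Rightarrow> 'a rel_class" where
 "elems C \<phi> = (\<Union>(t0, t1) \<in> \<phi>. El C t0 t1)"

context category
begin

lemma jmD:
 assumes "jointly_monic C r0 r1"
 shows "r0 : Arr C" "r1 : Arr C" "Dom C r0 = Dom C r1"
 using assms unfolding jointly_monic_def by blast+

lemma jm_unique:
 assumes "jointly_monic C r0 r1" "f : Arr C" "g : Arr C" "Dom C f = Dom C g" "Cod C f = Dom C r1" "Cod C g = Dom C r1"
  "r0 ## f = r0 ## g" "r1 ## f = r1 ## g"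
 shows "f = g"
proof -
 have "ALL T : Obj C. ALL f : Hom C T (Dom C r0). ALL g : Hom C T (Dom C r0). r0 ## f = r0 ## g & r1 ## f = r1 ## g \<longrightarrow> f = g"
  using assms(1) unfolding jointly_monic_def by blast
 from this[rule_format, of "Dom C g" f g] show ?thesis using assms jmD(3)[OF assms(1)] by simp
qed

lemma jmI:
 assumes "r0 : Arr C" "r1 : Arr C" "Dom C r0 = Dom C r1"
  "!!f g. f : Arr C ==> g : Arr C ==> Dom C f = Dom C g ==> Cod C f = Dom C r1 ==> Cod C g = Dom C r1 ==>
   r0 ## f = r0 ## g ==> r1 ## f = r1 ## g ==> f = g"
 shows "jointly_monic C r0 r1"
 unfolding jointly_monic_def
proof (intro conjI ballI impI)
 fix T f g assume "f : Hom C T (Dom C r0)" "g : Hom C T (Dom C r0)" "r0 ## f = r0 ## g & r1 ## f = r1 ## g"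
 then show "f = g" using assms(3) by (intro assms(4)[of f g]) simp_all
qed (fact assms)+

lemma ElE:
 assumes "(f, g) : El C r0 r1"
 obtains h where "h : Arr C" "Cod C h = Dom C r0" "f = r0 ## h" "g = r1 ## h"
 using assms unfolding El_def by blast

lemma ElI: "h : Arr C ==> Cod C h = Dom C r0 ==> (r0 ## h, r1 ## h) : El C r0 r1"
 unfolding El_def by blast

lemma El_self: "jointly_monic C r0 r1 ==> (r0, r1) : El C r0 r1"
 using ElI[of "Id C (Dom C r0)" r0 r1] jmD[of r0 r1] by simp

lemma repE:
 assumes "rep C A B F"
 obtains r0 r1 where "jointly_monic C r0 r1" "r0 : Arr C" "r1 : Arr C" "Dom C r0 = Dom C r1" "Cod C r0 = A" "Cod C r1 = B" "F = El C r0 r1"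
 using assms jmD unfolding rep_def by blast

lemma rep_obj: "rep C A B F ==> A : Obj C & B : Obj C"
 by (erule repE) auto

lemma rep_typed:
 assumes "rep C A B F" "(f, g) : F"
 shows "f : Arr C" "g : Arr C" "Dom C f = Dom C g" "Cod C f = A" "Cod C g = B"
proof -
 obtain r0 r1 where r: "jointly_monic C r0 r1" "r0 : Arr C" "r1 : Arr C" "Dom C r0 = Dom C r1" "Cod C r0 = A" "Cod C r1 = B" "F = El C r0 r1"
  using assms(1) by (rule repE)
 obtain h where h: "h : Arr C" "Cod C h = Dom C r0" "f = r0 ## h" "g = r1 ## h" using assms(2) r by (auto elim: ElE)
 show "f : Arr C" "g : Arr C" "Dom C f = Dom C g" "Cod C f = A" "Cod C g = B" using h r by simp_all
qed

lemma rep_precomp: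
 assumes "rep C A B F" "(f, g) : F" "h : Arr C" "Cod C h = Dom C g"
 shows "(f ## h, g ## h) : F"
proof -
 obtain r0 r1 where r: "jointly_monic C r0 r1" "r0 : Arr C" "r1 : Arr C" "Dom C r0 = Dom C r1" "Cod C r0 = A" "Cod C r1 = B" "F = El C r0 r1"
  using assms(1) by (rule repE)
 obtain k where k: "k : Arr C" "Cod C k = Dom C r0" "f = r0 ## k" "g = r1 ## k" using assms(2) r by (auto elim: ElE)
 have "(r0 ## (k ## h), r1 ## (k ## h)) : El C r0 r1" by (rule ElI) (use k r assms in simp_all)
 then show ?thesis using k r assms by simp
qed

lemma El_le_iff:
 assumes r: "jointly_monic C r0 r1" and s: "jointly_monic C s0 s1"
 shows "El C r0 r1 \<subseteq> El C s0 s1 \<longleftrightarrow> (EX h : Hom C (Dom C r0) (Dom C s0). s0 ## h = r0 & s1 ## h = r1)"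
proof
 assume "El C r0 r1 \<subseteq> El C s0 s1"
 then have "(r0, r1) : El C s0 s1" using El_self[OF r] by blast
 then obtain h where h: "h : Arr C" "Cod C h = Dom C s0" "r0 = s0 ## h" "r1 = s1 ## h" by (rule ElE)
 then have "Dom C r0 = Dom C h" using jmD[OF s] by simp
 then show "EX h : Hom C (Dom C r0) (Dom C s0). s0 ## h = r0 & s1 ## h = r1" using h by (intro bexI[of _ h]) simp_all
next
 assume "EX h : Hom C (Dom C r0) (Dom C s0). s0 ## h = r0 & s1 ## h = r1"
 then obtain h where h: "h : Arr C" "Dom C h = Dom C r0" "Cod C h = Dom C s0" "s0 ## h = r0" "s1 ## h = r1" by auto
 show "El C r0 r1 \<subseteq> El C s0 s1"
 proof (rule subrelI)
  fix f g assume "(f, g) : El C r0 r1"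
  then obtain k where k: "k : Arr C" "Cod C k = Dom C r0" "f = r0 ## k" "g = r1 ## k" by (rule ElE)
  have "(s0 ## (h ## k), s1 ## (h ## k)) : El C s0 s1" by (rule ElI) (use h k in simp_all)
  then show "(f, g) : El C s0 s1"
   using assoc_rewrite[OF h(4), of k] assoc_rewrite[OF h(5), of k] k h jmD[OF s] by simp
 qed
qed

lemma rel_class_eq_spans:
 assumes r: "jointly_monic C r0 r1"
 shows "rel_class C r0 r1 = spans C (El C r0 r1)"
proof (intro equalityI subrelI)
 note rd = jmD[OF r]
 fix t0 t1 assume "(t0, t1) : rel_class C r0 r1"
 then obtain i where i: "iso_in C i" "Cod C i = Dom C r0" "t0 = r0 ## i" "t1 = r1 ## i" unfolding rel_class_def by blast
 obtain j where j: "i : Arr C" "j : Arr C" "Dom C j = Cod C i" "Cod C j = Dom C i"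
  "j ## i = Id C (Dom C i)" "i ## j = Id C (Cod C i)" using i(1) by (rule isoE)
 note [simp] = rd(1,2) j(1-4) i(2) rd(3)
 have jm: "jointly_monic C t0 t1"
 proof (rule jmI)
  fix f g assume h: "f : Arr C" "g : Arr C" "Dom C f = Dom C g" "Cod C f = Dom C t1" "Cod C g = Dom C t1" "t0 ## f = t0 ## g" "t1 ## f = t1 ## g"
  have "i ## f = i ## g" by (rule jm_unique[OF r]) (use h i in simp_all)
  then show "f = g" by (rule monoD[OF iso_mono[OF i(1)]]) (use h i in simp_all)
 qed (use i in simp_all)
 have 1: "El C t0 t1 \<subseteq> El C r0 r1"
  unfolding El_le_iff[OF jm r] using i by (intro bexI[of _ i]) simp_all
 have "r0 ## (i ## j) = r0" "r1 ## (i ## j) = r1" using j(6) by simp_all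
 then have 2: "El C r0 r1 \<subseteq> El C t0 t1"
  unfolding El_le_iff[OF r jm] using i by (intro bexI[of _ j]) simp_all
 show "(t0, t1) : spans C (El C r0 r1)" unfolding spans_def using jm 1 2 by blast
next
 note rd = jmD[OF r]
 fix t0 t1 assume "(t0, t1) : spans C (El C r0 r1)"
 then have t: "jointly_monic C t0 t1" and e: "El C t0 t1 = El C r0 r1" unfolding spans_def by blast+
 note td = jmD[OF t]
 obtain i where i: "i : Arr C" "Dom C i = Dom C t0" "Cod C i = Dom C r0" "r0 ## i = t0" "r1 ## i = t1"
  using El_le_iff[OF t r] e by auto
 obtain j where j: "j : Arr C" "Dom C j = Dom C r0" "Cod C j = Dom C t0" "t0 ## j = r0" "t1 ## j = r1"
  using El_le_iff[OF r t] e by auto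
 have "i ## j = Id C (Dom C r1)"
  by (rule jm_unique[OF r])
   (use assoc_rewrite[OF i(4), of j] assoc_rewrite[OF i(5), of j] i(1-3) j rd in simp_all)
 moreover have "j ## i = Id C (Dom C t1)"
  by (rule jm_unique[OF t])
   (use assoc_rewrite[OF j(4), of i] assoc_rewrite[OF j(5), of i] j(1-3) i td rd in simp_all)
 ultimately have "iso_in C i" by (intro isoI[of i j]) (use i j rd td in simp_all)
 then show "(t0, t1) : rel_class C r0 r1" unfolding rel_class_def using i by auto
qed

lemma relations_iff: "\<phi> : relations C A B \<longleftrightarrow> (EX F. rep C A B F & \<phi> = spans C F)"
 unfolding relations_def rep_def using rel_class_eq_spans by auto metis+

lemma elems_spans:
 assumes "rep C A B F" shows "elems C (spans C F) = F"
proof -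
 obtain r0 r1 where r: "jointly_monic C r0 r1" "F = El C r0 r1" using assms by (auto elim: repE)
 have "(r0, r1) : spans C F" using r by (simp add: spans_def)
 moreover have "El C t0 t1 = F" if "(t0, t1) : spans C F" for t0 t1 using that by (simp add: spans_def)
 ultimately show ?thesis unfolding elems_def by blast
qed

lemma rep_converse:
 assumes "rep C A B F" shows "rep C B A (F\<inverse>)"
proof -
 obtain r0 r1 where r: "jointly_monic C r0 r1" "r0 : Arr C" "r1 : Arr C" "Dom C r0 = Dom C r1" "Cod C r0 = A" "Cod C r1 = B" "F = El C r0 r1"
  using assms(1) by (rule repE)
 have "jointly_monic C r1 r0" by (rule jmI) (use r jm_unique[OF r(1)] in simp_all)
 moreover have "F\<inverse> = El C r1 r0" unfolding r(7) El_def using r(4) by auto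
 ultimately show ?thesis unfolding rep_def using r by blast
qed

lemma spans_converse:
 assumes "rep C A B F" shows "(spans C F)\<inverse> = spans C (F\<inverse>)"
proof -
 have k: "(t1, t0) : spans C (G\<inverse>)" if t: "(t0, t1) : spans C G" for t0 t1 G
 proof -
  have j: "jointly_monic C t0 t1" "El C t0 t1 = G" using t by (simp_all add: spans_def)
  have "jointly_monic C t1 t0" by (rule jmI) (use jmD[OF j(1)] jm_unique[OF j(1)] in simp_all)
  moreover have "El C t1 t0 = G\<inverse>" unfolding j(2)[symmetric] El_def using jmD(3)[OF j(1)] by auto
  ultimately show ?thesis by (simp add: spans_def)
 qed
 show ?thesis
 proof (intro equalityI subrelI)
  fix a b assume "(a, b) : (spans C F)\<inverse>"
  then show "(a, b) : spans C (F\<inverse>)" using k[of b a F] by simp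
 next
  fix a b assume "(a, b) : spans C (F\<inverse>)"
  then show "(a, b) : (spans C F)\<inverse>" using k[of a b "F\<inverse>"] by simp
 qed
qed

lemma rel_le_iff:
 assumes F: "rep C A B F" and G: "rep C A' B' G"
 shows "rel_le C (spans C F) (spans C G) \<longleftrightarrow> F \<subseteq> G"
proof -
 obtain r0 r1 where r: "jointly_monic C r0 r1" "F = El C r0 r1" using F by (auto elim: repE)
 obtain s0 s1 where s: "jointly_monic C s0 s1" "G = El C s0 s1" using G by (auto elim: repE)
 have mem: "(r0, r1) : spans C F" "(s0, s1) : spans C G" using r s by (simp_all add: spans_def)
 have iff: "F \<subseteq> G \<longleftrightarrow> (EX h : Hom C (Dom C r0') (Dom C s0'). s0' ## h = r0' & s1' ## h = r1')"
  if "(r0', r1') : spans C F" "(s0', s1') : spans C G" for r0' r1' s0' s1'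
  using that El_le_iff[of r0' r1' s0' s1'] unfolding spans_def by (simp only: mem_Collect_eq case_prod_conv simp_thms)
 show ?thesis
 proof
  assume "rel_le C (spans C F) (spans C G)"
  then obtain x y where x: "x : spans C F" and y: "y : spans C G" and h: "case x of (r0, r1) \<Rightarrow> case y of (s0, s1) \<Rightarrow>
    EX h : Hom C (Dom C r0) (Dom C s0). s0 ## h = r0 & s1 ## h = r1"
   unfolding rel_le_def by fast
  obtain x0 x1 y0 y1 where xy: "x = (x0, x1)" "y = (y0, y1)" by (cases x, cases y) blast
  show "F \<subseteq> G" using iff[of x0 x1 y0 y1] x y h unfolding xy by (simp only: case_prod_conv)
 next
  assume "F \<subseteq> G"
  then show "rel_le C (spans C F) (spans C G)"
   unfolding rel_le_def using iff[OF mem] mem by (intro bexI[of _ "(r0, r1)"] bexI[of _ "(s0, s1)"] case_prodI) simp_all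
 qed
qed

end

context regular_additive
begin

lemma rep_local:
 assumes F: "rep C A B F" and e: "regular_epi C e" "Cod C e = Dom C g" and m: "(f ## e, g ## e) : F"
  and fg: "f : Arr C" "g : Arr C" "Dom C f = Dom C g"
 shows "(f, g) : F"
proof -
 obtain r0 r1 where r: "jointly_monic C r0 r1" "r0 : Arr C" "r1 : Arr C" "Dom C r0 = Dom C r1" "Cod C r0 = A" "Cod C r1 = B" "F = El C r0 r1"
  using F by (rule repE)
 obtain h where h: "h : Arr C" "Cod C h = Dom C r0" "f ## e = r0 ## h" "g ## e = r1 ## h" using m r by (auto elim: ElE)
 note ea = coverD(1)[OF e(1)]
 have "Dom C (f ## e) = Dom C h" unfolding h(3) using h r by simp
 then have dh: "Dom C h = Dom C e" using ea e fg by simp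
 have "Cod C (f ## e) = A" "Cod C (g ## e) = B" unfolding h(3,4) using h r by simp_all
 then have cf: "Cod C f = A" "Cod C g = B" using ea e fg by simp_all
 obtain u where u: "u : Arr C" "Dom C u = Cod C e" "Cod C u = Cod C h" "u ## e = h"
 proof (rule cover_desc[OF e(1) h(1) dh])
  fix k assume k: "k : Arr C" "Cod C k = Dom C e" "e ## k = \<zero> (Dom C k) (Cod C e)"
  have z: "r0 ## (h ## k) = \<zero> (Dom C k) A" "r1 ## (h ## k) = \<zero> (Dom C k) B"
   using assoc_rewrite[OF h(3)[symmetric], of k] assoc_rewrite[OF h(4)[symmetric], of k] h(1,2) dh k r fg e ea cf by simp_all
  show "h ## k = \<zero> (Dom C k) (Cod C h)"
   by (rule jm_unique[OF r(1)]) (use h(1,2) dh k r z in simp_all)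
 qed
 have "f = r0 ## u" "g = r1 ## u"
  by (rule epiD[OF coverD(2)[OF e(1)]], use u h r e ea fg cf in simp_all)+
 then show ?thesis using ElI[of u r0 r1] u h r by simp
qed

lemma rep_plus:
 assumes F: "rep C A B F" and m: "(f, g) : F" "(f', g') : F" "Dom C g = Dom C g'"
 shows "(f \<oplus> f', g \<oplus> g') : F"
proof -
 obtain r0 r1 where r: "jointly_monic C r0 r1" "r0 : Arr C" "r1 : Arr C" "Dom C r0 = Dom C r1" "Cod C r0 = A" "Cod C r1 = B" "F = El C r0 r1"
  using F by (rule repE)
 obtain h where h: "h : Arr C" "Cod C h = Dom C r0" "f = r0 ## h" "g = r1 ## h" using m r by (auto elim: ElE)
 obtain h' where h': "h' : Arr C" "Cod C h' = Dom C r0" "f' = r0 ## h'" "g' = r1 ## h'" using m r by (auto elim: ElE)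
 have d: "Dom C h = Dom C h'" using m(3) h h' r by simp
 have "(r0 ## (h \<oplus> h'), r1 ## (h \<oplus> h')) : F" unfolding r(7) by (rule ElI) (use h h' d in simp_all)
 then show ?thesis using h h' d r by (simp add: comp_pl)
qed

lemma rep_neg:
 assumes F: "rep C A B F" and m: "(f, g) : F"
 shows "(hom_neg C f, hom_neg C g) : F"
proof -
 obtain r0 r1 where r: "jointly_monic C r0 r1" "r0 : Arr C" "r1 : Arr C" "Dom C r0 = Dom C r1" "Cod C r0 = A" "Cod C r1 = B" "F = El C r0 r1"
  using F by (rule repE)
 obtain h where h: "h : Arr C" "Cod C h = Dom C r0" "f = r0 ## h" "g = r1 ## h" using m r by (auto elim: ElE)
 have "(r0 ## hom_neg C h, r1 ## hom_neg C h) : F" unfolding r(7) by (rule ElI) (use h in simp_all)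
 then show ?thesis using h r by (simp add: comp_ng)
qed

lemma rep_zero:
 assumes F: "rep C A B F" and T: "T : Obj C"
 shows "(\<zero> T A, \<zero> T B) : F"
proof -
 obtain r0 r1 where r: "jointly_monic C r0 r1" "r0 : Arr C" "r1 : Arr C" "Dom C r0 = Dom C r1" "Cod C r0 = A" "Cod C r1 = B" "F = El C r0 r1"
  using F by (rule repE)
 have "(r0 ## \<zero> T (Dom C r0), r1 ## \<zero> T (Dom C r0)) : F" unfolding r(7) by (rule ElI) (use r T in simp_all)
 then show ?thesis using r T by simp
qed

lemma rep_diff:
 assumes F: "rep C A B F" and m: "(f, g) : F" "(f', g') : F" "Dom C g = Dom C g'"
 shows "(f \<ominus> f', g \<ominus> g') : F"
 by (rule rep_plus[OF F m(1) rep_neg[OF F m(2)]]) (use m rep_typed[OF F m(2)] in simp)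

lemma rep_graph:
 assumes f: "f : Arr C"
 shows "rep C (Dom C f) (Cod C f) (El C (Id C (Dom C f)) f)"
proof -
 have "jointly_monic C (Id C (Dom C f)) f" by (rule jmI) (use f in simp_all)
 then show ?thesis unfolding rep_def using f by (intro exI[of _ "Id C (Dom C f)"] exI[of _ f]) simp
qed

lemma rep_gm:
 assumes S: "rep C A B S" and f: "f : Arr C" "Cod C f = A"
 shows "rep C (Dom C f) B {(x, y). x : Arr C & Cod C x = Dom C f & (f ## x, y) : S}"
proof -
 obtain s0 s1 where s: "jointly_monic C s0 s1" "s0 : Arr C" "s1 : Arr C" "Dom C s0 = Dom C s1" "Cod C s0 = A" "Cod C s1 = B" "S = El C s0 s1"
  using S by (rule repE)
 obtain a b where pb: "is_pullback C f s0 a b" using pullback_ex[of f s0] f s by auto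
 note d = pullbackD[OF pb]
 have db: "Cod C b = Dom C s1" using d s by simp
 have jm: "jointly_monic C a (s1 ## b)"
 proof (rule jmI)
  fix u v assume h: "u : Arr C" "v : Arr C" "Dom C u = Dom C v" "Cod C u = Dom C (s1 ## b)" "Cod C v = Dom C (s1 ## b)"
   "a ## u = a ## v" "(s1 ## b) ## u = (s1 ## b) ## v"
  have e1: "s1 ## (b ## u) = s1 ## (b ## v)" using h(1-5,7) d(3,4,6) db s by simp
  have "s0 ## (b ## u) = f ## (a ## u)" using assoc_rewrite[OF d(9)[symmetric], of u] h(1-5) d(1-4,6-8) db s by simp
  also have "\<dots> = s0 ## (b ## v)" unfolding h(6) using assoc_rewrite[OF d(9)[symmetric], of v] h(1-5) d(1-4,6-8) db s by simp
  finally have e0: "s0 ## (b ## u) = s0 ## (b ## v)" .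
  have e2: "b ## u = b ## v" by (rule jm_unique[OF s(1) _ _ _ _ _ e0 e1]) (use h(1-5) d(3,4,6) db s in simp_all)
  show "u = v" by (rule pullback_unique[OF pb _ _ _ _ _ h(6) e2]) (use h(1-5) d(3,4,6) db s in simp_all)
 qed (use d db s in simp_all)
 have "El C a (s1 ## b) = {(x, y). x : Arr C & Cod C x = Dom C f & (f ## x, y) : S}"
 proof (intro equalityI subrelI)
  fix x y assume "(x, y) : El C a (s1 ## b)"
  then obtain h where h: "h : Arr C" "Cod C h = Dom C a" "x = a ## h" "y = (s1 ## b) ## h" by (rule ElE)
  have "(s0 ## (b ## h), s1 ## (b ## h)) : S" unfolding s(7) by (rule ElI) (use h d in simp_all)
  moreover have "s0 ## (b ## h) = f ## (a ## h)" using assoc_rewrite[OF d(9)[symmetric], of h] h d(1-4,6-8) s by simp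
  ultimately show "(x, y) : {(x, y). x : Arr C & Cod C x = Dom C f & (f ## x, y) : S}" using h d(1-4,6-8) db s by simp
 next
  fix x y assume "(x, y) : {(x, y). x : Arr C & Cod C x = Dom C f & (f ## x, y) : S}"
  then have x: "x : Arr C" "Cod C x = Dom C f" "(f ## x, y) : S" by blast+
  then obtain h where h: "h : Arr C" "Cod C h = Dom C s0" "f ## x = s0 ## h" "y = s1 ## h" using s by (auto elim: ElE)
  have "Dom C (f ## x) = Dom C h" unfolding h(3) using h s by simp
  then have "Dom C x = Dom C h" using x f by simp
  then obtain u where u: "u : Arr C" "Dom C u = Dom C x" "Cod C u = Dom C a" "a ## u = x" "b ## u = h"
   using pullback_lift[OF pb x(1) h(1) _ x(2) h(2,3)] by blast
  have "(a ## u, (s1 ## b) ## u) : El C a (s1 ## b)" by (rule ElI) (use u in simp_all)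
  moreover have "(s1 ## b) ## u = y" using u h d s db by simp
  ultimately show "(x, y) : El C a (s1 ## b)" using u by simp
 qed
 then show ?thesis unfolding rep_def using jm d db s by (intro exI[of _ a] exI[of _ "s1 ## b"]) simp
qed

lemma rep_pull:
 assumes F: "rep C A B F" and p: "p : Arr C" "Cod C p = B"
 shows "rep C A (Dom C p) {(x, h). h : Arr C & Cod C h = Dom C p & (x, p ## h) : F}"
proof -
 have "{(x, h). h : Arr C & Cod C h = Dom C p & (x, p ## h) : F} =
  {(x, y). x : Arr C & Cod C x = Dom C p & (p ## x, y) : F\<inverse>}\<inverse>" by auto
 then show ?thesis using rep_converse[OF rep_gm[OF rep_converse[OF F] p]] by simp
qed

lemma rep_inter:
 assumes F: "rep C A B F" and G: "rep C A B G"
 shows "rep C A B (F \<inter> G)"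
proof -
 obtain r0 r1 where r: "jointly_monic C r0 r1" "r0 : Arr C" "r1 : Arr C" "Dom C r0 = Dom C r1" "Cod C r0 = A" "Cod C r1 = B" "F = El C r0 r1"
  using F by (rule repE)
 have AB: "A : Obj C" "B : Obj C" using rep_obj[OF F] by blast+
 have R: "rep C (Dom C r1) B {(x, y). x : Arr C & Cod C x = Dom C r0 & (r0 ## x, y) : G}" using rep_gm[OF G r(2,5)] r(4) by simp
 then obtain t0 t1 where t: "jointly_monic C t0 t1" "t0 : Arr C" "t1 : Arr C" "Dom C t0 = Dom C t1" "Cod C t0 = Dom C r1" "Cod C t1 = B"
  "{(x, y). x : Arr C & Cod C x = Dom C r0 & (r0 ## x, y) : G} = El C t0 t1" by (rule repE)
 obtain k where k: "is_kernel C (r1 ## t0 \<ominus> t1) k" using kernel_ex[of "r1 ## t0 \<ominus> t1"] t r by auto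
 note kd = kernelD[OF k]
 have ck: "Cod C k = Dom C t1" using kd(3) t r by simp
 have k0: "r1 ## (t0 ## k) = t1 ## k" using kd(4) kd(2) ck t r by (simp add: minus_comp minus_eq_zero_iff)
 note ty = kd(2) ck t(2-6) r(2-6)
 have jm: "jointly_monic C (r0 ## (t0 ## k)) (r1 ## (t0 ## k))"
 proof (rule jmI)
  fix u v assume h: "u : Arr C" "v : Arr C" "Dom C u = Dom C v" "Cod C u = Dom C (r1 ## (t0 ## k))" "Cod C v = Dom C (r1 ## (t0 ## k))"
   "(r0 ## (t0 ## k)) ## u = (r0 ## (t0 ## k)) ## v" "(r1 ## (t0 ## k)) ## u = (r1 ## (t0 ## k)) ## v"
  have e0: "t0 ## (k ## u) = t0 ## (k ## v)" by (rule jm_unique[OF r(1)]) (use h ty in simp_all)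
  have e1: "t1 ## (k ## u) = t1 ## (k ## v)" using h(7) unfolding k0 using h(1-5) ty by simp
  have "k ## u = k ## v" by (rule jm_unique[OF t(1) _ _ _ _ _ e0 e1]) (use h(1-5) ty in simp_all)
  then show "u = v" by (rule monoD[OF kd(5)]) (use h(1-5) ty in simp_all)
 qed (use ty in simp_all)
 have "El C (r0 ## (t0 ## k)) (r1 ## (t0 ## k)) = F \<inter> G"
 proof (intro equalityI subrelI)
  fix x y assume "(x, y) : El C (r0 ## (t0 ## k)) (r1 ## (t0 ## k))"
  then obtain h where h: "h : Arr C" "Cod C h = Dom C (r0 ## (t0 ## k))" "x = (r0 ## (t0 ## k)) ## h" "y = (r1 ## (t0 ## k)) ## h" by (rule ElE)
  have "(r0 ## (t0 ## (k ## h)), r1 ## (t0 ## (k ## h))) : F" unfolding r(7) by (rule ElI) (use h(1,2) ty in simp_all)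
  then have 1: "(x, y) : F" using h ty by simp
  have "(t0 ## (k ## h), t1 ## (k ## h)) : El C t0 t1" by (rule ElI) (use h(1,2) ty in simp_all)
  then have "(r0 ## (t0 ## (k ## h)), t1 ## (k ## h)) : G" unfolding t(7)[symmetric] by blast
  moreover have "t1 ## (k ## h) = y" unfolding h(4) k0 using h(1,2) ty by simp
  moreover have "r0 ## (t0 ## (k ## h)) = x" unfolding h(3) using h(1,2) ty by simp
  ultimately show "(x, y) : F \<inter> G" using 1 by simp
 next
  fix x y assume xy: "(x, y) : F \<inter> G"
  then obtain h where h: "h : Arr C" "Cod C h = Dom C r0" "x = r0 ## h" "y = r1 ## h" using r by (auto elim: ElE)
  then have "(h, y) : El C t0 t1" unfolding t(7)[symmetric] using xy by auto
  then obtain u where u: "u : Arr C" "Cod C u = Dom C t0" "h = t0 ## u" "y = t1 ## u" by (rule ElE)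
  have "r1 ## (t0 ## u) = t1 ## u" using h u by simp
  then have z: "(r1 ## t0 \<ominus> t1) ## u = \<zero> (Dom C u) (Cod C (r1 ## t0 \<ominus> t1))"
   using u(1,2) ty by (simp add: minus_comp minus_eq_zero_iff)
  obtain w where w: "w : Arr C" "Dom C w = Dom C u" "Cod C w = Dom C k" "k ## w = u"
   by (rule kernel_lift[OF k u(1) _ z]) (use u(2) ty in simp_all)
  have "((r0 ## (t0 ## k)) ## w, (r1 ## (t0 ## k)) ## w) : El C (r0 ## (t0 ## k)) (r1 ## (t0 ## k))"
   by (rule ElI) (use w ty in simp_all)
  moreover have "(r0 ## (t0 ## k)) ## w = x" "(r1 ## (t0 ## k)) ## w = y" using w h u ty by simp_all
  ultimately show "(x, y) : El C (r0 ## (t0 ## k)) (r1 ## (t0 ## k))" by simp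
 qed
 then show ?thesis unfolding rep_def using jm ty by (intro exI[of _ "r0 ## (t0 ## k)"] exI[of _ "r1 ## (t0 ## k)"]) simp
qed

lemma span_image:
 assumes a: "a0 : Arr C" "a1 : Arr C" "Dom C a0 = Dom C a1"
 obtains t0 t1 e where "jointly_monic C t0 t1" "regular_epi C e" "Dom C e = Dom C a0" "Cod C e = Dom C t0"
  "t0 ## e = a0" "t1 ## e = a1" "Cod C t0 = Cod C a0" "Cod C t1 = Cod C a1"
proof -
 obtain P i j p q where b: "biprod C (hom_plus C) (zero_arr C) (Cod C a0) (Cod C a1) P i j p q"
  by (rule biprodE[of "Cod C a0" "Cod C a1"]) (use a in simp_all)
 note bs = biprod_simps(1-15)[OF b]
 obtain w where w: "w : Arr C" "Dom C w = Dom C a0" "Cod C w = P" "p ## w = a0" "q ## w = a1"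
  by (rule biprod_pair[OF b a(1,2,3)]) simp_all
 obtain e m where e: "regular_epi C e" and m: "mono_in C m" and em: "Cod C e = Dom C m" and we: "w = m ## e"
  using factor_ex[OF w(1)] by blast
 note ty = coverD(1)[OF e] mono_arr[OF m] em
 have cm: "Cod C m = P" "Dom C e = Dom C a0" using w(2,3) unfolding we using ty by simp_all
 have "jointly_monic C (p ## m) (q ## m)"
 proof (rule jmI)
  fix f g assume h: "f : Arr C" "g : Arr C" "Dom C f = Dom C g" "Cod C f = Dom C (q ## m)" "Cod C g = Dom C (q ## m)"
   "(p ## m) ## f = (p ## m) ## g" "(q ## m) ## f = (q ## m) ## g"
  have "m ## f = m ## g" by (rule biprod_unique[OF b]) (use h bs ty cm in simp_all)
  then show "f = g" by (rule monoD[OF m]) (use h(1-5) bs ty cm in simp_all)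
 qed (use bs ty cm in simp_all)
 then show thesis
  by (rule that[OF _ e]) (use w(4,5) bs ty cm in \<open>simp_all add: we\<close>)
qed

lemma El_span_image:
 assumes a: "a0 : Arr C" "a1 : Arr C" "Dom C a0 = Dom C a1"
  and t: "jointly_monic C t0 t1" and e: "regular_epi C e" "Dom C e = Dom C a0" "Cod C e = Dom C t0" "t0 ## e = a0" "t1 ## e = a1"
 shows "El C t0 t1 = {(f, g). f : Arr C & g : Arr C & Dom C f = Dom C g \<and>
  (EX c h. regular_epi C c & Cod C c = Dom C g & h : Arr C & Cod C h = Dom C a0 & Dom C h = Dom C c & f ## c = a0 ## h & g ## c = a1 ## h)}"
proof (intro equalityI subrelI)
 note td = jmD[OF t]
 fix f g assume "(f, g) : El C t0 t1"
 then obtain k where k: "k : Arr C" "Cod C k = Dom C t0" "f = t0 ## k" "g = t1 ## k" by (rule ElE)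
 obtain c h where c: "regular_epi C c" "c : Arr C" "Cod C c = Dom C k" "h : Arr C" "Dom C h = Dom C c" "Cod C h = Dom C e" "e ## h = k ## c"
  by (rule cover_pullback[OF e(1) k(1)]) (use k e in simp_all)
 note ea = coverD(1)[OF e(1)]
 have "f ## c = a0 ## h" "g ## c = a1 ## h"
  using assoc_rewrite[OF e(4), of h] assoc_rewrite[OF e(5), of h] c k ea e(2,3) td by simp_all
 then show "(f, g) : {(f, g). f : Arr C & g : Arr C & Dom C f = Dom C g \<and>
  (EX c h. regular_epi C c & Cod C c = Dom C g & h : Arr C & Cod C h = Dom C a0 & Dom C h = Dom C c & f ## c = a0 ## h & g ## c = a1 ## h)}"
  using c k td e(2) by (intro CollectI case_prodI conjI exI[of _ c] exI[of _ h]) simp_all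
next
 note td = jmD[OF t]
 fix f g assume "(f, g) : {(f, g). f : Arr C & g : Arr C & Dom C f = Dom C g \<and>
  (EX c h. regular_epi C c & Cod C c = Dom C g & h : Arr C & Cod C h = Dom C a0 & Dom C h = Dom C c & f ## c = a0 ## h & g ## c = a1 ## h)}"
 then obtain c h where c: "f : Arr C" "g : Arr C" "Dom C f = Dom C g" "regular_epi C c" "Cod C c = Dom C g" "h : Arr C" "Cod C h = Dom C a0"
  "Dom C h = Dom C c" "f ## c = a0 ## h" "g ## c = a1 ## h" by blast
 note ea = coverD(1)[OF e(1)]
 have R: "rep C (Cod C t0) (Cod C t1) (El C t0 t1)" unfolding rep_def using t by blast
 have "(t0 ## (e ## h), t1 ## (e ## h)) : El C t0 t1" by (rule ElI) (use ea e(2,3) c in simp_all)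
 moreover have "t0 ## (e ## h) = f ## c" "t1 ## (e ## h) = g ## c"
  using assoc_rewrite[OF e(4), of h] assoc_rewrite[OF e(5), of h] c(6-10) ea e(2,3) td by simp_all
 ultimately have "(f ## c, g ## c) : El C t0 t1" by simp
 then show "(f, g) : El C t0 t1" by (rule rep_local[OF R c(4,5) _ c(1-3)])
qed

lemma rcomp_span:
 assumes F: "jointly_monic C r0 r1" and G: "jointly_monic C s0 s1" and c: "Cod C r1 = Cod C s0"
  and pb: "is_pullback C r1 s0 p q"
 shows "rcomp C (El C s0 s1) (El C r0 r1) = {(f, g). f : Arr C & g : Arr C & Dom C f = Dom C g \<and>
  (EX e h. regular_epi C e & Cod C e = Dom C g & h : Arr C & Cod C h = Dom C (r0 ## p) & Dom C h = Dom C e \<and>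
    f ## e = (r0 ## p) ## h & g ## e = (s1 ## q) ## h)}"
proof -
 note rd = jmD[OF F] and sd = jmD[OF G] and pd = pullbackD[OF pb]
 have ty: "Cod C p = Dom C r0" "Cod C q = Dom C s1" using pd rd sd by simp_all
 have iff: "(EX y. (f ## e, y) : El C r0 r1 & (y, g ## e) : El C s0 s1) \<longleftrightarrow>
  (EX h. h : Arr C & Cod C h = Dom C (r0 ## p) & Dom C h = Dom C e & f ## e = (r0 ## p) ## h & g ## e = (s1 ## q) ## h)"
  if fg: "f : Arr C" "g : Arr C" "Dom C f = Dom C g" "e : Arr C" "Cod C e = Dom C g" for f g e
 proof
  assume "EX y. (f ## e, y) : El C r0 r1 & (y, g ## e) : El C s0 s1"
  then obtain y where y: "(f ## e, y) : El C r0 r1" "(y, g ## e) : El C s0 s1" by blast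
  obtain h where h: "h : Arr C" "Cod C h = Dom C r0" "f ## e = r0 ## h" "y = r1 ## h" using y(1) by (rule ElE)
  obtain k where k: "k : Arr C" "Cod C k = Dom C s0" "y = s0 ## k" "g ## e = s1 ## k" using y(2) by (rule ElE)
  have "Dom C (f ## e) = Dom C h" unfolding h(3) using h rd by simp
  then have dh: "Dom C h = Dom C e" using fg by simp
  have "Dom C (g ## e) = Dom C k" unfolding k(4) using k sd by simp
  then have dk: "Dom C k = Dom C e" using fg by simp
  obtain u where u: "u : Arr C" "Dom C u = Dom C h" "Cod C u = Dom C p" "p ## u = h" "q ## u = k"
   by (rule pullback_lift[OF pb h(1) k(1)]) (use h k dh dk rd in simp_all)
  show "EX h. h : Arr C & Cod C h = Dom C (r0 ## p) & Dom C h = Dom C e & f ## e = (r0 ## p) ## h & g ## e = (s1 ## q) ## h"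
   using u h k dh pd rd sd ty by (intro exI[of _ u]) simp
 next
  assume "EX h. h : Arr C & Cod C h = Dom C (r0 ## p) & Dom C h = Dom C e & f ## e = (r0 ## p) ## h & g ## e = (s1 ## q) ## h"
  then obtain h where h: "h : Arr C" "Cod C h = Dom C (r0 ## p)" "f ## e = (r0 ## p) ## h" "g ## e = (s1 ## q) ## h" by blast
  have ch: "Cod C h = Dom C q" using h(2) pd rd ty by simp
  have 1: "(r0 ## (p ## h), r1 ## (p ## h)) : El C r0 r1" by (rule ElI) (use h(1) ch pd ty in simp_all)
  have 2: "(s0 ## (q ## h), s1 ## (q ## h)) : El C s0 s1" by (rule ElI) (use h(1) ch pd ty in simp_all)
  have 3: "r1 ## (p ## h) = s0 ## (q ## h)" using assoc_rewrite[OF pd(9), of h] h(1) ch pd(1-4,6-8) by simp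
  have 4: "r0 ## (p ## h) = f ## e" "s1 ## (q ## h) = g ## e" using h ch pd(3,4,6) rd sd ty by simp_all
  show "EX y. (f ## e, y) : El C r0 r1 & (y, g ## e) : El C s0 s1" using 1 2 unfolding 3 4 by blast
 qed
 show ?thesis unfolding rcomp_def
 proof (intro Collect_cong, clarify)
  fix f g
  show "(f : Arr C & g : Arr C & Dom C f = Dom C g \<and>
    (EX e y. regular_epi C e & Cod C e = Dom C g & (f ## e, y) : El C r0 r1 & (y, g ## e) : El C s0 s1)) =
  (f : Arr C & g : Arr C & Dom C f = Dom C g \<and>
  (EX e h. regular_epi C e & Cod C e = Dom C g & h : Arr C & Cod C h = Dom C (r0 ## p) & Dom C h = Dom C e \<and>
    f ## e = (r0 ## p) ## h & g ## e = (s1 ## q) ## h))"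
   using iff[of f g] coverD(1) by blast
 qed
qed

lemma rep_rcomp:
 assumes F: "rep C A B F" and G: "rep C B D G"
 shows "rep C A D (rcomp C G F)" "rel_comp C (spans C G) (spans C F) = spans C (rcomp C G F)"
proof -
 have key: "El C t0 t1 = rcomp C G F"
  if r: "(r0, r1) : spans C F" and s: "(s0, s1) : spans C G" and pb: "is_pullback C r1 s0 p q"
   and t: "jointly_monic C t0 t1" and e: "regular_epi C e" "Dom C e = Dom C p" "Cod C e = Dom C t0" "t0 ## e = r0 ## p" "t1 ## e = s1 ## q"
  for r0 r1 s0 s1 p q e t0 t1
 proof -
  have r': "jointly_monic C r0 r1" "El C r0 r1 = F" and s': "jointly_monic C s0 s1" "El C s0 s1 = G" using r s by (simp_all add: spans_def)
  note rd = jmD[OF r'(1)] and sd = jmD[OF s'(1)] and pd = pullbackD[OF pb]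
  have ty: "r0 ## p : Arr C" "s1 ## q : Arr C" "Dom C (r0 ## p) = Dom C (s1 ## q)" "Dom C (r0 ## p) = Dom C p" using rd sd pd by simp_all
  show ?thesis
   using El_span_image[OF ty(1-3) t e(1) _ e(3-5)] rcomp_span[OF r'(1) s'(1) pd(5) pb] e(2) ty(4) r'(2) s'(2) by simp
 qed
 obtain r0 r1 where r: "jointly_monic C r0 r1" "r0 : Arr C" "r1 : Arr C" "Dom C r0 = Dom C r1" "Cod C r0 = A" "Cod C r1 = B" "F = El C r0 r1"
  using F by (rule repE)
 obtain s0 s1 where s: "jointly_monic C s0 s1" "s0 : Arr C" "s1 : Arr C" "Dom C s0 = Dom C s1" "Cod C s0 = B" "Cod C s1 = D" "G = El C s0 s1"
  using G by (rule repE)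
 have mem: "(r0, r1) : spans C F" "(s0, s1) : spans C G" using r s by (simp_all add: spans_def)
 obtain p q where pb: "is_pullback C r1 s0 p q" using pullback_ex[of r1 s0] r s by auto
 note pd = pullbackD[OF pb]
 have ty: "r0 ## p : Arr C" "s1 ## q : Arr C" "Dom C (r0 ## p) = Dom C (s1 ## q)" "Dom C (r0 ## p) = Dom C p"
  "Cod C (r0 ## p) = A" "Cod C (s1 ## q) = D" using r s pd by simp_all
 obtain t0 t1 e where t: "jointly_monic C t0 t1" "regular_epi C e" "Dom C e = Dom C (r0 ## p)" "Cod C e = Dom C t0"
  "t0 ## e = r0 ## p" "t1 ## e = s1 ## q" "Cod C t0 = Cod C (r0 ## p)" "Cod C t1 = Cod C (s1 ## q)"
  by (rule span_image[OF ty(1-3)])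
 have Et: "El C t0 t1 = rcomp C G F" by (rule key[OF mem pb t(1,2) _ t(4-6)]) (use t(3) ty in simp)
 then show "rep C A D (rcomp C G F)" unfolding rep_def using t ty by metis
 show "rel_comp C (spans C G) (spans C F) = spans C (rcomp C G F)"
 proof (intro equalityI subrelI)
  fix u0 u1 assume "(u0, u1) : rel_comp C (spans C G) (spans C F)"
  then have "jointly_monic C u0 u1" "EX (r0, r1) : spans C F. EX (s0, s1) : spans C G. EX p q e. is_pullback C r1 s0 p q \<and>
     regular_epi C e & Dom C e = Dom C p & Cod C e = Dom C u0 & u0 ## e = r0 ## p & u1 ## e = s1 ## q"
   unfolding rel_comp_def by blast+
  then show "(u0, u1) : spans C (rcomp C G F)" using key unfolding spans_def by blast
 next
  fix u0 u1 assume u: "(u0, u1) : spans C (rcomp C G F)"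
  then have uj: "jointly_monic C u0 u1" and eq: "El C t0 t1 = El C u0 u1" using Et by (simp_all add: spans_def)
  note td = jmD[OF t(1)] and ud = jmD[OF uj]
  have "(u0, u1) : rel_class C t0 t1" unfolding rel_class_eq_spans[OF t(1)] using uj eq by (simp add: spans_def)
  then obtain i where i: "iso_in C i" "Cod C i = Dom C t0" "u0 = t0 ## i" "u1 = t1 ## i" unfolding rel_class_def by blast
  obtain j where j: "iso_in C j" "i : Arr C" "j : Arr C" "Dom C j = Cod C i" "Cod C j = Dom C i"
   "j ## i = Id C (Dom C i)" "i ## j = Id C (Cod C i)" using i(1) by (rule iso_inverse)
  note ea = coverD(1)[OF t(2)]
  obtain x where x: "is_cokernel C x e" using t(2) regular_epi_iff by blast
  have je: "regular_epi C (j ## e)" using cokernel_comp_iso[OF x j(1)] j i t(4) regular_epi_iff by auto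
  have "i ## (j ## e) = e" using assoc_rewrite[OF j(7), of e] j i t(4) ea by simp
  then have 1: "u0 ## (j ## e) = r0 ## p" "u1 ## (j ## e) = s1 ## q" using i j t(4-6) ea td by simp_all
  have 2: "Dom C (j ## e) = Dom C p" "Cod C (j ## e) = Dom C u0" using i j t(3,4) ea td ty by simp_all
  show "(u0, u1) : rel_comp C (spans C G) (spans C F)"
   unfolding rel_comp_def using uj mem pb je 1 2 by blast
 qed
qed

end

section \<open>The exact completion in terms of generalized elements\<close>

definition Eq :: "('o, 'a) cat \<Rightarrow> 'o \<Rightarrow> 'a rel_class \<Rightarrow> bool" where
 "Eq C A R \<longleftrightarrow> A : Obj C & rep C A A R & (ALL f. f : Arr C \<longrightarrow> Cod C f = A \<longrightarrow> (f, f) : R) \<and>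
  (ALL f g. (f, g) : R \<longrightarrow> (g, f) : R) & (ALL f g h. (f, g) : R \<longrightarrow> (g, h) : R \<longrightarrow> (f, h) : R)"

definition Mor :: "('o, 'a) cat \<Rightarrow> 'o \<Rightarrow> 'a rel_class \<Rightarrow> 'o \<Rightarrow> 'a rel_class \<Rightarrow> 'a rel_class \<Rightarrow> bool" where
 "Mor C A R B S F \<longleftrightarrow> rep C A B F \<and>
  (ALL f. f : Arr C \<longrightarrow> Cod C f = A \<longrightarrow> (EX e y. regular_epi C e & Cod C e = Dom C f & (Comp C f e, y) : F)) \<and>
  (ALL f g g'. (f, g) : F \<longrightarrow> (f, g') : F \<longrightarrow> (g, g') : S) \<and>
  (ALL f f' g g'. (f, f') : R \<longrightarrow> (f, g) : F \<longrightarrow> (g, g') : S \<longrightarrow> (f', g') : F)"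

definition eo :: "('o, 'a) cat \<Rightarrow> ('o, 'a) ex_obj \<Rightarrow> 'a rel_class" where
 "eo C a = elems C (snd a)"

definition el :: "('o, 'a) cat \<Rightarrow> ('o, 'a) ex_arr \<Rightarrow> 'a rel_class" where
 "el C f = elems C (fst (snd f))"

definition mk :: "('o, 'a) cat \<Rightarrow> ('o, 'a) ex_obj \<Rightarrow> 'a rel_class \<Rightarrow> ('o, 'a) ex_obj \<Rightarrow> ('o, 'a) ex_arr" where
 "mk C a F b = (a, spans C F, b)"

abbreviation Mr :: "('o, 'a) cat \<Rightarrow> ('o, 'a) ex_obj \<Rightarrow> ('o, 'a) ex_obj \<Rightarrow> 'a rel_class \<Rightarrow> bool" where
 "Mr C a b F \<equiv> Mor C (fst a) (eo C a) (fst b) (eo C b) F"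

definition gm :: "('o, 'a) cat \<Rightarrow> 'a \<Rightarrow> 'a rel_class \<Rightarrow> 'a rel_class" where
 "gm C f S = {(x, y). x : Arr C & Cod C x = Dom C f & (Comp C f x, y) : S}"

lemma EqD:
 assumes "Eq C A R"
 shows "A : Obj C" "rep C A A R" "f : Arr C ==> Cod C f = A ==> (f, f) : R" "(f, g) : R ==> (g, f) : R"
  "(f, g) : R ==> (g, h) : R ==> (f, h) : R"
 using assms unfolding Eq_def by blast+

lemma MorD:
 assumes "Mor C A R B S F"
 shows "rep C A B F" "(f, g) : F ==> (f, g') : F ==> (g, g') : S"
  "(f, f') : R ==> (f, g) : F ==> (g, g') : S ==> (f', g') : F"
 using assms unfolding Mor_def by blast+

context regular_additive
begin

lemma minus_plus: "f : Arr C ==> g : Arr C ==> Dom C f = Dom C g ==> Cod C f = Cod C g ==> (f \<ominus> g) \<oplus> g = f"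
 by (simp add: pl_assoc ng_pl)

lemma Mor_total:
 assumes "Mor C A R B S F" "f : Arr C" "Cod C f = A"
 obtains e y where "regular_epi C e" "e : Arr C" "Cod C e = Dom C f" "(f ## e, y) : F"
  "y : Arr C" "Dom C y = Dom C e" "Cod C y = B"
proof -
 obtain e y where e: "regular_epi C e" "Cod C e = Dom C f" "(f ## e, y) : F"
  using assms unfolding Mor_def by blast
 note t = rep_typed[OF MorD(1)[OF assms(1)] e(3)] and ea = coverD(1)[OF e(1)]
 have "Dom C y = Dom C e" using t(3) ea assms e by simp
 then show thesis using that e t ea by blast
qed

lemma Eq_diff_iff:
 assumes "Eq C A R" "f : Arr C" "g : Arr C" "Dom C f = Dom C g" "Cod C f = A" "Cod C g = A"
 shows "(f, g) : R \<longleftrightarrow> (\<zero> (Dom C g) A, g \<ominus> f) : R"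
proof
 note R = EqD[OF assms(1)]
 assume "(f, g) : R"
 from rep_diff[OF R(2) this R(3)[OF assms(2,5)]] show "(\<zero> (Dom C g) A, g \<ominus> f) : R" using assms by (simp add: pl_ng)
next
 note R = EqD[OF assms(1)]
 assume z: "(\<zero> (Dom C g) A, g \<ominus> f) : R"
 from rep_plus[OF R(2) z R(3)[OF assms(2,5)]] show "(f, g) : R" using assms minus_plus[of g f] by simp
qed

lemma rcompE:
 assumes "(f, g) : rcomp C G F"
 obtains e y where "f : Arr C" "g : Arr C" "Dom C f = Dom C g" "regular_epi C e" "e : Arr C" "Cod C e = Dom C g"
  "(f ## e, y) : F" "(y, g ## e) : G"
 using assms coverD(1) unfolding rcomp_def by blast

lemma rcompI:
 assumes "rep C A B F" "rep C B D G" "(f, y) : F" "(y, g) : G"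
 shows "(f, g) : rcomp C G F"
proof -
 note t = rep_typed[OF assms(1,3)] and t' = rep_typed[OF assms(2,4)]
 show ?thesis unfolding rcomp_def
  using t t' assms(3,4) cover_id[of "Dom C g"]
  by (intro CollectI case_prodI conjI exI[of _ "Id C (Dom C g)"] exI[of _ y]) simp_all
qed

lemma rcompI_cover:
 assumes "f : Arr C" "g : Arr C" "Dom C f = Dom C g" "regular_epi C e" "Cod C e = Dom C g" "(f ## e, y) : F" "(y, g ## e) : G"
 shows "(f, g) : rcomp C G F"
 using assms unfolding rcomp_def by blast

lemma Mor_iff:
 assumes R: "Eq C A R" and S: "Eq C B S" and F: "rep C A B F"
 shows "Mor C A R B S F \<longleftrightarrow> rcomp C S (rcomp C F R) = F & R \<subseteq> rcomp C (F\<inverse>) F & rcomp C F (F\<inverse>) \<subseteq> S"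
proof
 assume M: "Mor C A R B S F"
 note Rd = EqD[OF R] and Sd = EqD[OF S] and Md = MorD[OF M]
 have 1: "rcomp C S (rcomp C F R) \<subseteq> F"
 proof (rule subrelI)
  fix f g assume "(f, g) : rcomp C S (rcomp C F R)"
  then obtain e y where e: "f : Arr C" "g : Arr C" "Dom C f = Dom C g" "regular_epi C e" "e : Arr C" "Cod C e = Dom C g"
   "(f ## e, y) : rcomp C F R" "(y, g ## e) : S" by (rule rcompE)
  obtain d z where d: "f ## e : Arr C" "y : Arr C" "Dom C (f ## e) = Dom C y" "regular_epi C d" "d : Arr C" "Cod C d = Dom C y"
   "((f ## e) ## d, z) : R" "(z, y ## d) : F" using e(7) by (rule rcompE)
  have dd: "Cod C d = Dom C e" using d(3,6) e by simp
  have "(y ## d, (g ## e) ## d) : S" by (rule rep_precomp[OF Sd(2) e(8)]) (use e d dd in simp_all)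
  then have "((f ## e) ## d, (g ## e) ## d) : F" using Md(3)[OF Rd(4)[OF d(7)] d(8)] by blast
  then have fed: "(f ## (e ## d), g ## (e ## d)) : F" using e(1-6) d(5) dd by simp
  show "(f, g) : F" by (rule rep_local[OF F cover_comp[OF e(4) d(4) dd] _ fed]) (use e d dd in simp_all)
 qed
 have 2: "F \<subseteq> rcomp C S (rcomp C F R)"
 proof (rule subrelI)
  fix f g assume fg: "(f, g) : F"
  note t = rep_typed[OF F fg]
  show "(f, g) : rcomp C S (rcomp C F R)"
   by (rule rcompI[OF rep_rcomp(1)[OF Rd(2) F] Sd(2) rcompI[OF Rd(2) F Rd(3) fg] Sd(3)]) (use t in simp_all)
 qed
 have 3: "R \<subseteq> rcomp C (F\<inverse>) F"
 proof (rule subrelI)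
  fix f f' assume ff: "(f, f') : R"
  note t = rep_typed[OF Rd(2) ff]
  obtain e y where e: "regular_epi C e" "e : Arr C" "Cod C e = Dom C f" "(f ## e, y) : F" "y : Arr C" "Dom C y = Dom C e" "Cod C y = B"
   by (rule Mor_total[OF M t(1,4)])
  have "(f ## e, f' ## e) : R" by (rule rep_precomp[OF Rd(2) ff e(2)]) (use e t in simp)
  then have "(f' ## e, y) : F" using Md(3)[OF _ e(4) Sd(3)[OF e(5,7)]] by blast
  then show "(f, f') : rcomp C (F\<inverse>) F" by (intro rcompI_cover[OF t(1-3) e(1) _ e(4)]) (use e t in simp_all)
 qed
 have 4: "rcomp C F (F\<inverse>) \<subseteq> S"
 proof (rule subrelI)
  fix g g' assume "(g, g') : rcomp C F (F\<inverse>)"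
  then obtain e y where e: "g : Arr C" "g' : Arr C" "Dom C g = Dom C g'" "regular_epi C e" "e : Arr C" "Cod C e = Dom C g'"
   "(g ## e, y) : F\<inverse>" "(y, g' ## e) : F" by (rule rcompE)
  have "(g ## e, g' ## e) : S" using Md(2)[OF _ e(8)] e(7) by simp
  then show "(g, g') : S" by (rule rep_local[OF Sd(2) e(4,6)]) (use e in simp_all)
 qed
 show "rcomp C S (rcomp C F R) = F & R \<subseteq> rcomp C (F\<inverse>) F & rcomp C F (F\<inverse>) \<subseteq> S" using 1 2 3 4 by blast
next
 assume h: "rcomp C S (rcomp C F R) = F & R \<subseteq> rcomp C (F\<inverse>) F & rcomp C F (F\<inverse>) \<subseteq> S"
 note Rd = EqD[OF R] and Sd = EqD[OF S]
 show "Mor C A R B S F" unfolding Mor_def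
 proof (intro conjI allI impI)
  fix f assume "f : Arr C" "Cod C f = A"
  then have "(f, f) : rcomp C (F\<inverse>) F" using Rd(3) h by blast
  then show "EX e y. regular_epi C e & Cod C e = Dom C f & (f ## e, y) : F" by (rule rcompE) blast
 next
  fix f g g' assume "(f, g) : F" "(f, g') : F"
  then have "(g, g') : rcomp C F (F\<inverse>)" by (intro rcompI[OF rep_converse[OF F] F, of g f]) simp_all
  then show "(g, g') : S" using h by blast
 next
  fix f f' g g' assume m: "(f, f') : R" "(f, g) : F" "(g, g') : S"
  have "(f', g') : rcomp C S (rcomp C F R)"
   by (rule rcompI[OF rep_rcomp(1)[OF Rd(2) F] Sd(2) rcompI[OF Rd(2) F Rd(4)[OF m(1)] m(2)] m(3)])
  then show "(f', g') : F" using h by simp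
 qed (rule F)
qed

lemma Mor_eqI:
 assumes F: "Mor C A R B S F" and G: "Mor C A R B S G" and R: "Eq C A R"
  and ag: "!!f. f : Arr C ==> Cod C f = A ==> EX e y. regular_epi C e & Cod C e = Dom C f & (f ## e, y) : F & (f ## e, y) : G"
 shows "F = G"
proof -
 have "F \<subseteq> G" if F: "Mor C A R B S F" and G: "Mor C A R B S G"
  and ag: "!!f. f : Arr C ==> Cod C f = A ==> EX e y. regular_epi C e & Cod C e = Dom C f & (f ## e, y) : F & (f ## e, y) : G" for F G
 proof (rule subrelI)
  fix f g assume fg: "(f, g) : F"
  note t = rep_typed[OF MorD(1)[OF F] fg]
  obtain e y where e: "regular_epi C e" "Cod C e = Dom C f" "(f ## e, y) : F" "(f ## e, y) : G" using ag[OF t(1,4)] by blast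
  note ea = coverD(1)[OF e(1)]
  have "(f ## e, g ## e) : F" by (rule rep_precomp[OF MorD(1)[OF F] fg ea]) (use e t in simp)
  then have "(y, g ## e) : S" by (rule MorD(2)[OF F e(3)])
  moreover have "(f ## e, f ## e) : R" by (rule EqD(3)[OF R]) (use e ea t in simp_all)
  ultimately have fe: "(f ## e, g ## e) : G" using MorD(3)[OF G _ e(4)] by blast
  show "(f, g) : G" by (rule rep_local[OF MorD(1)[OF G] e(1) _ fe]) (use e t in simp_all)
 qed
 from this[OF F G ag] this[OF G F] ag show ?thesis by blast
qed

lemma Mor_id:
 assumes R: "Eq C A R" shows "Mor C A R A R R"
 unfolding Mor_def
proof (intro conjI allI impI)
 note Rd = EqD[OF R]
 show "rep C A A R" by (rule Rd(2))
 show "EX e y. regular_epi C e & Cod C e = Dom C f & (f ## e, y) : R" if "f : Arr C" "Cod C f = A" for f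
  using Rd(3)[OF that] cover_id[of "Dom C f"] that by (intro exI[of _ "Id C (Dom C f)"] exI[of _ f]) simp
 show "(g, g') : R" if "(f, g) : R" "(f, g') : R" for f g g'
  by (rule Rd(5)[OF Rd(4)[OF that(1)] that(2)])
 show "(f', g') : R" if "(f, f') : R" "(f, g) : R" "(g, g') : R" for f f' g g'
  by (rule Rd(5)[OF Rd(4)[OF that(1)] Rd(5)[OF that(2,3)]])
qed

lemma Mor_rcomp:
 assumes F: "Mor C A R B S F" and G: "Mor C B S D T G" and R: "Eq C A R" and S: "Eq C B S" and T: "Eq C D T"
 shows "Mor C A R D T (rcomp C G F)"
 unfolding Mor_def
proof (intro conjI allI impI)
 note Fd = MorD[OF F] and Gd = MorD[OF G] and Rd = EqD[OF R] and Sd = EqD[OF S] and Td = EqD[OF T]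
 show "rep C A D (rcomp C G F)" by (rule rep_rcomp(1)[OF Fd(1) Gd(1)])
 fix f assume f: "f : Arr C" "Cod C f = A"
 obtain e y where e: "regular_epi C e" "e : Arr C" "Cod C e = Dom C f" "(f ## e, y) : F" "y : Arr C" "Dom C y = Dom C e" "Cod C y = B"
  by (rule Mor_total[OF F f])
 obtain d z where d: "regular_epi C d" "d : Arr C" "Cod C d = Dom C y" "(y ## d, z) : G" "z : Arr C" "Dom C z = Dom C d" "Cod C z = D"
  by (rule Mor_total[OF G e(5,7)])
 have "((f ## e) ## d, y ## d) : F" by (rule rep_precomp[OF Fd(1) e(4) d(2,3)])
 then have "((f ## e) ## d, z) : rcomp C G F" by (rule rcompI[OF Fd(1) Gd(1) _ d(4)])
 then have "(f ## (e ## d), z) : rcomp C G F" using f e d by simp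
 moreover have "regular_epi C (e ## d)" by (rule cover_comp[OF e(1) d(1)]) (use e d in simp)
 ultimately show "EX e y. regular_epi C e & Cod C e = Dom C f & (f ## e, y) : rcomp C G F"
  using e d by (intro exI[of _ "e ## d"] exI[of _ z]) simp
next
 note Fd = MorD[OF F] and Gd = MorD[OF G] and Rd = EqD[OF R] and Sd = EqD[OF S] and Td = EqD[OF T]
 fix f h h' assume "(f, h) : rcomp C G F" "(f, h') : rcomp C G F"
 then obtain e y e' y' where e: "f : Arr C" "h : Arr C" "Dom C f = Dom C h" "regular_epi C e" "e : Arr C" "Cod C e = Dom C h"
   "(f ## e, y) : F" "(y, h ## e) : G" and
  e': "h' : Arr C" "Dom C f = Dom C h'" "regular_epi C e'" "e' : Arr C" "Cod C e' = Dom C h'" "(f ## e', y') : F" "(y', h' ## e') : G"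
  by (elim rcompE)
 have ee: "Cod C e = Cod C e'" using e e' by simp
 obtain a b where ab: "a : Arr C" "b : Arr C" "Dom C a = Dom C b" "Cod C a = Dom C e" "Cod C b = Dom C e'" "e ## a = e' ## b" "regular_epi C (e' ## b)"
  by (rule cover_common[OF e(4) e'(3) ee])
 note ty = rep_typed[OF Fd(1) e(7)] and t' = rep_typed[OF Fd(1) e'(6)]
 have dy: "Dom C y = Dom C e" "Dom C y' = Dom C e'" using ty(3) t'(3) e e' by simp_all
 have 1: "((f ## e) ## a, y ## a) : F" by (rule rep_precomp[OF Fd(1) e(7)]) (use ab dy in simp_all)
 have 2: "((f ## e') ## b, y' ## b) : F" by (rule rep_precomp[OF Fd(1) e'(6)]) (use ab dy in simp_all)
 have 3: "(f ## e) ## a = (f ## e') ## b" using ab(1-6) e(1-6) e'(1-5) by simp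
 have 4: "(y ## a, y' ## b) : S" using Fd(2)[OF 1] 2 3 by simp
 have 5: "(y ## a, (h ## e) ## a) : G" by (rule rep_precomp[OF Gd(1) e(8)]) (use ab e in simp_all)
 have 6: "(y' ## b, (h' ## e') ## b) : G" by (rule rep_precomp[OF Gd(1) e'(7)]) (use ab e' in simp_all)
 have 7: "(y' ## b, (h ## e) ## a) : G" by (rule Gd(3)[OF 4 5 Td(3)]) (use rep_typed[OF Gd(1) 5] in simp_all)
 have "((h ## e) ## a, (h' ## e') ## b) : T" by (rule Gd(2)[OF 7 6])
 then have he: "(h ## (e' ## b), h' ## (e' ## b)) : T" using ab(1-6) e(1-6) e'(1-5) by simp
 show "(h, h') : T" by (rule rep_local[OF Td(2) ab(7) _ he]) (use ab e e' in simp_all)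
next
 note Fd = MorD[OF F] and Gd = MorD[OF G] and Rd = EqD[OF R] and Sd = EqD[OF S] and Td = EqD[OF T]
 fix f f' h h' assume m: "(f, f') : R" "(f, h) : rcomp C G F" "(h, h') : T"
 obtain e y where e: "f : Arr C" "h : Arr C" "Dom C f = Dom C h" "regular_epi C e" "e : Arr C" "Cod C e = Dom C h"
   "(f ## e, y) : F" "(y, h ## e) : G" using m(2) by (rule rcompE)
 note t = rep_typed[OF Rd(2) m(1)] and t' = rep_typed[OF Td(2) m(3)] and ty = rep_typed[OF Fd(1) e(7)]
 have 1: "(f ## e, f' ## e) : R" by (rule rep_precomp[OF Rd(2) m(1) e(5)]) (use e t in simp)
 have 2: "(h ## e, h' ## e) : T" by (rule rep_precomp[OF Td(2) m(3) e(5)]) (use e t' in simp)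
 have 3: "(f' ## e, y) : F" by (rule Fd(3)[OF 1 e(7) Sd(3)]) (use ty in simp_all)
 have 4: "(y, h' ## e) : G" by (rule Gd(3)[OF Sd(3) e(8) 2]) (use ty in simp_all)
 show "(f', h') : rcomp C G F" by (rule rcompI_cover[OF t(2) t'(2) _ e(4) _ 3 4]) (use t t' e in simp_all)
qed

lemma Mor_gm:
 assumes R: "Eq C A R" and S: "Eq C B S" and f: "f : Arr C" "Dom C f = A" "Cod C f = B"
  and resp: "!!x x'. (x, x') : R ==> (f ## x, f ## x') : S"
 shows "Mor C A R B S (gm C f S)"
 unfolding Mor_def
proof (intro conjI allI impI)
 note Rd = EqD[OF R] and Sd = EqD[OF S]
 show "rep C A B (gm C f S)" using rep_gm[OF Sd(2) f(1,3)] f(2) unfolding gm_def by simp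
 fix x assume x: "x : Arr C" "Cod C x = A"
 have "(x, f ## x) : gm C f S" unfolding gm_def using x f Sd(3)[of "f ## x"] by simp
 then show "EX e y. regular_epi C e & Cod C e = Dom C x & (x ## e, y) : gm C f S"
  using x cover_id[of "Dom C x"] by (intro exI[of _ "Id C (Dom C x)"] exI[of _ "f ## x"]) simp
next
 note Rd = EqD[OF R] and Sd = EqD[OF S]
 fix x y y' assume "(x, y) : gm C f S" "(x, y') : gm C f S"
 then have "(f ## x, y) : S" "(f ## x, y') : S" by (simp_all add: gm_def)
 then show "(y, y') : S" using Sd(4,5) by blast
next
 note Rd = EqD[OF R] and Sd = EqD[OF S]
 fix x x' y y' assume h: "(x, x') : R" "(x, y) : gm C f S" "(y, y') : S"
 note t = rep_typed[OF Rd(2) h(1)]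
 have "(f ## x, y) : S" using h(2) by (simp add: gm_def)
 then have "(f ## x', y') : S" using resp[OF h(1)] h(3) Sd(4,5) by blast
 then show "(x', y') : gm C f S" using t f by (simp add: gm_def)
qed

lemma gmI:
 assumes "Eq C B S" "f : Arr C" "x : Arr C" "Cod C x = Dom C f" "Cod C f = B"
 shows "(x, f ## x) : gm C f S"
 using assms EqD(3)[OF assms(1), of "f ## x"] by (simp add: gm_def)

lemma equivalence_relation_iff:
 assumes A: "A : Obj C"
 shows "equivalence_relation C A r0 r1 \<longleftrightarrow> jointly_monic C r0 r1 & Cod C r0 = A & Cod C r1 = A & Eq C A (El C r0 r1)"
proof -
 have "(ALL T : Obj C. equiv (Hom C T A) {(r0 ## h, r1 ## h) | h. h : Hom C T (Dom C r0)}) \<longleftrightarrow> Eq C A (El C r0 r1)"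
  if j: "jointly_monic C r0 r1" and c: "Cod C r0 = A" "Cod C r1 = A"
 proof -
  note jd = jmD[OF j]
  have R: "rep C A A (El C r0 r1)" unfolding rep_def using j c by blast
  have st: "(f, g) : {(r0 ## h, r1 ## h) | h. h : Hom C T (Dom C r0)} \<longleftrightarrow> (f, g) : El C r0 r1 & Dom C g = T" for f g T
   unfolding El_def using jd by auto
  show ?thesis
  proof
   assume eq: "ALL T : Obj C. equiv (Hom C T A) {(r0 ## h, r1 ## h) | h. h : Hom C T (Dom C r0)}"
   show "Eq C A (El C r0 r1)" unfolding Eq_def
   proof (intro conjI allI impI)
    fix f assume f: "f : Arr C" "Cod C f = A"
    have "refl_on (Hom C (Dom C f) A) {(r0 ## h, r1 ## h) | h. h : Hom C (Dom C f) (Dom C r0)}"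
     using eq[rule_format, of "Dom C f"] f unfolding equiv_def by simp
    then have "(f, f) : {(r0 ## h, r1 ## h) | h. h : Hom C (Dom C f) (Dom C r0)}" by (rule refl_onD) (use f in simp)
    then show "(f, f) : El C r0 r1" unfolding st by blast
   next
    fix f g assume fg: "(f, g) : El C r0 r1"
    note t = rep_typed[OF R fg]
    have "sym {(r0 ## h, r1 ## h) | h. h : Hom C (Dom C g) (Dom C r0)}" using eq[rule_format, of "Dom C g"] t unfolding equiv_def by simp
    then have "(g, f) : {(r0 ## h, r1 ## h) | h. h : Hom C (Dom C g) (Dom C r0)}" by (rule symD) (use fg st in blast)
    then show "(g, f) : El C r0 r1" unfolding st by blast
   next
    fix f g h assume fg: "(f, g) : El C r0 r1" "(g, h) : El C r0 r1"
    note t = rep_typed[OF R fg(1)] and t' = rep_typed[OF R fg(2)]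
    have "trans {(r0 ## h, r1 ## h) | h. h : Hom C (Dom C g) (Dom C r0)}" using eq[rule_format, of "Dom C g"] t unfolding equiv_def by simp
    then have "(f, h) : {(r0 ## h, r1 ## h) | h. h : Hom C (Dom C g) (Dom C r0)}"
     by (rule transD[of _ f g h]) (use fg st t t' in simp_all)
    then show "(f, h) : El C r0 r1" unfolding st by blast
   qed (fact A R)+
  next
   assume E: "Eq C A (El C r0 r1)"
   note Ed = EqD[OF E]
   show "ALL T : Obj C. equiv (Hom C T A) {(r0 ## h, r1 ## h) | h. h : Hom C T (Dom C r0)}"
   proof
    fix T assume T: "T : Obj C"
    show "equiv (Hom C T A) {(r0 ## h, r1 ## h) | h. h : Hom C T (Dom C r0)}" (is "equiv _ ?E")
    proof (rule equivI)
     show "?E \<subseteq> Hom C T A \<times> Hom C T A" using jd c by auto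
     show "refl_on (Hom C T A) ?E" by (rule refl_onI) (use st Ed(3) in simp)
     show "sym ?E"
     proof (rule symI)
      fix f g assume "(f, g) : ?E"
      then have fg: "(f, g) : El C r0 r1" "Dom C g = T" unfolding st by blast+
      then show "(g, f) : ?E" unfolding st using Ed(4)[OF fg(1)] rep_typed[OF R fg(1)] by simp
     qed
     show "trans ?E"
     proof (rule transI)
      fix f g h assume "(f, g) : ?E" "(g, h) : ?E"
      then show "(f, h) : ?E" unfolding st using Ed(5) by blast
     qed
    qed
   qed
  qed
 qed
 then show ?thesis unfolding equivalence_relation_def by blast
qed

lemma ex_Obj_iff: "a : ex_Obj C \<longleftrightarrow> (EX R. Eq C (fst a) R & snd a = spans C R)"
proof
 assume "a : ex_Obj C"
 then obtain A r0 r1 where a: "a = (A, rel_class C r0 r1)" "A : Obj C" "equivalence_relation C A r0 r1" unfolding ex_Obj_def by blast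
 then have "jointly_monic C r0 r1" "Eq C A (El C r0 r1)" using equivalence_relation_iff by blast+
 then show "EX R. Eq C (fst a) R & snd a = spans C R" using a rel_class_eq_spans by auto
next
 assume "EX R. Eq C (fst a) R & snd a = spans C R"
 then obtain R where R: "Eq C (fst a) R" "snd a = spans C R" by blast
 obtain r0 r1 where r: "jointly_monic C r0 r1" "r0 : Arr C" "r1 : Arr C" "Dom C r0 = Dom C r1" "Cod C r0 = fst a" "Cod C r1 = fst a" "R = El C r0 r1"
  using EqD(2)[OF R(1)] by (rule repE)
 have "equivalence_relation C (fst a) r0 r1" using equivalence_relation_iff[OF EqD(1)[OF R(1)]] r R(1) by simp
 moreover have "a = (fst a, rel_class C r0 r1)" using R(2) rel_class_eq_spans[OF r(1)] r(7) by (metis prod.collapse)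
 ultimately show "a : ex_Obj C" unfolding ex_Obj_def using EqD(1)[OF R(1)] by blast
qed

abbreviation "E \<equiv> ex_reg C"

lemma ex_reg_simps: "Obj E = ex_Obj C" "Arr E = ex_Arr C" "Dom E f = fst f" "Cod E f = snd (snd f)"
 "Id E a = (a, snd a, a)" "Comp E g f = (fst f, rel_comp C (fst (snd g)) (fst (snd f)), snd (snd g))"
 unfolding ex_reg_def by (simp_all split: prod.splits)

lemma E_objD:
 assumes "a : Obj E"
 shows "Eq C (fst a) (eo C a)" "snd a = spans C (eo C a)"
proof -
 obtain R where R: "Eq C (fst a) R" "snd a = spans C R" using assms ex_Obj_iff ex_reg_simps(1) by blast
 have "eo C a = R" unfolding eo_def R(2) by (rule elems_spans[OF EqD(2)[OF R(1)]])
 then show "Eq C (fst a) (eo C a)" "snd a = spans C (eo C a)" using R by simp_all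
qed

lemma E_objI:
 assumes "Eq C A R"
 shows "(A, spans C R) : Obj E" "eo C (A, spans C R) = R"
 using assms ex_Obj_iff[of "(A, spans C R)"] ex_reg_simps(1) elems_spans[OF EqD(2)[OF assms]] by (auto simp: eo_def)

lemma E_arr_iff: "f : Arr E \<longleftrightarrow> (EX a b F. a : Obj E & b : Obj E & Mr C a b F & f = mk C a F b)"
proof
 assume "f : Arr E"
 then have "f : ex_Arr C" by (simp add: ex_reg_simps)
 then obtain A R \<phi> B S where f: "f = ((A, R), \<phi>, (B, S))" "(A, R) : ex_Obj C" "(B, S) : ex_Obj C" "\<phi> : relations C A B"
  "rel_comp C S (rel_comp C \<phi> R) = \<phi>" "rel_le C R (rel_comp C (converse \<phi>) \<phi>)" "rel_le C (rel_comp C \<phi> (converse \<phi>)) S"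
  unfolding ex_Arr_def by blast
 define a where "a = (A, R)"
 define b where "b = (B, S)"
 have ab: "a : Obj E" "b : Obj E" using f by (simp_all add: a_def b_def ex_reg_simps)
 note ad = E_objD[OF ab(1)] and bd = E_objD[OF ab(2)]
 have RS: "R = spans C (eo C a)" "S = spans C (eo C b)" "fst a = A" "fst b = B" using ad bd by (simp_all add: a_def b_def)
 obtain F where F: "rep C (fst a) (fst b) F" "\<phi> = spans C F" using f(4) relations_iff RS by blast
 note ra = EqD(2)[OF ad(1)] and rb = EqD(2)[OF bd(1)] and Fc = rep_converse[OF F(1)]
 note c1 = rep_rcomp[OF ra F(1)] and c2 = rep_rcomp[OF F(1) Fc] and c3 = rep_rcomp[OF Fc F(1)]
 note c4 = rep_rcomp[OF c1(1) rb]
 have "spans C (rcomp C (eo C b) (rcomp C F (eo C a))) = spans C F" using f(5) unfolding F(2) RS c1(2) c4(2) .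
 then have 1: "rcomp C (eo C b) (rcomp C F (eo C a)) = F" using elems_spans[OF c4(1)] elems_spans[OF F(1)] by simp
 have 2: "eo C a \<subseteq> rcomp C (F\<inverse>) F"
  using f(6) unfolding F(2) RS spans_converse[OF F(1)] c2(2) rel_le_iff[OF ra c2(1)] .
 have 3: "rcomp C F (F\<inverse>) \<subseteq> eo C b"
  using f(7) unfolding F(2) RS spans_converse[OF F(1)] c3(2) rel_le_iff[OF c3(1) rb] .
 have "Mr C a b F" using Mor_iff[OF ad(1) bd(1) F(1)] 1 2 3 by blast
 then show "EX a b F. a : Obj E & b : Obj E & Mr C a b F & f = mk C a F b"
  using ab f(1) F(2) by (intro exI[of _ a] exI[of _ b] exI[of _ F]) (simp add: mk_def a_def b_def)
next
 assume "EX a b F. a : Obj E & b : Obj E & Mr C a b F & f = mk C a F b"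
 then obtain a b F where ab: "a : Obj E" "b : Obj E" and M: "Mr C a b F" and f: "f = mk C a F b" by blast
 note ad = E_objD[OF ab(1)] and bd = E_objD[OF ab(2)] and F = MorD(1)[OF M]
 note ra = EqD(2)[OF ad(1)] and rb = EqD(2)[OF bd(1)] and Fc = rep_converse[OF F]
 note c1 = rep_rcomp[OF ra F] and c2 = rep_rcomp[OF F Fc] and c3 = rep_rcomp[OF Fc F]
 note c4 = rep_rcomp[OF c1(1) rb]
 have m: "rcomp C (eo C b) (rcomp C F (eo C a)) = F" "eo C a \<subseteq> rcomp C (F\<inverse>) F" "rcomp C F (F\<inverse>) \<subseteq> eo C b"
  using Mor_iff[OF ad(1) bd(1) F] M by blast+
 have "spans C F : relations C (fst a) (fst b)" using relations_iff F by blast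
 moreover have "rel_comp C (snd b) (rel_comp C (spans C F) (snd a)) = spans C F"
  unfolding ad(2) bd(2) c1(2) c4(2) m(1) ..
 moreover have "rel_le C (snd a) (rel_comp C (converse (spans C F)) (spans C F))"
  unfolding ad(2) spans_converse[OF F] c2(2) rel_le_iff[OF ra c2(1)] by (rule m(2))
 moreover have "rel_le C (rel_comp C (spans C F) (converse (spans C F))) (snd b)"
  unfolding bd(2) spans_converse[OF F] c3(2) rel_le_iff[OF c3(1) rb] by (rule m(3))
 moreover have "f = ((fst a, snd a), spans C F, (fst b, snd b))" unfolding f mk_def by simp
 moreover have "(fst a, snd a) : ex_Obj C" "(fst b, snd b) : ex_Obj C" using ab by (simp_all add: ex_reg_simps)
 ultimately have "f : ex_Arr C" unfolding ex_Arr_def by blast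
 then show "f : Arr E" by (simp add: ex_reg_simps)
qed

lemma E_mk:
 assumes "a : Obj E" "b : Obj E" "Mr C a b F"
 shows "mk C a F b : Arr E" "Dom E (mk C a F b) = a" "Cod E (mk C a F b) = b" "el C (mk C a F b) = F"
proof -
 show "mk C a F b : Arr E" using assms E_arr_iff by blast
 show "Dom E (mk C a F b) = a" "Cod E (mk C a F b) = b" by (simp_all add: mk_def ex_reg_simps)
 show "el C (mk C a F b) = F" using elems_spans[OF MorD(1)[OF assms(3)]] by (simp add: el_def mk_def)
qed

lemma E_arrD:
 assumes "f : Arr E"
 shows "Dom E f : Obj E" "Cod E f : Obj E" "Mr C (Dom E f) (Cod E f) (el C f)" "f = mk C (Dom E f) (el C f) (Cod E f)"
proof -
 obtain a b F where ab: "a : Obj E" "b : Obj E" "Mr C a b F" "f = mk C a F b" using assms E_arr_iff by blast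
 note m = E_mk[OF ab(1-3)]
 show "Dom E f : Obj E" "Cod E f : Obj E" "Mr C (Dom E f) (Cod E f) (el C f)" "f = mk C (Dom E f) (el C f) (Cod E f)"
  unfolding ab(4) m(2-4) using ab by blast+
qed

lemma E_eqI:
 assumes "f : Arr E" "g : Arr E" "Dom E f = Dom E g" "Cod E f = Cod E g" "el C f = el C g"
 shows "f = g"
 using E_arrD(4)[OF assms(1)] E_arrD(4)[OF assms(2)] assms(3-5) by simp

lemma E_comp:
 assumes "f : Arr E" "g : Arr E" "Cod E f = Dom E g"
 shows "Comp E g f : Arr E" "Dom E (Comp E g f) = Dom E f" "Cod E (Comp E g f) = Cod E g"
  "el C (Comp E g f) = rcomp C (el C g) (el C f)" "Mr C (Dom E f) (Cod E g) (rcomp C (el C g) (el C f))"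
proof -
 note fd = E_arrD[OF assms(1)] and gd = E_arrD[OF assms(2)]
 note F = fd(3)[unfolded assms(3)] and G = gd(3)
 show M: "Mr C (Dom E f) (Cod E g) (rcomp C (el C g) (el C f))"
  by (rule Mor_rcomp[OF F G E_objD(1) E_objD(1) E_objD(1)]) (use fd gd in simp_all)
 have "Comp E g f = mk C (Dom E f) (rcomp C (el C g) (el C f)) (Cod E g)"
  unfolding ex_reg_simps(6)
  by (subst fd(4), subst gd(4)) (simp add: mk_def rep_rcomp(2)[OF MorD(1)[OF F] MorD(1)[OF G]] ex_reg_simps(3,4))
 then show "Comp E g f : Arr E" "Dom E (Comp E g f) = Dom E f" "Cod E (Comp E g f) = Cod E g"
  "el C (Comp E g f) = rcomp C (el C g) (el C f)" using E_mk[OF fd(1) gd(2) M] by simp_all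
qed

lemma E_id:
 assumes "a : Obj E"
 shows "Id E a : Arr E" "Dom E (Id E a) = a" "Cod E (Id E a) = a" "el C (Id E a) = eo C a"
proof -
 have "Id E a = mk C a (eo C a) a" using E_objD(2)[OF assms] by (simp add: mk_def ex_reg_simps)
 then show "Id E a : Arr E" "Dom E (Id E a) = a" "Cod E (Id E a) = a" "el C (Id E a) = eo C a"
  using E_mk[OF assms assms Mor_id[OF E_objD(1)[OF assms]]] by simp_all
qed

lemma E_ext:
 assumes f: "f : Arr E" "g : Arr E" "Dom E f = Dom E g" "Cod E f = Cod E g"
  and ag: "!!x. x : Arr C ==> Cod C x = fst (Dom E g) ==>
   EX e y. regular_epi C e & Cod C e = Dom C x & (x ## e, y) : el C f & (x ## e, y) : el C g"
 shows "f = g"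
proof (rule E_eqI[OF f])
 note fd = E_arrD[OF f(1)] and gd = E_arrD[OF f(2)]
 show "el C f = el C g"
  by (rule Mor_eqI[OF fd(3)[unfolded f(3,4)] gd(3) E_objD(1)[OF gd(1)] ag])
qed

lemma E_total:
 assumes "f : Arr E" "x : Arr C" "Cod C x = fst (Dom E f)"
 obtains e y where "regular_epi C e" "e : Arr C" "Cod C e = Dom C x" "(x ## e, y) : el C f"
  "y : Arr C" "Dom C y = Dom C e" "Cod C y = fst (Cod E f)"
 by (rule Mor_total[OF E_arrD(3)[OF assms(1)] assms(2,3)])

lemma E_rep: "f : Arr E ==> rep C (fst (Dom E f)) (fst (Cod E f)) (el C f)"
 by (rule MorD(1)[OF E_arrD(3)])

lemma E_compI:
 assumes "f : Arr E" "g : Arr E" "Cod E f = Dom E g" "(x, y) : el C f" "(y, z) : el C g"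
 shows "(x, z) : el C (Comp E g f)"
 unfolding E_comp(4)[OF assms(1-3)]
 by (rule rcompI[OF E_rep[OF assms(1)] _ assms(4,5)]) (use E_rep[OF assms(2)] assms(3) in simp)

lemma E_total2:
 assumes fg: "f : Arr E" "g : Arr E" "Cod E f = Dom E g" and x: "x : Arr C" "Cod C x = fst (Dom E f)"
 obtains e y z where "regular_epi C e" "e : Arr C" "Cod C e = Dom C x" "(x ## e, y) : el C f" "(y, z) : el C g"
  "y : Arr C" "Dom C y = Dom C e" "Cod C y = fst (Cod E f)" "z : Arr C" "Dom C z = Dom C e" "Cod C z = fst (Cod E g)"
proof -
 obtain e y where e: "regular_epi C e" "e : Arr C" "Cod C e = Dom C x" "(x ## e, y) : el C f" "y : Arr C" "Dom C y = Dom C e" "Cod C y = fst (Cod E f)"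
  by (rule E_total[OF fg(1) x])
 obtain d z where d: "regular_epi C d" "d : Arr C" "Cod C d = Dom C y" "(y ## d, z) : el C g" "z : Arr C" "Dom C z = Dom C d" "Cod C z = fst (Cod E g)"
  by (rule E_total[OF fg(2) e(5)]) (use e fg in simp)
 have "((x ## e) ## d, y ## d) : el C f" by (rule rep_precomp[OF E_rep[OF fg(1)] e(4) d(2,3)])
 then have 1: "(x ## (e ## d), y ## d) : el C f" using x e d by simp
 have 2: "regular_epi C (e ## d)" by (rule cover_comp[OF e(1) d(1)]) (use e d in simp)
 show thesis by (rule that[OF 2 _ _ 1 d(4)]) (use e d in simp_all)
qed

lemma category_E: "category E"
proof
 fix f assume "f : Arr E"
 then show "Dom E f : Obj E" "Cod E f : Obj E" by (rule E_arrD)+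
next
 fix A assume "A : Obj E"
 then show "Id E A : Hom E A A" using E_id by simp
next
 fix f g A B D assume "f : Hom E A B" "g : Hom E B D"
 then show "Comp E g f : Hom E A D" using E_comp[of f g] by simp
next
 fix f A B assume f: "f : Hom E A B"
 then have fd: "f : Arr E" "Dom E f = A" "Cod E f = B" by simp_all
 have AB: "A : Obj E" "B : Obj E" using E_arrD[OF fd(1)] fd by simp_all
 note iA = E_id[OF AB(1)] and iB = E_id[OF AB(2)]
 have cB: "Cod E f = Dom E (Id E B)" and cA: "Cod E (Id E A) = Dom E f" using fd iA iB by simp_all
 note kB = E_comp[OF fd(1) iB(1) cB] and kA = E_comp[OF iA(1) fd(1) cA]
 show "Comp E (Id E B) f = f"
 proof (rule E_ext)
  fix x assume x: "x : Arr C" "Cod C x = fst (Dom E f)"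
  obtain e y where e: "regular_epi C e" "e : Arr C" "Cod C e = Dom C x" "(x ## e, y) : el C f" "y : Arr C" "Dom C y = Dom C e" "Cod C y = fst (Cod E f)"
   by (rule E_total[OF fd(1) x])
  have "(y, y) : el C (Id E B)" unfolding iB(4) by (rule EqD(3)[OF E_objD(1)[OF AB(2)] e(5)]) (use e fd in simp)
  from E_compI[OF fd(1) iB(1) cB e(4) this]
  show "EX e y. regular_epi C e & Cod C e = Dom C x & (x ## e, y) : el C (Comp E (Id E B) f) & (x ## e, y) : el C f"
   using e by blast
 qed (use kB fd iB in simp_all)
 show "Comp E f (Id E A) = f"
 proof (rule E_ext)
  fix x assume x: "x : Arr C" "Cod C x = fst (Dom E f)"
  obtain e y where e: "regular_epi C e" "e : Arr C" "Cod C e = Dom C x" "(x ## e, y) : el C f" "y : Arr C" "Dom C y = Dom C e" "Cod C y = fst (Cod E f)"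
   by (rule E_total[OF fd(1) x])
  have "(x ## e, x ## e) : el C (Id E A)" unfolding iA(4) by (rule EqD(3)[OF E_objD(1)[OF AB(1)]]) (use e x fd in simp_all)
  from E_compI[OF iA(1) fd(1) cA this e(4)]
  show "EX e y. regular_epi C e & Cod C e = Dom C x & (x ## e, y) : el C (Comp E f (Id E A)) & (x ## e, y) : el C f"
   using e by blast
 qed (use kA fd iA in simp_all)
next
 fix f g h A B D G assume "f : Hom E A B" "g : Hom E B D" "h : Hom E D G"
 then have t: "f : Arr E" "g : Arr E" "h : Arr E" and gf: "Cod E f = Dom E g" and hg: "Cod E g = Dom E h" by simp_all
 note k1 = E_comp[OF t(1,2) gf] and k2 = E_comp[OF t(2,3) hg]
 have c1: "Cod E (Comp E g f) = Dom E h" and c2: "Cod E f = Dom E (Comp E h g)" using k1 k2 gf hg by simp_all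
 note k3 = E_comp[OF k1(1) t(3) c1] and k4 = E_comp[OF t(1) k2(1) c2]
 show "Comp E (Comp E h g) f = Comp E h (Comp E g f)"
 proof (rule E_ext)
  fix x assume x: "x : Arr C" "Cod C x = fst (Dom E (Comp E h (Comp E g f)))"
  have x': "Cod C x = fst (Dom E f)" using x k1 k3 by simp
  obtain e y z where e: "regular_epi C e" "e : Arr C" "Cod C e = Dom C x" "(x ## e, y) : el C f" "(y, z) : el C g"
   "y : Arr C" "Dom C y = Dom C e" "Cod C y = fst (Cod E f)" "z : Arr C" "Dom C z = Dom C e" "Cod C z = fst (Cod E g)"
   by (rule E_total2[OF t(1,2) gf x(1) x'])
  obtain d w where d: "regular_epi C d" "d : Arr C" "Cod C d = Dom C z" "(z ## d, w) : el C h" "w : Arr C" "Dom C w = Dom C d" "Cod C w = fst (Cod E h)"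
   by (rule E_total[OF t(3) e(9)]) (use e hg in simp)
  have 1: "((x ## e) ## d, y ## d) : el C f" by (rule rep_precomp[OF E_rep[OF t(1)] e(4)]) (use d e in simp_all)
  have 2: "(y ## d, z ## d) : el C g" by (rule rep_precomp[OF E_rep[OF t(2)] e(5)]) (use d e in simp_all)
  have 3: "(x ## e) ## d = x ## (e ## d)" using x e d by simp
  have "regular_epi C (e ## d)" by (rule cover_comp[OF e(1) d(1)]) (use e d in simp)
  moreover have "Cod C (e ## d) = Dom C x" using e d by simp
  moreover have "(x ## (e ## d), w) : el C (Comp E (Comp E h g) f)"
   using E_compI[OF t(1) k2(1) c2 1 E_compI[OF t(2,3) hg 2 d(4)]] 3 by simp
  moreover have "(x ## (e ## d), w) : el C (Comp E h (Comp E g f))"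
   using E_compI[OF k1(1) t(3) c1 E_compI[OF t(1,2) gf 1 2] d(4)] 3 by simp
  ultimately show "EX e y. regular_epi C e & Cod C e = Dom C x & (x ## e, y) : el C (Comp E (Comp E h g) f) \<and>
    (x ## e, y) : el C (Comp E h (Comp E g f))" by blast
 qed (use k1 k2 k3 k4 in simp_all)
qed

end

section \<open>The exact completion of a regular additive category is additive\<close>

definition rplus :: "('o, 'a) cat \<Rightarrow> 'a rel_class \<Rightarrow> 'a rel_class \<Rightarrow> 'a rel_class" where
 "rplus C F G = {(f, g). f : Arr C & g : Arr C & Dom C f = Dom C g \<and>
  (EX e g1 g2. regular_epi C e & Cod C e = Dom C g & (Comp C f e, g1) : F & (Comp C f e, g2) : G \<and>
    Comp C g e = hom_plus C g1 g2)}"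

context regular_additive
begin

lemma rplusI:
 assumes F: "rep C A B F" "rep C A B G" and m: "(f, g1) : F" "(f, g2) : G"
 shows "(f, g1 \<oplus> g2) : rplus C F G"
proof -
 note t = rep_typed[OF F(1) m(1)] and t' = rep_typed[OF F(2) m(2)]
 have d: "Dom C g1 = Dom C g2" using t(3) t'(3) by simp
 show ?thesis unfolding rplus_def
  using t t' d m cover_id[of "Dom C g2"]
  by (intro CollectI case_prodI conjI exI[of _ "Id C (Dom C g2)"] exI[of _ g1] exI[of _ g2]) simp_all
qed

lemma rplusE:
 assumes "(f, g) : rplus C F G"
 obtains e g1 g2 where "f : Arr C" "g : Arr C" "Dom C f = Dom C g" "regular_epi C e" "e : Arr C" "Cod C e = Dom C g"
  "(f ## e, g1) : F" "(f ## e, g2) : G" "g ## e = g1 \<oplus> g2"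
 using assms coverD(1) unfolding rplus_def by blast

lemma rep_rplus:
 assumes F: "rep C A B F" and G: "rep C A B G"
 shows "rep C A B (rplus C F G)"
proof -
 have B: "B : Obj C" using rep_obj[OF F] by blast
 obtain P i j p q where b: "biprod C (hom_plus C) (zero_arr C) B B P i j p q" by (rule biprodE[OF B B])
 note bs = biprod_simps(1-15)[OF b]
 define M where "M = {(x, h). h : Arr C & Cod C h = Dom C p & (x, p ## h) : F} \<inter> {(x, h). h : Arr C & Cod C h = Dom C q & (x, q ## h) : G}"
 have M: "rep C A P M"
  unfolding M_def using rep_inter[OF rep_pull[OF F bs(10,12), unfolded bs(11)] rep_pull[OF G bs(13,15), unfolded bs(14)]] bs(11,14) by simp
 let ?d = "p \<oplus> q"
 have d: "?d : Arr C" "Dom C ?d = P" "Cod C ?d = B" using bs by simp_all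
 define N where "N = El C (Id C P) ?d"
 have N: "rep C P B N" using rep_graph[OF d(1)] d by (simp add: N_def)
 have "rplus C F G = rcomp C N M"
 proof (intro equalityI subrelI)
  fix f g assume "(f, g) : rplus C F G"
  then obtain e g1 g2 where e: "f : Arr C" "g : Arr C" "Dom C f = Dom C g" "regular_epi C e" "e : Arr C" "Cod C e = Dom C g"
   "(f ## e, g1) : F" "(f ## e, g2) : G" "g ## e = g1 \<oplus> g2" by (rule rplusE)
  note t = rep_typed[OF F e(7)] and t' = rep_typed[OF G e(8)]
  have dd: "Dom C g1 = Dom C g2" using t(3) t'(3) by simp
  obtain h where h: "h : Arr C" "Dom C h = Dom C g1" "Cod C h = P" "p ## h = g1" "q ## h = g2"
   by (rule biprod_pair[OF b t(2) t'(2) dd t(5) t'(5)])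
  have 1: "(f ## e, h) : M" unfolding M_def using h bs e by simp
  have "(Id C P ## h, ?d ## h) : N" unfolding N_def by (rule ElI) (use h bs in simp_all)
  moreover have "?d ## h = g ## e" using h bs e(9) by (simp add: pl_comp)
  ultimately have 2: "(h, g ## e) : N" using h bs by simp
  show "(f, g) : rcomp C N M" by (rule rcompI_cover[OF e(1-4,6) 1 2])
 next
  fix f g assume "(f, g) : rcomp C N M"
  then obtain e y where e: "f : Arr C" "g : Arr C" "Dom C f = Dom C g" "regular_epi C e" "e : Arr C" "Cod C e = Dom C g"
   "(f ## e, y) : M" "(y, g ## e) : N" by (rule rcompE)
  obtain k where k: "k : Arr C" "Cod C k = Dom C (Id C P)" "y = Id C P ## k" "g ## e = ?d ## k" using e(8) unfolding N_def by (rule ElE)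
  have yk: "y = k" "Cod C k = P" using k bs by simp_all
  have "(f ## e, p ## k) : F" "(f ## e, q ## k) : G" using e(7) unfolding M_def yk(1) by blast+
  moreover have "g ## e = p ## k \<oplus> q ## k" unfolding k(4) using k(1) yk bs by (simp add: pl_comp)
  ultimately show "(f, g) : rplus C F G" unfolding rplus_def using e(1-6) by blast
 qed
 then show ?thesis using rep_rcomp(1)[OF M N] by simp
qed

lemma Mor_total2:
 assumes F: "Mor C A R B S F" and G: "Mor C A R B' S' G" and f: "f : Arr C" "Cod C f = A"
 obtains e y z where "regular_epi C e" "e : Arr C" "Cod C e = Dom C f" "(f ## e, y) : F" "(f ## e, z) : G"
  "y : Arr C" "Dom C y = Dom C e" "Cod C y = B" "z : Arr C" "Dom C z = Dom C e" "Cod C z = B'"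
proof -
 obtain e y where e: "regular_epi C e" "e : Arr C" "Cod C e = Dom C f" "(f ## e, y) : F" "y : Arr C" "Dom C y = Dom C e" "Cod C y = B"
  by (rule Mor_total[OF F f])
 obtain d z where d: "regular_epi C d" "d : Arr C" "Cod C d = Dom C (f ## e)" "((f ## e) ## d, z) : G" "z : Arr C" "Dom C z = Dom C d" "Cod C z = B'"
  by (rule Mor_total[OF G, of "f ## e"]) (use f e in simp_all)
 have de: "Cod C d = Dom C e" using d(3) f e by simp
 have 1: "((f ## e) ## d, y ## d) : F" by (rule rep_precomp[OF MorD(1)[OF F] e(4) d(2)]) (use de e in simp)
 have 2: "(f ## e) ## d = f ## (e ## d)" using f e d(2) de by simp
 show thesis
  by (rule that[OF cover_comp[OF e(1) d(1) de] _ _ 1[unfolded 2] d(4)[unfolded 2]]) (use e d(2,5-7) de in simp_all)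
qed

lemma Mor_rplus:
 assumes F: "Mor C A R B S F" and G: "Mor C A R B S G" and R: "Eq C A R" and S: "Eq C B S"
 shows "Mor C A R B S (rplus C F G)"
 unfolding Mor_def
proof (intro conjI allI impI)
 note Fd = MorD[OF F] and Gd = MorD[OF G]
 show "rep C A B (rplus C F G)" by (rule rep_rplus[OF Fd(1) Gd(1)])
 fix f assume f: "f : Arr C" "Cod C f = A"
 obtain e y z where e: "regular_epi C e" "e : Arr C" "Cod C e = Dom C f" "(f ## e, y) : F" "(f ## e, z) : G"
  "y : Arr C" "Dom C y = Dom C e" "Cod C y = B" "z : Arr C" "Dom C z = Dom C e" "Cod C z = B"
  by (rule Mor_total2[OF F G f])
 show "EX e y. regular_epi C e & Cod C e = Dom C f & (f ## e, y) : rplus C F G"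
  using rplusI[OF Fd(1) Gd(1) e(4,5)] e by blast
next
 note Fd = MorD[OF F] and Gd = MorD[OF G] and Sd = EqD[OF S]
 fix f g g' assume "(f, g) : rplus C F G" "(f, g') : rplus C F G"
 then obtain e g1 g2 e' g1' g2' where e: "f : Arr C" "g : Arr C" "Dom C f = Dom C g" "regular_epi C e" "e : Arr C" "Cod C e = Dom C g"
  "(f ## e, g1) : F" "(f ## e, g2) : G" "g ## e = g1 \<oplus> g2" and
  e': "g' : Arr C" "Dom C f = Dom C g'" "regular_epi C e'" "e' : Arr C" "Cod C e' = Dom C g'"
  "(f ## e', g1') : F" "(f ## e', g2') : G" "g' ## e' = g1' \<oplus> g2'" by (elim rplusE)
 have ee: "Cod C e = Cod C e'" using e e' by simp
 obtain a b where ab: "a : Arr C" "b : Arr C" "Dom C a = Dom C b" "Cod C a = Dom C e" "Cod C b = Dom C e'" "e ## a = e' ## b" "regular_epi C (e' ## b)"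
  by (rule cover_common[OF e(4) e'(3) ee])
 note t1 = rep_typed[OF Fd(1) e(7)] and t2 = rep_typed[OF Gd(1) e(8)] and
  t1' = rep_typed[OF Fd(1) e'(6)] and t2' = rep_typed[OF Gd(1) e'(7)]
 have dd: "Dom C g1 = Dom C e" "Dom C g2 = Dom C e" "Dom C g1' = Dom C e'" "Dom C g2' = Dom C e'"
  using t1(3) t2(3) t1'(3) t2'(3) e e' by simp_all
 have 3: "(f ## e) ## a = (f ## e') ## b" using ab(1-6) e(1-6) e'(1-5) by simp
 have "((f ## e) ## a, g1 ## a) : F" by (rule rep_precomp[OF Fd(1) e(7)]) (use ab dd in simp_all)
 moreover have "((f ## e') ## b, g1' ## b) : F" by (rule rep_precomp[OF Fd(1) e'(6)]) (use ab dd in simp_all)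
 ultimately have s1: "(g1 ## a, g1' ## b) : S" unfolding 3 by (rule Fd(2))
 have "((f ## e) ## a, g2 ## a) : G" by (rule rep_precomp[OF Gd(1) e(8)]) (use ab dd in simp_all)
 moreover have "((f ## e') ## b, g2' ## b) : G" by (rule rep_precomp[OF Gd(1) e'(7)]) (use ab dd in simp_all)
 ultimately have s2: "(g2 ## a, g2' ## b) : S" unfolding 3 by (rule Gd(2))
 have s3: "(g1 ## a \<oplus> g2 ## a, g1' ## b \<oplus> g2' ## b) : S" by (rule rep_plus[OF Sd(2) s1 s2]) (use ab dd t1' t2' in simp)
 have "g1 ## a \<oplus> g2 ## a = (g ## e) ## a" unfolding e(9) using t1 t2 dd ab by (simp add: pl_comp)
 also have "\<dots> = g ## (e' ## b)" using ab(1-6) e(1-6) e'(1-5) by simp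
 finally have 4: "g1 ## a \<oplus> g2 ## a = g ## (e' ## b)" .
 have "g1' ## b \<oplus> g2' ## b = (g' ## e') ## b" unfolding e'(8) using t1' t2' dd ab by (simp add: pl_comp)
 also have "\<dots> = g' ## (e' ## b)" using ab(1-6) e'(1-5) by simp
 finally have "(g ## (e' ## b), g' ## (e' ## b)) : S" using s3 unfolding 4 by simp
 note l = this
 show "(g, g') : S" by (rule rep_local[OF Sd(2) ab(7) _ l]) (use ab e e' in simp_all)
next
 note Fd = MorD[OF F] and Gd = MorD[OF G] and Rd = EqD[OF R] and Sd = EqD[OF S]
 fix f f' g g' assume m: "(f, f') : R" "(f, g) : rplus C F G" "(g, g') : S"
 obtain e g1 g2 where e: "f : Arr C" "g : Arr C" "Dom C f = Dom C g" "regular_epi C e" "e : Arr C" "Cod C e = Dom C g"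
  "(f ## e, g1) : F" "(f ## e, g2) : G" "g ## e = g1 \<oplus> g2" using m(2) by (rule rplusE)
 note t = rep_typed[OF Rd(2) m(1)] and t' = rep_typed[OF Sd(2) m(3)]
  and t1 = rep_typed[OF Fd(1) e(7)] and t2 = rep_typed[OF Gd(1) e(8)]
 have dd: "Dom C g1 = Dom C e" "Dom C g2 = Dom C e" using t1(3) t2(3) e by simp_all
 have r: "(f ## e, f' ## e) : R" by (rule rep_precomp[OF Rd(2) m(1) e(5)]) (use e t in simp)
 have s: "(g ## e, g' ## e) : S" by (rule rep_precomp[OF Sd(2) m(3) e(5)]) (use e t' in simp)
 have ge: "g ## e : Arr C" "g' ## e : Arr C" "Dom C (g ## e) = Dom C e" "Dom C (g' ## e) = Dom C e" "Cod C (g ## e) = B" "Cod C (g' ## e) = B"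
  using e(1-6) t' by simp_all
 have z: "(\<zero> (Dom C e) B, g' ## e \<ominus> g ## e) : S" using Eq_diff_iff[OF S ge(1,2) _ ge(5,6)] s ge by simp
 have "(g2 \<oplus> \<zero> (Dom C e) B, g2 \<oplus> (g' ## e \<ominus> g ## e)) : S"
  by (rule rep_plus[OF Sd(2) Sd(3)[OF t2(2,5)] z]) (use dd ge in simp)
 then have s2: "(g2, g2 \<oplus> (g' ## e \<ominus> g ## e)) : S" using dd t2 by simp
 have 1: "(f' ## e, g1) : F" by (rule Fd(3)[OF r e(7) Sd(3)[OF t1(2,5)]])
 have 2: "(f' ## e, g2 \<oplus> (g' ## e \<ominus> g ## e)) : G" by (rule Gd(3)[OF r e(8) s2])
 have "g1 \<oplus> (g2 \<oplus> (g' ## e \<ominus> g ## e)) = (g ## e) \<oplus> (g' ## e \<ominus> g ## e)"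
  unfolding e(9) by (rule pl_assoc[symmetric]) (use t1 t2 dd ge in \<open>simp_all add: e(9)[symmetric]\<close>)
 also have "\<dots> = (g' ## e \<ominus> g ## e) \<oplus> (g ## e)" by (rule pl_comm) (use ge in simp_all)
 also have "\<dots> = g' ## e" by (rule minus_plus) (use ge in simp_all)
 finally have 3: "g' ## e = g1 \<oplus> (g2 \<oplus> (g' ## e \<ominus> g ## e))" by simp
 have 5: "f' : Arr C & g' : Arr C & Dom C f' = Dom C g' & Cod C e = Dom C g'" using e t t' by simp
 show "(f', g') : rplus C F G" unfolding rplus_def using 1 2 3 5 e(4) by blast
qed

lemma Mor_neg:
 assumes F: "Mor C A R B S F" and S: "Eq C B S"
 shows "Mor C A R B S {(x, y). y : Arr C & Cod C y = B & (x, hom_neg C y) : F}" (is "Mor C A R B S ?N")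
 unfolding Mor_def
proof (intro conjI allI impI)
 note Fd = MorD[OF F] and Sd = EqD[OF S]
 have n: "hom_neg C (Id C B) : Arr C" "Dom C (hom_neg C (Id C B)) = B" "Cod C (hom_neg C (Id C B)) = B" using Sd(1) by simp_all
 have "hom_neg C (Id C B) ## y = hom_neg C y" if "y : Arr C" "Cod C y = B" for y using that Sd(1) by (simp add: ng_comp)
 then have "?N = {(x, h). h : Arr C & Cod C h = B & (x, hom_neg C (Id C B) ## h) : F}" by auto
 then show "rep C A B ?N" using rep_pull[OF Fd(1) n(1,3)] n(2) by simp
 fix f assume f: "f : Arr C" "Cod C f = A"
 obtain e y where e: "regular_epi C e" "e : Arr C" "Cod C e = Dom C f" "(f ## e, y) : F" "y : Arr C" "Dom C y = Dom C e" "Cod C y = B"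
  by (rule Mor_total[OF F f])
 then have "(f ## e, hom_neg C y) : ?N" by simp
 then show "EX e y. regular_epi C e & Cod C e = Dom C f & (f ## e, y) : ?N" using e(1,3) by blast
next
 note Fd = MorD[OF F] and Sd = EqD[OF S]
 fix f g g' assume h: "(f, g) : ?N" "(f, g') : ?N"
 then have "(hom_neg C g, hom_neg C g') : S" using Fd(2) by blast
 from rep_neg[OF Sd(2) this] show "(g, g') : S" using h by simp
next
 note Fd = MorD[OF F] and Sd = EqD[OF S]
 fix f f' g g' assume h: "(f, f') : R" "(f, g) : ?N" "(g, g') : S"
 note t = rep_typed[OF Sd(2) h(3)]
 have "(f', hom_neg C g') : F" by (rule Fd(3)[OF h(1) _ rep_neg[OF Sd(2) h(3)]]) (use h(2) in simp)
 then show "(f', g') : ?N" using t by simp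
qed

lemma Mor_zero:
 assumes R: "Eq C A R" and S: "Eq C B S"
 shows "Mor C A R B S (gm C (\<zero> A B) S)"
proof (rule Mor_gm[OF R S])
 note Rd = EqD[OF R] and Sd = EqD[OF S]
 fix x x' assume x: "(x, x') : R"
 note t = rep_typed[OF Rd(2) x]
 show "(\<zero> A B ## x, \<zero> A B ## x') : S" using t Sd(1) Sd(3)[of "\<zero> (Dom C x') B"] by simp
qed (use EqD(1)[OF R] EqD(1)[OF S] in simp_all)

definition "plE f g = mk C (Dom E f) (rplus C (el C f) (el C g)) (Cod E f)"
definition "zeE a b = mk C a (gm C (\<zero> (fst a) (fst b)) (eo C b)) b"
definition "ngE f = mk C (Dom E f) {(x, y). y : Arr C & Cod C y = fst (Cod E f) & (x, hom_neg C y) : el C f} (Cod E f)"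

lemma plE:
 assumes "f : Arr E" "g : Arr E" "Dom E f = Dom E g" "Cod E f = Cod E g"
 shows "plE f g : Arr E" "Dom E (plE f g) = Dom E f" "Cod E (plE f g) = Cod E f" "el C (plE f g) = rplus C (el C f) (el C g)"
proof -
 note fd = E_arrD[OF assms(1)] and gd = E_arrD[OF assms(2), folded assms(3,4)]
 note m = E_mk[OF fd(1,2) Mor_rplus[OF fd(3) gd(3) E_objD(1)[OF fd(1)] E_objD(1)[OF fd(2)]]]
 show "plE f g : Arr E" "Dom E (plE f g) = Dom E f" "Cod E (plE f g) = Cod E f" "el C (plE f g) = rplus C (el C f) (el C g)"
  unfolding plE_def using m by blast+
qed

lemma zeE:
 assumes "a : Obj E" "b : Obj E"
 shows "zeE a b : Arr E" "Dom E (zeE a b) = a" "Cod E (zeE a b) = b" "el C (zeE a b) = gm C (\<zero> (fst a) (fst b)) (eo C b)"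
 unfolding zeE_def using E_mk[OF assms Mor_zero[OF E_objD(1)[OF assms(1)] E_objD(1)[OF assms(2)]]] by blast+

lemma ngE:
 assumes "f : Arr E"
 shows "ngE f : Arr E" "Dom E (ngE f) = Dom E f" "Cod E (ngE f) = Cod E f"
  "el C (ngE f) = {(x, y). y : Arr C & Cod C y = fst (Cod E f) & (x, hom_neg C y) : el C f}"
proof -
 note fd = E_arrD[OF assms(1)]
 note m = E_mk[OF fd(1,2) Mor_neg[OF fd(3) E_objD(1)[OF fd(2)]]]
 show "ngE f : Arr E" "Dom E (ngE f) = Dom E f" "Cod E (ngE f) = Cod E f"
  "el C (ngE f) = {(x, y). y : Arr C & Cod C y = fst (Cod E f) & (x, hom_neg C y) : el C f}"
  unfolding ngE_def using m by blast+
qed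

lemma E_plI:
 assumes "f : Arr E" "g : Arr E" "Dom E f = Dom E g" "Cod E f = Cod E g" "(x, y) : el C f" "(x, z) : el C g"
 shows "(x, y \<oplus> z) : el C (plE f g)"
 unfolding plE(4)[OF assms(1-4)]
 by (rule rplusI[OF E_rep[OF assms(1)] E_rep[OF assms(2), folded assms(3,4)] assms(5,6)])

lemma E_zeI:
 assumes "a : Obj E" "b : Obj E" "x : Arr C" "Cod C x = fst a"
 shows "(x, \<zero> (Dom C x) (fst b)) : el C (zeE a b)"
 unfolding zeE(4)[OF assms(1,2)]
proof -
 note A = EqD(1)[OF E_objD(1)[OF assms(1)]] and B = EqD(1)[OF E_objD(1)[OF assms(2)]]
 from gmI[OF E_objD(1)[OF assms(2)], of "\<zero> (fst a) (fst b)" x]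
 show "(x, \<zero> (Dom C x) (fst b)) : gm C (\<zero> (fst a) (fst b)) (eo C b)" using assms(3,4) A B by simp
qed

lemma E_ngI:
 assumes "f : Arr E" "(x, y) : el C f"
 shows "(x, hom_neg C y) : el C (ngE f)"
 unfolding ngE(4)[OF assms(1)] using assms(2) rep_typed[OF E_rep[OF assms(1)] assms(2)] by simp

lemma E_prec: "f : Arr E ==> (x, y) : el C f ==> d : Arr C ==> Cod C d = Dom C y ==> (x ## d, y ## d) : el C f"
 by (rule rep_precomp[OF E_rep])

lemma E_pair:
 assumes "f : Arr E" "g : Arr E" "Dom E f = Dom E g" "x : Arr C" "Cod C x = fst (Dom E f)"
 obtains e y z where "regular_epi C e" "e : Arr C" "Cod C e = Dom C x" "(x ## e, y) : el C f" "(x ## e, z) : el C g"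
  "y : Arr C" "Dom C y = Dom C e" "Cod C y = fst (Cod E f)" "z : Arr C" "Dom C z = Dom C e" "Cod C z = fst (Cod E g)"
 by (rule Mor_total2[OF E_arrD(3)[OF assms(1)] E_arrD(3)[OF assms(2), folded assms(3)] assms(4,5)])

lemma E_refine:
 assumes "regular_epi C e" "regular_epi C d" "e : Arr C" "d : Arr C" "Cod C d = Dom C e" "x : Arr C" "Cod C e = Dom C x"
 shows "regular_epi C (e ## d)" "e ## d : Arr C" "Cod C (e ## d) = Dom C x" "(x ## e) ## d = x ## (e ## d)" "Dom C (e ## d) = Dom C d"
 using cover_comp[OF assms(1,2,5)] assms by simp_all

lemma preadd_E: "preadd E plE zeE ngE"
proof -
 interpret E: category E by (rule category_E)
 show ?thesis
 proof
  fix f g assume "f : Arr E" "g : Arr E" "Dom E f = Dom E g" "Cod E f = Cod E g"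
  then show "plE f g : Arr E & Dom E (plE f g) = Dom E f & Cod E (plE f g) = Cod E f" using plE by blast
 next
  fix a b assume "a : Obj E" "b : Obj E"
  then show "zeE a b : Arr E & Dom E (zeE a b) = a & Cod E (zeE a b) = b" using zeE by blast
 next
  fix f assume "f : Arr E"
  then show "ngE f : Arr E & Dom E (ngE f) = Dom E f & Cod E (ngE f) = Cod E f" using ngE by blast
 next
  fix f g h assume t: "f : Arr E" "g : Arr E" "h : Arr E" "Dom E f = Dom E g" "Cod E f = Cod E g" "Dom E g = Dom E h" "Cod E g = Cod E h"
  note fg = plE[OF t(1,2,4,5)] and gh = plE[OF t(2,3,6,7)]
  have c1: "Dom E (plE f g) = Dom E h" "Cod E (plE f g) = Cod E h" "Dom E f = Dom E (plE g h)" "Cod E f = Cod E (plE g h)"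
   using fg gh t by simp_all
  note l = plE[OF fg(1) t(3) c1(1,2)] and r = plE[OF t(1) gh(1) c1(3,4)]
  show "plE (plE f g) h = plE f (plE g h)"
  proof (rule E_ext)
   fix x assume x: "x : Arr C" "Cod C x = fst (Dom E (plE f (plE g h)))"
   have x': "Cod C x = fst (Dom E f)" using x r by simp
   obtain e y z where e: "regular_epi C e" "e : Arr C" "Cod C e = Dom C x" "(x ## e, y) : el C f" "(x ## e, z) : el C g"
    "y : Arr C" "Dom C y = Dom C e" "Cod C y = fst (Cod E f)" "z : Arr C" "Dom C z = Dom C e" "Cod C z = fst (Cod E g)"
    by (rule E_pair[OF t(1,2,4) x(1) x'])
   obtain d w where d: "regular_epi C d" "d : Arr C" "Cod C d = Dom C (x ## e)" "((x ## e) ## d, w) : el C h" "w : Arr C" "Dom C w = Dom C d" "Cod C w = fst (Cod E h)"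
    by (rule E_total[OF t(3), of "x ## e"]) (use x x' e t in simp_all)
   have de: "Cod C d = Dom C e" using d(3) x e by simp
   note rf = E_refine[OF e(1) d(1) e(2) d(2) de x(1) e(3)]
   have 1: "((x ## e) ## d, y ## d) : el C f" by (rule E_prec[OF t(1) e(4) d(2)]) (use de e in simp)
   have 2: "((x ## e) ## d, z ## d) : el C g" by (rule E_prec[OF t(2) e(5) d(2)]) (use de e in simp)
   have "((x ## e) ## d, (y ## d \<oplus> z ## d) \<oplus> w) : el C (plE (plE f g) h)"
    by (rule E_plI[OF fg(1) t(3) c1(1,2) E_plI[OF t(1,2,4,5) 1 2] d(4)])
   moreover have "((x ## e) ## d, y ## d \<oplus> (z ## d \<oplus> w)) : el C (plE f (plE g h))"
    by (rule E_plI[OF t(1) gh(1) c1(3,4) 1 E_plI[OF t(2,3,6,7) 2 d(4)]])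
   moreover have "(y ## d \<oplus> z ## d) \<oplus> w = y ## d \<oplus> (z ## d \<oplus> w)" by (rule pl_assoc) (use e d de t in simp_all)
   ultimately show "EX e y. regular_epi C e & Cod C e = Dom C x & (x ## e, y) : el C (plE (plE f g) h) & (x ## e, y) : el C (plE f (plE g h))"
    using rf(1,3) unfolding rf(4) by metis
  qed (use l r fg gh t in simp_all)
 next
  fix f g assume t: "f : Arr E" "g : Arr E" "Dom E f = Dom E g" "Cod E f = Cod E g"
  note l = plE[OF t] and r = plE[OF t(2,1) t(3)[symmetric] t(4)[symmetric]]
  show "plE f g = plE g f"
  proof (rule E_ext)
   fix x assume x: "x : Arr C" "Cod C x = fst (Dom E (plE g f))"
   have x': "Cod C x = fst (Dom E f)" using x r t by simp
   obtain e y z where e: "regular_epi C e" "e : Arr C" "Cod C e = Dom C x" "(x ## e, y) : el C f" "(x ## e, z) : el C g"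
    "y : Arr C" "Dom C y = Dom C e" "Cod C y = fst (Cod E f)" "z : Arr C" "Dom C z = Dom C e" "Cod C z = fst (Cod E g)"
    by (rule E_pair[OF t(1-3) x(1) x'])
   have "y \<oplus> z = z \<oplus> y" by (rule pl_comm) (use e t in simp_all)
   then have "(x ## e, y \<oplus> z) : el C (plE g f)" using E_plI[OF t(2,1) t(3)[symmetric] t(4)[symmetric] e(5,4)] by simp
   with E_plI[OF t e(4,5)]
   show "EX e y. regular_epi C e & Cod C e = Dom C x & (x ## e, y) : el C (plE f g) & (x ## e, y) : el C (plE g f)" using e(1,3) by blast
  qed (use l r t in simp_all)
 next
  fix f assume t: "f : Arr E"
  note fd = E_arrD[OF t]
  note z = zeE[OF fd(1,2)] and n = ngE[OF t]
  have zd: "Dom E f = Dom E (zeE (Dom E f) (Cod E f))" "Cod E f = Cod E (zeE (Dom E f) (Cod E f))" using z by simp_all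
  have nd: "Dom E f = Dom E (ngE f)" "Cod E f = Cod E (ngE f)" using n by simp_all
  note l = plE[OF t z(1) zd] and r = plE[OF t n(1) nd]
  have key: "EX e y. regular_epi C e & Cod C e = Dom C x & e : Arr C & (x ## e, y) : el C f \<and>
    (x ## e, y) : el C (plE f (zeE (Dom E f) (Cod E f))) \<and>
    (x ## e, \<zero> (Dom C e) (fst (Cod E f))) : el C (plE f (ngE f)) \<and>
    (x ## e, \<zero> (Dom C e) (fst (Cod E f))) : el C (zeE (Dom E f) (Cod E f))"
   if x: "x : Arr C" "Cod C x = fst (Dom E f)" for x
  proof -
   obtain e y where e: "regular_epi C e" "e : Arr C" "Cod C e = Dom C x" "(x ## e, y) : el C f"
    "y : Arr C" "Dom C y = Dom C e" "Cod C y = fst (Cod E f)" by (rule E_total[OF t x])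
   have 0: "(x ## e, \<zero> (Dom C e) (fst (Cod E f))) : el C (zeE (Dom E f) (Cod E f))"
    using E_zeI[OF fd(1,2), of "x ## e"] x e by simp
   have 1: "(x ## e, y) : el C (plE f (zeE (Dom E f) (Cod E f)))"
    using E_plI[OF t z(1) zd e(4) 0] e by simp
   have 2: "(x ## e, \<zero> (Dom C e) (fst (Cod E f))) : el C (plE f (ngE f))"
    using E_plI[OF t n(1) nd e(4) E_ngI[OF t e(4)]] e by (simp add: pl_ng)
   show ?thesis using 0 1 2 e by blast
  qed
  show "plE f (zeE (Dom E f) (Cod E f)) = f"
   by (rule E_ext[OF l(1) t]) (use l key in \<open>simp, simp, blast\<close>)
  show "plE f (ngE f) = zeE (Dom E f) (Cod E f)"
  proof (rule E_ext[OF r(1) z(1)])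
   fix x assume "x : Arr C" "Cod C x = fst (Dom E (zeE (Dom E f) (Cod E f)))"
   then show "EX e y. regular_epi C e & Cod C e = Dom C x & (x ## e, y) : el C (plE f (ngE f)) & (x ## e, y) : el C (zeE (Dom E f) (Cod E f))"
    using key[of x] unfolding z(2) by blast
  qed (use r z in simp_all)
 next
  fix f g h assume t: "f : Arr E" "g : Arr E" "h : Arr E" "Dom E f = Dom E g" "Cod E f = Dom E h" "Cod E g = Dom E h"
  have cfg: "Cod E f = Cod E g" using t by simp
  note fg = plE[OF t(1,2,4) cfg] and hf = E_comp[OF t(1,3,5)] and hg = E_comp[OF t(2,3,6)]
  have c1: "Cod E (plE f g) = Dom E h" using fg t by simp
  have c2: "Dom E (Comp E h f) = Dom E (Comp E h g)" "Cod E (Comp E h f) = Cod E (Comp E h g)" using hf hg t by simp_all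
  note l = E_comp[OF fg(1) t(3) c1] and r = plE[OF hf(1) hg(1) c2]
  show "Comp E h (plE f g) = plE (Comp E h f) (Comp E h g)"
  proof (rule E_ext)
   fix x assume x: "x : Arr C" "Cod C x = fst (Dom E (plE (Comp E h f) (Comp E h g)))"
   have x': "Cod C x = fst (Dom E f)" using x r hf by simp
   obtain e y z where e: "regular_epi C e" "e : Arr C" "Cod C e = Dom C x" "(x ## e, y) : el C f" "(x ## e, z) : el C g"
    "y : Arr C" "Dom C y = Dom C e" "Cod C y = fst (Cod E f)" "z : Arr C" "Dom C z = Dom C e" "Cod C z = fst (Cod E g)"
    by (rule E_pair[OF t(1,2,4) x(1) x'])
   obtain d u where d: "regular_epi C d" "d : Arr C" "Cod C d = Dom C y" "(y ## d, u) : el C h" "u : Arr C" "Dom C u = Dom C d" "Cod C u = fst (Cod E h)"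
    by (rule E_total[OF t(3) e(6)]) (use e t in simp)
   obtain c v where c: "regular_epi C c" "c : Arr C" "Cod C c = Dom C (z ## d)" "((z ## d) ## c, v) : el C h" "v : Arr C" "Dom C v = Dom C c" "Cod C v = fst (Cod E h)"
    by (rule E_total[OF t(3), of "z ## d"]) (use e d t in simp_all)
   have de: "Cod C d = Dom C e" using d e by simp
   have cd: "Cod C c = Dom C d" using c(3) d e by simp
   note rf = E_refine[OF e(1) d(1) e(2) d(2) de x(1) e(3)]
   note rg = E_refine[OF rf(1) c(1) rf(2) c(2) _ x(1) rf(3), unfolded rf(5), OF cd]
   let ?x = "((x ## e) ## d) ## c"
   have xx: "?x = x ## ((e ## d) ## c)" unfolding rf(4) using rg(4) .
   have y1: "((x ## e) ## d, y ## d) : el C f" by (rule E_prec[OF t(1) e(4) d(2,3)])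
   have y2: "(?x, (y ## d) ## c) : el C f" by (rule E_prec[OF t(1) y1 c(2)]) (use e d cd in simp)
   have z1: "((x ## e) ## d, z ## d) : el C g" by (rule E_prec[OF t(2) e(5) d(2)]) (use e de in simp)
   have z2: "(?x, (z ## d) ## c) : el C g" by (rule E_prec[OF t(2) z1 c(2,3)])
   have u2: "((y ## d) ## c, u ## c) : el C h" by (rule E_prec[OF t(3) d(4) c(2)]) (use d cd in simp)
   have hh: "((y ## d) ## c \<oplus> (z ## d) ## c, u ## c \<oplus> v) : el C h"
    by (rule rep_plus[OF E_rep[OF t(3)] u2 c(4)]) (use d c cd in simp)
   have 1: "(?x, u ## c \<oplus> v) : el C (Comp E h (plE f g))"
    by (rule E_compI[OF fg(1) t(3) c1 E_plI[OF t(1,2,4) cfg y2 z2] hh])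
   have 2: "(?x, u ## c \<oplus> v) : el C (plE (Comp E h f) (Comp E h g))"
    by (rule E_plI[OF hf(1) hg(1) c2 E_compI[OF t(1,3,5) y2 u2] E_compI[OF t(2,3,6) z2 c(4)]])
   show "EX e y. regular_epi C e & Cod C e = Dom C x & (x ## e, y) : el C (Comp E h (plE f g)) & (x ## e, y) : el C (plE (Comp E h f) (Comp E h g))"
    using 1 2 rg(1,3) unfolding xx by blast
  qed (use l r fg hf hg t in simp_all)
 next
  fix f g h assume t: "f : Arr E" "g : Arr E" "h : Arr E" "Cod E f = Cod E g" "Cod E h = Dom E f" "Cod E h = Dom E g"
  have dfg: "Dom E f = Dom E g" using t by simp
  note fg = plE[OF t(1,2) dfg t(4)] and fh = E_comp[OF t(3,1,5)] and gh = E_comp[OF t(3,2,6)]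
  have c1: "Cod E h = Dom E (plE f g)" using fg t by simp
  have c2: "Dom E (Comp E f h) = Dom E (Comp E g h)" "Cod E (Comp E f h) = Cod E (Comp E g h)" using fh gh t by simp_all
  note l = E_comp[OF t(3) fg(1) c1] and r = plE[OF fh(1) gh(1) c2]
  show "Comp E (plE f g) h = plE (Comp E f h) (Comp E g h)"
  proof (rule E_ext)
   fix x assume x: "x : Arr C" "Cod C x = fst (Dom E (plE (Comp E f h) (Comp E g h)))"
   have x': "Cod C x = fst (Dom E h)" using x r fh by simp
   obtain e y where e: "regular_epi C e" "e : Arr C" "Cod C e = Dom C x" "(x ## e, y) : el C h"
    "y : Arr C" "Dom C y = Dom C e" "Cod C y = fst (Cod E h)" by (rule E_total[OF t(3) x(1) x'])
   have y': "Cod C y = fst (Dom E f)" using e t by simp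
   obtain d u v where d: "regular_epi C d" "d : Arr C" "Cod C d = Dom C y" "(y ## d, u) : el C f" "(y ## d, v) : el C g"
    "u : Arr C" "Dom C u = Dom C d" "Cod C u = fst (Cod E f)" "v : Arr C" "Dom C v = Dom C d" "Cod C v = fst (Cod E g)"
    by (rule E_pair[OF t(1,2) dfg e(5) y'])
   have de: "Cod C d = Dom C e" using d e by simp
   note rf = E_refine[OF e(1) d(1) e(2) d(2) de x(1) e(3)]
   have y1: "((x ## e) ## d, y ## d) : el C h" by (rule E_prec[OF t(3) e(4) d(2,3)])
   have 1: "((x ## e) ## d, u \<oplus> v) : el C (Comp E (plE f g) h)"
    by (rule E_compI[OF t(3) fg(1) c1 y1 E_plI[OF t(1,2) dfg t(4) d(4,5)]])
   have 2: "((x ## e) ## d, u \<oplus> v) : el C (plE (Comp E f h) (Comp E g h))"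
    by (rule E_plI[OF fh(1) gh(1) c2 E_compI[OF t(3,1,5) y1 d(4)] E_compI[OF t(3,2,6) y1 d(5)]])
   show "EX e y. regular_epi C e & Cod C e = Dom C x & (x ## e, y) : el C (Comp E (plE f g) h) & (x ## e, y) : el C (plE (Comp E f h) (Comp E g h))"
    using 1 2 rf(1,3) unfolding rf(4) by blast
  qed (use l r fg fh gh t in simp_all)
 qed
qed

lemma E_gm:
 assumes ab: "a : Obj E" "b : Obj E" and f: "f : Arr C" "Dom C f = fst a" "Cod C f = fst b"
  and resp: "!!x x'. (x, x') : eo C a ==> (f ## x, f ## x') : eo C b"
 shows "mk C a (gm C f (eo C b)) b : Arr E" "Dom E (mk C a (gm C f (eo C b)) b) = a" "Cod E (mk C a (gm C f (eo C b)) b) = b"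
  "el C (mk C a (gm C f (eo C b)) b) = gm C f (eo C b)"
  "!!x. x : Arr C ==> Cod C x = fst a ==> (x, f ## x) : el C (mk C a (gm C f (eo C b)) b)"
proof -
 note m = E_mk[OF ab Mor_gm[OF E_objD(1)[OF ab(1)] E_objD(1)[OF ab(2)] f resp]]
 show "mk C a (gm C f (eo C b)) b : Arr E" "Dom E (mk C a (gm C f (eo C b)) b) = a" "Cod E (mk C a (gm C f (eo C b)) b) = b"
  and el: "el C (mk C a (gm C f (eo C b)) b) = gm C f (eo C b)" using m by blast+
 show "(x, f ## x) : el C (mk C a (gm C f (eo C b)) b)" if "x : Arr C" "Cod C x = fst a" for x
  unfolding el by (rule gmI[OF E_objD(1)[OF ab(2)] f(1) that(1)]) (use that f in simp_all)
qed

lemma E_ext':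
 assumes f: "f : Arr E" "g : Arr E" "Dom E f = Dom E g" "Cod E f = Cod E g"
  and ag: "!!x. x : Arr C ==> Cod C x = fst (Dom E g) ==> EX y. (x, y) : el C f & (x, y) : el C g"
 shows "f = g"
proof (rule E_ext[OF f])
 fix x assume x: "x : Arr C" "Cod C x = fst (Dom E g)"
 obtain y where "(x, y) : el C f" "(x, y) : el C g" using ag[OF x] by blast
 then show "EX e y. regular_epi C e & Cod C e = Dom C x & (x ## e, y) : el C f & (x ## e, y) : el C g"
  using x cover_id[of "Dom C x"] by (intro exI[of _ "Id C (Dom C x)"] exI[of _ y]) simp
qed

lemma disc_iff: "A : Obj C ==> (x, y) : El C (Id C A) (Id C A) \<longleftrightarrow> x = y & x : Arr C & Cod C x = A"
 using ElI[of x "Id C A" "Id C A"] by (auto elim!: ElE)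

lemma Eq_disc:
 assumes "A : Obj C" shows "Eq C A (El C (Id C A) (Id C A))"
 using rep_graph[of "Id C A"] assms unfolding Eq_def by (simp add: disc_iff)

lemma E_idI: "a : Obj E ==> x : Arr C ==> Cod C x = fst a ==> (x, x) : el C (Id E a)"
 unfolding E_id(4) by (rule EqD(3)[OF E_objD(1)])

lemma additive_E: "additive_category E"
proof -
 interpret E: preadd E plE zeE ngE by (rule preadd_E)
 obtain Z where Z: "zero_object C Z" by (rule zero_objectE)
 then have Zo: "Z : Obj C" by (simp add: zero_object_def)
 let ?z = "(Z, spans C (El C (Id C Z) (Id C Z)))"
 note z = E_objI(1)[OF Eq_disc[OF Zo]]
 show ?thesis
 proof (rule E.additiveI[OF z])
  show "Id E ?z = zeE ?z ?z"
  proof (rule E_ext')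
   fix x assume x: "x : Arr C" "Cod C x = fst (Dom E (zeE ?z ?z))"
   then have x': "Cod C x = Z" using zeE(2)[OF z z] by simp
   have "x = \<zero> (Dom C x) Z" by (rule to_zero_object_unique[OF Z]) (use x x' Zo in simp_all)
   then have "(x, x) : el C (zeE ?z ?z)" using E_zeI[OF z z x(1)] x' by simp
   then show "EX y. (x, y) : el C (Id E ?z) & (x, y) : el C (zeE ?z ?z)" using E_idI[OF z x(1)] x' by auto
  qed (use E_id[OF z] zeE[OF z z] in simp_all)
 next
  fix a b assume ab: "a : Obj E" "b : Obj E"
  note A = EqD[OF E_objD(1)[OF ab(1)]] and B = EqD[OF E_objD(1)[OF ab(2)]]
  obtain P i j p q where bp: "biprod C (hom_plus C) (zero_arr C) (fst a) (fst b) P i j p q" by (rule biprodE[OF A(1) B(1)])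
  note bs = biprod_simps[OF bp]
  define R where "R = {(x, h). h : Arr C & Cod C h = P & (x, p ## h) : gm C p (eo C a)} \<inter>
    {(x, h). h : Arr C & Cod C h = P & (x, q ## h) : gm C q (eo C b)}"
  have Rm: "(x, y) : R \<longleftrightarrow> x : Arr C & Cod C x = P & y : Arr C & Cod C y = P & (p ## x, p ## y) : eo C a & (q ## x, q ## y) : eo C b" for x y
   unfolding R_def gm_def using bs(11,14) by auto
  have rp: "rep C P (fst a) (gm C p (eo C a))" using rep_gm[OF A(2) bs(10,12)] bs(11) by (simp add: gm_def)
  have rq: "rep C P (fst b) (gm C q (eo C b))" using rep_gm[OF B(2) bs(13,15)] bs(14) by (simp add: gm_def)
  have "rep C P P R" unfolding R_def by (rule rep_inter[OF rep_pull[OF rp bs(10,12), unfolded bs(11)] rep_pull[OF rq bs(13,15), unfolded bs(14)]])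
  then have R: "Eq C P R" unfolding Eq_def Rm
   using bs(3,10-15) A(3)[of "p ## f" for f] B(3)[of "q ## f" for f] by (simp, blast intro: A(4,5) B(4,5))
  let ?c = "(P, spans C R)"
  note c = E_objI[OF R]
  let ?i = "mk C a (gm C i (eo C ?c)) ?c" and ?j = "mk C b (gm C j (eo C ?c)) ?c"
   and ?p = "mk C ?c (gm C p (eo C a)) a" and ?q = "mk C ?c (gm C q (eo C b)) b"
  have ri: "(i ## x, i ## x') : eo C ?c" if x: "(x, x') : eo C a" for x x'
  proof -
   note t = rep_typed[OF A(2) x]
   have "p ## (i ## x) = x" "p ## (i ## x') = x'" "q ## (i ## x) = \<zero> (Dom C x') (fst b)" "q ## (i ## x') = \<zero> (Dom C x') (fst b)"
    using assoc_rewrite[OF bs(16), of x] assoc_rewrite[OF bs(16), of x'] assoc_rewrite[OF bs(18), of x] assoc_rewrite[OF bs(18), of x'] t bs(1-15) by simp_all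
   then show ?thesis unfolding c(2) Rm using t bs(1-15) x B(3)[of "\<zero> (Dom C x') (fst b)"] by simp
  qed
  have rj: "(j ## x, j ## x') : eo C ?c" if x: "(x, x') : eo C b" for x x'
  proof -
   note t = rep_typed[OF B(2) x]
   have "q ## (j ## x) = x" "q ## (j ## x') = x'" "p ## (j ## x) = \<zero> (Dom C x') (fst a)" "p ## (j ## x') = \<zero> (Dom C x') (fst a)"
    using assoc_rewrite[OF bs(17), of x] assoc_rewrite[OF bs(17), of x'] assoc_rewrite[OF bs(19), of x] assoc_rewrite[OF bs(19), of x'] t bs(1-15) by simp_all
   then show ?thesis unfolding c(2) Rm using t bs(1-15) x A(3)[of "\<zero> (Dom C x') (fst a)"] by simp
  qed
  have I: "?i : Arr E" "Dom E ?i = a" "Cod E ?i = ?c" "!!x. x : Arr C ==> Cod C x = fst a ==> (x, i ## x) : el C ?i"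
   by (rule E_gm[OF ab(1) c(1) bs(4,5)]; (erule ri | simp add: bs(6)))+
  have J: "?j : Arr E" "Dom E ?j = b" "Cod E ?j = ?c" "!!x. x : Arr C ==> Cod C x = fst b ==> (x, j ## x) : el C ?j"
   by (rule E_gm[OF ab(2) c(1) bs(7,8)]; (erule rj | simp add: bs(9)))+
  have P1: "?p : Arr E" "Dom E ?p = ?c" "Cod E ?p = a" "!!x. x : Arr C ==> Cod C x = P ==> (x, p ## x) : el C ?p"
   by (rule E_gm[OF c(1) ab(1) bs(10)]; simp add: bs(11,12) c(2) Rm)+
  have P2: "?q : Arr E" "Dom E ?q = ?c" "Cod E ?q = b" "!!x. x : Arr C ==> Cod C x = P ==> (x, q ## x) : el C ?q"
   by (rule E_gm[OF c(1) ab(2) bs(13)]; simp add: bs(14,15) c(2) Rm)+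
  have comps: "Cod E ?i = Dom E ?p" "Cod E ?j = Dom E ?q" "Cod E ?i = Dom E ?q" "Cod E ?j = Dom E ?p" "Cod E ?p = Dom E ?i" "Cod E ?q = Dom E ?j"
   using I(2,3) J(2,3) P1(2,3) P2(2,3) by simp_all
  note k1 = E_comp[OF I(1) P1(1) comps(1)] and k2 = E_comp[OF J(1) P2(1) comps(2)] and k3 = E_comp[OF I(1) P2(1) comps(3)]
   and k4 = E_comp[OF J(1) P1(1) comps(4)] and k5 = E_comp[OF P1(1) I(1) comps(5)] and k6 = E_comp[OF P2(1) J(1) comps(6)]
  have e1: "Comp E ?p ?i = Id E a"
  proof (rule E_ext')
   fix x assume x: "x : Arr C" "Cod C x = fst (Dom E (Id E a))"
   then have x': "Cod C x = fst a" using E_id(2)[OF ab(1)] by simp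
   have "p ## (i ## x) = x" using assoc_rewrite[OF bs(16), of x] x(1) x' bs(1-15) by simp
   then have "(x, x) : el C (Comp E ?p ?i)"
    using E_compI[OF I(1) P1(1) comps(1) I(4)[OF x(1) x'] P1(4)[of "i ## x"]] x(1) x' bs(1-15) by simp
   then show "EX y. (x, y) : el C (Comp E ?p ?i) & (x, y) : el C (Id E a)" using E_idI[OF ab(1) x(1) x'] by blast
  qed (use k1 E_id[OF ab(1)] I P1 in simp_all)
  have e2: "Comp E ?q ?j = Id E b"
  proof (rule E_ext')
   fix x assume x: "x : Arr C" "Cod C x = fst (Dom E (Id E b))"
   then have x': "Cod C x = fst b" using E_id(2)[OF ab(2)] by simp
   have "q ## (j ## x) = x" using assoc_rewrite[OF bs(17), of x] x(1) x' bs(1-15) by simp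
   then have "(x, x) : el C (Comp E ?q ?j)"
    using E_compI[OF J(1) P2(1) comps(2) J(4)[OF x(1) x'] P2(4)[of "j ## x"]] x(1) x' bs(1-15) by simp
   then show "EX y. (x, y) : el C (Comp E ?q ?j) & (x, y) : el C (Id E b)" using E_idI[OF ab(2) x(1) x'] by blast
  qed (use k2 E_id[OF ab(2)] J P2 in simp_all)
  have e3: "Comp E ?q ?i = zeE a b"
  proof (rule E_ext')
   fix x assume x: "x : Arr C" "Cod C x = fst (Dom E (zeE a b))"
   then have x': "Cod C x = fst a" using zeE(2)[OF ab] by simp
   have "q ## (i ## x) = \<zero> (Dom C x) (fst b)" using assoc_rewrite[OF bs(18), of x] x(1) x' bs(1-15) by simp
   then have "(x, \<zero> (Dom C x) (fst b)) : el C (Comp E ?q ?i)"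
    using E_compI[OF I(1) P2(1) comps(3) I(4)[OF x(1) x'] P2(4)[of "i ## x"]] x(1) x' bs(1-15) by simp
   then show "EX y. (x, y) : el C (Comp E ?q ?i) & (x, y) : el C (zeE a b)" using E_zeI[OF ab x(1) x'] by blast
  qed (use k3 zeE[OF ab] I P2 in simp_all)
  have e4: "Comp E ?p ?j = zeE b a"
  proof (rule E_ext')
   fix x assume x: "x : Arr C" "Cod C x = fst (Dom E (zeE b a))"
   then have x': "Cod C x = fst b" using zeE(2)[OF ab(2,1)] by simp
   have "p ## (j ## x) = \<zero> (Dom C x) (fst a)" using assoc_rewrite[OF bs(19), of x] x(1) x' bs(1-15) by simp
   then have "(x, \<zero> (Dom C x) (fst a)) : el C (Comp E ?p ?j)"
    using E_compI[OF J(1) P1(1) comps(4) J(4)[OF x(1) x'] P1(4)[of "j ## x"]] x(1) x' bs(1-15) by simp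
   then show "EX y. (x, y) : el C (Comp E ?p ?j) & (x, y) : el C (zeE b a)" using E_zeI[OF ab(2,1) x(1) x'] by blast
  qed (use k4 zeE[OF ab(2,1)] J P1 in simp_all)
  have dd: "Dom E (Comp E ?i ?p) = Dom E (Comp E ?j ?q)" "Cod E (Comp E ?i ?p) = Cod E (Comp E ?j ?q)"
   using k5 k6 I J P1 P2 by simp_all
  note k7 = plE[OF k5(1) k6(1) dd]
  have e5: "plE (Comp E ?i ?p) (Comp E ?j ?q) = Id E ?c"
  proof (rule E_ext')
   fix x assume x: "x : Arr C" "Cod C x = fst (Dom E (Id E ?c))"
   then have x': "Cod C x = P" using E_id(2)[OF c(1)] by simp
   have px: "p ## x : Arr C" "Cod C (p ## x) = fst a" "q ## x : Arr C" "Cod C (q ## x) = fst b" using x(1) x' bs(1-15) by simp_all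
   have "(x, i ## (p ## x)) : el C (Comp E ?i ?p)" by (rule E_compI[OF P1(1) I(1) comps(5) P1(4)[OF x(1) x'] I(4)[OF px(1,2)]])
   moreover have "(x, j ## (q ## x)) : el C (Comp E ?j ?q)" by (rule E_compI[OF P2(1) J(1) comps(6) P2(4)[OF x(1) x'] J(4)[OF px(3,4)]])
   ultimately have "(x, i ## (p ## x) \<oplus> j ## (q ## x)) : el C (plE (Comp E ?i ?p) (Comp E ?j ?q))" by (rule E_plI[OF k5(1) k6(1) dd])
   then have "(x, x) : el C (plE (Comp E ?i ?p) (Comp E ?j ?q))" unfolding biprod_decomp[OF bp x(1) x', symmetric] .
   then show "EX y. (x, y) : el C (plE (Comp E ?i ?p) (Comp E ?j ?q)) & (x, y) : el C (Id E ?c)" using E_idI[OF c(1) x(1)] x' by auto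
  qed (use k5 k7 E_id[OF c(1)] P1 I in simp_all)
  have "biprod E plE zeE a b ?c ?i ?j ?p ?q"
   unfolding biprod_def in_Hom using ab c(1) I(1-3) J(1-3) P1(1-3) P2(1-3) e1 e2 e3 e4 e5 by blast
  then show "EX P i j p q. biprod E plE zeE a b P i j p q" by blast
 qed
qed

lemma E_zero:
 assumes "a : Obj E" "b : Obj E"
 shows "zero_arr E a b = zeE a b"
proof -
 interpret E: preadd E plE zeE ngE by (rule preadd_E)
 obtain z where "zero_object E z" using additive_E unfolding additive_category_def by blast
 then show ?thesis by (rule E.zero_arr_ze[OF _ assms])
qed

end

section \<open>The exact completion of a regular additive category is abelian\<close>

context regular_additive
begin

lemma Mor_rcompI:
 assumes F: "rep C A B F" and G: "rep C B D G" and T: "Eq C D T"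
  and tot: "!!f. f : Arr C ==> Cod C f = A ==> EX e y z. regular_epi C e & Cod C e = Dom C f & (f ## e, y) : F & (y, z) : G"
  and fn: "!!f g g' h h'. (f, g) : F ==> (g, h) : G ==> (f, g') : F ==> (g', h') : G ==> (h, h') : T"
  and l: "!!f f' g. (f, f') : R ==> (f, g) : F ==> (f', g) : F"
  and r: "!!g h h'. (g, h) : G ==> (h, h') : T ==> (g, h') : G"
  and R: "Eq C A R"
 shows "Mor C A R D T (rcomp C G F)"
 unfolding Mor_def
proof (intro conjI allI impI)
 show "rep C A D (rcomp C G F)" by (rule rep_rcomp(1)[OF F G])
 fix f assume f: "f : Arr C" "Cod C f = A"
 obtain e y z where e: "regular_epi C e" "Cod C e = Dom C f" "(f ## e, y) : F" "(y, z) : G" using tot[OF f] by blast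
 show "EX e y. regular_epi C e & Cod C e = Dom C f & (f ## e, y) : rcomp C G F" using e(1,2) rcompI[OF F G e(3,4)] by blast
next
 note Td = EqD[OF T]
 fix f h h' assume "(f, h) : rcomp C G F" "(f, h') : rcomp C G F"
 then obtain e y e' y' where e: "f : Arr C" "h : Arr C" "Dom C f = Dom C h" "regular_epi C e" "e : Arr C" "Cod C e = Dom C h"
   "(f ## e, y) : F" "(y, h ## e) : G" and
  e': "h' : Arr C" "Dom C f = Dom C h'" "regular_epi C e'" "e' : Arr C" "Cod C e' = Dom C h'" "(f ## e', y') : F" "(y', h' ## e') : G"
  by (elim rcompE)
 have ee: "Cod C e = Cod C e'" using e e' by simp
 obtain a b where ab: "a : Arr C" "b : Arr C" "Dom C a = Dom C b" "Cod C a = Dom C e" "Cod C b = Dom C e'" "e ## a = e' ## b" "regular_epi C (e' ## b)"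
  by (rule cover_common[OF e(4) e'(3) ee])
 note ty = rep_typed[OF F e(7)] and t' = rep_typed[OF F e'(6)]
 have dy: "Dom C y = Dom C e" "Dom C y' = Dom C e'" using ty(3) t'(3) e e' by simp_all
 have 1: "((f ## e) ## a, y ## a) : F" by (rule rep_precomp[OF F e(7)]) (use ab dy in simp_all)
 have 2: "((f ## e') ## b, y' ## b) : F" by (rule rep_precomp[OF F e'(6)]) (use ab dy in simp_all)
 have 3: "(f ## e) ## a = (f ## e') ## b" using ab(1-6) e(1-6) e'(1-5) by simp
 have 5: "(y ## a, (h ## e) ## a) : G" by (rule rep_precomp[OF G e(8)]) (use ab e in simp_all)
 have 6: "(y' ## b, (h' ## e') ## b) : G" by (rule rep_precomp[OF G e'(7)]) (use ab e' in simp_all)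
 have "((h ## e) ## a, (h' ## e') ## b) : T" by (rule fn[OF 1 5 2[folded 3] 6])
 then have he: "(h ## (e' ## b), h' ## (e' ## b)) : T" using ab(1-6) e(1-6) e'(1-5) by simp
 show "(h, h') : T" by (rule rep_local[OF Td(2) ab(7) _ he]) (use ab e e' in simp_all)
next
 fix f f' g g' assume m: "(f, f') : R" "(f, g) : rcomp C G F" "(g, g') : T"
 obtain e y where e: "f : Arr C" "g : Arr C" "Dom C f = Dom C g" "regular_epi C e" "e : Arr C" "Cod C e = Dom C g"
   "(f ## e, y) : F" "(y, g ## e) : G" using m(2) by (rule rcompE)
 note t = rep_typed[OF EqD(2)[OF R] m(1)] and t' = rep_typed[OF EqD(2)[OF T] m(3)]
 have 1: "(f' ## e, y) : F" by (rule l[OF rep_precomp[OF EqD(2)[OF R] m(1)] e(7)]) (use e t in simp_all)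
 have 2: "(y, g' ## e) : G" by (rule r[OF e(8) rep_precomp[OF EqD(2)[OF T] m(3)]]) (use e t' in simp_all)
 show "(f', g') : rcomp C G F" by (rule rcompI_cover[OF _ _ _ e(4) _ 1 2]) (use t t' e in simp_all)
qed

lemma kernel_rep:
 assumes F: "rep C A B F"
 obtains k where "mono_in C k" "k : Arr C" "Cod C k = A"
  "!!x. x : Arr C ==> Cod C x = A ==> (x, \<zero> (Dom C x) B) : F \<longleftrightarrow> (EX u : Arr C. Cod C u = Dom C k & x = k ## u)"
proof -
 obtain r0 r1 where r: "jointly_monic C r0 r1" "r0 : Arr C" "r1 : Arr C" "Dom C r0 = Dom C r1" "Cod C r0 = A" "Cod C r1 = B" "F = El C r0 r1"
  by (rule repE[OF F])
 obtain n where n: "is_kernel C r1 n" using kernel_ex[OF r(3)] by blast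
 note nd = kernelD[OF n]
 have nr: "Cod C n = Dom C r0" using nd r by simp
 have z: "r1 ## (n ## u) = \<zero> (Dom C u) B" if "u : Arr C" "Cod C u = Dom C n" for u
  using assoc_rewrite[OF nd(4), of u] that nd(1-3) r(2-6) rep_obj[OF F] by simp
 show thesis
 proof (rule that[of "r0 ## n"])
  show "mono_in C (r0 ## n)"
  proof (rule mono_zeroI)
   fix h assume h: "h : Arr C" "Cod C h = Dom C (r0 ## n)" "(r0 ## n) ## h = \<zero> (Dom C h) (Cod C (r0 ## n))"
   have hn: "Cod C h = Dom C n" using h(2) nd nr r by simp
   have r0: "r0 ## (n ## h) = \<zero> (Dom C h) A" using h hn nd(1-3) nr r(2-6) by simp
   have "n ## h = \<zero> (Dom C h) (Dom C r1)"
    by (rule jm_unique[OF r(1)]) (use r0 z[OF h(1) hn] h(1) hn nd(1-3) r(2-6) in simp_all)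
   then have nz: "n ## h = \<zero> (Dom C h) (Cod C n)" unfolding nd(3) .
   have "Dom C (r0 ## n) = Dom C n" using nd nr r by simp
   then show "h = \<zero> (Dom C h) (Dom C (r0 ## n))" using mono_zeroD[OF nd(5) h(1) hn nz] by metis
  qed (use nd nr r in simp)
  show "r0 ## n : Arr C" "Cod C (r0 ## n) = A" using nd nr r by simp_all
  fix x assume x: "x : Arr C" "Cod C x = A"
  show "(x, \<zero> (Dom C x) B) : F \<longleftrightarrow> (EX u : Arr C. Cod C u = Dom C (r0 ## n) & x = (r0 ## n) ## u)"
  proof
   assume "(x, \<zero> (Dom C x) B) : F"
   then obtain h where h: "h : Arr C" "Cod C h = Dom C r0" "x = r0 ## h" "\<zero> (Dom C x) B = r1 ## h" unfolding r(7) by (rule ElE)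
   obtain u where u: "u : Arr C" "Dom C u = Dom C h" "Cod C u = Dom C n" "n ## u = h"
    by (rule kernel_lift[OF n h(1)]) (use h r in simp_all)
   show "EX u : Arr C. Cod C u = Dom C (r0 ## n) & x = (r0 ## n) ## u"
    by (rule bexI[OF _ u(1)]) (use u nd nr r h(3) in simp)
  next
   assume "EX u : Arr C. Cod C u = Dom C (r0 ## n) & x = (r0 ## n) ## u"
   then obtain u where u: "u : Arr C" "Cod C u = Dom C n" "x = (r0 ## n) ## u" using nd nr r by auto
   have "(r0 ## (n ## u), r1 ## (n ## u)) : F" unfolding r(7) by (rule ElI) (use u nd nr in simp_all)
   then show "(x, \<zero> (Dom C x) B) : F" unfolding z[OF u(1,2)] using u nd nr r(2-6) by simp
  qed
 qed
qed

lemma image_rep: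
 assumes F: "rep C A B F"
 obtains m where "mono_in C m" "m : Arr C" "Cod C m = B"
  "!!x y. (x, y) : F ==> EX w : Arr C. Cod C w = Dom C m & y = m ## w"
  "!!w. w : Arr C ==> Cod C w = Dom C m ==> EX e x. regular_epi C e & Cod C e = Dom C w & (x, m ## (w ## e)) : F"
proof -
 obtain r0 r1 where r: "jointly_monic C r0 r1" "r0 : Arr C" "r1 : Arr C" "Dom C r0 = Dom C r1" "Cod C r0 = A" "Cod C r1 = B" "F = El C r0 r1"
  by (rule repE[OF F])
 obtain q m where q: "regular_epi C q" "mono_in C m" "Cod C q = Dom C m" "r1 = m ## q" using factor_ex[OF r(3)] by blast
 note qa = coverD(1)[OF q(1)] and ma = mono_arr[OF q(2)]
 have dq: "Dom C q = Dom C r0" "Cod C m = B" using q r qa ma by simp_all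
 show thesis
 proof (rule that[OF q(2) ma dq(2)])
  fix x y assume "(x, y) : F"
  then obtain h where h: "h : Arr C" "Cod C h = Dom C r0" "x = r0 ## h" "y = r1 ## h" unfolding r(7) by (rule ElE)
  then have "q ## h : Arr C" "Cod C (q ## h) = Dom C m" "y = m ## (q ## h)" using q(3) qa ma dq unfolding q(4) by simp_all
  then show "EX w : Arr C. Cod C w = Dom C m & y = m ## w" by blast
 next
  fix w assume w: "w : Arr C" "Cod C w = Dom C m"
  then have wq: "Cod C w = Cod C q" using q by simp
  obtain e f where e: "regular_epi C e" "e : Arr C" "Cod C e = Dom C w" "f : Arr C" "Dom C f = Dom C e" "Cod C f = Dom C q" "q ## f = w ## e"
   by (rule cover_pullback[OF q(1) w(1) wq])
  have "(r0 ## f, r1 ## f) : F" unfolding r(7) by (rule ElI) (use e dq in simp_all)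
  moreover have "r1 ## f = m ## (w ## e)" using e(4-6) qa ma q(3) by (simp add: q(4) e(7))
  ultimately show "EX e x. regular_epi C e & Cod C e = Dom C w & (x, m ## (w ## e)) : F" using e(1,3) by metis
 qed
qed

lemma Eq_cosets:
 assumes m: "mono_in C m" "m : Arr C" "Cod C m = B"
 defines "S \<equiv> {(g, g'). g : Arr C & Cod C g = B & (EX w : Arr C. Cod C w = Dom C m & Dom C w = Dom C g & g' = g \<oplus> m ## w)}"
 shows "Eq C B S"
proof -
 have B: "B : Obj C" using m by auto
 have M: "Dom C m : Obj C" using m by simp
 obtain P i j p q where b: "biprod C (hom_plus C) (zero_arr C) B (Dom C m) P i j p q" by (rule biprodE[OF B M])
 note bs = biprod_simps(1-15)[OF b]
 have S: "S = El C p (p \<oplus> m ## q)"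
 proof (intro equalityI subrelI)
  fix g g' assume "(g, g') : S"
  then obtain w where w: "g : Arr C" "Cod C g = B" "w : Arr C" "Cod C w = Dom C m" "Dom C w = Dom C g" "g' = g \<oplus> m ## w"
   unfolding S_def by blast
  obtain h where h: "h : Arr C" "Dom C h = Dom C g" "Cod C h = P" "p ## h = g" "q ## h = w"
   by (rule biprod_pair[OF b w(1,3) w(5)[symmetric] w(2,4)])
  have "(p ## h, (p \<oplus> m ## q) ## h) : El C p (p \<oplus> m ## q)" by (rule ElI) (use h bs in simp_all)
  moreover have "(p \<oplus> m ## q) ## h = g'" using h bs m by (simp add: pl_comp w(6))
  ultimately show "(g, g') : El C p (p \<oplus> m ## q)" using h(4) by simp
 next
  fix g g' assume "(g, g') : El C p (p \<oplus> m ## q)"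
  then obtain h where h: "h : Arr C" "Cod C h = Dom C p" "g = p ## h" "g' = (p \<oplus> m ## q) ## h" by (rule ElE)
  then have "g' = g \<oplus> m ## (q ## h)" "g : Arr C" "Cod C g = B" "q ## h : Arr C" "Cod C (q ## h) = Dom C m" "Dom C (q ## h) = Dom C g"
   using bs m by (simp_all add: pl_comp)
  then show "(g, g') : S" unfolding S_def by blast
 qed
 have "jointly_monic C p (p \<oplus> m ## q)"
 proof (rule jmI)
  fix f g assume h: "f : Arr C" "g : Arr C" "Dom C f = Dom C g" "Cod C f = Dom C (p \<oplus> m ## q)" "Cod C g = Dom C (p \<oplus> m ## q)"
   "p ## f = p ## g" "(p \<oplus> m ## q) ## f = (p \<oplus> m ## q) ## g"
  have P: "Cod C f = P" "Cod C g = P" using h bs m by simp_all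
  have "p ## f \<oplus> m ## (q ## f) = p ## f \<oplus> m ## (q ## g)" using h(1-3,6,7) P bs m by (simp add: pl_comp)
  then have "m ## (q ## f) = m ## (q ## g)" by (rule pl_cancel[rotated -1]) (use h(1-3) P bs m in simp_all)
  note mq = this
  have "q ## f = q ## g" by (rule monoD[OF m(1) mq]) (use h(1-3) P bs m in simp_all)
  then show "f = g" by (rule biprod_unique[OF b h(1) P(1) h(2) P(2) h(6)])
 qed (use bs m in simp_all)
 then have rep: "rep C B B S" unfolding rep_def using bs m S by (intro exI[of _ p] exI[of _ "p \<oplus> m ## q"]) simp
 have refl: "(f, f) : S" if "f : Arr C" "Cod C f = B" for f
  unfolding S_def using that m M by (intro CollectI case_prodI conjI bexI[of _ "\<zero> (Dom C f) (Dom C m)"]) simp_all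
 have sym: "(g', g) : S" if gg: "(g, g') : S" for g g'
 proof -
  obtain w where w: "g : Arr C" "Cod C g = B" "w : Arr C" "Cod C w = Dom C m" "Dom C w = Dom C g" "g' = g \<oplus> m ## w"
   using gg unfolding S_def by blast
  have "g = g' \<oplus> m ## hom_neg C w" using w m by (simp add: pl_assoc comp_ng pl_ng)
  then show ?thesis unfolding S_def using w m by (intro CollectI case_prodI conjI bexI[of _ "hom_neg C w"]) simp_all
 qed
 have trans: "(g, g'') : S" if h: "(g, g') : S" "(g', g'') : S" for g g' g''
 proof -
  obtain w where w: "g : Arr C" "Cod C g = B" "w : Arr C" "Cod C w = Dom C m" "Dom C w = Dom C g" "g' = g \<oplus> m ## w"
   using h(1) unfolding S_def by blast
  obtain v where v: "v : Arr C" "Cod C v = Dom C m" "Dom C v = Dom C g'" "g'' = g' \<oplus> m ## v"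
   using h(2) unfolding S_def by blast
  have vg: "Dom C v = Dom C g" using v w m by simp
  have "g'' = g \<oplus> m ## (w \<oplus> v)" using w(1-5) v(1,2) vg m unfolding v(4) w(6) by (simp add: pl_assoc comp_pl)
  then show ?thesis unfolding S_def using w(1-5) v(1,2) vg by (intro CollectI case_prodI conjI bexI[of _ "w \<oplus> v"]) simp_all
 qed
 show ?thesis unfolding Eq_def using B rep refl sym trans by blast
qed

lemma E_sat:
 assumes "f : Arr E"
 shows "(x, y) : el C f ==> (x, y') : el C f ==> (y, y') : eo C (Cod E f)"
  "(x, x') : eo C (Dom E f) ==> (x, y) : el C f ==> (y, y') : eo C (Cod E f) ==> (x', y') : el C f"
 using MorD(2,3)[OF E_arrD(3)[OF assms]] by blast+

lemma E_typed:
 assumes "f : Arr E" "(x, y) : el C f"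
 shows "x : Arr C" "y : Arr C" "Dom C x = Dom C y" "Cod C x = fst (Dom E f)" "Cod C y = fst (Cod E f)"
  "(x, x) : eo C (Dom E f)" "(y, y) : eo C (Cod E f)"
 using rep_typed[OF E_rep[OF assms(1)] assms(2)] EqD(3)[OF E_objD(1)[OF E_arrD(1)[OF assms(1)]]]
  EqD(3)[OF E_objD(1)[OF E_arrD(2)[OF assms(1)]]] by blast+

lemma E_zero_iff:
 assumes "a : Obj E" "b : Obj E"
 shows "(x, y) : el C (zero_arr E a b) \<longleftrightarrow> x : Arr C & Cod C x = fst a & (\<zero> (Dom C x) (fst b), y) : eo C b"
 unfolding E_zero[OF assms] zeE(4)[OF assms] gm_def
 using EqD(1)[OF E_objD(1)[OF assms(1)]] EqD(1)[OF E_objD(1)[OF assms(2)]] by auto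

lemma E_zero_elem:
 assumes "f : Arr E" "x : Arr C" "Cod C x = fst (Dom E f)"
 shows "f = zero_arr E (Dom E f) (Cod E f) ==> (x, \<zero> (Dom C x) (fst (Cod E f))) : el C f"
  "(x, y) : el C f ==> f = zero_arr E (Dom E f) (Cod E f) ==> (\<zero> (Dom C x) (fst (Cod E f)), y) : eo C (Cod E f)"
proof -
 note fd = E_arrD[OF assms(1)]
 assume z: "f = zero_arr E (Dom E f) (Cod E f)"
 have "\<zero> (Dom C x) (fst (Cod E f)) : Arr C" "Cod C (\<zero> (Dom C x) (fst (Cod E f))) = fst (Cod E f)"
  using assms(2) EqD(1)[OF E_objD(1)[OF fd(2)]] by simp_all
 then have "(x, \<zero> (Dom C x) (fst (Cod E f))) : el C (zero_arr E (Dom E f) (Cod E f))"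
  unfolding E_zero_iff[OF fd(1,2)] using assms EqD(3)[OF E_objD(1)[OF fd(2)]] by blast
 then show "(x, \<zero> (Dom C x) (fst (Cod E f))) : el C f" unfolding z[symmetric] .
next
 note fd = E_arrD[OF assms(1)]
 assume z: "f = zero_arr E (Dom E f) (Cod E f)" and "(x, y) : el C f"
 then have "(x, y) : el C (zero_arr E (Dom E f) (Cod E f))" by simp
 then show "(\<zero> (Dom C x) (fst (Cod E f)), y) : eo C (Cod E f)" unfolding E_zero_iff[OF fd(1,2)] by blast
qed

lemma E_zeroI:
 assumes f: "f : Arr E"
  and "!!x. x : Arr C ==> Cod C x = fst (Dom E f) ==> EX e. regular_epi C e & Cod C e = Dom C x \<and>
   (x ## e, \<zero> (Dom C e) (fst (Cod E f))) : el C f"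
 shows "f = zero_arr E (Dom E f) (Cod E f)"
proof -
 note fd = E_arrD[OF f]
 note z = zeE[OF fd(1,2)]
 show ?thesis unfolding E_zero[OF fd(1,2)]
 proof (rule E_ext[OF f z(1)])
  fix x assume x: "x : Arr C" "Cod C x = fst (Dom E (zeE (Dom E f) (Cod E f)))"
  then have x': "Cod C x = fst (Dom E f)" using z by simp
  obtain e where e: "regular_epi C e" "Cod C e = Dom C x" "(x ## e, \<zero> (Dom C e) (fst (Cod E f))) : el C f"
   using assms(2)[OF x(1) x'] by blast
  note ea = coverD(1)[OF e(1)]
  have "(x ## e, \<zero> (Dom C e) (fst (Cod E f))) : el C (zeE (Dom E f) (Cod E f))"
   using E_zeI[OF fd(1,2), of "x ## e"] x x' e ea by simp
  then show "EX e y. regular_epi C e & Cod C e = Dom C x & (x ## e, y) : el C f & (x ## e, y) : el C (zeE (Dom E f) (Cod E f))"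
   using e by blast
 qed (use z in simp_all)
qed

lemma E_kernel:
 assumes f: "f : Arr E"
 obtains kk k where "is_kernel E f kk" "mono_in C k" "k : Arr C" "Cod C k = fst (Dom E f)" "fst (Dom E kk) = Dom C k"
  "el C kk = gm C k (eo C (Dom E f))"
  "ALL x. x : Arr C \<longrightarrow> Cod C x = fst (Dom E f) \<longrightarrow> ((x, \<zero> (Dom C x) (fst (Cod E f))) : el C f \<longleftrightarrow> (EX u : Arr C. Cod C u = Dom C k & x = k ## u))"
  "ALL u v. (u, v) : eo C (Dom E kk) \<longleftrightarrow> u : Arr C & Cod C u = Dom C k & v : Arr C & Cod C v = Dom C k & (k ## u, k ## v) : eo C (Dom E f)"
proof -
 interpret E: additive E by (rule additive.intro[OF additive_E])
 note fd = E_arrD[OF f] and F = E_rep[OF f]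
 note R = EqD[OF E_objD(1)[OF fd(1)]] and S = EqD[OF E_objD(1)[OF fd(2)]]
 obtain k where k: "mono_in C k" "k : Arr C" "Cod C k = fst (Dom E f)"
  "!!x. x : Arr C ==> Cod C x = fst (Dom E f) ==> (x, \<zero> (Dom C x) (fst (Cod E f))) : el C f \<longleftrightarrow> (EX u : Arr C. Cod C u = Dom C k & x = k ## u)"
  by (rule kernel_rep[OF F]) (blast | metis)
 have K: "Dom C k : Obj C" using k(2) by simp
 define Q where "Q = {(u, v). v : Arr C & Cod C v = Dom C k & (u, k ## v) : {(x, y). x : Arr C & Cod C x = Dom C k & (k ## x, y) : eo C (Dom E f)}}"
 have Qi: "(u, v) : Q \<longleftrightarrow> u : Arr C & Cod C u = Dom C k & v : Arr C & Cod C v = Dom C k & (k ## u, k ## v) : eo C (Dom E f)" for u v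
  unfolding Q_def by blast
 have rQ: "rep C (Dom C k) (Dom C k) Q" unfolding Q_def by (rule rep_pull[OF rep_gm[OF R(2) k(2,3)] k(2,3)])
 have kR: "(k ## u, k ## u) : eo C (Dom E f)" if "u : Arr C" "Cod C u = Dom C k" for u by (rule R(3)) (use that k in simp_all)
 have Q: "Eq C (Dom C k) Q" unfolding Eq_def using K rQ kR R(4,5) unfolding Qi by blast
 let ?K = "(Dom C k, spans C Q)"
 note Ko = E_objI[OF Q]
 let ?k = "mk C ?K (gm C k (eo C (Dom E f))) (Dom E f)"
 have resp: "(k ## u, k ## v) : eo C (Dom E f)" if "(u, v) : eo C ?K" for u v using that unfolding Ko(2) Qi by blast
 have kk: "?k : Arr E" "Dom E ?k = ?K" "Cod E ?k = Dom E f" "el C ?k = gm C k (eo C (Dom E f))"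
   "!!x. x : Arr C ==> Cod C x = Dom C k ==> (x, k ## x) : el C ?k"
  by (rule E_gm[OF Ko(1) fd(1) k(2)]; (erule resp | simp add: k(3)))+
 have mono: "mono_in E ?k"
 proof (rule E.mono_zeroI[OF kk(1)])
  fix h assume h: "h : Arr E" "Cod E h = Dom E ?k" "Comp E ?k h = zero_arr E (Dom E h) (Cod E ?k)"
  note kh = E_comp[OF h(1) kk(1) h(2)]
  have "h = zero_arr E (Dom E h) (Cod E h)"
  proof (rule E_zeroI[OF h(1)])
   fix x assume x: "x : Arr C" "Cod C x = fst (Dom E h)"
   obtain e u where e: "regular_epi C e" "e : Arr C" "Cod C e = Dom C x" "(x ## e, u) : el C h" "u : Arr C" "Dom C u = Dom C e" "Cod C u = fst (Cod E h)"
    by (rule E_total[OF h(1) x])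
   have uk: "Cod C u = Dom C k" using e(7) h(2) kk(2) by simp
   have xe: "x ## e : Arr C" "Cod C (x ## e) = fst (Dom E (Comp E ?k h))" "Dom C (x ## e) = Dom C e" using x e kh(2) by simp_all
   have z: "Comp E ?k h = zero_arr E (Dom E (Comp E ?k h)) (Cod E (Comp E ?k h))" unfolding kh(2,3) by (rule h(3))
   have "(x ## e, k ## u) : el C (Comp E ?k h)" by (rule E_compI[OF h(1) kk(1) h(2) e(4) kk(5)[OF e(5) uk]])
   from E_zero_elem(2)[OF kh(1) xe(1,2) this z]
   have "(\<zero> (Dom C e) (fst (Dom E f)), k ## u) : eo C (Dom E f)" using kh kk xe by simp
   moreover have "k ## \<zero> (Dom C e) (Dom C k) = \<zero> (Dom C e) (fst (Dom E f))" using k(2,3) K e(2) by simp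
   ultimately have "(\<zero> (Dom C e) (Dom C k), u) : Q" unfolding Qi using e uk K by simp
   then have "(u, \<zero> (Dom C e) (Dom C k)) : eo C (Cod E h)" using EqD(4)[OF Q] Ko(2) h(2) kk(2) by simp
   from E_sat(2)[OF h(1) E_typed(6)[OF h(1) e(4)] e(4) this]
   show "EX e. regular_epi C e & Cod C e = Dom C x & (x ## e, \<zero> (Dom C e) (fst (Cod E h))) : el C h" using e(1,3) h(2) kk(2) by auto
  qed
  then show "h = zero_arr E (Dom E h) (Dom E ?k)" unfolding h(2) .
 qed
 have cf: "Cod E ?k = Dom E f" by (rule kk(3))
 note fk = E_comp[OF kk(1) f cf]
 have zero: "Comp E f ?k = zero_arr E (Dom E (Comp E f ?k)) (Cod E (Comp E f ?k))"
 proof (rule E_zeroI[OF fk(1)])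
  fix u assume u: "u : Arr C" "Cod C u = fst (Dom E (Comp E f ?k))"
  have u': "Cod C u = Dom C k" using u fk kk by simp
  have "(k ## u, \<zero> (Dom C (k ## u)) (fst (Cod E f))) : el C f" by (subst k(4)) (use u u' k(2,3) in auto)
  then have "(k ## u, \<zero> (Dom C u) (fst (Cod E f))) : el C f" using u u' k(2,3) by simp
  from E_compI[OF kk(1) f cf kk(5)[OF u(1) u'] this]
  show "EX e. regular_epi C e & Cod C e = Dom C u & (u ## e, \<zero> (Dom C e) (fst (Cod E (Comp E f ?k)))) : el C (Comp E f ?k)"
   unfolding fk(3) using u(1) cover_id[of "Dom C u"] by (intro exI[of _ "Id C (Dom C u)"]) simp
 qed
 have "is_kernel E f ?k"
 proof (rule E.kernelI[OF f mono cf])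
  show "Comp E f ?k = zero_arr E (Dom E ?k) (Cod E f)" using zero unfolding fk(2,3) .
  fix h assume h: "h : Arr E" "Cod E h = Dom E f" "Comp E f h = zero_arr E (Dom E h) (Cod E f)"
  note fh = E_comp[OF h(1) f h(2)] and hd = E_arrD[OF h(1)]
  have z: "Comp E f h = zero_arr E (Dom E (Comp E f h)) (Cod E (Comp E f h))" unfolding fh(2,3) by (rule h(3))
  define H where "H = {(z, u). u : Arr C & Cod C u = Dom C k & (z, k ## u) : el C h}"
  have M: "Mr C (Dom E h) ?K H" unfolding Mor_def
  proof (intro conjI allI impI)
   show "rep C (fst (Dom E h)) (fst ?K) H"
    using rep_pull[OF E_rep[OF h(1)] k(2)] k(3) h(2) unfolding H_def by simp
   fix x assume x: "x : Arr C" "Cod C x = fst (Dom E h)"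
   obtain e y w where e: "regular_epi C e" "e : Arr C" "Cod C e = Dom C x" "(x ## e, y) : el C h" "(y, w) : el C f"
    "y : Arr C" "Dom C y = Dom C e" "Cod C y = fst (Cod E h)" "w : Arr C" "Dom C w = Dom C e" "Cod C w = fst (Cod E f)"
    by (rule E_total2[OF h(1) f h(2) x])
   have xe: "x ## e : Arr C" "Cod C (x ## e) = fst (Dom E (Comp E f h))" "Dom C (x ## e) = Dom C y" using x e fh(2) by simp_all
   from E_zero_elem(2)[OF fh(1) xe(1,2) E_compI[OF h(1) f h(2) e(4,5)] z]
   have "(\<zero> (Dom C y) (fst (Cod E f)), w) : eo C (Cod E f)" using fh xe by simp
   then have "(y, \<zero> (Dom C y) (fst (Cod E f))) : el C f" by (rule E_sat(2)[OF f E_typed(6)[OF f e(5)] e(5) S(4)])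
   then obtain u where u: "u : Arr C" "Cod C u = Dom C k" "y = k ## u" using k(4)[OF e(6)] e(8) h(2) by auto
   have "(x ## e, u) : H" unfolding H_def using u e(4) by simp
   then show "EX e u. regular_epi C e & Cod C e = Dom C x & (x ## e, u) : H" using e(1,3) by blast
  next
   fix x u u' assume "(x, u) : H" "(x, u') : H"
   then have a: "u : Arr C" "Cod C u = Dom C k" "(x, k ## u) : el C h" "u' : Arr C" "Cod C u' = Dom C k" "(x, k ## u') : el C h"
    unfolding H_def by blast+
   from E_sat(1)[OF h(1) a(3,6)] have "(k ## u, k ## u') : eo C (Dom E f)" unfolding h(2) .
   then show "(u, u') : eo C ?K" unfolding Ko(2) Qi using a by blast
  next
   fix x x' u u' assume "(x, x') : eo C (Dom E h)" "(x, u) : H" "(u, u') : eo C ?K"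
   then show "(x', u') : H" unfolding H_def Ko(2) Qi using E_sat(2)[OF h(1), unfolded h(2)] by blast
  qed
  note mm = E_mk[OF hd(1) Ko(1) M]
  let ?u = "mk C (Dom E h) H ?K"
  have cu: "Cod E ?u = Dom E ?k" using mm kk by simp
  note ku = E_comp[OF mm(1) kk(1) cu]
  have "Comp E ?k ?u = h"
  proof (rule E_ext[OF ku(1) h(1)])
   fix x assume x: "x : Arr C" "Cod C x = fst (Dom E h)"
   have x': "Cod C x = fst (Dom E ?u)" using x mm(2) by simp
   obtain e u where e: "regular_epi C e" "e : Arr C" "Cod C e = Dom C x" "(x ## e, u) : el C ?u" "u : Arr C" "Dom C u = Dom C e" "Cod C u = fst (Cod E ?u)"
    by (rule E_total[OF mm(1) x(1) x'])
   have u: "Cod C u = Dom C k" using e(7) mm(3) by simp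
   have "(x ## e, k ## u) : el C (Comp E ?k ?u)" by (rule E_compI[OF mm(1) kk(1) cu e(4) kk(5)[OF e(5) u]])
   moreover have "(x ## e, u) : H" using e(4) unfolding mm(4) .
   then have "(x ## e, k ## u) : el C h" unfolding H_def by blast
   ultimately show "EX e y. regular_epi C e & Cod C e = Dom C x & (x ## e, y) : el C (Comp E ?k ?u) & (x ## e, y) : el C h" using e by blast
  qed (use ku mm kk h(2) in simp_all)
  then show "EX u. u : Arr E & Dom E u = Dom E h & Cod E u = Dom E ?k & Comp E ?k u = h" using mm(1,2) cu by blast
 qed
 then show thesis
 proof (rule that[OF _ k(1-3) _ kk(4)])
  show "fst (Dom E ?k) = Dom C k" unfolding kk(2) by simp
  show "ALL x. x : Arr C \<longrightarrow> Cod C x = fst (Dom E f) \<longrightarrow> ((x, \<zero> (Dom C x) (fst (Cod E f))) : el C f \<longleftrightarrow> (EX u : Arr C. Cod C u = Dom C k & x = k ## u))"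
   by (intro allI impI k(4))
  show "ALL u v. (u, v) : eo C (Dom E ?k) \<longleftrightarrow> u : Arr C & Cod C u = Dom C k & v : Arr C & Cod C v = Dom C k & (k ## u, k ## v) : eo C (Dom E f)"
   unfolding kk(2) Ko(2) by (intro allI Qi)
 qed
qed

lemma gm_Id:
 assumes "Eq C B Q" shows "gm C (Id C B) Q = Q"
proof (intro equalityI subrelI)
 fix x y assume xy: "(x, y) : Q"
 note t = rep_typed[OF EqD(2)[OF assms] xy]
 have "Id C B ## x = x" "Dom C (Id C B) = B" using t(1,4) EqD(1)[OF assms] by simp_all
 then show "(x, y) : gm C (Id C B) Q" unfolding gm_def using xy t(1,4) by simp
next
 fix x y assume "(x, y) : gm C (Id C B) Q"
 then have a: "x : Arr C" "Cod C x = Dom C (Id C B)" "(Id C B ## x, y) : Q" unfolding gm_def by blast+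
 have b: "Cod C x = B" using a(2) EqD(1)[OF assms] by simp
 have c: "Id C B ## x = x" using a(1) b EqD(1)[OF assms] by simp
 show "(x, y) : Q" using a(3) unfolding c .
qed

lemma E_cokernel:
 assumes f: "f : Arr E"
 obtains c m where "is_cokernel E f c" "mono_in C m" "m : Arr C" "Cod C m = fst (Cod E f)"
  "ALL x y. (x, y) : el C f \<longrightarrow> (EX w : Arr C. Cod C w = Dom C m & y = m ## w)"
  "ALL w. w : Arr C \<longrightarrow> Cod C w = Dom C m \<longrightarrow> (EX e x. regular_epi C e & Cod C e = Dom C w & (x, m ## (w ## e)) : el C f)"
  "fst (Cod E c) = fst (Cod E f)" "ALL x. x : Arr C \<longrightarrow> Cod C x = fst (Cod E f) \<longrightarrow> (x, x) : el C c"
  "ALL y. (\<zero> (Dom C y) (fst (Cod E f)), y) : eo C (Cod E c) \<longrightarrow> (EX w : Arr C. Cod C w = Dom C m & y = m ## w)"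
proof -
 interpret E: additive E by (rule additive.intro[OF additive_E])
 note fd = E_arrD[OF f] and F = E_rep[OF f]
 note R = EqD[OF E_objD(1)[OF fd(1)]] and S = EqD[OF E_objD(1)[OF fd(2)]]
 define B where "B = fst (Cod E f)"
 have Bo: "B : Obj C" using S(1) by (simp add: B_def)
 obtain m where m: "mono_in C m" "m : Arr C" "Cod C m = B"
  "!!x y. (x, y) : el C f ==> EX w : Arr C. Cod C w = Dom C m & y = m ## w"
  "!!w. w : Arr C ==> Cod C w = Dom C m ==> EX e x. regular_epi C e & Cod C e = Dom C w & (x, m ## (w ## e)) : el C f"
  using image_rep[OF F] unfolding B_def by metis
 have M: "Dom C m : Obj C" using m(2) by simp
 define Q where "Q = {(g, g'). g : Arr C & Cod C g = B & (EX w : Arr C. Cod C w = Dom C m & Dom C w = Dom C g & g' = g \<oplus> m ## w)}"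
 have Q: "Eq C B Q" unfolding Q_def by (rule Eq_cosets[OF m(1-3)])
 note Qd = EqD[OF Q]
 have Q0: "(m ## w, \<zero> (Dom C w) B) : Q" if "w : Arr C" "Cod C w = Dom C m" for w
  unfolding Q_def using that m(2,3)
  by (intro CollectI case_prodI conjI bexI[of _ "hom_neg C w"]) (simp_all add: comp_ng pl_ng)
 have 0: "EX w : Arr C. Cod C w = Dom C m & y = m ## w" if h: "(\<zero> (Dom C y) B, y) : Q" for y
 proof -
  note t = rep_typed[OF Qd(2) h]
  obtain w where w: "w : Arr C" "Cod C w = Dom C m" "Dom C w = Dom C (\<zero> (Dom C y) B)" "y = \<zero> (Dom C y) B \<oplus> m ## w"
   using h unfolding Q_def by blast
  have "Dom C w = Dom C y" using w(3) t(2) Bo by simp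
  then have "\<zero> (Dom C y) B \<oplus> m ## w = m ## w" using w(1,2) m(2,3) by simp
  then show ?thesis using w by metis
 qed
 let ?Q = "(B, spans C Q)"
 note Qo = E_objI[OF Q]
 have resp: "(Id C B ## x, Id C B ## x') : eo C ?Q" if x: "(x, x') : eo C (Cod E f)" for x x'
 proof -
  note t = rep_typed[OF S(2) x, folded B_def]
  have "(\<zero> (Dom C x') B, x' \<ominus> x) : eo C (Cod E f)"
   using Eq_diff_iff[OF E_objD(1)[OF fd(2)], of x x'] x t by (simp add: B_def)
  moreover have z: "(\<zero> (Dom C x') (fst (Dom E f)), \<zero> (Dom C x') B) : el C f"
   unfolding B_def by (rule rep_zero[OF F]) (use t in simp)
  ultimately have "(\<zero> (Dom C x') (fst (Dom E f)), x' \<ominus> x) : el C f" by (intro E_sat(2)[OF f E_typed(6)[OF f z] z])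
  then obtain w where w: "w : Arr C" "Cod C w = Dom C m" "x' \<ominus> x = m ## w" using m(4) by blast
  have "Dom C (x' \<ominus> x) = Dom C x" using t by simp
  then have dw: "Dom C w = Dom C x" unfolding w(3) using w(1,2) m(2) by simp
  have "x \<oplus> m ## w = (x' \<ominus> x) \<oplus> x" unfolding w(3)[symmetric] by (rule pl_comm) (use t in simp_all)
  also have "\<dots> = x'" by (rule minus_plus) (use t in simp_all)
  finally have "(x, x') : Q" unfolding Q_def using t w(1,2) dw by auto
  then show ?thesis unfolding Qo(2) using t by simp
 qed
 have oB: "Dom C (Id C B) = fst (Cod E f)" "Cod C (Id C B) = fst ?Q" "Id C B : Arr C" using Bo by (simp_all add: B_def)
 let ?c = "mk C (Cod E f) (gm C (Id C B) (eo C ?Q)) ?Q"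
 have c: "?c : Arr E" "Dom E ?c = Cod E f" "Cod E ?c = ?Q" "el C ?c = gm C (Id C B) (eo C ?Q)"
  by (rule E_gm[OF fd(2) Qo(1) oB(3,1,2) resp], assumption)+
 have elc: "el C ?c = Q" by (rule trans[OF c(4)]) (subst Qo(2), rule gm_Id[OF Q])
 have ci: "(x, y) : el C ?c \<longleftrightarrow> (x, y) : Q" for x y
  by (simp only: elc)
 have cx: "(x, x) : el C ?c" if "x : Arr C" "Cod C x = B" for x unfolding ci by (rule Qd(3)[OF that])
 have cf: "Cod E f = Dom E ?c" using c(2) by simp
 note kc = E_comp[OF f c(1) cf]
 have zero: "Comp E ?c f = zero_arr E (Dom E (Comp E ?c f)) (Cod E (Comp E ?c f))"
 proof (rule E_zeroI[OF kc(1)])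
  fix x assume x: "x : Arr C" "Cod C x = fst (Dom E (Comp E ?c f))"
  have x': "Cod C x = fst (Dom E f)" using x kc by simp
  obtain e y where e: "regular_epi C e" "e : Arr C" "Cod C e = Dom C x" "(x ## e, y) : el C f" "y : Arr C" "Dom C y = Dom C e" "Cod C y = fst (Cod E f)"
   by (rule E_total[OF f x(1) x'])
  obtain w where w: "w : Arr C" "Cod C w = Dom C m" "y = m ## w" using m(4)[OF e(4)] by blast
  have "Dom C w = Dom C e" using e(6) w m(2) by simp
  then have "(y, \<zero> (Dom C e) B) : el C ?c" using Q0[OF w(1,2)] unfolding ci w(3) by simp
  from E_compI[OF f c(1) cf e(4) this]
  show "EX e. regular_epi C e & Cod C e = Dom C x & (x ## e, \<zero> (Dom C e) (fst (Cod E (Comp E ?c f)))) : el C (Comp E ?c f)"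
   using e(1,3) kc(3) c(3) by auto
 qed
 have epi: "epi_in E ?c"
 proof (rule E.epi_zeroI[OF c(1)])
  fix h assume h: "h : Arr E" "Dom E h = Cod E ?c" "Comp E h ?c = zero_arr E (Dom E ?c) (Cod E h)"
  note ch = h(2)[symmetric]
  note hc = E_comp[OF c(1) h(1) ch]
  have z: "Comp E h ?c = zero_arr E (Dom E (Comp E h ?c)) (Cod E (Comp E h ?c))" unfolding hc(2,3) by (rule h(3))
  have "h = zero_arr E (Dom E h) (Cod E h)"
  proof (rule E_zeroI[OF h(1)])
   fix x assume x: "x : Arr C" "Cod C x = fst (Dom E h)"
   obtain e y where e: "regular_epi C e" "e : Arr C" "Cod C e = Dom C x" "(x ## e, y) : el C h" "y : Arr C" "Dom C y = Dom C e" "Cod C y = fst (Cod E h)"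
    by (rule E_total[OF h(1) x])
   have xB: "Cod C x = B" using x h(2) c(3) by simp
   have xe: "x ## e : Arr C" "Cod C (x ## e) = B" "Dom C (x ## e) = Dom C e" "Cod C (x ## e) = fst (Dom E (Comp E h ?c))"
    using x e xB hc(2) c(2) by (simp_all add: B_def)
   from E_zero_elem(2)[OF hc(1) xe(1,4) E_compI[OF c(1) h(1) ch cx[OF xe(1,2)] e(4)] z]
   have "(\<zero> (Dom C e) (fst (Cod E h)), y) : eo C (Cod E h)" using hc xe by simp
   note s = EqD(4)[OF E_objD(1)[OF E_arrD(2)[OF h(1)]] this]
   from E_sat(2)[OF h(1) E_typed(6)[OF h(1) e(4)] e(4) s]
   show "EX e. regular_epi C e & Cod C e = Dom C x & (x ## e, \<zero> (Dom C e) (fst (Cod E h))) : el C h" using e(1,3) by blast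
  qed
  then show "h = zero_arr E (Cod E ?c) (Cod E h)" unfolding h(2) .
 qed
 have "is_cokernel E f ?c"
 proof (rule E.cokernelI[OF f epi c(2)])
  show "Comp E ?c f = zero_arr E (Dom E f) (Cod E ?c)" using zero unfolding kc(2,3) .
  fix h assume h: "h : Arr E" "Dom E h = Cod E f" "Comp E h f = zero_arr E (Dom E f) (Cod E h)"
  note ch = h(2)[symmetric] and hd = E_arrD[OF h(1)]
  note hf = E_comp[OF f h(1) ch]
  have z: "Comp E h f = zero_arr E (Dom E (Comp E h f)) (Cod E (Comp E h f))" unfolding hf(2,3) by (rule h(3))
  note Td = EqD[OF E_objD(1)[OF hd(2)]]
  have M: "Mr C ?Q (Cod E h) (el C h)" unfolding Mor_def
  proof (intro conjI allI impI)
   show "rep C (fst ?Q) (fst (Cod E h)) (el C h)" using E_rep[OF h(1)] h(2) by (simp add: B_def)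
   fix x assume x: "x : Arr C" "Cod C x = fst ?Q"
   have x': "Cod C x = fst (Dom E h)" using x h(2) by (simp add: B_def)
   show "EX e y. regular_epi C e & Cod C e = Dom C x & (x ## e, y) : el C h" by (rule E_total[OF h(1) x(1) x']) blast
  next
   show "(y, y') : eo C (Cod E h)" if "(x, y) : el C h" "(x, y') : el C h" for x y y' by (rule E_sat(1)[OF h(1) that])
  next
   fix g g' t t' assume a: "(g, g') : eo C ?Q" "(g, t) : el C h" "(t, t') : eo C (Cod E h)"
   obtain w where w: "w : Arr C" "Cod C w = Dom C m" "Dom C w = Dom C g" "g' = g \<oplus> m ## w"
    using a(1)[unfolded Qo(2)] unfolding Q_def by blast
   note tg = E_typed[OF h(1) a(2)]
   have gB: "Cod C g = B" using tg h(2) by (simp add: B_def)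
   obtain e x where e: "regular_epi C e" "Cod C e = Dom C w" "(x, m ## (w ## e)) : el C f" using m(5)[OF w(1,2)] by blast
   note ea = coverD(1)[OF e(1)] and te = E_typed[OF f e(3)]
   have y': "Cod C (m ## (w ## e)) = fst (Dom E h)" using te h(2) by simp
   obtain d s where d: "regular_epi C d" "d : Arr C" "Cod C d = Dom C (m ## (w ## e))" "((m ## (w ## e)) ## d, s) : el C h" "s : Arr C" "Dom C s = Dom C d" "Cod C s = fst (Cod E h)"
    by (rule E_total[OF h(1) te(2) y'])
   have de: "Cod C d = Dom C e" using d(3) w(1,2) m(2) e(2) ea by simp
   have dx: "Dom C x = Cod C d" using te(3) d(3) by simp
   have fd1: "(x ## d, (m ## (w ## e)) ## d) : el C f" by (rule E_prec[OF f e(3) d(2,3)])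
   have xd: "x ## d : Arr C" "Cod C (x ## d) = fst (Dom E (Comp E h f))" "Dom C (x ## d) = Dom C d" using te(1,4) dx d(2) hf(2) by simp_all
   from E_zero_elem(2)[OF hf(1) xd(1,2) E_compI[OF f h(1) ch fd1 d(4)] z]
   have "(\<zero> (Dom C d) (fst (Cod E h)), s) : eo C (Cod E h)" using hf xd by simp
   from E_sat(2)[OF h(1) E_typed(6)[OF h(1) d(4)] d(4) Td(4)[OF this]]
   have 1: "((m ## (w ## e)) ## d, \<zero> (Dom C d) (fst (Cod E h))) : el C h" .
   have ed: "e ## d : Arr C" "Dom C (e ## d) = Dom C d" "Cod C (e ## d) = Dom C g" "regular_epi C (e ## d)"
    using ea d(2) de e(2) w(3) cover_comp[OF e(1) d(1) de] by simp_all
   have tt: "Dom C t = Dom C g" using tg(3) by simp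
   have 2: "(g ## (e ## d), t ## (e ## d)) : el C h" by (rule E_prec[OF h(1) a(2) ed(1)]) (use ed tt in simp)
   have "(g ## (e ## d) \<oplus> (m ## (w ## e)) ## d, t ## (e ## d) \<oplus> \<zero> (Dom C d) (fst (Cod E h))) : el C h"
    by (rule rep_plus[OF E_rep[OF h(1)] 2 1]) (use tg(2) tt ed d(2) Td(1) in simp)
   moreover have "t ## (e ## d) \<oplus> \<zero> (Dom C d) (fst (Cod E h)) = t ## (e ## d)" using tg(2,5) tt ed by simp
   moreover have "g ## (e ## d) \<oplus> (m ## (w ## e)) ## d = g' ## (e ## d)"
    unfolding w(4) using tg(1) gB w(1-3) m(2,3) ea e(2) d(2) de by (simp add: pl_comp)
   ultimately have 3: "(g' ## (e ## d), t ## (e ## d)) : el C h" by simp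
   have g': "g' : Arr C" "Dom C g' = Dom C g" unfolding w(4) using tg(1) gB w(1-3) m(2,3) by simp_all
   have 4: "(g', t) : el C h" by (rule rep_local[OF E_rep[OF h(1)] ed(4) _ 3]) (use ed g' tg(2) tt in simp_all)
   show "(g', t') : el C h" by (rule E_sat(2)[OF h(1) E_typed(6)[OF h(1) 4] 4 a(3)])
  qed
  note mm = E_mk[OF Qo(1) hd(2) M]
  let ?u = "mk C ?Q (el C h) (Cod E h)"
  have cu: "Cod E ?c = Dom E ?u" using mm c by simp
  note uc = E_comp[OF c(1) mm(1) cu]
  have "Comp E ?u ?c = h"
  proof (rule E_ext[OF uc(1) h(1)])
   fix x assume x: "x : Arr C" "Cod C x = fst (Dom E h)"
   obtain e y where e: "regular_epi C e" "e : Arr C" "Cod C e = Dom C x" "(x ## e, y) : el C h" "y : Arr C" "Dom C y = Dom C e" "Cod C y = fst (Cod E h)"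
    by (rule E_total[OF h(1) x])
   have xe: "x ## e : Arr C" "Cod C (x ## e) = B" using x e h(2) by (simp_all add: B_def)
   have "(x ## e, y) : el C (Comp E ?u ?c)" by (rule E_compI[OF c(1) mm(1) cu cx[OF xe]]) (use e mm in simp)
   then show "EX e y. regular_epi C e & Cod C e = Dom C x & (x ## e, y) : el C (Comp E ?u ?c) & (x ## e, y) : el C h" using e by blast
  qed (use uc mm c h(2) in simp_all)
  then show "EX u. u : Arr E & Dom E u = Cod E ?c & Cod E u = Cod E h & Comp E u ?c = h" using mm(1,3) cu by metis
 qed
 then show thesis
 proof (rule that[OF _ m(1,2) m(3)[unfolded B_def]])
  show "ALL x y. (x, y) : el C f \<longrightarrow> (EX w : Arr C. Cod C w = Dom C m & y = m ## w)" by (intro allI impI m(4))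
  show "ALL w. w : Arr C \<longrightarrow> Cod C w = Dom C m \<longrightarrow> (EX e x. regular_epi C e & Cod C e = Dom C w & (x, m ## (w ## e)) : el C f)"
   by (intro allI impI m(5))
  show "fst (Cod E ?c) = fst (Cod E f)" unfolding c(3) B_def[symmetric] by simp
  show "ALL x. x : Arr C \<longrightarrow> Cod C x = fst (Cod E f) \<longrightarrow> (x, x) : el C ?c" unfolding B_def[symmetric] by (intro allI impI cx)
  show "ALL y. (\<zero> (Dom C y) (fst (Cod E f)), y) : eo C (Cod E ?c) \<longrightarrow> (EX w : Arr C. Cod C w = Dom C m & y = m ## w)"
   unfolding B_def[symmetric] unfolding c(3) unfolding Qo(2) by (intro allI impI 0)
 qed
qed

lemma E_mono_normal:
 assumes mono: "mono_in E f"
 shows "EX g. is_kernel E g f"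
proof -
 interpret E: additive E by (rule additive.intro[OF additive_E])
 have f: "f : Arr E" using mono unfolding mono_in_def by blast
 note fd = E_arrD[OF f] and F = E_rep[OF f]
 note R = EqD[OF E_objD(1)[OF fd(1)]] and S = EqD[OF E_objD(1)[OF fd(2)]]
 obtain kk k where k0: "is_kernel E f kk" "mono_in C k" "k : Arr C" "Cod C k = fst (Dom E f)" "fst (Dom E kk) = Dom C k"
  "el C kk = gm C k (eo C (Dom E f))"
  "ALL x. x : Arr C \<longrightarrow> Cod C x = fst (Dom E f) \<longrightarrow> ((x, \<zero> (Dom C x) (fst (Cod E f))) : el C f \<longleftrightarrow> (EX u : Arr C. Cod C u = Dom C k & x = k ## u))"
  "ALL u v. (u, v) : eo C (Dom E kk) \<longleftrightarrow> u : Arr C & Cod C u = Dom C k & v : Arr C & Cod C v = Dom C k & (k ## u, k ## v) : eo C (Dom E f)"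
  by (rule E_kernel[OF f])
 note k = k0(1-6) k0(7)[rule_format]
 note kd = E.kernelD[OF k(1)]
 have kz: "kk = zero_arr E (Dom E kk) (Cod E kk)" using E.mono_zeroD[OF mono kd(2,3,4)] unfolding kd(3) .
 have inj0: "(\<zero> (Dom C x) (fst (Dom E f)), x) : eo C (Dom E f)" if x: "(x, \<zero> (Dom C x) (fst (Cod E f))) : el C f" for x
 proof -
  note t = E_typed[OF f x]
  obtain u where u: "u : Arr C" "Cod C u = Dom C k" "x = k ## u" using k(7)[OF t(1,4)] x by blast
  have "(u, k ## u) : el C kk" unfolding k(6) by (rule gmI[OF E_objD(1)[OF fd(1)] k(3) u(1,2) k(4)])
  from E_zero_elem(2)[OF kd(2) u(1) _ this kz] show ?thesis using u k(3,5) kd(3) by simp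
 qed
 have inj: "(x, x') : eo C (Dom E f)" if xy: "(x, y) : el C f" "(x', y') : el C f" "(y, y') : eo C (Cod E f)" for x x' y y'
 proof -
  have xy': "(x, y') : el C f" by (rule E_sat(2)[OF f E_typed(6)[OF f xy(1)] xy(1,3)])
  note t = E_typed[OF f xy'] and t' = E_typed[OF f xy(2)]
  have "(x' \<ominus> x, y' \<ominus> y') : el C f" by (rule rep_diff[OF F xy(2) xy']) simp
  moreover have "y' \<ominus> y' = \<zero> (Dom C (x' \<ominus> x)) (fst (Cod E f))" using t t' by (simp add: pl_ng)
  ultimately have "(\<zero> (Dom C (x' \<ominus> x)) (fst (Dom E f)), x' \<ominus> x) : eo C (Dom E f)" using inj0 by simp
  then show ?thesis using Eq_diff_iff[OF E_objD(1)[OF fd(1)], of x x'] t t' by simp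
 qed
 obtain c m where c0: "is_cokernel E f c" "mono_in C m" "m : Arr C" "Cod C m = fst (Cod E f)"
  "ALL x y. (x, y) : el C f \<longrightarrow> (EX w : Arr C. Cod C w = Dom C m & y = m ## w)"
  "ALL w. w : Arr C \<longrightarrow> Cod C w = Dom C m \<longrightarrow> (EX e x. regular_epi C e & Cod C e = Dom C w & (x, m ## (w ## e)) : el C f)"
  "fst (Cod E c) = fst (Cod E f)" "ALL x. x : Arr C \<longrightarrow> Cod C x = fst (Cod E f) \<longrightarrow> (x, x) : el C c"
  "ALL y. (\<zero> (Dom C y) (fst (Cod E f)), y) : eo C (Cod E c) \<longrightarrow> (EX w : Arr C. Cod C w = Dom C m & y = m ## w)"
  by (rule E_cokernel[OF f])
 note c = c0(1,3,4) c0(6)[rule_format] c0(7) c0(8)[rule_format] c0(9)[rule_format]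
 note cd = E.cokernelD[OF c(1)]
 have "is_kernel E c f"
 proof (rule E.kernelI[OF cd(2) mono cd(3)[symmetric] cd(4)])
  fix h assume h: "h : Arr E" "Cod E h = Dom E c" "Comp E c h = zero_arr E (Dom E h) (Cod E c)"
  note ch = E_comp[OF h(1) cd(2) h(2)] and hd = E_arrD[OF h(1)]
  have z: "Comp E c h = zero_arr E (Dom E (Comp E c h)) (Cod E (Comp E c h))" unfolding ch(2,3) by (rule h(3))
  have hf: "Cod E h = Cod E f" using h(2) cd(3) by simp
  let ?G = "rcomp C ((el C f)\<inverse>) (el C h)"
  have M: "Mr C (Dom E h) (Dom E f) ?G"
  proof (rule Mor_rcompI[OF E_rep[OF h(1)] _ E_objD(1)[OF fd(1)] _ _ _ _ E_objD(1)[OF hd(1)]])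
   show "rep C (fst (Cod E h)) (fst (Dom E f)) ((el C f)\<inverse>)" unfolding hf by (rule rep_converse[OF F])
   show "(y, y') : eo C (Dom E f)" if "(x, g) : el C h" "(g, y) : (el C f)\<inverse>" "(x, g') : el C h" "(g', y') : (el C f)\<inverse>" for x g g' y y'
    by (rule inj) (use that E_sat(1)[OF h(1) that(1,3)] hf in auto)
   show "(x', g) : el C h" if "(x, x') : eo C (Dom E h)" "(x, g) : el C h" for x x' g
    by (rule E_sat(2)[OF h(1) that E_typed(7)[OF h(1) that(2)]])
   show "(g, y') : (el C f)\<inverse>" if "(g, y) : (el C f)\<inverse>" "(y, y') : eo C (Dom E f)" for g y y'
    using E_sat(2)[OF f that(2) _ E_typed(7)[OF f]] that(1) by blast
   fix x assume x: "x : Arr C" "Cod C x = fst (Dom E h)"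
   obtain e y where e: "regular_epi C e" "e : Arr C" "Cod C e = Dom C x" "(x ## e, y) : el C h" "y : Arr C" "Dom C y = Dom C e" "Cod C y = fst (Cod E h)"
    by (rule E_total[OF h(1) x])
   have yB: "Cod C y = fst (Cod E f)" using e(7) hf by simp
   have xe: "x ## e : Arr C" "Cod C (x ## e) = fst (Dom E (Comp E c h))" "Dom C (x ## e) = Dom C y" using x e ch(2) by simp_all
   from E_zero_elem(2)[OF ch(1) xe(1,2) E_compI[OF h(1) cd(2) h(2) e(4) c(6)[OF e(5) yB]] z]
   have "(\<zero> (Dom C y) (fst (Cod E f)), y) : eo C (Cod E c)" using xe(3) ch(3) c(5) by simp
   then obtain w where w: "w : Arr C" "Cod C w = Dom C m" "y = m ## w" using c(7) by blast
   obtain d v where d: "regular_epi C d" "Cod C d = Dom C w" "(v, m ## (w ## d)) : el C f" using c(4)[OF w(1,2)] by blast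
   note da = coverD(1)[OF d(1)]
   have yd: "m ## (w ## d) = y ## d" "Dom C w = Dom C y" using w d(2) da c(2) by simp_all
   have de: "Cod C d = Dom C e" using d(2) yd(2) e(6) by simp
   note rf = E_refine[OF e(1) d(1) e(2) da de x(1) e(3)]
   have "((x ## e) ## d, y ## d) : el C h" by (rule E_prec[OF h(1) e(4) da]) (use d(2) yd in simp)
   moreover have "(y ## d, v) : (el C f)\<inverse>" using d(3) yd(1) by simp
   ultimately show "EX e y z. regular_epi C e & Cod C e = Dom C x & (x ## e, y) : el C h & (y, z) : (el C f)\<inverse>"
    using rf(1,3) unfolding rf(4) by blast
  qed
  note u = E_mk[OF hd(1) fd(1) M]
  let ?u = "mk C (Dom E h) ?G (Dom E f)"
  note fu = E_comp[OF u(1) f u(3)]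
  have "Comp E f ?u = h"
  proof (rule E_ext[OF fu(1) h(1)])
   fix x assume x: "x : Arr C" "Cod C x = fst (Dom E h)"
   have x': "Cod C x = fst (Dom E ?u)" using x u(2) by simp
   obtain e v where e: "regular_epi C e" "e : Arr C" "Cod C e = Dom C x" "(x ## e, v) : el C ?u" "v : Arr C" "Dom C v = Dom C e" "Cod C v = fst (Cod E ?u)"
    by (rule E_total[OF u(1) x(1) x'])
   obtain d y where d: "regular_epi C d" "d : Arr C" "Cod C d = Dom C v" "((x ## e) ## d, y) : el C h" "(y, v ## d) : (el C f)\<inverse>"
    using e(4) unfolding u(4) by (elim rcompE) blast
   have de: "Cod C d = Dom C e" using d(3) e(6) by simp
   note rf = E_refine[OF e(1) d(1) e(2) d(2) de x(1) e(3)]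
   have "((x ## e) ## d, y) : el C (Comp E f ?u)"
    by (rule E_compI[OF u(1) f u(3) E_prec[OF u(1) e(4) d(2,3)]]) (use d(5) in simp)
   then show "EX e y. regular_epi C e & Cod C e = Dom C x & (x ## e, y) : el C (Comp E f ?u) & (x ## e, y) : el C h"
    using d(4) rf(1,3) unfolding rf(4) by blast
  qed (use fu(2,3) u(2) hf in simp_all)
  then show "EX u. u : Arr E & Dom E u = Dom E h & Cod E u = Dom E f & Comp E f u = h" using u(1-3) by blast
 qed
 then show ?thesis by blast
qed

lemma E_epi_normal:
 assumes epi: "epi_in E f"
 shows "EX g. is_cokernel E g f"
proof -
 interpret E: additive E by (rule additive.intro[OF additive_E])
 have f: "f : Arr E" using epi unfolding epi_in_def by blast
 note fd = E_arrD[OF f] and F = E_rep[OF f]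
 note R = EqD[OF E_objD(1)[OF fd(1)]] and S = EqD[OF E_objD(1)[OF fd(2)]]
 obtain c m where c0: "is_cokernel E f c" "mono_in C m" "m : Arr C" "Cod C m = fst (Cod E f)"
  "ALL x y. (x, y) : el C f \<longrightarrow> (EX w : Arr C. Cod C w = Dom C m & y = m ## w)"
  "ALL w. w : Arr C \<longrightarrow> Cod C w = Dom C m \<longrightarrow> (EX e x. regular_epi C e & Cod C e = Dom C w & (x, m ## (w ## e)) : el C f)"
  "fst (Cod E c) = fst (Cod E f)" "ALL x. x : Arr C \<longrightarrow> Cod C x = fst (Cod E f) \<longrightarrow> (x, x) : el C c"
  "ALL y. (\<zero> (Dom C y) (fst (Cod E f)), y) : eo C (Cod E c) \<longrightarrow> (EX w : Arr C. Cod C w = Dom C m & y = m ## w)"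
  by (rule E_cokernel[OF f])
 note c = c0(1,3,4) c0(6)[rule_format] c0(7) c0(8)[rule_format] c0(9)[rule_format]
 note cd = E.cokernelD[OF c(1)]
 have cz: "c = zero_arr E (Dom E c) (Cod E c)" using E.epi_zeroD[OF epi cd(2,3,4)] unfolding cd(3) .
 have surj: "EX d x. regular_epi C d & d : Arr C & Cod C d = Dom C y & (x, y ## d) : el C f" if y: "y : Arr C" "Cod C y = fst (Cod E f)" for y
 proof -
  have y': "Cod C y = fst (Dom E c)" using y cd(3) by simp
  from E_zero_elem(2)[OF cd(2) y(1) y' c(6)[OF y] cz] obtain w where w: "w : Arr C" "Cod C w = Dom C m" "y = m ## w"
   using c(5,7) by auto
  obtain d x where d: "regular_epi C d" "Cod C d = Dom C w" "(x, m ## (w ## d)) : el C f" using c(4)[OF w(1,2)] by blast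
  note da = coverD(1)[OF d(1)]
  have "m ## (w ## d) = y ## d" "Dom C w = Dom C y" using w d(2) da c(2) by simp_all
  then show ?thesis using d da by metis
 qed
 obtain kk k where k0: "is_kernel E f kk" "mono_in C k" "k : Arr C" "Cod C k = fst (Dom E f)" "fst (Dom E kk) = Dom C k"
  "el C kk = gm C k (eo C (Dom E f))"
  "ALL x. x : Arr C \<longrightarrow> Cod C x = fst (Dom E f) \<longrightarrow> ((x, \<zero> (Dom C x) (fst (Cod E f))) : el C f \<longleftrightarrow> (EX u : Arr C. Cod C u = Dom C k & x = k ## u))"
  "ALL u v. (u, v) : eo C (Dom E kk) \<longleftrightarrow> u : Arr C & Cod C u = Dom C k & v : Arr C & Cod C v = Dom C k & (k ## u, k ## v) : eo C (Dom E f)"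
  by (rule E_kernel[OF f])
 note k = k0(1-6) k0(7)[rule_format]
 note kd = E.kernelD[OF k(1)]
 have "is_cokernel E kk f"
 proof (rule E.cokernelI[OF kd(2) epi kd(3)[symmetric] kd(4)])
  fix h assume h: "h : Arr E" "Dom E h = Cod E kk" "Comp E h kk = zero_arr E (Dom E kk) (Cod E h)"
  note kh = h(2)[symmetric] and hd = E_arrD[OF h(1)]
  note ch = E_comp[OF kd(2) h(1) kh] and T = EqD[OF E_objD(1)[OF hd(2)]]
  have z: "Comp E h kk = zero_arr E (Dom E (Comp E h kk)) (Cod E (Comp E h kk))" unfolding ch(2,3) by (rule h(3))
  have hf: "Dom E h = Dom E f" using h(2) kd(3) by simp
  have kill: "(\<zero> (Dom C x) (fst (Cod E h)), t) : eo C (Cod E h)" if xt: "(x, \<zero> (Dom C x) (fst (Cod E f))) : el C f" "(x, t) : el C h" for x t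
  proof -
   note tx = E_typed[OF f xt(1)]
   obtain u where u: "u : Arr C" "Cod C u = Dom C k" "x = k ## u" using k(7)[OF tx(1,4)] xt(1) by blast
   have "(u, x) : el C kk" unfolding k(6) u(3) by (rule gmI[OF E_objD(1)[OF fd(1)] k(3) u(1,2) k(4)])
   from E_zero_elem(2)[OF ch(1) u(1) _ E_compI[OF kd(2) h(1) kh this xt(2)] z]
   show ?thesis using u k(3,5) ch(2,3) by simp
  qed
  let ?G = "rcomp C (el C h) ((el C f)\<inverse>)"
  have M: "Mr C (Cod E f) (Cod E h) ?G"
  proof (rule Mor_rcompI[OF rep_converse[OF F] _ E_objD(1)[OF hd(2)] _ _ _ _ E_objD(1)[OF fd(2)]])
   show "rep C (fst (Dom E f)) (fst (Cod E h)) (el C h)" using E_rep[OF h(1)] unfolding hf .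
   show "(t, t') : eo C (Cod E h)"
    if a: "(y, x) : (el C f)\<inverse>" "(x, t) : el C h" "(y, x') : (el C f)\<inverse>" "(x', t') : el C h" for y x x' t t'
   proof -
    have b: "(x, y) : el C f" "(x', y) : el C f" using a by simp_all
    note t1 = E_typed[OF f b(1)] and t2 = E_typed[OF f b(2)] and t3 = E_typed[OF h(1) a(2)] and t4 = E_typed[OF h(1) a(4)]
    have "(x' \<ominus> x, y \<ominus> y) : el C f" by (rule rep_diff[OF F b(2,1)]) simp
    moreover have "y \<ominus> y = \<zero> (Dom C (x' \<ominus> x)) (fst (Cod E f))" using t1 t2 by (simp add: pl_ng)
    ultimately have 1: "(x' \<ominus> x, \<zero> (Dom C (x' \<ominus> x)) (fst (Cod E f))) : el C f" by simp
    have 2: "(x' \<ominus> x, t' \<ominus> t) : el C h" by (rule rep_diff[OF E_rep[OF h(1)] a(4,2)]) (use t1 t2 t3 t4 in simp)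
    from kill[OF 1 2] show ?thesis using Eq_diff_iff[OF E_objD(1)[OF hd(2)], of t t'] t1 t2 t3 t4 by simp
   qed
   show "(y', x) : (el C f)\<inverse>" if "(y, y') : eo C (Cod E f)" "(y, x) : (el C f)\<inverse>" for y y' x
    using E_sat(2)[OF f E_typed(6)[OF f] _ that(1)] that(2) by blast
   show "(x, t') : el C h" if "(x, t) : el C h" "(t, t') : eo C (Cod E h)" for x t t'
    by (rule E_sat(2)[OF h(1) E_typed(6)[OF h(1) that(1)] that])
   fix y assume y: "y : Arr C" "Cod C y = fst (Cod E f)"
   obtain e x where e: "regular_epi C e" "e : Arr C" "Cod C e = Dom C y" "(x, y ## e) : el C f" using surj[OF y] by blast
   note tx = E_typed[OF f e(4)]
   have x': "Cod C x = fst (Dom E h)" using tx hf by simp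
   obtain d t where d: "regular_epi C d" "d : Arr C" "Cod C d = Dom C x" "(x ## d, t) : el C h" "t : Arr C" "Dom C t = Dom C d" "Cod C t = fst (Cod E h)"
    by (rule E_total[OF h(1) tx(1) x'])
   have de: "Cod C d = Dom C e" "Cod C d = Dom C (y ## e)" using d(3) tx(3) y e by simp_all
   note rf = E_refine[OF e(1) d(1) e(2) d(2) de(1) y(1) e(3)]
   have "((y ## e) ## d, x ## d) : (el C f)\<inverse>" using E_prec[OF f e(4) d(2) de(2)] by simp
   then show "EX e x t. regular_epi C e & Cod C e = Dom C y & (y ## e, x) : (el C f)\<inverse> & (x, t) : el C h"
    using d(4) rf(1,3) unfolding rf(4) by blast
  qed
  note u = E_mk[OF fd(2) hd(2) M]
  let ?u = "mk C (Cod E f) ?G (Cod E h)"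
  note uf = E_comp[OF f u(1) u(2)[symmetric]]
  have "Comp E ?u f = h"
  proof (rule E_ext[OF uf(1) h(1)])
   fix x assume x: "x : Arr C" "Cod C x = fst (Dom E h)"
   have x': "Cod C x = fst (Dom E f)" using x hf by simp
   obtain e y where e: "regular_epi C e" "e : Arr C" "Cod C e = Dom C x" "(x ## e, y) : el C f"
    "y : Arr C" "Dom C y = Dom C e" "Cod C y = fst (Cod E f)"
    by (rule E_total[OF f x(1) x'])
   have xe: "Cod C (x ## e) = fst (Dom E h)" "x ## e : Arr C" "Dom C (x ## e) = Dom C e" using x e by simp_all
   obtain d t where d: "regular_epi C d" "d : Arr C" "Cod C d = Dom C (x ## e)" "((x ## e) ## d, t) : el C h" "t : Arr C" "Dom C t = Dom C d" "Cod C t = fst (Cod E h)"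
    by (rule E_total[OF h(1) xe(2,1)])
   have de: "Cod C d = Dom C e" "Cod C d = Dom C y" using d(3) xe e by simp_all
   note rf = E_refine[OF e(1) d(1) e(2) d(2) de(1) x(1) e(3)]
   have fd': "((x ## e) ## d, y ## d) : el C f" by (rule E_prec[OF f e(4) d(2) de(2)])
   have "(y ## d, t) : el C ?u" unfolding u(4)
    by (rule rcompI[OF rep_converse[OF F] E_rep[OF h(1), unfolded hf] _ d(4)]) (use fd' in simp)
   from E_compI[OF f u(1) u(2)[symmetric] fd' this]
   show "EX e y. regular_epi C e & Cod C e = Dom C x & (x ## e, y) : el C (Comp E ?u f) & (x ## e, y) : el C h"
    using d(4) rf(1,3) unfolding rf(4) by blast
  qed (use uf(2,3) u(3) hf in simp_all)
  then show "EX u. u : Arr E & Dom E u = Cod E f & Cod E u = Cod E h & Comp E u f = h" using u(1-3) by blast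
 qed
 then show ?thesis by blast
qed

lemma abelian_E: "abelian_category E"
 unfolding abelian_category_def
 using additive_E E_kernel E_cokernel E_mono_normal E_epi_normal by metis

section \<open>The embedding into the exact completion\<close>

lemma Mor_to_discrete:
 assumes F: "Mor C A R B (El C (Id C B) (Id C B)) F"
 obtains g where "g : Arr C" "Dom C g = A" "Cod C g = B" "ALL x y. (x, y) : F \<longleftrightarrow> x : Arr C & Cod C x = A & y = g ## x"
proof -
 note Fd = MorD[OF F]
 have AB: "A : Obj C" "B : Obj C" using rep_obj[OF Fd(1)] by blast+
 obtain r0 r1 where r: "jointly_monic C r0 r1" "r0 : Arr C" "r1 : Arr C" "Dom C r0 = Dom C r1" "Cod C r0 = A" "Cod C r1 = B" "F = El C r0 r1"
  by (rule repE[OF Fd(1)])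
 have single: "y = y'" if "(x, y) : F" "(x, y') : F" for x y y'
  using Fd(2)[OF that] unfolding disc_iff[OF AB(2)] by blast
 have m: "mono_in C r0"
 proof (rule mono_zeroI[OF r(2)])
  fix h assume h: "h : Arr C" "Cod C h = Dom C r0" "r0 ## h = \<zero> (Dom C h) (Cod C r0)"
  have "(r0 ## h, r1 ## h) : F" unfolding r(7) by (rule ElI[OF h(1,2)])
  then have 1: "(\<zero> (Dom C h) A, r1 ## h) : F" unfolding h(3) r(5) .
  have D: "Dom C h : Obj C" "Dom C r1 : Obj C" using h(1) r(3) by simp_all
  have 2: "r1 ## h = \<zero> (Dom C h) B" by (rule single[OF 1 rep_zero[OF Fd(1) D(1)]])
  show "h = \<zero> (Dom C h) (Dom C r0)"
   by (rule jm_unique[OF r(1)]) (use h 2 r(2-6) D in simp_all)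
 qed
 have iA: "Id C A : Arr C" "Cod C (Id C A) = A" "Dom C (Id C A) = A" using AB by simp_all
 obtain e y where e: "regular_epi C e" "e : Arr C" "Cod C e = Dom C (Id C A)" "(Id C A ## e, y) : F" "y : Arr C" "Dom C y = Dom C e" "Cod C y = B"
  by (rule Mor_total[OF F iA(1,2)])
 have "Id C A ## e = e" using e(2,3) iA(3) by simp
 then have ey: "(e, y) : F" using e(4) by simp
 obtain h where h: "h : Arr C" "Cod C h = Dom C r0" "e = r0 ## h" "y = r1 ## h" using ey unfolding r(7) by (rule ElE)
 have "iso_in C r0" by (rule mono_cover_iso[OF m h(1,2) e(1)[unfolded h(3)]])
 then obtain j where j: "r0 : Arr C" "j : Arr C" "Dom C j = Cod C r0" "Cod C j = Dom C r0" "j ## r0 = Id C (Dom C r0)" "r0 ## j = Id C (Cod C r0)"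
  by (rule isoE)
 have fwd: "(x, (r1 ## j) ## x) : F" if x: "x : Arr C" "Cod C x = A" for x
 proof -
  have jx: "j ## x : Arr C" "Cod C (j ## x) = Dom C r0" using j(2-4) x r(5) by simp_all
  have 1: "(r0 ## (j ## x), r1 ## (j ## x)) : F" unfolding r(7) by (rule ElI[OF jx])
  have 2: "r0 ## (j ## x) = x" using assoc_rewrite[OF j(6), of x] j(1-4) x r(5) by simp
  have 3: "r1 ## (j ## x) = (r1 ## j) ## x" using j(2-4) x r(3-5) by simp
  show ?thesis using 1 unfolding 2 3 .
 qed
 have iff: "(x, y) : F \<longleftrightarrow> x : Arr C & Cod C x = A & y = (r1 ## j) ## x" for x y
 proof
  assume xy: "(x, y) : F"
  note t = rep_typed[OF Fd(1) xy]
  show "x : Arr C & Cod C x = A & y = (r1 ## j) ## x" using t(1,4) single[OF xy fwd[OF t(1,4)]] by blast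
 next
  assume "x : Arr C & Cod C x = A & y = (r1 ## j) ## x"
  then show "(x, y) : F" using fwd by blast
 qed
 have "r1 ## j : Arr C" "Dom C (r1 ## j) = A" "Cod C (r1 ## j) = B" using j(2-4) r(2-6) by simp_all
 then show thesis using that iff by blast
qed

lemma emb_obj:
 assumes A: "A : Obj C"
 shows "FObj (ex_embedding C) A : Obj E" "fst (FObj (ex_embedding C) A) = A"
  "eo C (FObj (ex_embedding C) A) = El C (Id C A) (Id C A)"
proof -
 have j: "jointly_monic C (Id C A) (Id C A)" by (rule jmI) (use A in simp_all)
 have o: "FObj (ex_embedding C) A = (A, spans C (El C (Id C A) (Id C A)))"
  by (simp add: ex_embedding_def ex_obj_embedding_def rel_class_eq_spans[OF j])
 show "FObj (ex_embedding C) A : Obj E" "fst (FObj (ex_embedding C) A) = A"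
  "eo C (FObj (ex_embedding C) A) = El C (Id C A) (Id C A)"
  using E_objI[OF Eq_disc[OF A]] unfolding o by simp_all
qed

lemma graph_iff: "f : Arr C ==> (x, y) : El C (Id C (Dom C f)) f \<longleftrightarrow> x : Arr C & Cod C x = Dom C f & y = f ## x"
proof
 assume f: "f : Arr C" and "(x, y) : El C (Id C (Dom C f)) f"
 then obtain h where h: "h : Arr C" "Cod C h = Dom C (Id C (Dom C f))" "x = Id C (Dom C f) ## h" "y = f ## h" by (elim ElE)
 then have "Cod C h = Dom C f" "x = h" using f by simp_all
 then show "x : Arr C & Cod C x = Dom C f & y = f ## x" using h(1,4) by simp
next
 assume f: "f : Arr C" and x: "x : Arr C & Cod C x = Dom C f & y = f ## x"
 have "(Id C (Dom C f) ## x, f ## x) : El C (Id C (Dom C f)) f" by (rule ElI) (use f x in simp_all)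
 then show "(x, y) : El C (Id C (Dom C f)) f" using f x by simp
qed

lemma emb_arr:
 assumes f: "f : Arr C"
 shows "FArr (ex_embedding C) f : Arr E" "Dom E (FArr (ex_embedding C) f) = FObj (ex_embedding C) (Dom C f)"
  "Cod E (FArr (ex_embedding C) f) = FObj (ex_embedding C) (Cod C f)"
  "(x, y) : el C (FArr (ex_embedding C) f) \<longleftrightarrow> x : Arr C & Cod C x = Dom C f & y = f ## x"
proof -
 have AB: "Dom C f : Obj C" "Cod C f : Obj C" using f by simp_all
 note a = emb_obj[OF AB(1)] and b = emb_obj[OF AB(2)]
 let ?G = "El C (Id C (Dom C f)) f"
 have j: "jointly_monic C (Id C (Dom C f)) f" by (rule jmI) (use f in simp_all)
 have eq: "FArr (ex_embedding C) f = mk C (FObj (ex_embedding C) (Dom C f)) ?G (FObj (ex_embedding C) (Cod C f))"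
  by (simp add: ex_embedding_def mk_def rel_class_eq_spans[OF j])
 have "Mr C (FObj (ex_embedding C) (Dom C f)) (FObj (ex_embedding C) (Cod C f)) ?G"
  unfolding a(2,3) b(2,3) Mor_def
 proof (intro conjI allI impI)
  show "rep C (Dom C f) (Cod C f) ?G" by (rule rep_graph[OF f])
  fix x assume x: "x : Arr C" "Cod C x = Dom C f"
  have xi: "x ## Id C (Dom C x) = x" "Dom C x : Obj C" using x by simp_all
  have "(x ## Id C (Dom C x), f ## x) : ?G" unfolding xi(1) graph_iff[OF f] using x by blast
  then show "EX e y. regular_epi C e & Cod C e = Dom C x & (x ## e, y) : ?G"
   using cover_id[OF xi(2)] xi(2) by (intro exI[of _ "Id C (Dom C x)"] exI[of _ "f ## x"]) simp
 next
  fix x y y' assume "(x, y) : ?G" "(x, y') : ?G"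
  then have "x : Arr C" "Cod C x = Dom C f" "y = f ## x" "y' = f ## x" unfolding graph_iff[OF f] by blast+
  then show "(y, y') : El C (Id C (Cod C f)) (Id C (Cod C f))" unfolding disc_iff[OF AB(2)] using f by simp
 next
  fix x x' y y' assume h: "(x, x') : El C (Id C (Dom C f)) (Id C (Dom C f))" "(x, y) : ?G" "(y, y') : El C (Id C (Cod C f)) (Id C (Cod C f))"
  then show "(x', y') : ?G" unfolding disc_iff[OF AB(1)] disc_iff[OF AB(2)] by blast
 qed
 note m = E_mk[OF a(1) b(1) this, folded eq]
 show "FArr (ex_embedding C) f : Arr E" "Dom E (FArr (ex_embedding C) f) = FObj (ex_embedding C) (Dom C f)"
  "Cod E (FArr (ex_embedding C) f) = FObj (ex_embedding C) (Cod C f)" using m(1-3) by blast+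
 show "(x, y) : el C (FArr (ex_embedding C) f) \<longleftrightarrow> x : Arr C & Cod C x = Dom C f & y = f ## x"
  unfolding m(4) by (rule graph_iff[OF f])
qed

lemma full_functor_emb: "full_functor C E (ex_embedding C)"
proof -
 interpret E: category E by (rule category_E)
 let ?F = "ex_embedding C"
 have id: "FArr ?F (Id C A) = Id E (FObj ?F A)" if A: "A : Obj C" for A
 proof -
  have i: "Id C A : Arr C" "Dom C (Id C A) = A" "Cod C (Id C A) = A" using A by simp_all
  note e = emb_arr[OF i(1), unfolded i(2,3)] and d = E_id[OF emb_obj(1)[OF A]]
  have s: "el C (FArr ?F (Id C A)) = el C (Id E (FObj ?F A))"
  proof (intro equalityI subrelI)
   fix x y assume "(x, y) : el C (FArr ?F (Id C A))"
   then have "x : Arr C" "Cod C x = A" "y = Id C A ## x" unfolding e(4) by blast+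
   then show "(x, y) : el C (Id E (FObj ?F A))" unfolding d(4) emb_obj(3)[OF A] disc_iff[OF A] by simp
  next
   fix x y assume "(x, y) : el C (Id E (FObj ?F A))"
   then have "x = y" "x : Arr C" "Cod C x = A" unfolding d(4) emb_obj(3)[OF A] disc_iff[OF A] by blast+
   then show "(x, y) : el C (FArr ?F (Id C A))" unfolding e(4) by simp
  qed
  show ?thesis by (rule E_eqI[OF e(1) d(1) _ _ s]) (simp_all add: e(2,3) d(2,3))
 qed
 have comp: "FArr ?F (g ## f) = Comp E (FArr ?F g) (FArr ?F f)" if fg: "f : Arr C" "g : Arr C" "Cod C f = Dom C g" for f g
 proof -
  have gf: "g ## f : Arr C" "Dom C (g ## f) = Dom C f" "Cod C (g ## f) = Cod C g" using fg by simp_all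
  note e = emb_arr[OF gf(1), unfolded gf(2,3)] and e1 = emb_arr[OF fg(1)] and e2 = emb_arr[OF fg(2)]
  have c: "Cod E (FArr ?F f) = Dom E (FArr ?F g)" unfolding e1(3) e2(2) fg(3) ..
  note k = E_comp[OF e1(1) e2(1) c]
  show ?thesis
  proof (rule E_ext'[OF e(1) k(1)])
   show "Dom E (FArr ?F (g ## f)) = Dom E (Comp E (FArr ?F g) (FArr ?F f))" unfolding k(2) e(2) e1(2) ..
   show "Cod E (FArr ?F (g ## f)) = Cod E (Comp E (FArr ?F g) (FArr ?F f))" unfolding k(3) e(3) e2(3) ..
   fix x assume x: "x : Arr C" "Cod C x = fst (Dom E (Comp E (FArr ?F g) (FArr ?F f)))"
   have D: "Dom C f : Obj C" using fg by simp
   have xf: "Cod C x = Dom C f" using x(2) unfolding k(2) e1(2) emb_obj(2)[OF D] .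
   have fx: "f ## x : Arr C" "Cod C (f ## x) = Dom C g" "(g ## f) ## x = g ## (f ## x)" using fg x(1) xf by simp_all
   have "(x, f ## x) : el C (FArr ?F f)" "(f ## x, g ## (f ## x)) : el C (FArr ?F g)" unfolding e1(4) e2(4) using x(1) xf fx by blast+
   then have "(x, g ## (f ## x)) : el C (Comp E (FArr ?F g) (FArr ?F f))" by (rule E_compI[OF e1(1) e2(1) c])
   moreover have "(x, g ## (f ## x)) : el C (FArr ?F (g ## f))" unfolding e(4) fx(3) using x(1) xf by blast
   ultimately show "EX y. (x, y) : el C (FArr ?F (g ## f)) & (x, y) : el C (Comp E (FArr ?F g) (FArr ?F f))" by blast
  qed
 qed
 have F: "is_functor C E ?F" unfolding is_functor_def
 proof (intro conjI ballI impI)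
  show "FObj ?F A : Obj E" if "A : Obj C" for A by (rule emb_obj(1)[OF that])
  show "FArr ?F f : Hom E (FObj ?F A) (FObj ?F B)" if "f : Hom C A B" for A B f
  proof -
   have f: "f : Arr C" "Dom C f = A" "Cod C f = B" using that unfolding Hom_def by blast+
   show ?thesis unfolding Hom_def using emb_arr(1-3)[OF f(1)] unfolding f(2,3) by blast
  qed
  show "FArr ?F (Id C A) = Id E (FObj ?F A)" if "A : Obj C" for A by (rule id[OF that])
  show "FArr ?F (g ## f) = Comp E (FArr ?F g) (FArr ?F f)" if "f : Arr C" "g : Arr C" "Cod C f = Dom C g" for f g
   by (rule comp[OF that])
 qed
 have "bij_betw (FArr ?F) (Hom C A B) (Hom E (FObj ?F A) (FObj ?F B))" if A: "A : Obj C" and B: "B : Obj C" for A B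
  unfolding bij_betw_def
 proof (intro conjI equalityI subsetI)
  show "inj_on (FArr ?F) (Hom C A B)"
  proof (rule inj_onI)
   fix f g assume "f : Hom C A B" "g : Hom C A B" and eq: "FArr ?F f = FArr ?F g"
   then have f: "f : Arr C" "Dom C f = A" and g: "g : Arr C" "Dom C g = A" unfolding Hom_def by blast+
   have i: "Id C A : Arr C" "Cod C (Id C A) = A" "f ## Id C A = f" "g ## Id C A = g" using A f g by auto
   have "(Id C A, f ## Id C A) : el C (FArr ?F f)" unfolding emb_arr(4)[OF f(1)] f(2) using i(1,2) by blast
   then have "(Id C A, f ## Id C A) : el C (FArr ?F g)" unfolding eq .
   then have "f ## Id C A = g ## Id C A" unfolding emb_arr(4)[OF g(1)] by blast
   then show "f = g" unfolding i(3,4) .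
  qed
  show "\<phi> : Hom E (FObj ?F A) (FObj ?F B)" if "\<phi> : FArr ?F ` Hom C A B" for \<phi>
  proof -
   obtain f where f: "f : Arr C" "Dom C f = A" "Cod C f = B" "\<phi> = FArr ?F f" using \<open>\<phi> : FArr ?F ` Hom C A B\<close> unfolding Hom_def by blast
   show ?thesis unfolding f(4) Hom_def using emb_arr(1-3)[OF f(1)] unfolding f(2,3) by blast
  qed
  show "\<phi> : FArr ?F ` Hom C A B" if "\<phi> : Hom E (FObj ?F A) (FObj ?F B)" for \<phi>
  proof -
   have p: "\<phi> : Arr E" "Dom E \<phi> = FObj ?F A" "Cod E \<phi> = FObj ?F B" using \<open>\<phi> : Hom E (FObj ?F A) (FObj ?F B)\<close> unfolding Hom_def by blast+
   have M: "Mor C A (El C (Id C A) (Id C A)) B (El C (Id C B) (Id C B)) (el C \<phi>)"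
    using E_arrD(3)[OF p(1)] unfolding p(2,3) emb_obj(2,3)[OF A] emb_obj(2,3)[OF B] .
   obtain g where g: "g : Arr C" "Dom C g = A" "Cod C g = B" "ALL x y. (x, y) : el C \<phi> \<longleftrightarrow> x : Arr C & Cod C x = A & y = g ## x"
    by (rule Mor_to_discrete[OF M])
   note e = emb_arr[OF g(1), unfolded g(2,3)]
   have s: "el C (FArr ?F g) = el C \<phi>"
   proof (intro equalityI subrelI)
    show "(x, y) : el C \<phi>" if "(x, y) : el C (FArr ?F g)" for x y using that g(4) unfolding e(4) by blast
    show "(x, y) : el C (FArr ?F g)" if "(x, y) : el C \<phi>" for x y unfolding e(4) using that g(4) by blast
   qed
   have "FArr ?F g = \<phi>" by (rule E_eqI[OF e(1) p(1) _ _ s]) (simp_all add: e(2,3) p(2,3))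
   moreover have "g : Hom C A B" unfolding Hom_def using g(1-3) by blast
   ultimately show ?thesis by blast
  qed
 qed
 then have "fully_faithful C E ?F" unfolding fully_faithful_def by blast
 then show ?thesis using F by (intro full_functor.intro full_functor_axioms.intro category_axioms category_E)
qed

end

section \<open>The torsion theory in the exact completion\<close>

definition torsion :: "('o, 'a) cat \<Rightarrow> ('o, 'a) ex_obj set" where
 "torsion C = {a : Obj (ex_reg C). ALL Y : Obj C. ALL f : Hom (ex_reg C) a (FObj (ex_embedding C) Y).
  f = zero_arr (ex_reg C) a (FObj (ex_embedding C) Y)}"

definition torsion_free :: "('o, 'a) cat \<Rightarrow> ('o, 'a) ex_obj set" where
 "torsion_free C = {b : Obj (ex_reg C). EX i. iso_in (ex_reg C) i & Dom (ex_reg C) i = b \<and>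
  Cod (ex_reg C) i : FObj (ex_embedding C) ` Obj C}"

context stable_additive
begin

lemma E_unit:
 assumes b: "b : Obj E"
 obtains kk \<eta> where "is_kernel E \<eta> kk" "is_cokernel E kk \<eta>" "Cod E kk = b" "Dom E \<eta> = b" "Cod E \<eta> : FObj (ex_embedding C) ` Obj C"
  "!!Y f. Y : Obj C ==> f : Arr E ==> Dom E f = Dom E kk ==> Cod E f = FObj (ex_embedding C) Y ==> f = zero_arr E (Dom E f) (Cod E f)"
proof -
 interpret E: additive E by (rule additive.intro[OF additive_E])
 note R = EqD[OF E_objD(1)[OF b]]
 obtain k where k: "mono_in C k" "k : Arr C" "Cod C k = fst b"
  "!!x. x : Arr C ==> Cod C x = fst b ==> (x, \<zero> (Dom C x) (fst b)) : eo C b \<longleftrightarrow> (EX u : Arr C. Cod C u = Dom C k & x = k ## u)"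
  by (rule kernel_rep[OF R(2)]) (blast | metis)
 obtain q where q: "is_cokernel C k q" using cokernel_ex[OF k(2)] by blast
 note qd = cokernelD[OF q]
 have qr: "regular_epi C q" using q regular_epi_iff by blast
 let ?B = "Cod C q"
 have B: "?B : Obj C" using qd(2) by simp
 note eB = emb_obj[OF B]
 let ?b = "FObj (ex_embedding C) ?B"
 have dq: "Dom C q = fst b" using qd(3) k(3) by simp
 have resp: "(q ## x, q ## x') : eo C ?b" if x: "(x, x') : eo C b" for x x'
 proof -
  note t = rep_typed[OF R(2) x]
  note s = R(4)[OF iffD1[OF Eq_diff_iff[OF E_objD(1)[OF b] t] x]]
  have d: "x' \<ominus> x : Arr C" "Dom C (x' \<ominus> x) = Dom C x'" "Cod C (x' \<ominus> x) = fst b" using t by simp_all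
  obtain u where u: "u : Arr C" "Cod C u = Dom C k" "x' \<ominus> x = k ## u" using k(4)[OF d(1,3)] s unfolding d(2) by blast
  have du: "Dom C u = Dom C x'" using d(2) u(1,2) k(2) unfolding u(3) by simp
  have e1: "q ## (x' \<ominus> x) = \<zero> (Dom C x') ?B" unfolding u(3) using assoc_rewrite[OF qd(4), of u] u(1,2) du k(2) qd(2,3) B by simp
  have e2: "q ## (x' \<ominus> x) = q ## x' \<ominus> q ## x" using t qd(2) dq by (simp add: comp_pl comp_ng)
  have e3: "q ## x' \<ominus> q ## x = \<zero> (Dom C x') ?B \<longleftrightarrow> q ## x' = q ## x" by (rule minus_eq_zero_iff) (use t qd(2) dq in simp_all)
  have "q ## x' = q ## x" by (rule iffD1[OF e3 e1[unfolded e2]])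
  then show ?thesis unfolding eB(3) disc_iff[OF B] using t qd(2) dq by simp
 qed
 let ?\<eta> = "mk C b (gm C q (eo C ?b)) ?b"
 have \<eta>: "?\<eta> : Arr E" "Dom E ?\<eta> = b" "Cod E ?\<eta> = ?b" "!!x. x : Arr C ==> Cod C x = fst b ==> (x, q ## x) : el C ?\<eta>"
  by (rule E_gm[OF b eB(1) qd(2) dq]; (erule resp | simp add: eB(2)))+
 have epi: "epi_in E ?\<eta>"
 proof (rule E.epi_zeroI[OF \<eta>(1)])
  fix h assume h: "h : Arr E" "Dom E h = Cod E ?\<eta>" "Comp E h ?\<eta> = zero_arr E (Dom E ?\<eta>) (Cod E h)"
  note ch = h(2)[symmetric]
  note hc = E_comp[OF \<eta>(1) h(1) ch]
  have z: "Comp E h ?\<eta> = zero_arr E (Dom E (Comp E h ?\<eta>)) (Cod E (Comp E h ?\<eta>))" unfolding hc(2,3) by (rule h(3))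
  have "h = zero_arr E (Dom E h) (Cod E h)"
  proof (rule E_zeroI[OF h(1)])
   fix x assume x: "x : Arr C" "Cod C x = fst (Dom E h)"
   have xB: "Cod C x = Cod C q" using x(2) unfolding h(2) \<eta>(3) eB(2) .
   obtain e y where e: "regular_epi C e" "e : Arr C" "Cod C e = Dom C x" "y : Arr C" "Dom C y = Dom C e" "Cod C y = Dom C q" "q ## y = x ## e"
    by (rule cover_pullback[OF qr x(1) xB])
   have qy: "q ## y : Arr C" "Cod C (q ## y) = fst (Dom E h)" "Dom C (q ## y) = Dom C e" using e(4-6) qd(2) x(2)[unfolded xB] by simp_all
   obtain d t where d: "regular_epi C d" "d : Arr C" "Cod C d = Dom C (q ## y)" "((q ## y) ## d, t) : el C h" "t : Arr C" "Dom C t = Dom C d" "Cod C t = fst (Cod E h)"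
    by (rule E_total[OF h(1) qy(1,2)])
   have de: "Cod C d = Dom C e" using d(3) qy(3) by simp
   note rf = E_refine[OF e(1) d(1) e(2) d(2) de x(1) e(3)]
   have yb: "Cod C y = fst b" using e(6) dq by simp
   have 1: "(y ## d, (q ## y) ## d) : el C ?\<eta>" by (rule E_prec[OF \<eta>(1) \<eta>(4)[OF e(4) yb] d(2,3)])
   have yd: "y ## d : Arr C" "Cod C (y ## d) = fst (Dom E (Comp E h ?\<eta>))" "Dom C (y ## d) = Dom C d"
    unfolding hc(2) \<eta>(2) using e(4-6) d(2) de dq by simp_all
   from E_zero_elem(2)[OF hc(1) yd(1,2) E_compI[OF \<eta>(1) h(1) ch 1 d(4)] z]
   have "(\<zero> (Dom C d) (fst (Cod E h)), t) : eo C (Cod E h)" unfolding hc(3) yd(3) .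
   note s = EqD(4)[OF E_objD(1)[OF E_arrD(2)[OF h(1)]] this]
   from E_sat(2)[OF h(1) E_typed(6)[OF h(1) d(4)] d(4) s]
   have "(x ## (e ## d), \<zero> (Dom C (e ## d)) (fst (Cod E h))) : el C h" unfolding e(7) rf(4,5) .
   then show "EX e. regular_epi C e & Cod C e = Dom C x & (x ## e, \<zero> (Dom C e) (fst (Cod E h))) : el C h"
    using rf(1,3) by blast
  qed
  then show "h = zero_arr E (Cod E ?\<eta>) (Cod E h)" unfolding h(2) .
 qed
 obtain g where g: "is_cokernel E g ?\<eta>" using E_epi_normal[OF epi] by blast
 obtain kk k2 where k0: "is_kernel E ?\<eta> kk" "mono_in C k2" "k2 : Arr C" "Cod C k2 = fst (Dom E ?\<eta>)" "fst (Dom E kk) = Dom C k2"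
  "el C kk = gm C k2 (eo C (Dom E ?\<eta>))"
  "ALL x. x : Arr C \<longrightarrow> Cod C x = fst (Dom E ?\<eta>) \<longrightarrow> ((x, \<zero> (Dom C x) (fst (Cod E ?\<eta>))) : el C ?\<eta> \<longleftrightarrow> (EX u : Arr C. Cod C u = Dom C k2 & x = k2 ## u))"
  "ALL u v. (u, v) : eo C (Dom E kk) \<longleftrightarrow> u : Arr C & Cod C u = Dom C k2 & v : Arr C & Cod C v = Dom C k2 & (k2 ## u, k2 ## v) : eo C (Dom E ?\<eta>)"
  by (rule E_kernel[OF \<eta>(1)])
 note kk = k0(1-5) k0(7)[rule_format] k0(8)[rule_format]
 note kd = E.kernelD[OF kk(1)]
 have el0: "(x, \<zero> (Dom C x) ?B) : el C ?\<eta> \<longleftrightarrow> q ## x = \<zero> (Dom C x) ?B" if x: "x : Arr C" "Cod C x = fst b" for x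
 proof
  assume a: "(x, \<zero> (Dom C x) ?B) : el C ?\<eta>"
  from E_sat(1)[OF \<eta>(1) \<eta>(4)[OF x] a] have "(q ## x, \<zero> (Dom C x) ?B) : eo C ?b" unfolding \<eta>(3) .
  then show "q ## x = \<zero> (Dom C x) ?B" unfolding eB(3) disc_iff[OF B] by blast
 next
  assume a: "q ## x = \<zero> (Dom C x) ?B"
  show "(x, \<zero> (Dom C x) ?B) : el C ?\<eta>" using \<eta>(4)[OF x] unfolding a .
 qed
 have ck: "Cod C k2 = fst b" using kk(4) unfolding \<eta>(2) .
 have k2: "(EX u : Arr C. Cod C u = Dom C k2 & x = k2 ## u) \<longleftrightarrow> q ## x = \<zero> (Dom C x) ?B" if x: "x : Arr C" "Cod C x = fst b" for x
  using kk(6)[of x, unfolded \<eta>(2,3) eB(2), OF x] el0[OF x] by blast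
 have q2: "is_kernel C q k2"
 proof (rule kernelI[OF qd(2) kk(2)])
  show "Cod C k2 = Dom C q" using ck dq by simp
  show "q ## k2 = \<zero> (Dom C k2) (Cod C q)"
   by (rule iffD1[OF k2[OF kk(3) ck]], rule bexI[of _ "Id C (Dom C k2)"]) (use kk(3) in simp_all)
  fix h assume h: "h : Arr C" "Cod C h = Dom C q" "q ## h = \<zero> (Dom C h) (Cod C q)"
  have hb: "Cod C h = fst b" using h(2) dq by simp
  obtain u where u: "u : Arr C" "Cod C u = Dom C k2" "h = k2 ## u" using iffD2[OF k2[OF h(1) hb] h(3)] by blast
  then have "Dom C u = Dom C h" "k2 ## u = h" using kk(3) by simp_all
  then show "EX u. u : Arr C & Dom C u = Dom C h & Cod C u = Dom C k2 & k2 ## u = h" using u(1,2) by blast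
 qed
 have kq: "Cod C k = Dom C q" using k(3) dq by simp
 obtain t where t: "t : Arr C" "Dom C t = Dom C k" "Cod C t = Dom C k2" "k2 ## t = k"
  by (rule kernel_lift[OF q2 k(2) kq qd(4)])
 have tepi: "epi_in C t" by (rule lift_to_kernel_of_cokernel_epi[OF q q2 t])
 have k0: "(k, \<zero> (Dom C k) (fst b)) : eo C b"
  by (rule iffD2[OF k(4)[OF k(2,3)]], rule bexI[of _ "Id C (Dom C k)"]) (use k(2) in simp_all)
 have K: "Dom C k2 : Obj C" "Dom C t : Obj C" using kk(3) t(1) by simp_all
 have kill: "f = zero_arr E (Dom E f) (Cod E f)" if Y: "Y : Obj C" and f: "f : Arr E" "Dom E f = Dom E kk" "Cod E f = FObj (ex_embedding C) Y" for Y f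
 proof -
  note eY = emb_obj[OF Y]
  have M: "Mor C (Dom C k2) (eo C (Dom E kk)) Y (El C (Id C Y) (Id C Y)) (el C f)"
   using E_arrD(3)[OF f(1)] unfolding f(2,3) kk(5) eY(2,3) .
  obtain g where g: "g : Arr C" "Dom C g = Dom C k2" "Cod C g = Y" "ALL x y. (x, y) : el C f \<longleftrightarrow> x : Arr C & Cod C x = Dom C k2 & y = g ## x"
   by (rule Mor_to_discrete[OF M])
  have z2: "k2 ## \<zero> (Dom C t) (Dom C k2) = \<zero> (Dom C k) (fst b)" using kk(3) K ck t(2) by simp
  have s: "(t, \<zero> (Dom C t) (Dom C k2)) : eo C (Dom E kk)" unfolding kk(7) \<eta>(2) t(4) z2 using k0 t(1,3) K by simp
  have ft: "(t, g ## t) : el C f" using g(4) t(1,3) by blast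
  have "(\<zero> (Dom C t) (Dom C k2), g ## t) : el C f" by (rule E_sat(2)[OF f(1) s[folded f(2)] ft E_typed(7)[OF f(1) ft]])
  then have "g ## t = g ## \<zero> (Dom C t) (Dom C k2)" using g(4) by blast
  moreover have "g ## \<zero> (Dom C t) (Dom C k2) = \<zero> (Dom C t) (Cod C g)" using g(1,2) K by simp
  ultimately have gt: "g ## t = \<zero> (Dom C t) (Cod C g)" by (rule trans)
  have dg: "Dom C g = Cod C t" using g(2) t(3) by simp
  note g0 = epi_zeroD[OF tepi g(1) dg gt, unfolded g(3) t(3)]
  show ?thesis
  proof (rule E_zeroI[OF f(1)])
   fix x assume x: "x : Arr C" "Cod C x = fst (Dom E f)"
   have xk: "Cod C x = Dom C k2" using x(2) unfolding f(2) kk(5) .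
   have xo: "Dom C x : Obj C" "x ## Id C (Dom C x) = x" "Dom C (Id C (Dom C x)) = Dom C x" "Cod C (Id C (Dom C x)) = Dom C x" using x(1) by simp_all
   have "\<zero> (Dom C k2) Y ## x = \<zero> (Dom C x) Y" using x(1) xk Y by simp
   then have "g ## x = \<zero> (Dom C x) Y" unfolding g0 .
   then have "(x, \<zero> (Dom C x) Y) : el C f" using g(4) x(1) xk by metis
   then have "(x ## Id C (Dom C x), \<zero> (Dom C (Id C (Dom C x))) (fst (Cod E f))) : el C f" unfolding f(3) eY(2) xo(2,3) .
   then show "EX e. regular_epi C e & Cod C e = Dom C x & (x ## e, \<zero> (Dom C e) (fst (Cod E f))) : el C f"
    using cover_id[OF xo(1)] xo(4) by blast
  qed
 qed
 have ckk: "Cod E kk = b" using kd(3) unfolding \<eta>(2) .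
 have c\<eta>: "Cod E ?\<eta> : FObj (ex_embedding C) ` Obj C" unfolding \<eta>(3) using B by blast
 show thesis
  by (rule that[OF kk(1) E.cokernel_of_kernel[OF g kk(1)] ckk \<eta>(2) c\<eta>]) (rule kill)
qed

lemma torsion_free_iso: "b : torsion_free C ==> EX i. iso_in E i & Dom E i = b & Cod E i : FObj (ex_embedding C) ` Obj C"
 unfolding torsion_free_def by blast

lemma emb_torsion_free: "FObj (ex_embedding C) ` Obj C \<subseteq> torsion_free C"
proof (rule image_subsetI)
 interpret E: category E by (rule category_E)
 fix A assume A: "A : Obj C"
 note o = emb_obj(1)[OF A]
 note i = E.iso_id[OF o] and d = E_id(2,3)[OF o]
 have "Cod E (Id E (FObj (ex_embedding C) A)) : FObj (ex_embedding C) ` Obj C" unfolding d(2) using A by blast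
 then show "FObj (ex_embedding C) A : torsion_free C" unfolding torsion_free_def using o i d(1) by blast
qed

lemma torsion_theory_E: "torsion_theory E (torsion C) (torsion_free C)"
proof -
 interpret E: additive E by (rule additive.intro[OF additive_E])
 let ?F = "FObj (ex_embedding C)"
 have T: "replete E (torsion C)" unfolding replete_def
 proof (intro conjI allI impI)
  show "torsion C \<subseteq> Obj E" unfolding torsion_def by blast
  fix f assume f: "iso_in E f & Dom E f : torsion C"
  then have i: "iso_in E f" and d: "Dom E f : torsion C" by blast+
  note fa = E.iso_arr[OF i]
  have co: "Cod E f : Obj E" by (rule E_arrD(2)[OF fa])
  have "g = zero_arr E (Cod E f) (?F Y)" if Y: "Y : Obj C" and g: "g : Hom E (Cod E f) (?F Y)" for Y g
  proof -
   have ga: "g : Arr E" "Dom E g = Cod E f" "Cod E g = ?F Y" using g unfolding Hom_def by blast+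
   note gf = E_comp[OF fa ga(1) ga(2)[symmetric]]
   have "Comp E g f : Hom E (Dom E f) (?F Y)" unfolding Hom_def using gf(1-3) ga(3) by simp
   then have "Comp E g f = zero_arr E (Dom E f) (?F Y)" using d Y unfolding torsion_def by blast
   then have "Comp E g f = zero_arr E (Dom E f) (Cod E g)" unfolding ga(3) .
   from E.epi_zeroD[OF E.iso_epi[OF i] ga(1,2) this] show ?thesis unfolding ga(3) .
  qed
  then show "Cod E f : torsion C" unfolding torsion_def using co by blast
 qed
 have F: "replete E (torsion_free C)" unfolding replete_def
 proof (intro conjI allI impI)
  show "torsion_free C \<subseteq> Obj E" unfolding torsion_free_def by blast
  fix f assume f: "iso_in E f & Dom E f : torsion_free C"
  then have i: "iso_in E f" and d: "Dom E f : torsion_free C" by blast+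
  obtain j where j: "iso_in E j" "Dom E j = Dom E f" "Cod E j : ?F ` Obj C" using torsion_free_iso[OF d] by blast
  obtain g where g: "iso_in E g" "f : Arr E" "g : Arr E" "Dom E g = Cod E f" "Cod E g = Dom E f"
   by (rule E.iso_inverse[OF i])
  have c: "Cod E g = Dom E j" using g(5) j(2) by simp
  note k = E_comp[OF g(3) E.iso_arr[OF j(1)] c]
  have "iso_in E (Comp E j g)" by (rule E.iso_comp[OF g(1) j(1) c])
  moreover have "Dom E (Comp E j g) = Cod E f" "Cod E (Comp E j g) : ?F ` Obj C" unfolding k(2,3) using g(4) j(3) by simp_all
  ultimately show "Cod E f : torsion_free C" unfolding torsion_free_def using E_arrD(2)[OF g(2)] by blast
 qed
 have H: "ALL A : torsion C. ALL B : torsion_free C. ALL f : Hom E A B. f = zero_arr E A B"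
 proof (intro ballI)
  fix A B f assume A: "A : torsion C" and B: "B : torsion_free C" and "f : Hom E A B"
  then have f: "f : Arr E" "Dom E f = A" "Cod E f = B" unfolding Hom_def by blast+
  obtain j where j: "iso_in E j" "Dom E j = B" "Cod E j : ?F ` Obj C" using torsion_free_iso[OF B] by blast
  obtain Y where Y: "Y : Obj C" "Cod E j = ?F Y" using j(3) by blast
  have c: "Cod E f = Dom E j" using f(3) j(2) by simp
  note k = E_comp[OF f(1) E.iso_arr[OF j(1)] c]
  have "Comp E j f : Hom E A (?F Y)" unfolding Hom_def using k(1-3) f(2) Y(2) by simp
  then have "Comp E j f = zero_arr E A (?F Y)" using A Y(1) unfolding torsion_def by blast
  then have "Comp E j f = zero_arr E (Dom E f) (Cod E j)" unfolding f(2) Y(2) .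
  from E.mono_zeroD[OF E.iso_mono[OF j(1)] f(1) c this] show "f = zero_arr E A B" unfolding f(2) j(2) .
 qed
 have Q: "ALL B : Obj E. EX k q. Cod E k = B & Dom E q = B & Dom E k : torsion C & Cod E q : torsion_free C & is_kernel E q k & is_cokernel E k q"
 proof
  fix B assume B: "B : Obj E"
  obtain kk \<eta> where u: "is_kernel E \<eta> kk" "is_cokernel E kk \<eta>" "Cod E kk = B" "Dom E \<eta> = B" "Cod E \<eta> : ?F ` Obj C"
   and z: "!!Y f. Y : Obj C ==> f : Arr E ==> Dom E f = Dom E kk ==> Cod E f = ?F Y ==> f = zero_arr E (Dom E f) (Cod E f)"
   using E_unit[OF B] by metis
  have ko: "Dom E kk : Obj E" by (rule E_arrD(1)[OF E.kernelD(2)[OF u(1)]])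
  have "f = zero_arr E (Dom E kk) (?F Y)" if Y: "Y : Obj C" and "f : Hom E (Dom E kk) (?F Y)" for Y f
  proof -
   have f: "f : Arr E" "Dom E f = Dom E kk" "Cod E f = ?F Y" using \<open>f : Hom E (Dom E kk) (?F Y)\<close> unfolding Hom_def by blast+
   show ?thesis using z[OF Y f] unfolding f(2,3) .
  qed
  then have "Dom E kk : torsion C" unfolding torsion_def using ko by blast
  then show "EX k q. Cod E k = B & Dom E q = B & Dom E k : torsion C & Cod E q : torsion_free C & is_kernel E q k & is_cokernel E k q"
   using u emb_torsion_free by blast
 qed
 show ?thesis unfolding torsion_theory_def by (intro conjI T F H Q)
qed

lemma ambient_exact_completion:
 shows "torsion_free_subcategory_of_abelian TYPE(('a, 'b) ex_cat) C"
  "regular_epi_semi_localization_of_abelian TYPE(('a, 'b) ex_cat) C"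
  "semi_localization_of_exact_completion C"
proof -
 interpret S: stable_additive E by (rule stable_additive_of_abelian[OF abelian_E])
 interpret U: full_functor C E "ex_embedding C" by (rule full_functor_emb)
 note tt = torsion_theory_E
 note sr = S.torsion_theory_semi_reflective(1)[OF tt]
 have sub: "torsion_free C \<subseteq> Obj E" unfolding torsion_free_def by blast
 have eq: "equivalent_cats C (full_sub E (torsion_free C))"
  by (rule U.equivalence[OF sub emb_torsion_free]) (erule torsion_free_iso)
 show "torsion_free_subcategory_of_abelian TYPE(('a, 'b) ex_cat) C"
  unfolding torsion_free_subcategory_of_abelian_def using abelian_E tt eq by blast
 interpret I: full_functor "full_sub E (torsion_free C)" E id_fun by (rule S.full_functor_inclusion[OF sub])
 have img: "FObj id_fun ` Obj (full_sub E (torsion_free C)) = torsion_free C" by (simp add: id_fun_def)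
 obtain L \<eta> where L: "semi_localization (full_sub E (torsion_free C)) E id_fun L \<eta>" and
  u: "!!Q. Q : Obj E ==> Dom E (\<eta> Q) = Q & universal E (torsion_free C) (\<eta> Q)"
  using I.semi_localization_of_semi_reflective[unfolded img, OF sr] by metis
 have via: "semi_localization_via C E (torsion_free C) L \<eta>" unfolding semi_localization_via_def using sub L eq by blast
 have "ALL Q : Obj E. regular_epi E (\<eta> Q)" using S.torsion_theory_semi_reflective(2)[OF tt] u by blast
 then show "regular_epi_semi_localization_of_abelian TYPE(('a, 'b) ex_cat) C"
  unfolding regular_epi_semi_localization_of_abelian_def using abelian_E via by blast
 have "semi_reflective E (FObj (ex_embedding C) ` Obj C)"
  by (rule S.semi_reflective_transfer[OF sr emb_torsion_free]) (erule torsion_free_iso)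
 then obtain L' \<eta>' where "semi_localization C E (ex_embedding C) L' \<eta>'" by (rule U.semi_localization_of_semi_reflective)
 then show "semi_localization_of_exact_completion C" unfolding semi_localization_of_exact_completion_def by blast
qed

end

section \<open>The equivalence of the seven conditions\<close>

lemma stable_additive_of_semi_reflective:
 assumes X: "category X" and ab: "abelian_category C" and sr: "semi_reflective C S" and eq: "equivalent_cats X (full_sub C S)"
 shows "stable_additive X"
proof -
 interpret C: stable_additive C by (rule stable_additive_of_abelian[OF ab])
 have S: "S \<subseteq> Obj C" using sr unfolding semi_reflective_def by blast
 obtain U where U: "full_functor X C U" "FObj U ` Obj X \<subseteq> S" and ess: "!!B. B : S ==> EX i. iso_in C i & Dom C i = B & Cod C i : FObj U ` Obj X"
  using C.equivalence_full_functor[OF S X eq] by metis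
 have "semi_reflective C (FObj U ` Obj X)" by (rule C.semi_reflective_transfer[OF sr U(2)]) (erule ess)
 then have "semi_reflective_functor X C U" using U(1) C.additive
  by (intro semi_reflective_functor.intro semi_reflective_functor_axioms.intro)
 then show ?thesis by (rule semi_reflective_functor.stable_additive_X[OF _ stable_additive_of_abelian[OF ab]])
qed

lemma stable_additive_of_semi_localization:
 fixes X :: "('o, 'a) cat"
 assumes X: "category X" and sl: "semi_localization_of_abelian TYPE(('p, 'q) cat) X"
 shows "stable_additive X"
proof -
 obtain C :: "('p, 'q) cat" and S L \<eta> where C: "abelian_category C" and v: "semi_localization_via X C S L \<eta>"
  using sl unfolding semi_localization_of_abelian_def by blast
 have S: "S \<subseteq> Obj C" and s: "semi_localization (full_sub C S) C id_fun L \<eta>" and eq: "equivalent_cats X (full_sub C S)"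
  using v unfolding semi_localization_via_def by blast+
 interpret C: stable_additive C by (rule stable_additive_of_abelian[OF C])
 from semi_reflective_of_semi_localization[OF C.category_full_sub[OF S] C.category_axioms s]
 have "semi_reflective C S" by (simp add: id_fun_def)
 then show ?thesis by (rule stable_additive_of_semi_reflective[OF X C _ eq])
qed

lemma stable_additive_of_torsion_free:
 fixes X :: "('o, 'a) cat"
 assumes X: "category X" and tf: "torsion_free_subcategory_of_abelian TYPE(('p, 'q) cat) X"
 shows "stable_additive X"
proof -
 obtain C :: "('p, 'q) cat" and T F where C: "abelian_category C" and tt: "torsion_theory C T F" and eq: "equivalent_cats X (full_sub C F)"
  using tf unfolding torsion_free_subcategory_of_abelian_def by blast
 interpret C: stable_additive C by (rule stable_additive_of_abelian[OF C])
 show ?thesis by (rule stable_additive_of_semi_reflective[OF X C C.torsion_theory_semi_reflective(1)[OF tt] eq])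
qed

lemma stable_additive_of_exact_completion:
 assumes X: "regular_category X" and sl: "semi_localization_of_exact_completion X" and ad: "additive_category (ex_reg X)"
 shows "stable_additive X"
proof -
 have cX: "category X" using X unfolding regular_category_def by blast
 have cE: "category (ex_reg X)" using ad unfolding additive_category_def by blast
 obtain L \<eta> where L: "semi_localization X (ex_reg X) (ex_embedding X) L \<eta>"
  using sl unfolding semi_localization_of_exact_completion_def by blast
 have r: "is_reflection X (ex_reg X) (ex_embedding X) L \<eta>" using L unfolding semi_localization_def by blast
 have S: "semi_reflective_functor X (ex_reg X) (ex_embedding X)"
  by (intro semi_reflective_functor.intro semi_reflective_functor_axioms.intro full_functor_of_reflection[OF cX cE r] ad
    semi_reflective_of_semi_localization[OF cX cE L])
 interpret A: additive X by (rule additive.intro[OF semi_reflective_functor.additive_X[OF S]])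
 interpret R: regular_additive X by (rule A.regular_additiveI[OF X])
 show ?thesis by (rule semi_reflective_functor.stable_additive_X[OF S stable_additive_of_abelian[OF R.abelian_E]])
qed

theorem theorem7p1:
  fixes X :: "('o, 'a) cat"
  assumes "category X"
  shows
    "let a = regular_category X \<and> additive_category X \<and>
             has_stable_coequalizers_of_equivalence_relations X;
         b = semi_localization_of_abelian TYPE(('o, 'a) ex_cat) X;
         c = regular_epi_semi_localization_of_abelian TYPE(('o, 'a) ex_cat) X;
         d = regular_category X \<and> semi_localization_of_exact_completion X \<and>
             additive_category (ex_reg X);
         e = regular_category X \<and> additive_category X \<and> has_stable_cokernels X;
         f = additive_category X \<and> has_factorizations X \<and> regular_epis_pullback_stable X;
         g = torsion_free_subcategory_of_abelian TYPE(('o, 'a) ex_cat) X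
     in (a \<longleftrightarrow> b) \<and> (a \<longleftrightarrow> c) \<and> (a \<longleftrightarrow> d) \<and> (a \<longleftrightarrow> e) \<and> (a \<longleftrightarrow> f) \<and> (a \<longleftrightarrow> g) \<and>
        (semi_localization_of_abelian TYPE(('p, 'q) cat) X \<longrightarrow> b) \<and>
        (regular_epi_semi_localization_of_abelian TYPE(('p, 'q) cat) X \<longrightarrow> c) \<and>
        (torsion_free_subcategory_of_abelian TYPE(('p, 'q) cat) X \<longrightarrow> g)"
proof -
 have reg: "regular_epi_semi_localization_of_abelian TYPE(('o, 'a) ex_cat) X \<Longrightarrow> semi_localization_of_abelian TYPE(('o, 'a) ex_cat) X"
  "regular_epi_semi_localization_of_abelian TYPE(('p, 'q) cat) X \<Longrightarrow> semi_localization_of_abelian TYPE(('p, 'q) cat) X"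
  unfolding regular_epi_semi_localization_of_abelian_def semi_localization_of_abelian_def by blast+
 note e = stable_additive_iff[of X]
 have a: "stable_additive X \<longleftrightarrow> regular_category X \<and> additive_category X \<and> has_stable_coequalizers_of_equivalence_relations X"
 proof
  assume st: "stable_additive X"
  show "regular_category X \<and> additive_category X \<and> has_stable_coequalizers_of_equivalence_relations X"
   using st e stable_additive.stable_coequalizers[OF st] by blast
 next
  assume h: "regular_category X \<and> additive_category X \<and> has_stable_coequalizers_of_equivalence_relations X"
  then have r: "regular_category X" and ad: "additive_category X" and co: "has_stable_coequalizers_of_equivalence_relations X" by blast+
  note ra = additive.regular_additiveI[OF additive.intro[OF ad] r]
  show "stable_additive X" using regular_additive.stable_cokernels_of_stable_coequalizers[OF ra co] r ad e by blast
 qed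
 have f: "stable_additive X \<longleftrightarrow> additive_category X \<and> has_factorizations X \<and> regular_epis_pullback_stable X"
 proof
  assume st: "stable_additive X"
  have "regular_epis_pullback_stable X" using st e unfolding regular_category_def by blast
  then show "additive_category X \<and> has_factorizations X \<and> regular_epis_pullback_stable X"
   using st e stable_additive.factorizations[OF st] by blast
 next
  assume h: "additive_category X \<and> has_factorizations X \<and> regular_epis_pullback_stable X"
  then have ad: "additive_category X" and fa: "has_factorizations X" and ps: "regular_epis_pullback_stable X" by blast+
  show "stable_additive X" by (rule additive.stable_additive_of_factorizations[OF additive.intro[OF ad] fa ps])
 qed
 note fwd = stable_additive.ambient_exact_completion[where C = X]
 note b' = stable_additive_of_semi_localization[OF assms, where ?'p = 'p and ?'q = 'q]
 note g' = stable_additive_of_torsion_free[OF assms, where ?'p = 'p and ?'q = 'q]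
 have b: "stable_additive X \<longleftrightarrow> semi_localization_of_abelian TYPE(('o, 'a) ex_cat) X"
  by (rule iffI[OF reg(1)[OF fwd(2)] stable_additive_of_semi_localization[OF assms]])
 have c: "stable_additive X \<longleftrightarrow> regular_epi_semi_localization_of_abelian TYPE(('o, 'a) ex_cat) X"
  by (rule iffI[OF fwd(2) stable_additive_of_semi_localization[OF assms reg(1)]])
 have g: "stable_additive X \<longleftrightarrow> torsion_free_subcategory_of_abelian TYPE(('o, 'a) ex_cat) X"
  by (rule iffI[OF fwd(1) stable_additive_of_torsion_free[OF assms]])
 have d: "stable_additive X \<longleftrightarrow> regular_category X \<and> semi_localization_of_exact_completion X \<and> additive_category (ex_reg X)"
 proof
  assume st: "stable_additive X"
  then have r: "regular_category X" and ad: "additive_category X" using e by blast+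
  note ra = additive.regular_additiveI[OF additive.intro[OF ad] r]
  show "regular_category X \<and> semi_localization_of_exact_completion X \<and> additive_category (ex_reg X)"
   using r fwd(3)[OF st] regular_additive.additive_E[OF ra] by blast
 next
  assume "regular_category X \<and> semi_localization_of_exact_completion X \<and> additive_category (ex_reg X)"
  then show "stable_additive X" using stable_additive_of_exact_completion[of X] by blast
 qed
 note ab = trans[OF a[symmetric] b] trans[OF a[symmetric] c] trans[OF a[symmetric] d] trans[OF a[symmetric] e]
  trans[OF a[symmetric] f] trans[OF a[symmetric] g]
 show ?thesis unfolding Let_def
  by (intro conjI impI; (rule ab | (rule iffD1[OF b], erule b') | (rule iffD1[OF c], rule b', erule reg(2)) | (rule iffD1[OF g], erule g')))
qed

end
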